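(* Let $u \in L^\infty_{loc}([0,\infty)\times\mathbb{T}^d;\mathbb{R}^d)$ with $\nabla\cdot u = 0$ be relaxation enhancing. Then there exists a smooth increasing diffeomorphism $\sigma:[0,1)\to[0,\infty)$ such that for all $\nu>0$, all $s\in[0,1)$ and all $\theta_0\in L^2_0(\mathbb{T}^d)$, $$\Phi^{u_\sigma,\nu}_{s,1}\theta_0 = 0,$$ where $u_\sigma(t,x) = \sigma'(t)\,u(\sigma(t),x)$ is the accelerated flow on $[0,1)\times\mathbb{T}^d$ and $\Phi^{u_\sigma,\nu}_{s,1}\theta_0 := \lim_{t\to1^-}\Phi^{u_\sigma,\nu}_{s,t}\theta_0$ in $L^2(\mathbb{T}^d)$ (the claim includes that this limit exists).
   Context: $\mathbb{T}^d$ is the $d$-dimensional torus, and $L^2_0(\mathbb{T}^d) := \{\theta\in L^2(\mathbb{T}^d) : \int_{\mathbb{T}^d}\theta\,dx=0\}$ with the $L^2$ norm. Divergence conditions $\nabla\cdot u=0$ are in the sense of distributions in $x$. $L^\infty_{loc}([0,T_* )\times\mathbb{T}^d)$ means essentially bounded on $[0,T]\times\mathbb{T}^d$ for every $T<T_*$. Solution operator: for a divergence-free flow $v\in L^\infty_{loc}([0,T_* )\times\mathbb{T}^d;\mathbb{R}^d)$ with $T_*\in(0,\infty]$, $\nu>0$ and $0\le s\le t<T_*$, the operator $\Phi^{v,\nu}_{s,t}:L^2_0(\mathbb{T}^d)\to L^2_0(\mathbb{T}^d)$ is the solution operator of $$\partial_t\theta-\nu\Delta\theta+v\cdot\nabla\theta=0,$$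 that is, $\theta(t):=\Phi^{v,\nu}_{s,t}\theta_0$ is the (weak) solution on $[s,T_* )\times\mathbb{T}^d$ with $\theta(s)=\theta_0$. It is used with $T_*=\infty$ for $u$ and with $T_*=1$ for $u_\sigma$. Dissipation time: for $\nu>0$, $$\tau^u(\nu):=\sup_{s\ge0}\Big(\inf\{t-s : t\ge s,\ \|\Phi^{u,\nu}_{s,t}\|_{L^2_0\to L^2_0}\le\tfrac12\}\Big).$$ A divergence-free flow $u\in L^\infty_{loc}([0,\infty)\times\mathbb{T}^d)$ is relaxation enhancing if $\lim_{\nu\to0}\nu\,\tau^u(\nu)=0$. *)

theory Defs
  imports "HOL-Analysis.Analysis"
begin

section \<open>The torus\<close>

text \<open>
  The torus is \<open>\<real>\<^sup>n / \<int>\<^sup>n\<close>; functions on it are 1-periodic functions on \<open>\<real>\<^sup>n\<close>, integrated over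
  the unit cell. Elements of \<open>L\<^sup>2\<close> and \<open>L\<^sup>\<infinity>\<close> are represented by periodic Lebesgue measurable
  functions.
\<close>

definition periodic :: "(real^'n \<Rightarrow> 'b) \<Rightarrow> bool" where
  "periodic f \<longleftrightarrow> (\<forall>x i. f (x + axis i 1) = f x)"

definition torus :: "(real^'n) measure" where
  "torus = lebesgue_on (cbox 0 1)"

definition L2 :: "(real^'n \<Rightarrow> real) set" where
  "L2 = {f. f \<in> borel_measurable lebesgue \<and> periodic f \<and> integrable torus (\<lambda>x. (f x)\<^sup>2)}"

definition L2_0 :: "(real^'n \<Rightarrow> real) set" where
  "L2_0 = {f \<in> L2. (LINT x|torus. f x) = 0}"

text \<open>Only meaningful on \<open>L2\<close>: the Bochner integral of a non-integrable function is 0.\<close>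

definition L2_norm :: "(real^'n \<Rightarrow> real) \<Rightarrow> real" where
  "L2_norm f = sqrt (LINT x|torus. (f x)\<^sup>2)"

definition L2_tendsto :: "('t \<Rightarrow> real^'n \<Rightarrow> real) \<Rightarrow> (real^'n \<Rightarrow> real) \<Rightarrow> 't filter \<Rightarrow> bool" where
  "L2_tendsto f g F \<longleftrightarrow> g \<in> L2 \<and> (\<forall>\<^sub>F t in F. f t \<in> L2) \<and>
     ((\<lambda>t. L2_norm (\<lambda>x. f t x - g x)) \<longlongrightarrow> 0) F"

definition L2_0_opnorm :: "((real^'n \<Rightarrow> real) \<Rightarrow> real^'n \<Rightarrow> real) \<Rightarrow> ennreal" where
  "L2_0_opnorm A = (SUP f\<in>{f \<in> L2_0. L2_norm f \<le> 1}. ennreal (L2_norm (A f)))"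


section \<open>Smooth functions\<close>

abbreviation dir_deriv ::
  "'a \<Rightarrow> ('a::euclidean_space \<Rightarrow> real) \<Rightarrow> 'a \<Rightarrow> real" where
  "dir_deriv e f p \<equiv> frechet_derivative f (at p) e"

primrec C_k :: "nat \<Rightarrow> ('a::euclidean_space \<Rightarrow> real) \<Rightarrow> bool" where
  "C_k 0 f \<longleftrightarrow> continuous_on UNIV f"
| "C_k (Suc k) f \<longleftrightarrow> (\<forall>p. f differentiable (at p)) \<and> (\<forall>e\<in>Basis. C_k k (dir_deriv e f))"

definition smooth :: "('a::euclidean_space \<Rightarrow> real) \<Rightarrow> bool" where
  "smooth f \<longleftrightarrow> (\<forall>k. C_k k f)"

text \<open>Smoothness on an interval, with one-sided derivatives at end points belonging to it.\<close>

definition smooth_on_interval :: "real set \<Rightarrow> (real \<Rightarrow> real) \<Rightarrow> bool" where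
  "smooth_on_interval I f \<longleftrightarrow> (\<exists>D :: nat \<Rightarrow> real \<Rightarrow> real. (\<forall>t\<in>I. D 0 t = f t) \<and>
     (\<forall>k. \<forall>t\<in>I. (D k has_real_derivative D (Suc k) t) (at t within I)))"

definition increasing_diffeo :: "(real \<Rightarrow> real) \<Rightarrow> real set \<Rightarrow> real set \<Rightarrow> bool" where
  "increasing_diffeo \<sigma> I J \<longleftrightarrow> bij_betw \<sigma> I J \<and> strict_mono_on I \<sigma> \<and>
     smooth_on_interval I \<sigma> \<and> smooth_on_interval J (inv_into I \<sigma>)"


section \<open>Flows\<close>

text \<open>A final time is an extended real, so that \<open>[s, \<infinity>)\<close> is included.\<close>

definition time_interval :: "real \<Rightarrow> ereal \<Rightarrow> real set" where
  "time_interval s T' = {t. s \<le> t \<and> ereal t < T'}"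

definition Linf_loc :: "ereal \<Rightarrow> (real \<Rightarrow> real^'n \<Rightarrow> real^'n) \<Rightarrow> bool" where
  "Linf_loc T' v \<longleftrightarrow>
     (\<lambda>(t, x). v t x) \<in> borel_measurable (lebesgue_on (time_interval 0 T' \<times> UNIV)) \<and>
     (\<forall>t\<in>time_interval 0 T'. periodic (v t)) \<and>
     (\<forall>T\<in>time_interval 0 T'. \<exists>C. AE (t, x) in lebesgue_on ({0..T} \<times> UNIV). norm (v t x) \<le> C)"

definition divergence_free :: "ereal \<Rightarrow> (real \<Rightarrow> real^'n \<Rightarrow> real^'n) \<Rightarrow> bool" where
  "divergence_free T' v \<longleftrightarrow>
     (AE t in lebesgue_on (time_interval 0 T').
        \<forall>\<psi>. smooth \<psi> \<and> periodic \<psi> \<longrightarrow> (LINT x|torus. dir_deriv (v t x) \<psi> x) = 0)"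

definition accelerated_flow ::
  "(real \<Rightarrow> real) \<Rightarrow> (real \<Rightarrow> real^'n \<Rightarrow> real^'n) \<Rightarrow> real \<Rightarrow> real^'n \<Rightarrow> real^'n" where
  "accelerated_flow \<sigma> u t x = vector_derivative \<sigma> (at t within {0..<1}) *\<^sub>R u (\<sigma> t) x"


section \<open>The advection-diffusion equation\<close>

definition test_function :: "real \<Rightarrow> ereal \<Rightarrow> (real \<times> (real^'n) \<Rightarrow> real) \<Rightarrow> bool" where
  "test_function s T' \<phi> \<longleftrightarrow> smooth \<phi> \<and> (\<forall>t. periodic (\<lambda>x. \<phi> (t, x))) \<and>
     (\<exists>a b. s < a \<and> ereal b < T' \<and> (\<forall>t x. t \<notin> {a..b} \<longrightarrow> \<phi> (t, x) = 0))"

definition laplacian_x :: "(real \<times> (real^'n) \<Rightarrow> real) \<Rightarrow> real \<times> (real^'n) \<Rightarrow> real" where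
  "laplacian_x \<phi> p = (\<Sum>e\<in>Basis. dir_deriv (0, e) (dir_deriv (0, e) \<phi>) p)"

text \<open>
  Weak solutions on \<open>[s, T')\<close> are curves in \<open>C([s, T'); L\<^sup>2\<^sub>0)\<close> with \<open>\<theta>(s) = \<theta>\<^sub>0\<close> that solve
  \<open>\<partial>\<^sub>t \<theta> - \<nu> \<Delta> \<theta> + \<nabla> \<cdot> (v \<theta>) = 0\<close> in the sense of distributions; \<open>v \<cdot> \<nabla> \<theta> = \<nabla> \<cdot> (v \<theta>)\<close> for
  divergence-free \<open>v\<close>. Since \<open>v\<close> is locally bounded and \<open>\<nu> > 0\<close>, such a curve is automatically in
  \<open>L\<^sup>2\<^sub>l\<^sub>o\<^sub>c([s, T'); H\<^sup>1)\<close> and is unique up to null sets at each time. The integrals are iterated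
  because \<open>\<theta>\<close> is a family of representatives, not assumed jointly measurable in \<open>(t, x)\<close>.
\<close>

definition weak_solution ::
  "(real \<Rightarrow> real^'n \<Rightarrow> real^'n) \<Rightarrow> ereal \<Rightarrow> real \<Rightarrow> real \<Rightarrow> (real^'n \<Rightarrow> real) \<Rightarrow>
   (real \<Rightarrow> real^'n \<Rightarrow> real) \<Rightarrow> bool" where
  "weak_solution v T' \<nu> s \<theta>\<^sub>0 \<theta> \<longleftrightarrow>
     (\<forall>t\<in>time_interval s T'. \<theta> t \<in> L2_0 \<and> L2_tendsto \<theta> (\<theta> t) (at t within time_interval s T')) \<and>
     (AE x in torus. \<theta> s x = \<theta>\<^sub>0 x) \<and>
     (\<forall>\<phi>. test_function s T' \<phi> \<longrightarrow>
        (LINT t|lebesgue_on (time_interval s T'). LINT x|torus.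
           \<theta> t x * (dir_deriv (1, 0) \<phi> (t, x) + \<nu> * laplacian_x \<phi> (t, x)
                    + dir_deriv (0, v t x) \<phi> (t, x))) = 0)"

text \<open>
  The solution is unique only up to null sets, so \<open>SOME\<close> picks a representative; its value at
  time \<open>t\<close> is well defined as an element of \<open>L\<^sup>2\<^sub>0\<close>.
\<close>

definition solution_op ::
  "(real \<Rightarrow> real^'n \<Rightarrow> real^'n) \<Rightarrow> ereal \<Rightarrow> real \<Rightarrow> real \<Rightarrow> real \<Rightarrow>
   (real^'n \<Rightarrow> real) \<Rightarrow> real^'n \<Rightarrow> real" where
  "solution_op v T' \<nu> s t \<theta>\<^sub>0 = (SOME \<theta>. weak_solution v T' \<nu> s \<theta>\<^sub>0 \<theta>) t"

text \<open>Infima of empty sets of times are \<open>\<infinity>\<close>, whence the extended values.\<close>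

definition dissipation_time :: "(real \<Rightarrow> real^'n \<Rightarrow> real^'n) \<Rightarrow> real \<Rightarrow> ennreal" where
  "dissipation_time u \<nu> =
     (SUP s\<in>{0..}. INF t\<in>{t. s \<le> t \<and> L2_0_opnorm (solution_op u \<infinity> \<nu> s t) \<le> 1 / 2}. ennreal (t - s))"

definition relaxation_enhancing :: "(real \<Rightarrow> real^'n \<Rightarrow> real^'n) \<Rightarrow> bool" where
  "relaxation_enhancing u \<longleftrightarrow>
     ((\<lambda>\<nu>. ennreal \<nu> * dissipation_time u \<nu>) \<longlongrightarrow> 0) (at_right 0)"

end

theory Submission
  imports Defs
begin

text \<open>
  If \<open>\<sigma>\<close> is affine with slope \<open>c\<close> on a time interval, the accelerated flow with diffusivity \<open>\<nu>\<close> is there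
  a time rescaling of \<open>u\<close> with diffusivity \<open>\<nu> / c\<close>. Relaxation enhancement says that the dissipation
  time of \<open>u\<close> at \<open>\<nu> / c\<close> is \<open>o(c / \<nu>)\<close>, so for \<open>c = c\<^sub>k\<close> large the \<open>L\<^sup>2\<close> norm is halved on the \<open>k\<close>-th of a
  sequence of intervals accumulating at 1, for all \<open>\<nu>\<close> between \<open>1 / (k + 1)\<close> and \<open>k + 1\<close>. A fixed \<open>\<nu>\<close> is
  in this range for all large \<open>k\<close>, and the norm never increases, so it tends to 0.

  Transferring solutions between \<open>u\<close> and the accelerated flow needs existence, uniqueness and the energy
  inequality for weak solutions. They are read off the coefficients in a real trigonometric basis, in
  which a weak solution is an infinite system of integral equations: truncation gives existence
  (Galerkin), and testing against truncations of the solution gives the energy inequality.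
\<close>

text \<open>Each interval is used only in part. The speed is constant on its first half, where the
  dissipation time of \<open>u\<close> is exploited; the second half serves to change the speed
  smoothly, and there only monotonicity of the norm is used. A bound \<open>len k / (k + 1)\<close>
  on \<open>\<mu>\<close> times the dissipation time at \<open>\<mu> = \<nu> / c k\<close> means,
  when \<open>\<nu> \<ge> 1 / (k + 1)\<close>, that halving takes less than
  \<open>c k * len k\<close>, which is the time of \<open>u\<close> covered by the first half;
  \<open>\<nu> \<le> k + 1\<close> keeps \<open>\<mu>\<close> where this bound is known.

  The obstacle is that a weak solution is merely continuous into L2: it is not an admissible test
  function, and it is not assumed jointly measurable. Its coefficients, however, are continuous in
  time. In the energy balance of a truncation the transport term does not cancel, but it sees only
  the truncation error, and the dissipation absorbs the gradient next to it. What is left is a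
  multiple of the squared error, which tends to 0, so that no gradient bound on the solution is
  required. The same cancellation makes the Galerkin approximations a Cauchy sequence, and no
  compactness is involved.\<close>

section \<open>The unit cell as a probability space\<close>

lemma space_torus [simp]: "space torus = cbox 0 1"
  by (simp add: torus_def)

lemma emeasure_torus: "emeasure (torus :: (real^'n) measure) (cbox 0 1) = 1"
proof -
  have "emeasure lborel (cbox 0 (1::real^'n)) = ennreal (\<Prod>b\<in>Basis. ((1::real^'n) - 0) \<bullet> b)"
  proof (rule emeasure_lborel_cbox)
    show "0 \<bullet> b \<le> 1 \<bullet> b" if "b \<in> Basis" for b :: "real^'n"
      using that by (auto simp: Basis_vec_def inner_axis)
  qed
  also have "(\<Prod>b\<in>Basis. ((1::real^'n) - 0) \<bullet> b) = 1"
    by (intro prod.neutral) (auto simp: Basis_vec_def inner_axis)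
  finally show ?thesis
    by (simp add: torus_def emeasure_restrict_space)
qed

interpretation torus: finite_measure "torus :: (real^'n) measure"
  by standard (simp add: emeasure_torus)

lemma measure_torus [simp]: "measure (torus :: (real^'n) measure) (cbox 0 1) = 1"
  by (simp add: measure_def emeasure_torus)

lemma measurable_torus: "f \<in> borel_measurable lebesgue \<Longrightarrow> f \<in> borel_measurable torus"
  unfolding torus_def by (rule measurable_restrict_space1)

lemma measurable_borel_torus: "f \<in> borel_measurable borel \<Longrightarrow> f \<in> borel_measurable torus"
  by (intro measurable_torus borel_measurable_subalgebra[of borel lebesgue])
    (auto simp: sets_completionI_sub)

subsection \<open>Square integrable functions\<close>

text \<open>Square integrability on the cell without periodicity, for functions such as products
  with the velocity field, which is only known to be measurable there.\<close>

definition sqi :: "(real^'n \<Rightarrow> real) \<Rightarrow> bool" where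
  "sqi f \<longleftrightarrow> f \<in> borel_measurable torus \<and> integrable torus (\<lambda>x. (f x)\<^sup>2)"

definition ip :: "(real^'n \<Rightarrow> real) \<Rightarrow> (real^'n \<Rightarrow> real) \<Rightarrow> real" where
  "ip f g = (LINT x|torus. f x * g x)"

lemma sqi_measurable [measurable_dest]: "sqi f \<Longrightarrow> f \<in> borel_measurable torus"
  by (simp add: sqi_def)

lemma L2_sqi: "f \<in> L2 \<Longrightarrow> sqi f"
  by (auto simp: L2_def sqi_def measurable_torus)

lemma L2_0_L2: "f \<in> L2_0 \<Longrightarrow> f \<in> L2"
  by (simp add: L2_0_def)

lemma sqi_mult_integrable:
  assumes "sqi f" "sqi g"
  shows "integrable torus (\<lambda>x. f x * g x)"
proof (rule Bochner_Integration.integrable_bound)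
  show "integrable torus (\<lambda>x. (f x)\<^sup>2 + (g x)\<^sup>2)"
    using assms by (auto simp: sqi_def)
  show "(\<lambda>x. f x * g x) \<in> borel_measurable torus"
    using assms by (auto simp: sqi_def)
  show "AE x in torus. norm (f x * g x) \<le> norm ((f x)\<^sup>2 + (g x)\<^sup>2)"
  proof (rule AE_I2)
    fix x
    have "0 \<le> (\<bar>f x\<bar> - \<bar>g x\<bar>)\<^sup>2" by simp
    then have "2 * (\<bar>f x\<bar> * \<bar>g x\<bar>) \<le> (f x)\<^sup>2 + (g x)\<^sup>2"
      by (simp add: power2_diff)
    moreover have "0 \<le> \<bar>f x\<bar> * \<bar>g x\<bar>" by simp
    ultimately have "\<bar>f x\<bar> * \<bar>g x\<bar> \<le> (f x)\<^sup>2 + (g x)\<^sup>2" by linarith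
    then show "norm (f x * g x) \<le> norm ((f x)\<^sup>2 + (g x)\<^sup>2)"
      by (simp add: abs_mult)
  qed
qed

lemma sqi_bounded:
  assumes "f \<in> borel_measurable torus" "\<And>x. x \<in> cbox 0 1 \<Longrightarrow> \<bar>f x\<bar> \<le> B"
  shows "sqi f"
  unfolding sqi_def
proof (intro conjI assms(1) torus.integrable_const_bound[where B="B\<^sup>2"])
  show "AE x in torus. norm ((f x)\<^sup>2) \<le> B\<^sup>2"
    using assms(2) by (intro AE_I2) (metis norm_power power_mono abs_ge_zero real_norm_def space_torus)
qed (use assms(1) in measurable)

lemma sqi_const: "sqi (\<lambda>x. c)"
  by (rule sqi_bounded[where B="\<bar>c\<bar>"]) auto

lemma sqi_integrable: "sqi f \<Longrightarrow> integrable torus f"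
  using sqi_mult_integrable[OF _ sqi_const[of 1]] by simp

lemma sqi_add: assumes "sqi f" "sqi g" shows "sqi (\<lambda>x. f x + g x)"
  unfolding sqi_def power2_sum
  using assms sqi_mult_integrable[OF assms] by (auto simp: sqi_def mult.assoc)

lemma sqi_cmult: "sqi f \<Longrightarrow> sqi (\<lambda>x. c * f x)"
  by (auto simp: sqi_def power_mult_distrib)

lemma sqi_diff: "sqi f \<Longrightarrow> sqi g \<Longrightarrow> sqi (\<lambda>x. f x - g x)"
  using sqi_add[of f "\<lambda>x. (-1) * g x"] sqi_cmult[of g "-1"] by simp

lemma sqi_sum: "(\<And>i. i \<in> I \<Longrightarrow> sqi (f i)) \<Longrightarrow> sqi (\<lambda>x. \<Sum>i\<in>I. f i x)"
  by (induction I rule: infinite_finite_induct) (auto intro: sqi_add sqi_const)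

lemma sqi_bmult:
  assumes "sqi f" "w \<in> borel_measurable torus" "\<And>x. x \<in> cbox 0 1 \<Longrightarrow> \<bar>w x\<bar> \<le> B"
  shows "sqi (\<lambda>x. w x * f x)"
  unfolding sqi_def
proof
  show "(\<lambda>x. w x * f x) \<in> borel_measurable torus"
    using assms by (auto simp: sqi_def)
  show "integrable torus (\<lambda>x. (w x * f x)\<^sup>2)"
  proof (rule Bochner_Integration.integrable_bound)
    show "integrable torus (\<lambda>x. B\<^sup>2 * (f x)\<^sup>2)"
      using assms by (auto simp: sqi_def)
    show "(\<lambda>x. (w x * f x)\<^sup>2) \<in> borel_measurable torus"
      using assms by (auto simp: sqi_def)
    show "AE x in torus. norm ((w x * f x)\<^sup>2) \<le> norm (B\<^sup>2 * (f x)\<^sup>2)"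
    proof (rule AE_I2)
      fix x :: "real^'a" assume "x \<in> space torus"
      then have "\<bar>w x\<bar> \<le> B" using assms(3) by auto
      then have "(w x)\<^sup>2 \<le> B\<^sup>2"
        by (metis power_mono abs_ge_zero power2_abs)
      then show "norm ((w x * f x)\<^sup>2) \<le> norm (B\<^sup>2 * (f x)\<^sup>2)"
        by (simp add: power_mult_distrib mult_right_mono abs_mult)
    qed
  qed
qed

lemma sqi_abs: "sqi f \<Longrightarrow> sqi (\<lambda>x. \<bar>f x\<bar>)"
  by (auto simp: sqi_def)

lemma ip_commute: "ip f g = ip g f"
  by (simp add: ip_def mult.commute)

lemma ip_add_left: "sqi f \<Longrightarrow> sqi g \<Longrightarrow> sqi h \<Longrightarrow> ip (\<lambda>x. f x + g x) h = ip f h + ip g h"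
  unfolding ip_def
  by (simp add: distrib_right sqi_mult_integrable)

lemma ip_cmult_left: "ip (\<lambda>x. c * f x) h = c * ip f h"
  unfolding ip_def by (simp add: mult.assoc)

lemma ip_diff_left: "sqi f \<Longrightarrow> sqi g \<Longrightarrow> sqi h \<Longrightarrow> ip (\<lambda>x. f x - g x) h = ip f h - ip g h"
  unfolding ip_def
  by (simp add: left_diff_distrib sqi_mult_integrable)

lemma ip_sum_left:
  "(\<And>i. i \<in> I \<Longrightarrow> sqi (f i)) \<Longrightarrow> sqi h \<Longrightarrow> ip (\<lambda>x. \<Sum>i\<in>I. f i x) h = (\<Sum>i\<in>I. ip (f i) h)"
proof (induction I rule: infinite_finite_induct)
  case (insert i I)
  then show ?case by (simp add: ip_add_left sqi_sum)
qed (auto simp: ip_def)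

lemma ip_add_right: "sqi f \<Longrightarrow> sqi g \<Longrightarrow> sqi h \<Longrightarrow> ip h (\<lambda>x. f x + g x) = ip h f + ip h g"
  by (subst (1 2 3) ip_commute) (rule ip_add_left)

lemma ip_cmult_right: "ip h (\<lambda>x. c * f x) = c * ip h f"
  by (subst (1 2) ip_commute) (rule ip_cmult_left)

lemma ip_diff_right: "sqi f \<Longrightarrow> sqi g \<Longrightarrow> sqi h \<Longrightarrow> ip h (\<lambda>x. f x - g x) = ip h f - ip h g"
  by (subst (1 2 3) ip_commute) (rule ip_diff_left)

lemma ip_sum_right:
  "(\<And>i. i \<in> I \<Longrightarrow> sqi (f i)) \<Longrightarrow> sqi h \<Longrightarrow> ip h (\<lambda>x. \<Sum>i\<in>I. f i x) = (\<Sum>i\<in>I. ip h (f i))"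
  by (subst (1 2) ip_commute) (rule ip_sum_left)

lemma ip_nonneg: "0 \<le> ip f f"
  unfolding ip_def by (rule integral_nonneg_AE) auto

lemma L2_norm_ip: "L2_norm f = sqrt (ip f f)"
  by (simp add: L2_norm_def ip_def power2_eq_square)

lemma L2_norm_sq: "(L2_norm f)\<^sup>2 = ip f f"
  by (simp add: L2_norm_ip ip_nonneg)

lemma L2_norm_nonneg [simp]: "0 \<le> L2_norm f"
  by (simp add: L2_norm_ip ip_nonneg)

lemma ip_cong:
  assumes "AE x in torus. f x = f' x" "AE x in torus. g x = g' x"
    "f \<in> borel_measurable torus" "f' \<in> borel_measurable torus"
    "g \<in> borel_measurable torus" "g' \<in> borel_measurable torus"
  shows "ip f g = ip f' g'"
  unfolding ip_def using assms
  by (intro integral_cong_AE) auto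

lemma L2_norm_cong:
  assumes "AE x in torus. f x = g x"
    "f \<in> borel_measurable torus" "g \<in> borel_measurable torus"
  shows "L2_norm f = L2_norm g"
  unfolding L2_norm_ip using ip_cong[OF assms(1) assms(1)] assms by simp

lemma L2_norm_cmult: "L2_norm (\<lambda>x. c * f x) = \<bar>c\<bar> * L2_norm f"
  by (simp add: L2_norm_ip ip_cmult_left ip_cmult_right real_sqrt_mult flip: mult.assoc)

lemma L2_norm_minus_commute: "L2_norm (\<lambda>x. f x - g x) = L2_norm (\<lambda>x. g x - f x)"
  by (simp add: L2_norm_def power2_commute)

lemma ip_add_sq:
  assumes "sqi f" "sqi g"
  shows "ip (\<lambda>x. f x + g x) (\<lambda>x. f x + g x) = ip f f + 2 * ip f g + ip g g"
  using assms by (simp add: ip_add_left ip_add_right sqi_add ip_commute[of g f])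

lemma ip_diff_sq:
  assumes "sqi f" "sqi g"
  shows "ip (\<lambda>x. f x - g x) (\<lambda>x. f x - g x) = ip f f - 2 * ip f g + ip g g"
  using assms by (simp add: ip_diff_left ip_diff_right sqi_diff ip_commute[of g f])

text \<open>The quadratic polynomial in \<open>c\<close> given by the squared norm of
  \<open>f + c g\<close> is nonnegative; it is evaluated at its minimum. If
  \<open>ip g g = 0\<close> it is affine, hence constant.\<close>

lemma Cauchy_Schwarz_ip:
  assumes "sqi f" "sqi g"
  shows "\<bar>ip f g\<bar> \<le> L2_norm f * L2_norm g"
proof -
  have *: "0 \<le> ip f f + 2 * c * ip f g + c\<^sup>2 * ip g g" for c
    using ip_nonneg[of "\<lambda>x. f x + c * g x"] ip_add_sq[OF assms(1) sqi_cmult[OF assms(2), of c]]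
    by (simp add: ip_cmult_left ip_cmult_right power2_eq_square mult.assoc)
  have "(ip f g)\<^sup>2 \<le> ip f f * ip g g"
  proof (cases "ip g g = 0")
    case True
    have "ip f g = 0"
    proof (rule ccontr)
      assume "ip f g \<noteq> 0"
      \<comment> \<open>This \<open>c\<close> gives the affine polynomial the value -1.\<close>
      with *[of "- (ip f f + 1) / (2 * ip f g)"] True have "0 \<le> ip f f + - (ip f f + 1)"
        by (simp add: field_simps)
      then show False by simp
    qed
    then show ?thesis using ip_nonneg[of f] ip_nonneg[of g] by simp
  next
    case False
    then have "ip g g > 0" using ip_nonneg[of g] by simp
    with *[of "- ip f g / ip g g"] show ?thesis
      by (simp add: field_simps power2_eq_square)
  qed
  then have "sqrt ((ip f g)\<^sup>2) \<le> sqrt (ip f f * ip g g)"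
    by (rule real_sqrt_le_mono)
  then show ?thesis by (simp add: L2_norm_ip real_sqrt_mult)
qed

lemma L2_norm_triangle:
  assumes "sqi f" "sqi g"
  shows "L2_norm (\<lambda>x. f x + g x) \<le> L2_norm f + L2_norm g"
proof (rule power2_le_imp_le)
  show "(L2_norm (\<lambda>x. f x + g x))\<^sup>2 \<le> (L2_norm f + L2_norm g)\<^sup>2"
    using Cauchy_Schwarz_ip[OF assms]
    by (simp add: L2_norm_sq ip_add_sq assms power2_sum)
qed simp

lemma L2_norm_triangle_diff:
  assumes "sqi f" "sqi g" "sqi h"
  shows "L2_norm (\<lambda>x. f x - h x) \<le> L2_norm (\<lambda>x. f x - g x) + L2_norm (\<lambda>x. g x - h x)"
  using L2_norm_triangle[OF sqi_diff[OF assms(1,2)] sqi_diff[OF assms(2,3)]] by simp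

lemma L2_norm_diff_ge:
  assumes "sqi f" "sqi g"
  shows "\<bar>L2_norm f - L2_norm g\<bar> \<le> L2_norm (\<lambda>x. f x - g x)"
  using L2_norm_triangle[OF sqi_diff[OF assms] assms(2)]
    L2_norm_triangle[OF sqi_diff[OF assms(2,1)] assms(1)] L2_norm_minus_commute[of f g]
  by simp

lemma L2_norm_bounded:
  assumes "f \<in> borel_measurable torus" "\<And>x. x \<in> cbox 0 1 \<Longrightarrow> \<bar>f x\<bar> \<le> B" "0 \<le> B"
  shows "L2_norm f \<le> B"
proof -
  have le: "(f x)\<^sup>2 \<le> B\<^sup>2" if "x \<in> cbox 0 1" for x
    using assms(2)[OF that] by (metis power_mono abs_ge_zero power2_abs)
  have "(LINT x|torus. (f x)\<^sup>2) \<le> (LINT x|(torus :: (real^'a) measure). B\<^sup>2)"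
    using sqi_bounded[OF assms(1,2)] le by (intro integral_mono) (auto simp: sqi_def)
  also have "\<dots> = B\<^sup>2" by simp
  finally show ?thesis unfolding L2_norm_def
    using assms(3) by (simp add: real_le_lsqrt)
qed

lemma L2_norm_eq_0:
  assumes "sqi f" "L2_norm f = 0"
  shows "AE x in torus. f x = 0"
proof -
  have "(LINT x|torus. (f x)\<^sup>2) = 0"
    using assms(2) by (simp add: L2_norm_def)
  then have "AE x in torus. (f x)\<^sup>2 = 0"
    using assms(1) by (subst (asm) integral_nonneg_eq_0_iff_AE) (auto simp: sqi_def)
  then show ?thesis by simp
qed

lemma L2_add: "f \<in> L2 \<Longrightarrow> g \<in> L2 \<Longrightarrow> (\<lambda>x. f x + g x) \<in> L2"
  using sqi_add[OF L2_sqi L2_sqi, of f g] by (auto simp: L2_def sqi_def periodic_def)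

lemma L2_cmult: "f \<in> L2 \<Longrightarrow> (\<lambda>x. c * f x) \<in> L2"
  using sqi_cmult[OF L2_sqi, of f c] by (auto simp: L2_def sqi_def periodic_def)

lemma L2_diff: "f \<in> L2 \<Longrightarrow> g \<in> L2 \<Longrightarrow> (\<lambda>x. f x - g x) \<in> L2"
  using L2_add[OF _ L2_cmult[of g "-1"]] by simp

lemma L2_zero: "(\<lambda>x. 0) \<in> L2"
  by (auto simp: L2_def periodic_def)

lemma L2_sum: "(\<And>i. i \<in> I \<Longrightarrow> f i \<in> L2) \<Longrightarrow> (\<lambda>x. \<Sum>i\<in>I. f i x) \<in> L2"
  by (induction I rule: infinite_finite_induct) (auto intro: L2_add L2_zero)

text \<open>The limit is taken pointwise, so that it inherits periodicity everywhere.\<close>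

lemma L2_complete:
  fixes f :: "nat \<Rightarrow> real^'n \<Rightarrow> real"
  assumes f: "\<And>n. f n \<in> L2"
    and cauchy: "\<And>e. e > 0 \<Longrightarrow> \<exists>N. \<forall>m\<ge>N. \<forall>n\<ge>N. L2_norm (\<lambda>x. f m x - f n x) \<le> e"
  obtains g where "g \<in> L2" "(\<lambda>n. L2_norm (\<lambda>x. f n x - g x)) \<longlonglongrightarrow> 0"
proof -
  note sf = L2_sqi[OF f]
  \<comment> \<open>A subsequence that converges geometrically fast, so that its increments are
    summable.\<close>
  have "\<exists>r::nat\<Rightarrow>nat. \<forall>k. (\<forall>m\<ge>r k. \<forall>n\<ge>r k. L2_norm (\<lambda>x. f m x - f n x) \<le> (1/2)^k) \<and> r k < r (Suc k)"
  proof (rule dependent_nat_choice)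
    show "\<exists>N. \<forall>m\<ge>N. \<forall>n\<ge>N. L2_norm (\<lambda>x. f m x - f n x) \<le> (1/2)^0"
      using cauchy[of 1] by simp
    fix N k
    obtain N' where "\<forall>m\<ge>N'. \<forall>n\<ge>N'. L2_norm (\<lambda>x. f m x - f n x) \<le> (1/2)^Suc k"
      using cauchy[of "(1/2)^Suc k"] by auto
    then show "\<exists>M. (\<forall>m\<ge>M. \<forall>n\<ge>M. L2_norm (\<lambda>x. f m x - f n x) \<le> (1/2)^Suc k) \<and> N < M"
      by (intro exI[of _ "max N' (Suc N)"]) auto
  qed
  then obtain r :: "nat \<Rightarrow> nat"
    where r: "\<And>k m n. m \<ge> r k \<Longrightarrow> n \<ge> r k \<Longrightarrow> L2_norm (\<lambda>x. f m x - f n x) \<le> (1/2)^k"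
      and mono: "\<And>k. r k < r (Suc k)" by blast
  have smono: "strict_mono r" using mono by (simp add: strict_mono_Suc_iff)
  \<comment> \<open>The increments are summable in L2, hence in L1 because the cell has mass one. So
    the sum of their absolute values is finite almost everywhere, and the subsequence converges
    there.\<close>
  define d where "d k x = f (r (Suc k)) x - f (r k) x" for k x
  have sd: "sqi (d k)" for k unfolding d_def by (intro sqi_diff sf)
  have dn: "L2_norm (d k) \<le> (1/2)^k" for k
    unfolding d_def using mono[of k] by (intro r) auto
  have "(\<integral>\<^sup>+x. (\<Sum>k. ennreal \<bar>d k x\<bar>) \<partial>torus) = (\<Sum>k. \<integral>\<^sup>+x. ennreal \<bar>d k x\<bar> \<partial>torus)"
    by (intro nn_integral_suminf) (use sqi_measurable[OF sd] in measurable)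
  also have "\<dots> \<le> (\<Sum>k. ennreal ((1/2)^k))"
  proof (intro suminf_le)
    fix k
    have "(\<integral>\<^sup>+x. ennreal \<bar>d k x\<bar> \<partial>torus) = ennreal (LINT x|torus. \<bar>d k x\<bar>)"
      using sqi_integrable[OF sqi_abs[OF sd[of k]]] by (intro nn_integral_eq_integral) auto
    also have "(LINT x|torus. \<bar>d k x\<bar>) = ip (\<lambda>x. \<bar>d k x\<bar>) (\<lambda>x. 1)"
      by (simp add: ip_def)
    also have "\<dots> \<le> L2_norm (\<lambda>x. \<bar>d k x\<bar>) * L2_norm (\<lambda>x::real^'n. 1)"
      using Cauchy_Schwarz_ip[OF sqi_abs[OF sd[of k]] sqi_const[of 1]] by linarith
    also have "\<dots> = L2_norm (d k)" by (simp add: L2_norm_def)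
    also have "\<dots> \<le> (1/2)^k" by (rule dn)
    finally show "(\<integral>\<^sup>+x. ennreal \<bar>d k x\<bar> \<partial>torus) \<le> ennreal ((1/2)^k)"
      by (simp add: ennreal_leI)
  qed auto
  also have "\<dots> = ennreal (\<Sum>k. (1/2)^k)"
    by (intro suminf_ennreal2) auto
  also have "\<dots> < \<infinity>" by simp
  finally have "AE x in torus. (\<Sum>k. ennreal \<bar>d k x\<bar>) \<noteq> \<infinity>"
    using sd by (intro nn_integral_PInf_AE) auto
  then have conv: "AE x in torus. convergent (\<lambda>k. f (r k) x)"
  proof eventually_elim
    case (elim x)
    then have "summable (\<lambda>k. \<bar>d k x\<bar>)"
      by (intro summable_suminf_not_top) auto
    then have "summable (\<lambda>k. d k x)"
      by (rule summable_rabs_cancel)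
    moreover have "(\<Sum>k<n. d k x) = f (r n) x - f (r 0) x" for n
      unfolding d_def by (rule sum_lessThan_telescope)
    ultimately have "convergent (\<lambda>n. f (r n) x - f (r 0) x)"
      by (simp add: summable_iff_convergent)
    from convergent_add[OF this convergent_const[of "f (r 0) x"]] show ?case by simp
  qed
  define g where "g x = lim (\<lambda>k. f (r k) x)" for x
  have lim: "AE x in torus. (\<lambda>k. f (r k) x) \<longlonglongrightarrow> g x"
    using conv by eventually_elim (simp add: g_def convergent_LIMSEQ_iff)
  have per: "periodic g"
    using f by (auto simp: periodic_def L2_def g_def)
  have gm: "g \<in> borel_measurable lebesgue"
    unfolding g_def using f by (intro borel_measurable_lim_metric) (auto simp: L2_def)
  then have gmt: "g \<in> borel_measurable torus" by (rule measurable_torus)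
  \<comment> \<open>Fatou's lemma along the subsequence transfers the Cauchy bound to the distance
    from the pointwise limit.\<close>
  have key: "(\<integral>\<^sup>+x. ennreal ((f n x - g x)\<^sup>2) \<partial>torus) \<le> ennreal (((1/2)^k)\<^sup>2)" if n: "n \<ge> r k" for n k
  proof -
    have "(\<integral>\<^sup>+x. ennreal ((f n x - g x)\<^sup>2) \<partial>torus)
        = (\<integral>\<^sup>+x. liminf (\<lambda>j. ennreal ((f n x - f (r j) x)\<^sup>2)) \<partial>torus)"
    proof (rule nn_integral_cong_AE)
      show "AE x in torus. ennreal ((f n x - g x)\<^sup>2) = liminf (\<lambda>j. ennreal ((f n x - f (r j) x)\<^sup>2))"
        using lim
      proof eventually_elim
        case (elim x)
        then have "(\<lambda>j. ennreal ((f n x - f (r j) x)\<^sup>2)) \<longlonglongrightarrow> ennreal ((f n x - g x)\<^sup>2)"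
          by (intro tendsto_intros tendsto_ennrealI)
        then show ?case by (metis lim_imp_Liminf sequentially_bot)
      qed
    qed
    also have "\<dots> \<le> liminf (\<lambda>j. \<integral>\<^sup>+x. ennreal ((f n x - f (r j) x)\<^sup>2) \<partial>torus)"
      by (intro nn_integral_liminf) (use sqi_measurable[OF sf] in measurable)
    also have "\<dots> \<le> ennreal (((1/2)^k)\<^sup>2)"
    proof (rule Liminf_le)
      show "\<forall>\<^sub>F j in sequentially. (\<integral>\<^sup>+x. ennreal ((f n x - f (r j) x)\<^sup>2) \<partial>torus) \<le> ennreal (((1/2)^k)\<^sup>2)"
        using eventually_ge_at_top[of k]
      proof eventually_elim
        case (elim j)
        have "(\<integral>\<^sup>+x. ennreal ((f n x - f (r j) x)\<^sup>2) \<partial>torus) = ennreal (LINT x|torus. (f n x - f (r j) x)\<^sup>2)"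
          using sqi_diff[OF sf sf] by (intro nn_integral_eq_integral) (auto simp: sqi_def)
        also have "(LINT x|torus. (f n x - f (r j) x)\<^sup>2) = (L2_norm (\<lambda>x. f n x - f (r j) x))\<^sup>2"
          by (simp add: L2_norm_def)
        also have "\<dots> \<le> ((1/2)^k)\<^sup>2"
          using r[of k n "r j"] n elim smono by (intro power_mono) (auto simp: strict_mono_less_eq)
        finally show ?case by (simp add: ennreal_leI)
      qed
    qed simp
    finally show ?thesis .
  qed
  have sfg: "sqi (\<lambda>x. f n x - g x)" if "n \<ge> r 0" for n
    unfolding sqi_def
  proof
    show "(\<lambda>x. f n x - g x) \<in> borel_measurable torus"
      using sqi_measurable[OF sf[of n]] gmt by measurable
    then show "integrable torus (\<lambda>x. (f n x - g x)\<^sup>2)"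
      using key[OF that] by (intro integrableI_nonneg) (auto intro: le_less_trans)
  qed
  have "sqi g"
    using sqi_diff[OF sf[of "r 0"] sfg[of "r 0"]] by simp
  with per gm have "g \<in> L2" by (simp add: L2_def sqi_def)
  moreover have "(\<lambda>n. L2_norm (\<lambda>x. f n x - g x)) \<longlonglongrightarrow> 0"
  proof (rule LIMSEQ_I)
    fix e :: real assume "e > 0"
    then obtain k where k: "(1/2)^k < e"
      using real_arch_pow_inv[of e "1/2"] by auto
    have "norm (L2_norm (\<lambda>x. f n x - g x) - 0) < e" if "n \<ge> r k" for n
    proof -
      have "r 0 \<le> r k" using smono by (simp add: strict_mono_less_eq)
      then have "ennreal (LINT x|torus. (f n x - g x)\<^sup>2) = (\<integral>\<^sup>+x. ennreal ((f n x - g x)\<^sup>2) \<partial>torus)"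
        using sfg[of n] that by (intro nn_integral_eq_integral[symmetric]) (auto simp: sqi_def)
      then have "(LINT x|torus. (f n x - g x)\<^sup>2) \<le> ((1/2)^k)\<^sup>2"
        using key[OF that] by (metis ennreal_le_iff zero_le_power2)
      then have "L2_norm (\<lambda>x. f n x - g x) \<le> (1/2)^k"
        unfolding L2_norm_def by (intro real_le_lsqrt) auto
      then show ?thesis using k by simp
    qed
    then show "\<exists>N. \<forall>n\<ge>N. norm (L2_norm (\<lambda>x. f n x - g x) - 0) < e" by blast
  qed
  ultimately show thesis by (rule that)
qed

subsection \<open>Functions of class \<open>C\<^sup>k\<close>\<close>

lemma C_k_SucI:
  assumes "\<And>p. (f has_derivative f' p) (at p)" "\<And>e. e \<in> Basis \<Longrightarrow> C_k k (\<lambda>p. f' p e)"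
  shows "C_k (Suc k) f"
proof -
  have "frechet_derivative f (at p) = f' p" for p
    using frechet_derivative_at[OF assms(1)] by simp
  with assms show ?thesis by (auto simp: differentiable_def)
qed

lemma C_k_Suc_has_derivative:
  "C_k (Suc k) f \<Longrightarrow> (f has_derivative frechet_derivative f (at p)) (at p)"
  using frechet_derivative_works by auto

lemma C_k_Suc_D: "C_k (Suc k) f \<Longrightarrow> C_k k f"
proof (induction k arbitrary: f)
  case 0
  then show ?case
    by (auto intro!: continuous_at_imp_continuous_on simp: differentiable_imp_continuous_within)
next
  case (Suc k)
  then show ?case by (metis C_k.simps(2))
qed

lemma C_k_continuous: "C_k k f \<Longrightarrow> continuous_on UNIV f"
  by (induction k) (auto dest: C_k_Suc_D simp del: C_k.simps(2))

lemma C_k_const: "C_k k (\<lambda>p. c)"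
proof (induction k arbitrary: c)
  case (Suc k)
  then show ?case
    by (intro C_k_SucI[where f'="\<lambda>p e. 0"]) (auto intro!: derivative_eq_intros)
qed simp

lemma C_k_add: "C_k k f \<Longrightarrow> C_k k g \<Longrightarrow> C_k k (\<lambda>p. f p + g p)"
proof (induction k arbitrary: f g)
  case (Suc k)
  show ?case
  proof (rule C_k_SucI)
    show "((\<lambda>p. f p + g p) has_derivative
        (\<lambda>e. dir_deriv e f p + dir_deriv e g p)) (at p)" for p
      by (intro has_derivative_add Suc.prems[THEN C_k_Suc_has_derivative])
    show "C_k k (\<lambda>p. dir_deriv e f p + dir_deriv e g p)" if "e \<in> Basis" for e
      using Suc that by auto
  qed
qed (simp add: continuous_on_add)

lemma C_k_mult: "C_k k f \<Longrightarrow> C_k k g \<Longrightarrow> C_k k (\<lambda>p. f p * g p)"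
proof (induction k arbitrary: f g)
  case (Suc k)
  show ?case
  proof (rule C_k_SucI)
    show "((\<lambda>p. f p * g p) has_derivative
        (\<lambda>e. f p * dir_deriv e g p + dir_deriv e f p * g p)) (at p)" for p
      by (intro has_derivative_mult Suc.prems[THEN C_k_Suc_has_derivative])
    show "C_k k (\<lambda>p. f p * dir_deriv e g p + dir_deriv e f p * g p)" if "e \<in> Basis" for e
      using Suc that C_k_Suc_D[OF Suc.prems(1)] C_k_Suc_D[OF Suc.prems(2)]
      by (intro C_k_add Suc.IH) auto
  qed
qed (simp add: continuous_on_mult)

text \<open>\<open>D\<close> is a chain of successive derivatives. A directional derivative of
  \<open>D m\<close> after \<open>L\<close> is a constant times \<open>D (Suc m)\<close> after
  \<open>L\<close>, so an induction over \<open>k\<close> for all \<open>m\<close> at once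
  closes.\<close>

lemma C_k_compose_linear:
  fixes L :: "'a::euclidean_space \<Rightarrow> real"
  assumes D: "\<And>m x. (D m has_real_derivative D (Suc m) x) (at x)" and L: "bounded_linear L"
  shows "C_k k (\<lambda>p. D m (L p))"
proof (induction k arbitrary: m)
  case 0
  have "continuous_on UNIV (D m)"
    by (meson D DERIV_isCont continuous_at_imp_continuous_on)
  then show ?case
    using continuous_on_compose2[OF _ linear_continuous_on[OF L], of UNIV "D m" UNIV] by simp
next
  case (Suc k)
  show ?case
  proof (rule C_k_SucI)
    show "((\<lambda>p. D m (L p)) has_derivative (\<lambda>e. L e * D (Suc m) (L p))) (at p)" for p
      using has_derivative_compose[OF bounded_linear_imp_has_derivative[OF L, of "at p"]
          D[of m "L p", unfolded has_field_derivative_def]]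
      by (simp add: mult.commute)
    show "C_k k (\<lambda>p. L e * D (Suc m) (L p))" for e
      by (intro C_k_mult C_k_const Suc.IH)
  qed
qed

lemma smooth_const: "smooth (\<lambda>p. c)"
  by (simp add: smooth_def C_k_const)

lemma smooth_add: "smooth f \<Longrightarrow> smooth g \<Longrightarrow> smooth (\<lambda>p. f p + g p)"
  by (simp add: smooth_def C_k_add)

lemma smooth_mult: "smooth f \<Longrightarrow> smooth g \<Longrightarrow> smooth (\<lambda>p. f p * g p)"
  by (simp add: smooth_def C_k_mult)

lemma smooth_compose_linear:
  fixes L :: "'a::euclidean_space \<Rightarrow> real"
  assumes "\<And>m x. (D m has_real_derivative D (Suc m) x) (at x)" "bounded_linear L"
  shows "smooth (\<lambda>p. D m (L p))"
  using C_k_compose_linear[of D L, OF assms] by (simp add: smooth_def)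

lemma smooth_has_derivative: "smooth f \<Longrightarrow> (f has_derivative frechet_derivative f (at p)) (at p)"
  using C_k_Suc_has_derivative[of 0 f] by (auto simp: smooth_def simp del: C_k.simps)

lemma smooth_dir_deriv: "smooth f \<Longrightarrow> e \<in> Basis \<Longrightarrow> smooth (dir_deriv e f)"
  unfolding smooth_def by (metis C_k.simps(2))

lemma smooth_continuous: "smooth f \<Longrightarrow> continuous_on S f"
  unfolding smooth_def by (meson C_k_continuous continuous_on_subset subset_UNIV)

subsection \<open>Integration by parts on the torus\<close>

lemma continuous_integrable_torus: "continuous_on UNIV f \<Longrightarrow> integrable torus (f :: real^'n \<Rightarrow> real)"
  unfolding torus_def by (rule continuous_imp_integrable) (erule continuous_on_subset, simp)

lemma torus_integral_HK:
  fixes f :: "real^'n \<Rightarrow> real"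
  shows "integrable torus f \<Longrightarrow> (LINT x|torus. f x) = integral (cbox 0 1) f"
  unfolding torus_def by (rule lebesgue_integral_eq_integral) auto

lemma continuous_on_UNIV_measurable_torus: "continuous_on UNIV f \<Longrightarrow> f \<in> borel_measurable torus"
  by (intro measurable_borel_torus borel_measurable_continuous_onI)

text \<open>The translated cube is cut at \<open>x $ j = 1\<close>. The piece beyond the cut, moved
  back by one period, is the piece of the original cube with \<open>x $ j\<close> at most
  \<open>t\<close>.\<close>

lemma periodic_integral_shift:
  fixes F :: "real^'n \<Rightarrow> real"
  assumes F: "continuous_on UNIV F" and per: "periodic F" and t: "0 \<le> t" "t \<le> 1"
  shows "integral (cbox 0 1) (\<lambda>x. F (x + t *\<^sub>R axis j 1)) = integral (cbox 0 1) F"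
proof -
  let ?e = "axis j 1 :: real^'n"
  have int: "F integrable_on cbox a b" for a b
    by (rule integrable_continuous[OF continuous_on_subset[OF F subset_UNIV]])
  have nth: "?e $ i = (if i = j then 1 else 0)" for i by (simp add: axis_def)
  have inner: "x \<bullet> ?e = x $ j" for x by (simp add: inner_axis)
  have all: "(\<forall>i. P i) \<longleftrightarrow> P j \<and> (\<forall>i. i \<noteq> j \<longrightarrow> P i)" for P by metis
  have box: "x \<in> cbox (\<alpha> *\<^sub>R ?e) (1 + \<beta> *\<^sub>R ?e) \<longleftrightarrow>
      \<alpha> \<le> x $ j \<and> x $ j \<le> 1 + \<beta> \<and> (\<forall>i. i \<noteq> j \<longrightarrow> 0 \<le> x $ i \<and> x $ i \<le> 1)" for x \<alpha> \<beta>
    unfolding mem_box_cart by (subst all) (simp add: nth)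
  have s1: "cbox (t *\<^sub>R ?e) (1 + t *\<^sub>R ?e) \<inter> {x. x \<bullet> ?e \<le> 1} = cbox (t *\<^sub>R ?e) 1"
    and s2: "cbox (t *\<^sub>R ?e) (1 + t *\<^sub>R ?e) \<inter> {x. x \<bullet> ?e \<ge> 1} = cbox ?e (1 + t *\<^sub>R ?e)"
    and s3: "cbox 0 1 \<inter> {x. x \<bullet> ?e \<le> t} = cbox 0 (1 + (t - 1) *\<^sub>R ?e)"
    and s4: "cbox 0 1 \<inter> {x. x \<bullet> ?e \<ge> t} = cbox (t *\<^sub>R ?e) 1"
    using t box[of _ t 0] box[of _ 0 0] box[of _ 1 t] box[of _ 0 "t - 1"] box[of _ t t]
    by (auto simp: inner)
  have "integral (cbox 0 1) (\<lambda>x. F (x + t *\<^sub>R ?e)) = integral (cbox 0 1) (F \<circ> (+) (t *\<^sub>R ?e))"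
    by (simp add: o_def add.commute)
  also have "\<dots> = integral (cbox (t *\<^sub>R ?e) (1 + t *\<^sub>R ?e)) F"
    using integral_shift_cbox_plus[of 0 1 F "t *\<^sub>R ?e"] by simp
  also have "\<dots> = integral (cbox (t *\<^sub>R ?e) 1) F + integral (cbox ?e (1 + t *\<^sub>R ?e)) F"
    by (intro integral_unique has_integral_split[where c=1 and k="?e"])
      (auto simp: s1 s2 int intro!: integrable_integral)
  also have "integral (cbox ?e (1 + t *\<^sub>R ?e)) F = integral (cbox 0 (1 + (t - 1) *\<^sub>R ?e)) (F \<circ> (+) ?e)"
    using integral_shift_cbox_plus[of 0 "1 + (t - 1) *\<^sub>R ?e" F ?e] by (simp add: algebra_simps)
  also have "F \<circ> (+) ?e = F"
    using per by (auto simp: periodic_def o_def add.commute)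
  also have "integral (cbox (t *\<^sub>R ?e) 1) F + integral (cbox 0 (1 + (t - 1) *\<^sub>R ?e)) F = integral (cbox 0 1) F"
    by (subst add.commute, intro integral_unique[symmetric] has_integral_split[where c=t and k="?e"])
      (auto simp: s3 s4 int intro!: integrable_integral)
  finally show ?thesis .
qed

text \<open>The integral over the translated cell is constant by periodicity, and its derivative at
  translation 0 is the integral of the partial derivative. A one-sided derivative is enough, since
  translations range over \<open>{0..1}\<close>.\<close>

lemma torus_integral_partial_eq_0:
  fixes \<psi> :: "real^'n \<Rightarrow> real"
  assumes per: "periodic \<psi>" and d: "\<And>x. (\<psi> has_derivative \<psi>' x) (at x)"
    and c: "continuous_on UNIV (\<lambda>x. \<psi>' x (axis j 1))"
  shows "(LINT x|torus. \<psi>' x (axis j 1)) = 0"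
proof -
  let ?e = "axis j 1 :: real^'n"
  have cont: "continuous_on UNIV \<psi>"
    using d by (meson has_derivative_continuous continuous_at_imp_continuous_on)
  have "((\<lambda>t. integral (cbox 0 1) (\<lambda>x. \<psi> (x + t *\<^sub>R ?e))) has_field_derivative
      integral (cbox 0 1) (\<lambda>x. \<psi>' (x + 0 *\<^sub>R ?e) ?e)) (at 0 within {0..1})"
  proof (rule leibniz_rule_field_derivative)
    fix t x assume "t \<in> {0..1::real}"
    have "((\<lambda>t. x + t *\<^sub>R ?e) has_derivative (\<lambda>t. t *\<^sub>R ?e)) (at t within {0..1})"
      by (auto intro!: derivative_eq_intros)
    from has_derivative_compose[OF this d[of "x + t *\<^sub>R ?e"]]
    show "((\<lambda>t. \<psi> (x + t *\<^sub>R ?e)) has_field_derivative \<psi>' (x + t *\<^sub>R ?e) ?e) (at t within {0..1})"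
      using linear_cmul[OF has_derivative_linear[OF d[of "x + t *\<^sub>R ?e"]]]
      by (simp add: has_field_derivative_def mult_commute_abs)
  next
    fix t :: real
    show "(\<lambda>x. \<psi> (x + t *\<^sub>R ?e)) integrable_on cbox 0 1"
      by (intro integrable_continuous continuous_on_compose2[OF cont] continuous_intros) auto
  next
    show "continuous_on ({0..1} \<times> cbox 0 1) (\<lambda>(t, x). \<psi>' (x + t *\<^sub>R ?e) ?e)"
      unfolding split_beta
      by (intro continuous_on_compose2[OF c] continuous_intros) auto
  qed auto
  moreover have "((\<lambda>t. integral (cbox 0 1) (\<lambda>x. \<psi> (x + t *\<^sub>R ?e))) has_field_derivative 0) (at 0 within {0..1})"
  proof (rule has_field_derivative_transform_within[where d=1])
    show "((\<lambda>t. integral (cbox 0 1) \<psi>) has_field_derivative 0) (at 0 within {0..1})"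
      by (rule DERIV_const)
  qed (use periodic_integral_shift[OF cont per] in auto)
  ultimately have "integral (cbox 0 1) (\<lambda>x. \<psi>' x ?e) = 0"
    using vector_derivative_unique_within_closed_interval[of 0 1 0]
    by (simp add: has_real_derivative_iff_has_vector_derivative)
  then show ?thesis
    using torus_integral_HK[OF continuous_integrable_torus[OF c]] by simp
qed

subsection \<open>The Hartley basis\<close>

text \<open>
  The functions \<open>cas (2\<pi> k \<bullet> x)\<close> with \<open>cas a = cos a + sin a\<close> form a real orthonormal basis of
  \<open>L\<^sup>2\<close> indexed by all \<open>k \<in> \<int>\<^sup>n\<close>; the gradient of the \<open>k\<close>-th one is \<open>2\<pi> k\<close> times the \<open>(-k)\<close>-th one.
\<close>

definition freq :: "int^'n \<Rightarrow> real^'n" where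
  "freq k = (\<chi> i. real_of_int (k $ i))"

definition hart :: "int^'n \<Rightarrow> real^'n \<Rightarrow> real" where
  "hart k x = cos (2 * pi * (freq k \<bullet> x)) + sin (2 * pi * (freq k \<bullet> x))"

text \<open>Eigenvalue of minus the Laplacian on \<open>hart k\<close>.\<close>

definition lam :: "int^'n \<Rightarrow> real" where
  "lam k = 4 * pi\<^sup>2 * (freq k \<bullet> freq k)"

text \<open>Cubes of frequencies are invariant under negation, as is required because
  differentiation exchanges the modes \<open>k\<close> and \<open>- k\<close>.\<close>

definition modes :: "nat \<Rightarrow> (int^'n) set" where
  "modes n = {k. \<forall>i. \<bar>k $ i\<bar> \<le> int n}"

lemma freq_minus [simp]: "freq (- k) = - freq k"
  by (simp add: freq_def vec_eq_iff)

lemma freq_add: "freq (k + l) = freq k + freq l"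
  by (simp add: freq_def vec_eq_iff)

lemma freq_diff: "freq (k - l) = freq k - freq l"
  by (simp add: freq_def vec_eq_iff)

lemma freq_0 [simp]: "freq 0 = 0"
  by (simp add: freq_def vec_eq_iff)

lemma freq_nth: "freq k $ i = real_of_int (k $ i)"
  by (simp add: freq_def)

lemma hart_0 [simp]: "hart 0 x = 1"
  by (simp add: hart_def)

lemma hart_minus: "hart (- k) x = cos (2 * pi * (freq k \<bullet> x)) - sin (2 * pi * (freq k \<bullet> x))"
  by (simp add: hart_def)

lemma lam_nonneg [simp]: "0 \<le> lam k"
  by (simp add: lam_def)

lemma finite_modes [simp]: "finite (modes n)"
proof -
  have "(modes n :: (int^'a) set) \<subseteq> (\<lambda>f. \<chi> i. f i) ` (UNIV \<rightarrow>\<^sub>E {- int n..int n})"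
  proof
    fix k :: "int^'a" assume "k \<in> modes n"
    then have "k = (\<chi> i. vec_nth k i)" "vec_nth k \<in> UNIV \<rightarrow>\<^sub>E {- int n..int n}"
      by (auto simp: modes_def abs_le_iff minus_le_iff)
    then show "k \<in> (\<lambda>f. \<chi> i. f i) ` (UNIV \<rightarrow>\<^sub>E {- int n..int n})" by blast
  qed
  then show ?thesis by (rule finite_subset) (intro finite_imageI finite_PiE, auto)
qed

lemma modes_mono: "m \<le> n \<Longrightarrow> modes m \<subseteq> modes n"
  by (auto simp: modes_def) (meson order_trans of_nat_le_iff)

lemma uminus_modes [simp]: "- k \<in> modes n \<longleftrightarrow> k \<in> modes n"
  by (simp add: modes_def)

lemma finite_subset_modes:
  assumes "finite F"
  obtains n where "F \<subseteq> modes n"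
proof -
  have "\<exists>n. k \<in> modes n" for k :: "int^'a"
  proof -
    have "\<bar>k $ i\<bar> \<le> int (nat (\<Sum>i\<in>UNIV. \<bar>k $ i\<bar>))" for i
      using member_le_sum[of i UNIV "\<lambda>i. \<bar>k $ i\<bar>"] by (simp add: sum_nonneg)
    then show ?thesis unfolding modes_def by blast
  qed
  with assms have "\<exists>n. F \<subseteq> modes n"
  proof (induction F)
    case (insert k F)
    then obtain a b where "k \<in> modes a" "F \<subseteq> modes b" by metis
    then have "insert k F \<subseteq> modes (max a b)"
      using modes_mono[of a "max a b"] modes_mono[of b "max a b"] by auto
    then show ?case by blast
  qed simp
  then show thesis using that by blast
qed

text \<open>For functions made of modes outside \<open>modes n\<close> this bounds the L2 norm by
  \<open>1 / n\<close> times that of the gradient.\<close>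

lemma lam_ge:
  assumes "k \<notin> modes n"
  shows "(real n)\<^sup>2 \<le> lam k"
proof -
  obtain i where "int n < \<bar>k $ i\<bar>" using assms by (auto simp: modes_def not_le)
  then have "real n \<le> \<bar>freq k $ i\<bar>" by (simp add: freq_nth)
  also have "\<bar>freq k $ i\<bar> \<le> norm (freq k)" by (rule component_le_norm_cart)
  finally have "(real n)\<^sup>2 \<le> (norm (freq k))\<^sup>2" by (simp add: power_mono)
  also have "\<dots> = 1 * (freq k \<bullet> freq k)" by (simp add: power2_norm_eq_inner)
  also have "\<dots> \<le> 4 * pi\<^sup>2 * (freq k \<bullet> freq k)"
  proof (rule mult_right_mono)
    have "1\<^sup>2 \<le> pi\<^sup>2" using pi_gt3 by (intro power_mono) auto
    then show "1 \<le> 4 * pi\<^sup>2" by simp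
  qed simp
  finally show ?thesis by (simp add: lam_def)
qed

lemma hart_bound: "\<bar>hart k x\<bar> \<le> 2"
  unfolding hart_def
  using abs_cos_le_one[of "2 * pi * (freq k \<bullet> x)"] abs_sin_le_one[of "2 * pi * (freq k \<bullet> x)"] by linarith

lemma hart_has_derivative:
  "(hart k has_derivative (\<lambda>w. 2 * pi * (freq k \<bullet> w) * hart (- k) x)) (at x)"
  unfolding hart_def freq_minus
  by (auto intro!: derivative_eq_intros simp: algebra_simps)

lemma dir_deriv_hart: "dir_deriv w (hart k) x = 2 * pi * (freq k \<bullet> w) * hart (- k) x"
  using frechet_derivative_at[OF hart_has_derivative, of k x] by metis

lemma continuous_on_hart [continuous_intros]: "continuous_on S (hart k)"
  unfolding hart_def by (intro continuous_intros)

lemma hart_measurable_borel [measurable]: "hart k \<in> borel_measurable borel"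
  by (intro borel_measurable_continuous_onI continuous_intros)

lemma hart_measurable [measurable]: "hart k \<in> borel_measurable torus"
  by (intro measurable_borel_torus hart_measurable_borel)

lemma sqi_hart [simp]: "sqi (hart k)"
  by (rule sqi_bounded[OF hart_measurable hart_bound])

lemma periodic_hart: "periodic (hart k)"
proof -
  have "2 * pi * (freq k \<bullet> (x + axis i 1)) = 2 * pi * (freq k \<bullet> x) + 2 * pi * of_int (k $ i)" for x :: "real^'a" and i
    by (simp add: inner_add_right inner_axis freq_nth algebra_simps)
  then show ?thesis
    unfolding periodic_def hart_def
    by (simp only: cos_add sin_add sin_int_2pin cos_int_2pin) simp
qed

lemma hart_measurable_lebesgue: "hart k \<in> borel_measurable lebesgue"
  by (intro borel_measurable_subalgebra[of borel lebesgue] hart_measurable_borel)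
    (auto simp: sets_completionI_sub)

lemma hart_L2: "hart k \<in> L2"
  using sqi_hart[of k] periodic_hart[of k] hart_measurable_lebesgue[of k]
  by (simp add: L2_def sqi_def)

text \<open>The \<open>m\<close>-th derivative of cas: differentiation shifts the argument by
  \<open>pi / 2\<close>.\<close>

definition cas_chain :: "nat \<Rightarrow> real \<Rightarrow> real" where
  "cas_chain m a = cos (a + real m * (pi / 2)) + sin (a + real m * (pi / 2))"

lemma cas_chain: "(cas_chain m has_real_derivative cas_chain (Suc m) a) (at a)"
proof -
  have "a + real (Suc m) * (pi / 2) = (a + real m * (pi / 2)) + pi / 2"
    by (simp add: algebra_simps)
  then have "cas_chain (Suc m) a = cos (a + real m * (pi / 2)) - sin (a + real m * (pi / 2))"
    unfolding cas_chain_def by (simp only:) (simp add: cos_add sin_add)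
  then show ?thesis
    unfolding cas_chain_def by (auto intro!: derivative_eq_intros)
qed

lemma smooth_hart: "smooth (hart k)"
proof -
  have "bounded_linear (\<lambda>x. 2 * pi * (freq k \<bullet> x))"
    by (intro bounded_linear_intros)
  from smooth_compose_linear[of cas_chain, OF cas_chain this, of 0] show ?thesis
    by (simp add: cas_chain_def hart_def[abs_def])
qed

text \<open>For nonzero \<open>m\<close> the mode is, up to a nonzero factor, a partial derivative
  of the periodic function \<open>hart (- m)\<close>.\<close>

lemma integral_hart: "(LINT x|torus. hart m x) = (if m = 0 then 1 else 0)"
proof (cases "m = 0")
  case False
  then obtain j where j: "m $ j \<noteq> 0" by (auto simp: vec_eq_iff)
  have "(LINT x|torus. 2 * pi * (freq (- m) \<bullet> axis j 1) * hart (- (- m)) x) = 0"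
    by (rule torus_integral_partial_eq_0[OF periodic_hart hart_has_derivative])
      (intro continuous_intros)
  with j False show ?thesis by (simp add: inner_axis freq_nth)
qed simp

text \<open>Reduces orthogonality to integrals of single modes, and shows that trigonometric
  polynomials are closed under multiplication.\<close>

lemma hart_mult:
  "hart k x * hart l x = (hart (k - l) x + hart (l - k) x + hart (k + l) x - hart (- (k + l)) x) / 2"
proof -
  define a b where "a = 2 * pi * (freq k \<bullet> x)" and "b = 2 * pi * (freq l \<bullet> x)"
  have h: "hart k x = cos a + sin a" "hart l x = cos b + sin b"
    "hart (k - l) x = cos (a - b) + sin (a - b)" "hart (l - k) x = cos (b - a) + sin (b - a)"
    "hart (k + l) x = cos (a + b) + sin (a + b)" "hart (- (k + l)) x = cos (a + b) - sin (a + b)"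
    unfolding hart_minus unfolding hart_def a_def b_def freq_diff freq_add
    by (simp_all add: inner_diff_left inner_add_left right_diff_distrib distrib_left)
  show ?thesis
    unfolding h cos_add sin_add cos_diff sin_diff by algebra
qed

lemma hart_orthonormal: "ip (hart k) (hart l) = (if k = l then 1 else 0)"
proof -
  have "ip (hart k) (hart l) = ((LINT x|torus. hart (k - l) x) + (LINT x|torus. hart (l - k) x)
      + (LINT x|torus. hart (k + l) x) - (LINT x|torus. hart (- (k + l)) x)) / 2"
    unfolding ip_def hart_mult by (simp add: sqi_integrable)
  also have "\<dots> = (if k = l then 1 else 0)"
    unfolding integral_hart by (auto simp: add_eq_0_iff)
  finally show ?thesis .
qed

subsection \<open>Completeness of the Hartley basis\<close>

definition trig :: "(real^'n \<Rightarrow> real) \<Rightarrow> bool" where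
  "trig p \<longleftrightarrow> (\<exists>n a. p = (\<lambda>x. \<Sum>k\<in>modes n. a k * hart k x))"

lemma trigI:
  assumes "finite F"
  shows "trig (\<lambda>x. \<Sum>k\<in>F. a k * hart k x)"
proof -
  obtain n where n: "F \<subseteq> modes n" using finite_subset_modes[OF assms] .
  have "(\<Sum>k\<in>F. a k * hart k x) = (\<Sum>k\<in>modes n. (if k \<in> F then a k else 0) * hart k x)" for x
    using n by (intro sum.mono_neutral_cong_left) auto
  then show ?thesis unfolding trig_def by (auto simp: fun_eq_iff)
qed

lemma trig_hart: "trig (\<lambda>x. c * hart k x)"
  using trigI[of "{k}" "\<lambda>_. c"] by simp

lemma trig_const: "trig (\<lambda>x. c)"
  using trig_hart[of c 0] by simp

lemma trig_add:
  assumes "trig p" "trig q"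
  shows "trig (\<lambda>x. p x + q x)"
proof -
  obtain m a n b where pq: "p = (\<lambda>x. \<Sum>k\<in>modes m. a k * hart k x)" "q = (\<lambda>x. \<Sum>k\<in>modes n. b k * hart k x)"
    using assms by (auto simp: trig_def)
  let ?N = "modes (max m n)"
  have "p x = (\<Sum>k\<in>?N. (if k \<in> modes m then a k else 0) * hart k x)" for x
    unfolding pq using modes_mono[of m "max m n"] by (intro sum.mono_neutral_cong_left) auto
  moreover have "q x = (\<Sum>k\<in>?N. (if k \<in> modes n then b k else 0) * hart k x)" for x
    unfolding pq using modes_mono[of n "max m n"] by (intro sum.mono_neutral_cong_left) auto
  ultimately have "p x + q x = (\<Sum>k\<in>?N. ((if k \<in> modes m then a k else 0) + (if k \<in> modes n then b k else 0)) * hart k x)" for x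
    by (simp add: sum.distrib distrib_right)
  then show ?thesis unfolding trig_def fun_eq_iff by (intro exI allI) 
qed

lemma trig_sum: "finite I \<Longrightarrow> (\<And>i. i \<in> I \<Longrightarrow> trig (p i)) \<Longrightarrow> trig (\<lambda>x. \<Sum>i\<in>I. p i x)"
  by (induction I rule: finite_induct) (auto intro: trig_add trig_const)

lemma trig_hart_mult: "trig (\<lambda>x. c * (hart k x * hart l x))"
proof -
  have "trig (\<lambda>x. c/2 * hart (k - l) x + c/2 * hart (l - k) x + c/2 * hart (k + l) x + (- c/2) * hart (- (k + l)) x)"
    by (intro trig_add trig_hart)
  moreover have "c * (hart k x * hart l x)
      = c/2 * hart (k - l) x + c/2 * hart (l - k) x + c/2 * hart (k + l) x + (- c/2) * hart (- (k + l)) x" for x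
    unfolding hart_mult by (simp add: field_simps)
  ultimately show ?thesis by simp
qed

lemma trig_mult:
  assumes "trig p" "trig q"
  shows "trig (\<lambda>x. p x * q x)"
proof -
  obtain m a n b where pq: "p = (\<lambda>x. \<Sum>k\<in>modes m. a k * hart k x)" "q = (\<lambda>x. \<Sum>k\<in>modes n. b k * hart k x)"
    using assms by (auto simp: trig_def)
  have "p x * q x = (\<Sum>k\<in>modes m. \<Sum>l\<in>modes n. (a k * b l) * (hart k x * hart l x))" for x
    unfolding pq by (simp add: sum_product ac_simps)
  then show ?thesis by (auto intro!: trig_sum trig_hart_mult)
qed

lemma trig_cos: "trig (\<lambda>x. cos (2 * pi * x $ i))"
  and trig_sin: "trig (\<lambda>x. sin (2 * pi * x $ i))"
proof -
  have f: "freq (axis i 1) \<bullet> x = x $ i" for x :: "real^'a"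
  proof -
    have "freq (axis i 1) = (axis i 1 :: real^'a)"
      by (simp add: vec_eq_iff freq_def axis_def)
    then show ?thesis by (simp add: inner_axis')
  qed
  have "trig (\<lambda>x. 1/2 * hart (axis i 1) x + 1/2 * hart (- axis i 1) x)"
    by (intro trig_add trig_hart)
  then show "trig (\<lambda>x. cos (2 * pi * x $ i))"
    by (simp add: hart_def f mult.assoc flip: add_divide_distrib diff_divide_distrib)
  have "trig (\<lambda>x. 1/2 * hart (axis i 1) x + (-1/2) * hart (- axis i 1) x)"
    by (intro trig_add trig_hart)
  then show "trig (\<lambda>x. sin (2 * pi * x $ i))"
    by (simp add: hart_def f mult.assoc flip: add_divide_distrib diff_divide_distrib)
qed

lemma continuous_on_trig: "trig p \<Longrightarrow> continuous_on S p"
  by (auto simp: trig_def intro!: continuous_intros)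

text \<open>
  Stone--Weierstrass on the image of the cube under \<open>x \<mapsto> (cos (2\<pi> x\<^sub>i), sin (2\<pi> x\<^sub>i))\<^sub>i\<close>, which
  identifies only boundary points; a function vanishing on the boundary descends to the image.
\<close>

lemma trig_approx_continuous:
  fixes g :: "real^'n \<Rightarrow> real"
  assumes g: "continuous_on UNIV g" and van: "\<And>x. x \<notin> box 0 1 \<Longrightarrow> g x = 0" and e: "e > 0"
  obtains p where "trig p" "\<And>x. x \<in> cbox 0 1 \<Longrightarrow> \<bar>g x - p x\<bar> < e"
proof -
  define E :: "real^'n \<Rightarrow> (real^'n) \<times> (real^'n)"
    where "E x = (\<chi> i. cos (2 * pi * x $ i), \<chi> i. sin (2 * pi * x $ i))" for x
  define S where "S = E ` cbox 0 1"
  have contE: "continuous_on T E" for T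
    unfolding E_def by (intro continuous_intros continuous_on_vec_lambda)
  have inj: "g x = g y" if xy: "x \<in> cbox 0 1" "y \<in> cbox 0 1" "E x = E y" for x y
  proof (cases "x = y")
    case False
    then obtain i where i: "x $ i \<noteq> y $ i" by (auto simp: vec_eq_iff)
    have "cos (2 * pi * x $ i) = cos (2 * pi * y $ i) \<and> sin (2 * pi * x $ i) = sin (2 * pi * y $ i)"
      using xy(3) by (auto simp: E_def vec_eq_iff)
    then obtain n :: int where "2 * pi * x $ i = 2 * pi * y $ i + 2 * of_int n * pi"
      using sin_cos_eq_iff[of "2 * pi * x $ i" "2 * pi * y $ i"] by (auto simp: mult.commute mult.left_commute)
    then have "2 * pi * (x $ i - y $ i - of_int n) = 0" by (simp add: algebra_simps)
    then have n: "x $ i - y $ i = of_int n" by simp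
    have r: "0 \<le> x $ i" "x $ i \<le> 1" "0 \<le> y $ i" "y $ i \<le> 1"
      using xy by (auto simp: mem_box_cart)
    with n i have "of_int n \<le> (1::real)" "of_int n \<ge> (-1::real)" "n \<noteq> 0" by auto
    \<comment> \<open>Two points of the cube with the same image differ in this coordinate by a
      nonzero integer of size at most 1. So one coordinate is 0 and the other 1, and both points lie
      on the boundary, where \<open>g\<close> vanishes.\<close>
    then have "n = 1 \<or> n = -1" by linarith
    with n r have "(x $ i = 1 \<and> y $ i = 0) \<or> (x $ i = 0 \<and> y $ i = 1)" by auto
    then have "x \<notin> box 0 1" "y \<notin> box 0 1" by (auto simp: mem_box_cart intro!: exI[of _ i])
    then show ?thesis using van by simp
  qed simp
  define G where "G z = g (SOME x. x \<in> cbox 0 1 \<and> E x = z)" for z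
  have G: "G (E x) = g x" if "x \<in> cbox 0 1" for x
  proof -
    have "(SOME y. y \<in> cbox 0 1 \<and> E y = E x) \<in> cbox 0 1 \<and> E (SOME y. y \<in> cbox 0 1 \<and> E y = E x) = E x"
      using that by (intro someI[of "\<lambda>y. y \<in> cbox 0 1 \<and> E y = E x" x]) simp
    then show ?thesis using inj that unfolding G_def by blast
  qed
  \<comment> \<open>By compactness of the cube the image carries the quotient topology: the preimage
    under \<open>G\<close> of a closed set is the image under \<open>E\<close> of a compact
    set.\<close>
  have contG: "continuous_on S G"
    unfolding continuous_on_closed_invariant
  proof (intro allI impI)
    fix B :: "real set" assume "closed B"
    then have "closed (g -` B)"
      using g by (simp add: continuous_closed_vimage continuous_on_eq_continuous_at)
    then have "compact (cbox 0 1 \<inter> g -` B)" by (intro compact_Int_closed compact_cbox)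
    then have "compact (E ` (cbox 0 1 \<inter> g -` B))" by (intro compact_continuous_image contE)
    then have "closed (E ` (cbox 0 1 \<inter> g -` B))" by (rule compact_imp_closed)
    moreover have "E ` (cbox 0 1 \<inter> g -` B) \<inter> S = G -` B \<inter> S"
      by (auto simp: S_def G)
    ultimately show "\<exists>A. closed A \<and> A \<inter> S = G -` B \<inter> S" by blast
  qed
  \<comment> \<open>The coordinates of the image pull back to cosines and sines, so they belong to
    this ring, and they separate points.\<close>
  define R where "R = {F. continuous_on S F \<and> trig (\<lambda>x. F (E x))}"
  interpret function_ring_on R S
  proof
    show "compact S" unfolding S_def by (intro compact_continuous_image contE compact_cbox)
    fix z w assume zw: "z \<in> S" "w \<in> S" "z \<noteq> w"
    then consider i where "fst z $ i \<noteq> fst w $ i" | i where "snd z $ i \<noteq> snd w $ i"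
      by (auto simp: prod_eq_iff vec_eq_iff)
    then show "\<exists>F\<in>R. F z \<noteq> F w"
    proof cases
      case 1
      have "(\<lambda>z. fst z $ i) \<in> R"
        by (auto simp: R_def E_def trig_cos intro!: continuous_intros)
      then show ?thesis using 1 by (intro bexI[of _ "\<lambda>z. fst z $ i"]) auto
    next
      case 2
      have "(\<lambda>z. snd z $ i) \<in> R"
        by (auto simp: R_def E_def trig_sin intro!: continuous_intros)
      then show ?thesis using 2 by (intro bexI[of _ "\<lambda>z. snd z $ i"]) auto
    qed
  qed (auto simp: R_def intro: trig_const trig_add trig_mult continuous_intros)
  obtain F where F: "F \<in> R" "\<forall>z\<in>S. \<bar>G z - F z\<bar> < e"
    using Stone_Weierstrass_basic[OF contG e] by blast
  show thesis
  proof (rule that)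
    show "trig (\<lambda>x. F (E x))" using F by (simp add: R_def)
    show "\<bar>g x - F (E x)\<bar> < e" if "x \<in> cbox 0 1" for x
      using F(2) G[OF that] that by (force simp: S_def)
  qed
qed

lemma L2_norm_dominated_convergence:
  assumes "\<And>n. f n \<in> borel_measurable torus" "sqi w"
    "\<And>n. AE x in torus. \<bar>f n x\<bar> \<le> w x" "AE x in torus. (\<lambda>n. f n x) \<longlonglongrightarrow> 0"
  shows "(\<lambda>n. L2_norm (f n)) \<longlonglongrightarrow> 0"
proof -
  have "(\<lambda>n. LINT x|torus. (f n x)\<^sup>2) \<longlonglongrightarrow> (LINT x|torus. (\<lambda>x::real^'a. 0) x)"
  proof (rule integral_dominated_convergence)
    show "integrable torus (\<lambda>x. (w x)\<^sup>2)" using assms(2) by (simp add: sqi_def)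
    show "AE x in torus. (\<lambda>n. (f n x)\<^sup>2) \<longlonglongrightarrow> 0"
      using assms(4) by eventually_elim (auto intro: tendsto_eq_intros)
    show "AE x in torus. norm ((f n x)\<^sup>2) \<le> (w x)\<^sup>2" for n
      using assms(3)[of n] by eventually_elim (metis abs_ge_zero norm_power power_mono real_norm_def)
  qed (use assms(1) in auto)
  then show ?thesis
    unfolding L2_norm_def using tendsto_real_sqrt by fastforce
qed

lemma AE_torus_box: "AE x in torus. x \<in> box 0 (1::real^'n)"
proof -
  have "negligible (cbox 0 1 - box 0 (1::real^'n))" by (rule negligible_frontier_interval)
  then have "cbox 0 1 - box 0 (1::real^'n) \<in> null_sets lebesgue"
    by (simp add: negligible_iff_null_sets)
  then have "AE x in lebesgue. x \<notin> cbox 0 1 - box 0 (1::real^'n)" by (rule AE_not_in)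
  then show ?thesis
    unfolding torus_def by (subst AE_restrict_space_iff) (auto elim: eventually_mono)
qed

lemma AE_torus_if_lebesgue: "AE x in lebesgue. P x \<Longrightarrow> AE x in torus. P x"
  unfolding torus_def by (subst AE_restrict_space_iff) (auto elim: eventually_mono)

text \<open>A measurable function is almost everywhere a limit of continuous functions. Clipping
  them to \<open>[- B, B]\<close> supplies a dominating constant. A cut-off that vanishes outside
  the open cube and tends to 1 inside it provides the boundary condition of
  \<open>trig_approx_continuous\<close> and does not affect the limit almost everywhere.\<close>

lemma continuous_approx_bounded:
  fixes f :: "real^'n \<Rightarrow> real"
  assumes f: "f \<in> borel_measurable lebesgue" and B: "\<And>x. \<bar>f x\<bar> \<le> B" and e: "e > 0"
  obtains g where "continuous_on UNIV g" "\<And>x. x \<notin> box 0 1 \<Longrightarrow> g x = 0" "L2_norm (\<lambda>x. f x - g x) < e"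
proof -
  have "f measurable_on UNIV" using lebesgue_measurable_imp_measurable_on_real[OF f] by simp
  then obtain N G where N: "negligible N" and G: "\<And>n. continuous_on UNIV (G n)"
    and lim: "\<And>x. x \<notin> N \<Longrightarrow> (\<lambda>n. G n x) \<longlonglongrightarrow> f x"
    unfolding measurable_on_def by auto
  define g where "g n x = min 1 (real n * infdist x (- box 0 1)) * max (- B) (min B (G n x))"
    for n :: nat and x :: "real^'n"
  have B0: "0 \<le> B" using B[of 0] by linarith
  have ne: "- box 0 (1::real^'n) \<noteq> {}" proof -
    have "(0::real^'n) \<in> - box 0 1" by (simp add: mem_box_cart)
    then show ?thesis by blast
  qed
  have cont: "continuous_on UNIV (g n)" for n
    unfolding g_def by (intro continuous_intros G)
  have van: "g n x = 0" if "x \<notin> box 0 1" for n x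
    using that by (simp add: g_def)
  have bd: "\<bar>g n x\<bar> \<le> B" for n x
  proof -
    have "\<bar>g n x\<bar> \<le> 1 * B"
      unfolding g_def abs_mult using B0
      by (intro mult_mono) (auto simp: infdist_nonneg)
    then show ?thesis by simp
  qed
  have "(\<lambda>n. L2_norm (\<lambda>x. f x - g n x)) \<longlonglongrightarrow> 0"
  proof (rule L2_norm_dominated_convergence)
    show "(\<lambda>x. f x - g n x) \<in> borel_measurable torus" for n
      using measurable_torus[OF f] continuous_on_UNIV_measurable_torus[OF cont[of n]] by auto
    show "sqi (\<lambda>x. 2 * B)" by (rule sqi_const)
    have "\<bar>f x - g n x\<bar> \<le> 2 * B" for n x
      using B[of x] bd[of n x] by linarith
    then show "AE x in torus. \<bar>f x - g n x\<bar> \<le> 2 * B" for n by auto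
    have "AE x in lebesgue. x \<notin> N"
      using N by (intro AE_not_in) (simp add: negligible_iff_null_sets)
    then have "AE x in torus. x \<notin> N" by (rule AE_torus_if_lebesgue)
    with AE_torus_box show "AE x in torus. (\<lambda>n. f x - g n x) \<longlonglongrightarrow> 0"
    proof eventually_elim
      case (elim x)
      have d: "infdist x (- box 0 1) > 0"
        using elim ne in_closed_iff_infdist_zero[of "- box 0 1" x] infdist_nonneg[of x "- box 0 1"]
        by (auto simp: open_box less_le closed_Compl)
      obtain n0 where n0: "1 < real n0 * infdist x (- box 0 1)"
        using reals_Archimedean3[OF d] by blast
      have "\<forall>\<^sub>F n in sequentially. min 1 (real n * infdist x (- box 0 1)) = 1"
        using eventually_ge_at_top[of n0]
      proof eventually_elim
        case (elim n)
        have "real n0 * infdist x (- box 0 1) \<le> real n * infdist x (- box 0 1)"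
          using elim d by (intro mult_right_mono) auto
        with n0 show ?case by simp
      qed
      then have l1: "(\<lambda>n. min 1 (real n * infdist x (- box 0 1))) \<longlonglongrightarrow> 1"
        by (rule tendsto_eventually)
      have l2: "(\<lambda>n. max (- B) (min B (G n x))) \<longlonglongrightarrow> max (- B) (min B (f x))"
        by (intro tendsto_intros lim elim)
      have "max (- B) (min B (f x)) = f x" using B[of x] by (auto simp: abs_le_iff)
      with tendsto_mult[OF l1 l2] have "(\<lambda>n. g n x) \<longlonglongrightarrow> f x" by (simp add: g_def)
      then show ?case by (auto intro: tendsto_eq_intros)
    qed
  qed
  from order_tendstoD(2)[OF this e] obtain n where "L2_norm (\<lambda>x. f x - g n x) < e"
    by (auto simp: eventually_sequentially)
  then show thesis using that cont van by blast
qed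

text \<open>Three approximations, each with error \<open>e/3\<close>: bounded values, then
  continuous with zero boundary values, then trigonometric.\<close>

lemma trig_dense:
  fixes f :: "real^'n \<Rightarrow> real"
  assumes f: "f \<in> L2" and e: "e > 0"
  obtains p where "trig p" "L2_norm (\<lambda>x. f x - p x) < e"
proof -
  note sf = L2_sqi[OF f]
  have fm: "f \<in> borel_measurable lebesgue" using f by (simp add: L2_def)
  define c where "c n x = max (- real n) (min (real n) (f x))" for n x
  have cm: "c n \<in> borel_measurable lebesgue" for n
    unfolding c_def using fm by measurable
  have cb: "\<bar>c n x\<bar> \<le> real n" for n x by (auto simp: c_def)
  have sc: "sqi (c n)" for n using measurable_torus[OF cm] cb by (rule sqi_bounded)
  have "(\<lambda>n. L2_norm (\<lambda>x. f x - c n x)) \<longlonglongrightarrow> 0"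
  proof (rule L2_norm_dominated_convergence)
    show "(\<lambda>x. f x - c n x) \<in> borel_measurable torus" for n
      using sqi_diff[OF sf sc] by (simp add: sqi_def)
    show "sqi (\<lambda>x. \<bar>f x\<bar>)" by (rule sqi_abs[OF sf])
    have "\<bar>f x - c n x\<bar> \<le> \<bar>f x\<bar>" for n x by (auto simp: c_def)
    then show "AE x in torus. \<bar>f x - c n x\<bar> \<le> \<bar>f x\<bar>" for n by auto
    show "AE x in torus. (\<lambda>n. f x - c n x) \<longlonglongrightarrow> 0"
    proof (rule AE_I2)
      fix x
      obtain n0 where n0: "\<bar>f x\<bar> \<le> real n0" using real_arch_simple by blast
      have "\<forall>\<^sub>F n in sequentially. f x - c n x = 0"
        using eventually_ge_at_top[of n0] by eventually_elim (use n0 in \<open>auto simp: c_def\<close>)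
      then show "(\<lambda>n. f x - c n x) \<longlonglongrightarrow> 0" by (rule tendsto_eventually)
    qed
  qed
  then obtain n where n: "L2_norm (\<lambda>x. f x - c n x) < e/3"
    using order_tendstoD(2)[of _ 0 _ "e/3"] e by (force simp: eventually_sequentially)
  obtain g where g: "continuous_on UNIV g" "\<And>x. x \<notin> box 0 1 \<Longrightarrow> g x = 0" "L2_norm (\<lambda>x. c n x - g x) < e/3"
    using continuous_approx_bounded[OF cm cb, of "e/3"] e by auto
  obtain p where p: "trig p" "\<And>x. x \<in> cbox 0 1 \<Longrightarrow> \<bar>g x - p x\<bar> < e/3"
    using trig_approx_continuous[OF g(1,2), of "e/3"] e by auto
  have bdd: "sqi h" if "continuous_on UNIV h" for h :: "real^'n \<Rightarrow> real"
  proof -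
    have "bounded (h ` cbox 0 1)"
      by (intro compact_imp_bounded compact_continuous_image compact_cbox continuous_on_subset[OF that subset_UNIV])
    then obtain C where "\<And>x. x \<in> cbox 0 1 \<Longrightarrow> \<bar>h x\<bar> \<le> C" by (auto simp: bounded_iff)
    then show ?thesis using continuous_on_UNIV_measurable_torus[OF that] sqi_bounded by blast
  qed
  have sp: "sqi p" by (rule bdd[OF continuous_on_trig[OF p(1)]])
  note sg = bdd[OF g(1)]
  have gp: "L2_norm (\<lambda>x. g x - p x) \<le> e/3"
    using sqi_diff[OF sg sp] p(2) e by (intro L2_norm_bounded) (auto intro: less_imp_le simp: sqi_def)
  have "L2_norm (\<lambda>x. f x - p x) \<le> L2_norm (\<lambda>x. f x - c n x) + L2_norm (\<lambda>x. c n x - p x)"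
    by (rule L2_norm_triangle_diff[OF sf sc sp])
  also have "L2_norm (\<lambda>x. c n x - p x) \<le> L2_norm (\<lambda>x. c n x - g x) + L2_norm (\<lambda>x. g x - p x)"
    by (rule L2_norm_triangle_diff[OF sc sg sp])
  finally have "L2_norm (\<lambda>x. f x - p x) < e" using n g(3) gp by linarith
  with p(1) show thesis by (rule that)
qed

subsection \<open>Projections and Parseval's identity\<close>

definition comb :: "(int^'n) set \<Rightarrow> (int^'n \<Rightarrow> real) \<Rightarrow> real^'n \<Rightarrow> real" where
  "comb F a = (\<lambda>x. \<Sum>k\<in>F. a k * hart k x)"

lemma sqi_comb [simp]: "sqi (comb F a)"
  unfolding comb_def by (intro sqi_sum sqi_cmult sqi_hart)

lemma comb_L2: "comb F a \<in> L2"
  unfolding comb_def by (intro L2_sum L2_cmult hart_L2)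

lemma ip_comb_hart: "finite F \<Longrightarrow> ip (comb F a) (hart l) = (if l \<in> F then a l else 0)"
  unfolding comb_def by (simp add: ip_sum_left ip_cmult_left sqi_cmult hart_orthonormal if_distrib cong: if_cong)

lemma ip_comb_left: "sqi f \<Longrightarrow> ip (comb F a) f = (\<Sum>k\<in>F. a k * ip f (hart k))"
  unfolding comb_def by (simp add: ip_sum_left ip_cmult_left sqi_cmult ip_commute[of f])

lemma ip_comb_right: "sqi f \<Longrightarrow> ip f (comb F a) = (\<Sum>k\<in>F. a k * ip f (hart k))"
  by (metis ip_comb_left ip_commute)

lemma ip_comb_comb: "finite F \<Longrightarrow> ip (comb F a) (comb F b) = (\<Sum>k\<in>F. a k * b k)"
  by (subst ip_comb_left) (auto simp: ip_comb_hart intro!: sum.cong)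

lemma L2_norm_comb: "finite F \<Longrightarrow> L2_norm (comb F a) = sqrt (\<Sum>k\<in>F. (a k)\<^sup>2)"
  by (simp add: L2_norm_ip ip_comb_comb power2_eq_square)

abbreviation proj :: "nat \<Rightarrow> (real^'n \<Rightarrow> real) \<Rightarrow> real^'n \<Rightarrow> real" where
  "proj n f \<equiv> comb (modes n) (\<lambda>k. ip f (hart k))"

lemma L2_norm_proj_residual:
  "sqi f \<Longrightarrow> (L2_norm (\<lambda>x. f x - proj n f x))\<^sup>2 = (L2_norm f)\<^sup>2 - (\<Sum>k\<in>modes n. (ip f (hart k))\<^sup>2)"
  unfolding L2_norm_sq
  by (subst ip_diff_sq) (auto simp: ip_comb_right ip_comb_hart power2_eq_square)

lemma Bessel: "sqi f \<Longrightarrow> (\<Sum>k\<in>modes n. (ip f (hart k))\<^sup>2) \<le> (L2_norm f)\<^sup>2"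
  using L2_norm_proj_residual[of f n] zero_le_power2[of "L2_norm (\<lambda>x. f x - proj n f x)"] by linarith

lemma L2_norm_proj_le:
  assumes "sqi f"
  shows "L2_norm (proj n f) \<le> L2_norm f"
  using real_sqrt_le_mono[OF Bessel[OF assms, of n]] by (simp add: L2_norm_comb)

text \<open>The degrees may differ, so that one good trigonometric polynomial controls all later
  projections.\<close>

lemma proj_best_approx:
  assumes f: "sqi f" and mn: "m \<le> n"
  shows "L2_norm (\<lambda>x. f x - proj n f x) \<le> L2_norm (\<lambda>x. f x - comb (modes m) a x)"
proof -
  define b where "b k = (if k \<in> modes m then a k else 0)" for k
  have "comb (modes m) a = comb (modes n) b"
    unfolding comb_def b_def using modes_mono[OF mn]
    by (intro ext sum.mono_neutral_cong_left) auto
  then have "(L2_norm (\<lambda>x. f x - comb (modes m) a x))\<^sup>2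
      = (L2_norm f)\<^sup>2 - 2 * (\<Sum>k\<in>modes n. b k * ip f (hart k)) + (\<Sum>k\<in>modes n. (b k)\<^sup>2)"
    unfolding L2_norm_sq using f by (simp add: ip_diff_sq ip_comb_right ip_comb_hart power2_eq_square)
  also have "\<dots> = (L2_norm (\<lambda>x. f x - proj n f x))\<^sup>2 + (\<Sum>k\<in>modes n. (ip f (hart k) - b k)\<^sup>2)"
    using f by (simp add: L2_norm_proj_residual power2_diff sum.distrib sum_subtractf sum_distrib_left algebra_simps)
  finally have "(L2_norm (\<lambda>x. f x - proj n f x))\<^sup>2 \<le> (L2_norm (\<lambda>x. f x - comb (modes m) a x))\<^sup>2"
    by (simp add: sum_nonneg)
  then show ?thesis by (rule power2_le_imp_le) simp
qed

theorem proj_tendsto: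
  assumes f: "f \<in> L2"
  shows "(\<lambda>n. L2_norm (\<lambda>x. f x - proj n f x)) \<longlonglongrightarrow> 0"
proof (rule LIMSEQ_I)
  fix e :: real assume "e > 0"
  from trig_dense[OF f this] obtain p where p: "trig p" "L2_norm (\<lambda>x. f x - p x) < e" .
  obtain m a where "p = comb (modes m) a" using p(1) by (auto simp: trig_def comb_def)
  then have "L2_norm (\<lambda>x. f x - proj n f x) < e" if "n \<ge> m" for n
    using proj_best_approx[OF L2_sqi[OF f] that, of a] p(2) by simp
  then show "\<exists>m. \<forall>n\<ge>m. norm (L2_norm (\<lambda>x. f x - proj n f x) - 0) < e" by auto
qed

lemma ip_tendsto:
  assumes "(\<lambda>n. L2_norm (\<lambda>x. f n x - g x)) \<longlonglongrightarrow> 0" "\<And>n. sqi (f n)" "sqi g" "sqi h"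
  shows "(\<lambda>n. ip (f n) h) \<longlonglongrightarrow> ip g h"
proof (rule LIM_zero_cancel, rule Lim_null_comparison)
  show "(\<lambda>n. L2_norm (\<lambda>x. f n x - g x) * L2_norm h) \<longlonglongrightarrow> 0"
    using tendsto_mult_right[OF assms(1), of "L2_norm h"] by simp
  show "\<forall>\<^sub>F n in sequentially. norm (ip (f n) h - ip g h) \<le> L2_norm (\<lambda>x. f n x - g x) * L2_norm h"
    using Cauchy_Schwarz_ip[OF sqi_diff[OF assms(2,3)] assms(4)] assms
    by (simp add: ip_diff_left)
qed

theorem Parseval:
  assumes f: "f \<in> L2" and g: "sqi g"
  shows "(\<lambda>n. \<Sum>k\<in>modes n. ip f (hart k) * ip g (hart k)) \<longlonglongrightarrow> ip f g"
proof -
  have "(\<lambda>n. ip (proj n f) g) \<longlonglongrightarrow> ip f g"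
    using proj_tendsto[OF f] L2_sqi[OF f] g
    by (intro ip_tendsto) (auto simp: L2_norm_minus_commute[of f])
  then show ?thesis using g by (simp add: ip_comb_left)
qed

subsection \<open>Bounded measurable functions on an interval\<close>

text \<open>A class of coefficients that is closed under products and whose members are integrable
  on the compact interval. Bounds at every point turn indefinite integrals into Lipschitz
  functions.\<close>

definition bm :: "real \<Rightarrow> real \<Rightarrow> (real \<Rightarrow> real) \<Rightarrow> bool" where
  "bm a b g \<longleftrightarrow> g \<in> borel_measurable (lebesgue_on {a..b}) \<and> (\<exists>C. \<forall>t\<in>{a..b}. \<bar>g t\<bar> \<le> C)"

lemma bmI: "g \<in> borel_measurable (lebesgue_on {a..b}) \<Longrightarrow> (\<And>t. t \<in> {a..b} \<Longrightarrow> \<bar>g t\<bar> \<le> C) \<Longrightarrow> bm a b g"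
  unfolding bm_def by blast

lemma bm_bound:
  assumes "bm a b g"
  obtains C where "0 \<le> C" "\<And>t. t \<in> {a..b} \<Longrightarrow> \<bar>g t\<bar> \<le> C"
proof -
  obtain C where "\<forall>t\<in>{a..b}. \<bar>g t\<bar> \<le> C" using assms by (auto simp: bm_def)
  then show thesis by (intro that[of "max C 0"]) (auto simp: le_max_iff_disj)
qed

lemma bm_absint: "bm a b g \<Longrightarrow> g absolutely_integrable_on {a..b}"
  unfolding bm_def
  by (auto intro!: measurable_bounded_by_integrable_imp_absolutely_integrable[where g="\<lambda>_. C" for C]
      simp: integrable_const_ivl)

lemma bm_integrable: "bm a b g \<Longrightarrow> g integrable_on {a..b}"
  using bm_absint set_lebesgue_integral_eq_integral(1) by blast

lemma bm_subinterval:
  assumes "bm a b g" "a \<le> c" "d \<le> b"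
  shows "bm c d g"
proof -
  have "{c..d} \<subseteq> {a..b}" using assms by auto
  then show ?thesis using assms(1) unfolding bm_def
    by (metis measurable_restrict_mono subsetD)
qed

lemma bm_continuous: "continuous_on {a..b} g \<Longrightarrow> bm a b g"
  unfolding bm_def
proof
  assume c: "continuous_on {a..b} g"
  then show "g \<in> borel_measurable (lebesgue_on {a..b})"
    by (intro continuous_imp_measurable_on_sets_lebesgue) auto
  have "bounded (g ` {a..b})"
    using c by (intro compact_imp_bounded compact_continuous_image) auto
  then show "\<exists>C. \<forall>t\<in>{a..b}. \<bar>g t\<bar> \<le> C" by (auto simp: bounded_iff)
qed

lemma bm_const: "bm a b (\<lambda>t. c)"
  by (intro bm_continuous continuous_intros)

lemma bm_add: "bm a b f \<Longrightarrow> bm a b g \<Longrightarrow> bm a b (\<lambda>t. f t + g t)"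
  unfolding bm_def by (auto, meson abs_triangle_ineq add_mono order_trans)

lemma bm_mult:
  assumes "bm a b f" "bm a b g"
  shows "bm a b (\<lambda>t. f t * g t)"
proof -
  obtain C D where "0 \<le> C" "0 \<le> D" "\<And>t. t \<in> {a..b} \<Longrightarrow> \<bar>f t\<bar> \<le> C" "\<And>t. t \<in> {a..b} \<Longrightarrow> \<bar>g t\<bar> \<le> D"
    using bm_bound assms by metis
  then show ?thesis
    using assms by (intro bmI[where C="C * D"]) (auto simp: bm_def abs_mult intro!: mult_mono)
qed

lemma bm_cmult: "bm a b g \<Longrightarrow> bm a b (\<lambda>t. c * g t)"
  by (intro bm_mult bm_const)

lemma bm_diff: "bm a b f \<Longrightarrow> bm a b g \<Longrightarrow> bm a b (\<lambda>t. f t - g t)"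
  using bm_add[of a b f "\<lambda>t. (-1) * g t"] bm_cmult[of a b g "-1"] by simp

lemma bm_sum: "(\<And>i. i \<in> I \<Longrightarrow> bm a b (f i)) \<Longrightarrow> bm a b (\<lambda>t. \<Sum>i\<in>I. f i t)"
  by (induction I rule: infinite_finite_induct) (auto intro: bm_add bm_const)

lemmas bm_intros = bm_const bm_add bm_mult bm_diff bm_sum

lemma bm_integral_bound:
  assumes "bm a b g" "\<And>t. t \<in> {a..b} \<Longrightarrow> \<bar>g t\<bar> \<le> C" "a \<le> b" "0 \<le> C"
  shows "\<bar>integral {a..b} g\<bar> \<le> C * (b - a)"
  using has_integral_bound[of C g "integral {a..b} g" a b] assms bm_integrable[OF assms(1)]
  by (auto simp: integrable_integral cbox_interval)

lemma integral_diff_bm: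
  assumes "bm a b g" "a \<le> s" "s \<le> t" "t \<le> b"
  shows "integral {a..t} g - integral {a..s} g = integral {s..t} g"
  using Henstock_Kurzweil_Integration.integral_combine[of a s t g]
    bm_integrable[OF bm_subinterval[OF assms(1), of a t]] assms by auto

lemma bm_indefinite_continuous:
  assumes "bm a b g"
  shows "continuous_on {a..b} (\<lambda>t. integral {a..t} g)"
  by (rule indefinite_integral_continuous_1[OF bm_integrable[OF assms]])

text \<open>
  The difference of the two sides is Lipschitz with quadratic modulus, hence has derivative zero;
  this avoids the differentiation theorem for the Lebesgue integral.
\<close>

lemma product_rule:
  assumes "a \<le> b" and g: "bm a b g" and h: "bm a b h"
    and x: "\<And>t. t \<in> {a..b} \<Longrightarrow> x t = x a + integral {a..t} g"
    and y: "\<And>t. t \<in> {a..b} \<Longrightarrow> y t = y a + integral {a..t} h"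
  shows "x b * y b - x a * y a = integral {a..b} (\<lambda>t. x t * h t + g t * y t)"
proof -
  obtain C where C: "0 \<le> C" "\<And>t. t \<in> {a..b} \<Longrightarrow> \<bar>g t\<bar> \<le> C" using bm_bound[OF g] by blast
  obtain D where D: "0 \<le> D" "\<And>t. t \<in> {a..b} \<Longrightarrow> \<bar>h t\<bar> \<le> D" using bm_bound[OF h] by blast
  have "continuous_on {a..b} (\<lambda>t. x a + integral {a..t} g)"
    by (intro continuous_intros bm_indefinite_continuous g)
  then have cx: "continuous_on {a..b} x" using x continuous_on_cong by (metis (mono_tags, lifting))
  have "continuous_on {a..b} (\<lambda>t. y a + integral {a..t} h)"
    by (intro continuous_intros bm_indefinite_continuous h)
  then have cy: "continuous_on {a..b} y" using y continuous_on_cong by (metis (mono_tags, lifting))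
  have bxy: "bm a b (\<lambda>t. x t * h t + g t * y t)"
    by (intro bm_intros g h bm_continuous cx cy)
  have dx: "x t - x s = integral {s..t} g" if "a \<le> s" "s \<le> t" "t \<le> b" for s t
    using x[of s] x[of t] integral_diff_bm[OF g, of s t] that by simp
  have dy: "y t - y s = integral {s..t} h" if "a \<le> s" "s \<le> t" "t \<le> b" for s t
    using y[of s] y[of t] integral_diff_bm[OF h, of s t] that by simp
  have lx: "\<bar>x t - x s\<bar> \<le> C * (t - s)" if "a \<le> s" "s \<le> t" "t \<le> b" for s t
    unfolding dx[OF that] using that C by (intro bm_integral_bound bm_subinterval[OF g]) auto
  have ly: "\<bar>y t - y s\<bar> \<le> D * (t - s)" if "a \<le> s" "s \<le> t" "t \<le> b" for s t
    unfolding dy[OF that] using that D by (intro bm_integral_bound bm_subinterval[OF h]) auto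
  define \<psi> where "\<psi> t = x t * y t - integral {a..t} (\<lambda>t. x t * h t + g t * y t)" for t
  define K where "K = 2 * C * D"
  have quad: "\<bar>\<psi> t - \<psi> s\<bar> \<le> K * (t - s)\<^sup>2" if st: "a \<le> s" "s \<le> t" "t \<le> b" for s t
  proof -
    note sub = bm_subinterval[OF _ st(1,3)]
    note bs = sub[OF g] sub[OF h] sub[OF bxy] sub[OF bm_continuous[OF cx]] sub[OF bm_continuous[OF cy]]
    have i: "integral {s..t} (\<lambda>r. x t * h r + g r * y s) = x t * integral {s..t} h + integral {s..t} g * y s"
      using bm_integrable[OF sub[OF g]] bm_integrable[OF sub[OF h]]
      by (subst Henstock_Kurzweil_Integration.integral_add) (auto intro: integrable_on_cmult_left integrable_on_mult_right integrable_on_mult_left)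
    have "\<psi> t - \<psi> s = x t * y t - x s * y s - integral {s..t} (\<lambda>t. x t * h t + g t * y t)"
      using integral_diff_bm[OF bxy st] by (simp add: \<psi>_def)
    \<comment> \<open>With \<open>x\<close> frozen at \<open>t\<close> and \<open>y\<close> frozen
      at \<open>s\<close>, the integral reproduces the increment of the product exactly. Unfreezing
      costs an increment of \<open>x\<close> or \<open>y\<close> times a bounded function, which is
      quadratic in \<open>t - s\<close> after integration.\<close>
    also have "x t * y t - x s * y s = integral {s..t} (\<lambda>r. x t * h r + g r * y s)"
      unfolding i dx[OF st, symmetric] dy[OF st, symmetric] by (simp add: algebra_simps)
    also have "\<dots> - integral {s..t} (\<lambda>t. x t * h t + g t * y t)
        = integral {s..t} (\<lambda>r. (x t * h r + g r * y s) - (x r * h r + g r * y r))"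
      by (intro Henstock_Kurzweil_Integration.integral_diff[symmetric] bm_integrable bm_intros bs)
    also have "\<bar>\<dots>\<bar> \<le> (K * (t - s)) * (t - s)"
    proof (rule bm_integral_bound)
      show "bm s t (\<lambda>r. (x t * h r + g r * y s) - (x r * h r + g r * y r))"
        by (intro bm_intros bs)
      fix r assume r: "r \<in> {s..t}"
      have "\<bar>(x t * h r + g r * y s) - (x r * h r + g r * y r)\<bar> = \<bar>(x t - x r) * h r + g r * (y s - y r)\<bar>"
        by (simp add: algebra_simps)
      also have "\<dots> \<le> \<bar>x t - x r\<bar> * \<bar>h r\<bar> + \<bar>g r\<bar> * \<bar>y s - y r\<bar>"
        by (metis abs_mult abs_triangle_ineq)
      also have "\<dots> \<le> (C * (t - s)) * D + C * (D * (t - s))"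
      proof (intro add_mono mult_mono)
        have "\<bar>x t - x r\<bar> \<le> C * (t - r)" using lx[of r t] r st by auto
        also have "\<dots> \<le> C * (t - s)" using r C by (intro mult_left_mono) auto
        finally show "\<bar>x t - x r\<bar> \<le> C * (t - s)" .
        have "\<bar>y s - y r\<bar> \<le> D * (r - s)" using ly[of s r] r st by (auto simp: abs_minus_commute)
        also have "\<dots> \<le> D * (t - s)" using r D by (intro mult_left_mono) auto
        finally show "\<bar>y s - y r\<bar> \<le> D * (t - s)" .
      qed (use C D r st in auto)
      finally show "\<bar>(x t * h r + g r * y s) - (x r * h r + g r * y r)\<bar> \<le> K * (t - s)"
        by (simp add: K_def algebra_simps)
    qed (use st C D in \<open>auto simp: K_def\<close>)
    finally show ?thesis by (simp add: power2_eq_square mult.assoc)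
  qed
  have quad': "\<bar>\<psi> t - \<psi> s\<bar> \<le> K * \<bar>t - s\<bar> * \<bar>t - s\<bar>" if "s \<in> {a..b}" "t \<in> {a..b}" for s t
    using quad[of s t] quad[of t s] that
    by (cases "s \<le> t") (auto simp: power2_eq_square abs_minus_commute mult.assoc)
  have "(\<psi> has_field_derivative 0) (at t within {a..b})" if t: "t \<in> {a..b}" for t
    unfolding has_field_derivative_iff
  proof (rule Lim_null_comparison)
    show "\<forall>\<^sub>F s in at t within {a..b}. norm ((\<psi> s - \<psi> t) / (s - t)) \<le> K * \<bar>s - t\<bar>"
      unfolding eventually_at_filter
      using quad'[OF t] by (intro always_eventually) (auto simp: divide_simps)
    have "((\<lambda>s. K * \<bar>s - t\<bar>) \<longlongrightarrow> K * \<bar>t - t\<bar>) (at t within {a..b})"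
      by (intro tendsto_intros)
    then show "((\<lambda>s. K * \<bar>s - t\<bar>) \<longlongrightarrow> 0) (at t within {a..b})" by simp
  qed
  then obtain c where "\<And>t. t \<in> {a..b} \<Longrightarrow> \<psi> t = c"
    using has_field_derivative_zero_constant[of "{a..b}" \<psi>] by auto
  then have "\<psi> b = \<psi> a" using \<open>a \<le> b\<close> by simp
  then show ?thesis by (simp add: \<psi>_def)
qed

subsection \<open>Algebras of functions closed under differentiation\<close>

inductive_set alg :: "(real \<Rightarrow> real) set \<Rightarrow> (real \<Rightarrow> real) set" for B where
  base: "f \<in> B \<Longrightarrow> f \<in> alg B"
| const: "(\<lambda>x. c) \<in> alg B"
| add: "f \<in> alg B \<Longrightarrow> g \<in> alg B \<Longrightarrow> (\<lambda>x. f x + g x) \<in> alg B"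
| mult: "f \<in> alg B \<Longrightarrow> g \<in> alg B \<Longrightarrow> (\<lambda>x. f x * g x) \<in> alg B"

text \<open>By the Leibniz rule, if the generators have their derivatives in the algebra then so has
  every element. A whole chain of higher derivatives can then be chosen without a formula for any of
  them.\<close>

lemma alg_chain:
  assumes B: "\<And>f. f \<in> B \<Longrightarrow> \<exists>f'\<in>alg B. \<forall>x\<in>I. (f has_real_derivative f' x) (at x within I)"
    and f: "f \<in> alg B"
  obtains D where "D 0 = f" "\<And>k. D k \<in> alg B"
    "\<And>k x. x \<in> I \<Longrightarrow> (D k has_real_derivative D (Suc k) x) (at x within I)"
proof -
  have d: "\<exists>f'\<in>alg B. \<forall>x\<in>I. (f has_real_derivative f' x) (at x within I)" if "f \<in> alg B" for f
    using that
  proof induction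
    case (base f)
    then show ?case by (rule B)
  next
    case (const c)
    show ?case by (rule bexI[OF _ alg.const[of 0]]) auto
  next
    case (add f g)
    then obtain f' g' where "f' \<in> alg B" "g' \<in> alg B"
      "\<forall>x\<in>I. (f has_real_derivative f' x) (at x within I)" "\<forall>x\<in>I. (g has_real_derivative g' x) (at x within I)"
      by blast
    then show ?case
      by (intro bexI[OF _ alg.add[of f' B g']]) (auto intro!: derivative_eq_intros)
  next
    case (mult f g)
    then obtain f' g' where "f' \<in> alg B" "g' \<in> alg B"
      "\<forall>x\<in>I. (f has_real_derivative f' x) (at x within I)" "\<forall>x\<in>I. (g has_real_derivative g' x) (at x within I)"
      by blast
    then show ?case using mult.hyps
      by (intro bexI[OF _ alg.add[OF alg.mult[of f' B g] alg.mult[of f B g']]]) (auto intro!: derivative_eq_intros)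
  qed
  have "\<exists>D. \<forall>n. (D n \<in> alg B \<and> (n = 0 \<longrightarrow> D n = f)) \<and>
      (\<forall>x\<in>I. (D n has_real_derivative D (Suc n) x) (at x within I))"
    by (rule dependent_nat_choice) (use f d in auto)
  then show thesis using that by blast
qed

subsection \<open>A smooth step\<close>

text \<open>For \<open>n = 0\<close> the classical function that is flat at 0. The powers of
  \<open>1 / x\<close> are included because its derivatives produce them.\<close>

definition flat :: "nat \<Rightarrow> real \<Rightarrow> real" where
  "flat n x = (if x > 0 then exp (- (1 / x)) / x ^ n else 0)"

lemma flat_tendsto_0: "(flat n \<longlongrightarrow> 0) (at 0)"
proof -
  have "((\<lambda>x. (inverse x) ^ n / exp (inverse x)) \<longlongrightarrow> 0) (at_right (0::real))"
    by (rule filterlim_compose[OF tendsto_power_div_exp_0 filterlim_inverse_at_top_right])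
  then have "(flat n \<longlongrightarrow> 0) (at_right 0)"
    by (rule Lim_transform_eventually)
      (auto simp: eventually_at_right_less flat_def exp_minus field_simps intro!: eventually_at_rightI[of 0 1])
  moreover have "(flat n \<longlongrightarrow> 0) (at_left 0)"
    by (rule Lim_transform_eventually[of "\<lambda>_. 0"])
      (auto simp: flat_def intro!: eventually_at_leftI[of "-1"])
  ultimately show ?thesis by (simp add: filterlim_split_at)
qed

lemma flat_deriv: "(flat n has_real_derivative flat (Suc (Suc n)) x + (- real n) * flat (Suc n) x) (at x)"
proof -
  consider "x > 0" | "x < 0" | "x = 0" by linarith
  then show ?thesis
  proof cases
    case 1
    have "((\<lambda>x. exp (- (1 / x)) / x ^ n) has_real_derivative flat (Suc (Suc n)) x + (- real n) * flat (Suc n) x) (at x)"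
      using 1 by (cases n) (auto intro!: derivative_eq_intros simp: flat_def field_simps power2_eq_square,
          metis One_nat_def power_minus_mult mult.commute neq0_conv)
    then show ?thesis
      by (rule has_field_derivative_transform_within_open[where S="{0<..}"]) (use 1 in \<open>auto simp: flat_def\<close>)
  next
    case 2
    have "((\<lambda>x. 0) has_real_derivative 0) (at x)" by simp
    then have "(flat n has_real_derivative 0) (at x)"
      by (rule has_field_derivative_transform_within_open[where S="{..<0}"]) (use 2 in \<open>auto simp: flat_def\<close>)
    then show ?thesis using 2 by (simp add: flat_def)
  next
    case 3
    \<comment> \<open>Away from 0 the difference quotient is \<open>flat (Suc n)\<close>
      itself.\<close>
    have "((\<lambda>h. (flat n h - flat n 0) / (h - 0)) \<longlongrightarrow> 0) (at 0)"
      by (rule Lim_transform_eventually[OF flat_tendsto_0[of "Suc n"]])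
        (auto simp: flat_def eventually_at_filter)
    then have "(flat n has_real_derivative 0) (at 0)"
      by (simp add: has_field_derivative_iff)
    then show ?thesis using 3 by (simp add: flat_def)
  qed
qed

lemma flat_0_pos: "x > 0 \<Longrightarrow> flat 0 x > 0"
  and flat_nonneg: "0 \<le> flat n x"
  by (auto simp: flat_def)

text \<open>The quotient \<open>f x / (f x + f (1 - x))\<close> with \<open>f = flat 0\<close>. The
  chain \<open>S\<close> of all derivatives is returned because test functions and the time change
  are built from scaled copies of it.\<close>

lemma smooth_step:
  obtains S :: "nat \<Rightarrow> real \<Rightarrow> real" where
    "\<And>k x. (S k has_real_derivative S (Suc k) x) (at x)"
    "\<And>x. x \<le> 0 \<Longrightarrow> S 0 x = 0" "\<And>x. x \<ge> 1 \<Longrightarrow> S 0 x = 1" "\<And>x. 0 \<le> S 0 x" "\<And>x. S 0 x \<le> 1"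
proof -
  define den where "den x = flat 0 x + flat 0 (1 - x)" for x
  have den: "den x > 0" for x
    using flat_0_pos[of x] flat_0_pos[of "1 - x"] flat_nonneg[of 0 x] flat_nonneg[of 0 "1 - x"]
    unfolding den_def by (cases "x > 0") (auto intro: add_pos_nonneg add_nonneg_pos)
  define r where "r x = inverse (den x)" for x
  \<comment> \<open>The reciprocal \<open>r\<close> of the denominator is a generator of its own:
    its derivative is a product of \<open>den'\<close> and two factors \<open>r\<close>, up to
    sign.\<close>
  define B where "B = {r} \<union> range flat \<union> range (\<lambda>n x. flat n (1 - x))"
  have fl: "flat n \<in> alg B" "(\<lambda>x. flat n (1 - x)) \<in> alg B" "r \<in> alg B" for n
    by (auto simp: B_def intro: alg.base)
  define f' where "f' n x = flat (Suc (Suc n)) x + (- real n) * flat (Suc n) x" for n x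
  have f': "f' n \<in> alg B" "(\<lambda>x. (-1) * f' n (1 - x)) \<in> alg B" for n
    unfolding f'_def by (intro alg.add alg.mult alg.const fl)+
  have d1: "(flat n has_real_derivative f' n x) (at x)" for n x
    unfolding f'_def by (rule flat_deriv)
  have d2: "((\<lambda>x. flat n (1 - x)) has_real_derivative (-1) * f' n (1 - x)) (at x)" for n x
  proof -
    have "((\<lambda>x. 1 - x) has_real_derivative (-1)) (at x)" for x :: real
      by (auto intro!: derivative_eq_intros)
    from DERIV_chain2[OF d1 this, of n x] show ?thesis by (simp add: mult.commute)
  qed
  define den' where "den' x = f' 0 x + (-1) * f' 0 (1 - x)" for x
  have den': "den' \<in> alg B" unfolding den'_def by (intro alg.add f')
  have "(den has_real_derivative den' x) (at x)" for x
    unfolding den_def[abs_def] den'_def by (intro DERIV_add d1 d2)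
  then have d3: "(r has_real_derivative (-1) * (den' x * (r x * r x))) (at x)" for x
    unfolding r_def[abs_def] using den[of x]
    by (auto intro!: derivative_eq_intros simp: power2_eq_square divide_simps)
  have r': "(\<lambda>x. (-1) * (den' x * (r x * r x))) \<in> alg B"
    by (intro alg.mult alg.const fl den')
  have B: "\<exists>g'\<in>alg B. \<forall>x\<in>UNIV. (g has_real_derivative g' x) (at x)" if "g \<in> B" for g
  proof -
    consider "g = r" | n where "g = flat n" | n where "g = (\<lambda>x. flat n (1 - x))"
      using \<open>g \<in> B\<close> by (auto simp: B_def)
    then show ?thesis
    proof cases
      case 1
      then show ?thesis using d3 by (intro bexI[OF _ r']) auto
    next
      case 2
      then show ?thesis using d1 by (intro bexI[OF _ f'(1)]) auto
    next
      case 3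
      then show ?thesis using d2 by (intro bexI[OF _ f'(2)]) auto
    qed
  qed
  have "(\<lambda>x. flat 0 x * r x) \<in> alg B" by (intro alg.mult fl)
  from alg_chain[of B UNIV, OF B this]
  obtain S where S: "S 0 = (\<lambda>x. flat 0 x * r x)" "\<And>k x. (S k has_real_derivative S (Suc k) x) (at x)"
    by (metis UNIV_I)
  show thesis
  proof
    show "(S k has_real_derivative S (Suc k) x) (at x)" for k x by (rule S)
    show "S 0 x = 0" if "x \<le> 0" for x using that by (simp add: S flat_def)
    show "S 0 x = 1" if "x \<ge> 1" for x
      using that den[of x] by (simp add: S r_def den_def flat_def)
    show "0 \<le> S 0 x" for x using den[of x] flat_nonneg[of 0 x] by (simp add: S r_def)
    show "S 0 x \<le> 1" for x
      using den[of x] flat_nonneg[of 0 "1 - x"] by (simp add: S r_def field_simps) (simp add: den_def)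
  qed
qed

subsection \<open>The drift in Hartley coordinates\<close>

text \<open>A flow at one instant. The bound holds at every point, so estimates need no exceptional
  sets.\<close>

definition tame :: "real \<Rightarrow> (real^'n \<Rightarrow> real^'n) \<Rightarrow> bool" where
  "tame M w \<longleftrightarrow> w \<in> borel_measurable torus \<and> (\<forall>x. norm (w x) \<le> M) \<and>
     (\<forall>\<psi>. smooth \<psi> \<and> periodic \<psi> \<longrightarrow> (LINT x|torus. dir_deriv (w x) \<psi> x) = 0)"

text \<open>Coefficient \<open>l\<close> of minus the divergence of \<open>f w\<close>, with the
  derivative moved to the mode.\<close>

definition drift :: "(real^'n \<Rightarrow> real^'n) \<Rightarrow> (real^'n \<Rightarrow> real) \<Rightarrow> int^'n \<Rightarrow> real" where
  "drift w f l = (LINT x|torus. f x * dir_deriv (w x) (hart l) x)"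

definition grad :: "(int^'n) set \<Rightarrow> (int^'n \<Rightarrow> real) \<Rightarrow> real^'n \<Rightarrow> real^'n" where
  "grad F a x = (\<Sum>k\<in>F. (2 * pi * a k * hart (- k) x) *\<^sub>R freq k)"

lemma comb_has_derivative: "(comb F a has_derivative (\<lambda>w. grad F a x \<bullet> w)) (at x)"
proof -
  have "((\<lambda>x. \<Sum>k\<in>F. a k * hart k x) has_derivative
      (\<lambda>w. \<Sum>k\<in>F. a k * (2 * pi * (freq k \<bullet> w) * hart (- k) x))) (at x)"
    by (intro has_derivative_sum has_derivative_mult_right hart_has_derivative)
  moreover have "(\<Sum>k\<in>F. a k * (2 * pi * (freq k \<bullet> w) * hart (- k) x)) = grad F a x \<bullet> w" for w
    unfolding grad_def by (simp add: inner_sum_left ac_simps)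
  ultimately show ?thesis by (simp add: comb_def)
qed

lemma continuous_on_grad: "continuous_on S (grad F a)"
  unfolding grad_def by (intro continuous_intros)

lemma grad_measurable [measurable]: "grad F a \<in> borel_measurable torus"
  by (intro measurable_borel_torus borel_measurable_continuous_onI continuous_on_grad)

lemma sqi_norm_grad: "finite F \<Longrightarrow> sqi (\<lambda>x. norm (grad F a x))"
proof (rule sqi_bounded)
  fix x :: "real^'a"
  have "norm (grad F a x) \<le> (\<Sum>k\<in>F. norm ((2 * pi * a k * hart (- k) x) *\<^sub>R freq k))"
    unfolding grad_def by (rule norm_sum)
  also have "\<dots> \<le> (\<Sum>k\<in>F. 2 * pi * \<bar>a k\<bar> * 2 * norm (freq k))"
  proof (rule sum_mono)
    fix k
    have "norm ((2 * pi * a k * hart (- k) x) *\<^sub>R freq k) = (2 * pi * \<bar>a k\<bar> * norm (freq k)) * \<bar>hart (- k) x\<bar>"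
      by (simp add: abs_mult)
    also have "\<dots> \<le> (2 * pi * \<bar>a k\<bar> * norm (freq k)) * 2"
      by (intro mult_left_mono hart_bound) auto
    finally show "norm ((2 * pi * a k * hart (- k) x) *\<^sub>R freq k) \<le> 2 * pi * \<bar>a k\<bar> * 2 * norm (freq k)" by simp
  qed
  finally show "\<bar>norm (grad F a x)\<bar> \<le> (\<Sum>k\<in>F. 2 * pi * \<bar>a k\<bar> * 2 * norm (freq k))" by simp
qed measurable

text \<open>Cross terms vanish because \<open>hart (- k)\<close> and \<open>hart (- l)\<close> are
  orthogonal for distinct \<open>k\<close> and \<open>l\<close>.\<close>

lemma L2_norm_grad:
  assumes "finite F"
  shows "(L2_norm (\<lambda>x. norm (grad F a x)))\<^sup>2 = (\<Sum>k\<in>F. lam k * (a k)\<^sup>2)"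
proof -
  have "(L2_norm (\<lambda>x. norm (grad F a x)))\<^sup>2 = (LINT x|torus. grad F a x \<bullet> grad F a x)"
    by (simp add: L2_norm_sq ip_def power2_norm_eq_inner flip: power2_eq_square)
  also have "\<dots> = (LINT x|torus. (\<Sum>k\<in>F. \<Sum>l\<in>F. (4 * pi\<^sup>2 * a k * a l * (freq k \<bullet> freq l)) * (hart (- k) x * hart (- l) x)))"
    unfolding grad_def inner_sum_left
    by (intro Bochner_Integration.integral_cong refl, unfold inner_sum_right, intro sum.cong refl)
      (simp add: power2_eq_square)
  also have "\<dots> = (\<Sum>k\<in>F. \<Sum>l\<in>F. (4 * pi\<^sup>2 * a k * a l * (freq k \<bullet> freq l)) * ip (hart (- k)) (hart (- l)))"
    unfolding ip_def
    by (simp add: Bochner_Integration.integral_sum sqi_mult_integrable)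
  also have "\<dots> = (\<Sum>k\<in>F. lam k * (a k)\<^sup>2)"
    using assms by (simp add: hart_orthonormal lam_def power2_eq_square if_distrib ac_simps cong: if_cong)
  finally show ?thesis .
qed

lemma sqi_dir_deriv_hart:
  assumes "tame M w"
  shows "sqi (\<lambda>x. dir_deriv (w x) (hart l) x)"
proof (rule sqi_bounded)
  have [measurable]: "w \<in> borel_measurable torus" using assms by (simp add: tame_def)
  show "(\<lambda>x. dir_deriv (w x) (hart l) x) \<in> borel_measurable torus"
    unfolding dir_deriv_hart by measurable
  fix x
  have "norm (w x) \<le> M" using assms by (simp add: tame_def)
  then have "\<bar>freq l \<bullet> w x\<bar> \<le> norm (freq l) * M"
    by (meson Cauchy_Schwarz_ineq2 mult_left_mono norm_ge_zero order_trans)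
  then have "2 * pi * \<bar>freq l \<bullet> w x\<bar> * \<bar>hart (- l) x\<bar> \<le> 2 * pi * (norm (freq l) * M) * 2"
    using hart_bound[of "- l" x] by (intro mult_mono) auto
  then show "\<bar>dir_deriv (w x) (hart l) x\<bar> \<le> 2 * pi * (norm (freq l) * M) * 2"
    unfolding dir_deriv_hart by (simp add: abs_mult)
qed

lemma drift_ip: "drift w f l = ip f (\<lambda>x. dir_deriv (w x) (hart l) x)"
  by (simp add: drift_def ip_def)

lemma drift_diff: "tame M w \<Longrightarrow> sqi f \<Longrightarrow> sqi g \<Longrightarrow> drift w (\<lambda>x. f x - g x) l = drift w f l - drift w g l"
  unfolding drift_ip by (intro ip_diff_left sqi_dir_deriv_hart)

lemma drift_comb:
  "tame M w \<Longrightarrow> drift w (comb F a) l = (\<Sum>k\<in>F. a k * drift w (hart k) l)"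
  unfolding drift_ip
  by (simp add: ip_comb_left sqi_dir_deriv_hart) (simp add: ip_commute)

lemma sqi_grad_inner:
  assumes "tame M w" "finite F"
  shows "sqi (\<lambda>x. grad F a x \<bullet> w x)"
proof -
  have "sqi (\<lambda>x. \<Sum>k\<in>F. a k * dir_deriv (w x) (hart k) x)"
    by (intro sqi_sum sqi_cmult sqi_dir_deriv_hart[OF assms(1)])
  moreover have "(\<Sum>k\<in>F. a k * dir_deriv (w x) (hart k) x) = grad F a x \<bullet> w x" for x
    unfolding grad_def dir_deriv_hart by (simp add: inner_sum_left ac_simps)
  ultimately show ?thesis by simp
qed

lemma sum_drift:
  assumes "tame M w" "sqi f"
  shows "(\<Sum>l\<in>F. a l * drift w f l) = ip f (\<lambda>x. grad F a x \<bullet> w x)"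
proof -
  have "(\<Sum>l\<in>F. a l * drift w f l) = ip f (\<lambda>x. \<Sum>l\<in>F. a l * dir_deriv (w x) (hart l) x)"
    using assms by (simp add: drift_ip ip_sum_right ip_cmult_right sqi_cmult sqi_dir_deriv_hart)
  also have "(\<lambda>x. \<Sum>l\<in>F. a l * dir_deriv (w x) (hart l) x) = (\<lambda>x. grad F a x \<bullet> w x)"
    unfolding grad_def dir_deriv_hart by (simp add: inner_sum_left ac_simps)
  finally show ?thesis .
qed

text \<open>Summing first gives a single integral of \<open>f\<close> against \<open>w\<close> times
  the gradient of \<open>comb F a\<close>. The bound therefore contains only the gradient norm of
  the test polynomial and no derivative of \<open>f\<close>.\<close>

lemma drift_bound:
  assumes w: "tame M w" and f: "sqi f" and F: "finite F"
  shows "\<bar>\<Sum>l\<in>F. a l * drift w f l\<bar> \<le> M * L2_norm f * sqrt (\<Sum>l\<in>F. lam l * (a l)\<^sup>2)"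
proof -
  have M: "norm (w x) \<le> M" for x using w by (simp add: tame_def)
  then have M0: "0 \<le> M" by (meson norm_ge_zero order_trans)
  note sg = sqi_norm_grad[OF F, of a]
  have "\<bar>\<Sum>l\<in>F. a l * drift w f l\<bar> = \<bar>LINT x|torus. f x * (grad F a x \<bullet> w x)\<bar>"
    by (simp add: sum_drift[OF w f] ip_def)
  also have "\<dots> \<le> (LINT x|torus. M * (\<bar>f x\<bar> * norm (grad F a x)))"
  proof (rule integral_abs_bound[THEN order_trans], rule integral_mono)
    show "integrable torus (\<lambda>x. \<bar>f x * (grad F a x \<bullet> w x)\<bar>)"
      by (intro integrable_abs sqi_mult_integrable f sqi_grad_inner[OF w F])
    show "integrable torus (\<lambda>x. M * (\<bar>f x\<bar> * norm (grad F a x)))"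
      by (intro integrable_mult_right sqi_mult_integrable sqi_abs f sg)
    fix x
    have "\<bar>grad F a x \<bullet> w x\<bar> \<le> norm (grad F a x) * M"
      by (meson Cauchy_Schwarz_ineq2 M mult_left_mono norm_ge_zero order_trans)
    then have "\<bar>f x\<bar> * \<bar>grad F a x \<bullet> w x\<bar> \<le> \<bar>f x\<bar> * (norm (grad F a x) * M)"
      by (rule mult_left_mono) simp
    then show "\<bar>f x * (grad F a x \<bullet> w x)\<bar> \<le> M * (\<bar>f x\<bar> * norm (grad F a x))"
      by (simp add: abs_mult ac_simps)
  qed
  also have "\<dots> = M * ip (\<lambda>x. \<bar>f x\<bar>) (\<lambda>x. norm (grad F a x))"
    by (simp add: ip_def)
  also have "\<dots> \<le> M * (L2_norm (\<lambda>x. \<bar>f x\<bar>) * L2_norm (\<lambda>x. norm (grad F a x)))"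
    using Cauchy_Schwarz_ip[OF sqi_abs[OF f] sg] M0 by (intro mult_left_mono) auto
  also have "L2_norm (\<lambda>x. norm (grad F a x)) = sqrt (\<Sum>l\<in>F. lam l * (a l)\<^sup>2)"
    by (simp flip: L2_norm_grad[OF F])
  also have "L2_norm (\<lambda>x. \<bar>f x\<bar>) = L2_norm f" by (simp add: L2_norm_def)
  finally show ?thesis by (simp add: mult.assoc)
qed

lemma drift_bound1:
  assumes "tame M w" "sqi f"
  shows "\<bar>drift w f l\<bar> \<le> M * L2_norm f * sqrt (lam l)"
  using drift_bound[OF assms, of "{l}" "\<lambda>_. 1"] by simp

lemma smooth_comb: "finite F \<Longrightarrow> smooth (comb F a)"
  unfolding comb_def
  by (induction F rule: finite_induct) (auto intro: smooth_const smooth_add smooth_mult[OF smooth_const smooth_hart])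

lemma periodic_comb: "periodic (comb F a)"
  by (simp add: periodic_hart[unfolded periodic_def] comb_def periodic_def)

text \<open>\<open>\<integral> p (w \<cdot> \<nabla>p) = \<integral> w \<cdot> \<nabla>(p\<^sup>2/2) = 0\<close> for trigonometric polynomials \<open>p\<close>.\<close>

lemma drift_comb_self:
  assumes w: "tame M w" and F: "finite F"
  shows "(\<Sum>l\<in>F. a l * drift w (comb F a) l) = 0"
proof -
  let ?p = "comb F a"
  have d: "((\<lambda>x. ?p x * ?p x) has_derivative (\<lambda>v. ?p x * (grad F a x \<bullet> v) + (grad F a x \<bullet> v) * ?p x)) (at x)" for x
    by (intro has_derivative_mult comb_has_derivative)
  have "dir_deriv v (\<lambda>x. ?p x * ?p x) x = 2 * (?p x * (grad F a x \<bullet> v))" for v x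
    using fun_cong[OF frechet_derivative_at[OF d[of x]], of v] by simp
  moreover have "smooth (\<lambda>x. ?p x * ?p x)" "periodic (\<lambda>x. ?p x * ?p x)"
    using periodic_comb[of F a] by (auto intro!: smooth_mult smooth_comb F simp: periodic_def)
  ultimately have "(LINT x|torus. 2 * (?p x * (grad F a x \<bullet> w x))) = 0"
    using w[unfolded tame_def, THEN conjunct2, THEN conjunct2, rule_format, of "\<lambda>x. ?p x * ?p x"] by simp
  then show ?thesis by (simp add: sum_drift[OF w] ip_def)
qed

text \<open>Polarization of \<open>drift_comb_self\<close>, which says that the quadratic form of
  the drift vanishes.\<close>

lemma drift_antisym:
  assumes w: "tame M w"
  shows "drift w (hart k) l = - drift w (hart l) k"
proof -
  have diag: "drift w (hart j) j = 0" for j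
    using drift_comb_self[OF w, of "{j}" "\<lambda>_. 1"] by (simp add: comb_def)
  show ?thesis
  proof (cases "k = l")
    case False
    then show ?thesis
      using drift_comb_self[OF w, of "{k, l}" "\<lambda>_. 1"] diag
      by (simp add: drift_comb[OF w] add_eq_0_iff)
  qed (simp add: diag)
qed

subsection \<open>Curves in \<open>L\<^sup>2\<close> and time-dependent drifts\<close>

text \<open>
  Weak solutions depend on the flow only up to null sets, so it suffices to treat flows that are Borel
  and satisfy the bounds and the divergence condition at every time.
\<close>

definition nice :: "ereal \<Rightarrow> (real \<Rightarrow> real^'n \<Rightarrow> real^'n) \<Rightarrow> bool" where
  "nice T' v \<longleftrightarrow> (\<lambda>(t, x). v t x) \<in> borel_measurable borel \<and>
     (\<forall>T\<in>time_interval 0 T'. \<exists>M. \<forall>t\<in>{0..T}. tame M (v t))"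

definition curve :: "real set \<Rightarrow> (real \<Rightarrow> real^'n \<Rightarrow> real) \<Rightarrow> bool" where
  "curve I \<theta> \<longleftrightarrow> (\<forall>t\<in>I. \<theta> t \<in> L2 \<and> ((\<lambda>s. L2_norm (\<lambda>x. \<theta> s x - \<theta> t x)) \<longlongrightarrow> 0) (at t within I))"

lemma curve_L2: "curve I \<theta> \<Longrightarrow> t \<in> I \<Longrightarrow> \<theta> t \<in> L2"
  by (simp add: curve_def)

lemma curve_sqi: "curve I \<theta> \<Longrightarrow> t \<in> I \<Longrightarrow> sqi (\<theta> t)"
  by (simp add: curve_def L2_sqi)

lemma curve_subset: "curve I \<theta> \<Longrightarrow> J \<subseteq> I \<Longrightarrow> curve J \<theta>"
  unfolding curve_def by (meson subsetD tendsto_within_subset)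

lemma eventually_at_within_mem: "\<forall>\<^sub>F s in at t within I. s \<in> I"
  by (simp add: eventually_at_filter)

lemma curve_ip_continuous:
  assumes c: "curve I \<theta>" and h: "sqi h"
  shows "continuous_on I (\<lambda>t. ip (\<theta> t) h)"
  unfolding continuous_on_def
proof
  fix t assume t: "t \<in> I"
  show "((\<lambda>t. ip (\<theta> t) h) \<longlongrightarrow> ip (\<theta> t) h) (at t within I)"
  proof (rule LIM_zero_cancel, rule Lim_null_comparison)
    show "((\<lambda>s. L2_norm (\<lambda>x. \<theta> s x - \<theta> t x) * L2_norm h) \<longlongrightarrow> 0) (at t within I)"
      using tendsto_mult_right[of _ 0 _ "L2_norm h"] c t by (fastforce simp: curve_def)
    show "\<forall>\<^sub>F s in at t within I. norm (ip (\<theta> s) h - ip (\<theta> t) h) \<le> L2_norm (\<lambda>x. \<theta> s x - \<theta> t x) * L2_norm h"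
      using eventually_at_within_mem
    proof eventually_elim
      case (elim s)
      note ss = curve_sqi[OF c elim] curve_sqi[OF c t]
      then show ?case using Cauchy_Schwarz_ip[OF sqi_diff[OF ss] h] by (simp add: ip_diff_left h)
    qed
  qed
qed

lemma curve_norm_continuous:
  assumes c: "curve I \<theta>"
  shows "continuous_on I (\<lambda>t. L2_norm (\<theta> t))"
  unfolding continuous_on_def
proof
  fix t assume t: "t \<in> I"
  show "((\<lambda>t. L2_norm (\<theta> t)) \<longlongrightarrow> L2_norm (\<theta> t)) (at t within I)"
  proof (rule LIM_zero_cancel, rule Lim_null_comparison)
    show "((\<lambda>s. L2_norm (\<lambda>x. \<theta> s x - \<theta> t x)) \<longlongrightarrow> 0) (at t within I)"
      using c t by (simp add: curve_def)
    show "\<forall>\<^sub>F s in at t within I. norm (L2_norm (\<theta> s) - L2_norm (\<theta> t)) \<le> L2_norm (\<lambda>x. \<theta> s x - \<theta> t x)"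
      using eventually_at_within_mem
    proof eventually_elim
      case (elim s)
      show ?case using L2_norm_diff_ge[OF curve_sqi[OF c elim] curve_sqi[OF c t]] by simp
    qed
  qed
qed

lemma curve_diff:
  assumes c: "curve I \<theta>" "curve I \<eta>"
  shows "curve I (\<lambda>t x. \<theta> t x - \<eta> t x)"
  unfolding curve_def
proof (intro ballI conjI)
  fix t assume t: "t \<in> I"
  show "(\<lambda>x. \<theta> t x - \<eta> t x) \<in> L2" using c t by (intro L2_diff curve_L2)
  have lim: "((\<lambda>s. L2_norm (\<lambda>x. \<theta> s x - \<theta> t x) + L2_norm (\<lambda>x. \<eta> s x - \<eta> t x)) \<longlongrightarrow> 0) (at t within I)"
    using c t unfolding curve_def by (intro tendsto_add_zero) blast+
  show "((\<lambda>s. L2_norm (\<lambda>x. \<theta> s x - \<eta> s x - (\<theta> t x - \<eta> t x))) \<longlongrightarrow> 0) (at t within I)"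
  proof (rule Lim_null_comparison[OF _ lim])
    show "\<forall>\<^sub>F s in at t within I. norm (L2_norm (\<lambda>x. \<theta> s x - \<eta> s x - (\<theta> t x - \<eta> t x)))
        \<le> L2_norm (\<lambda>x. \<theta> s x - \<theta> t x) + L2_norm (\<lambda>x. \<eta> s x - \<eta> t x)"
      using eventually_at_within_mem
    proof eventually_elim
      case (elim s)
      have "L2_norm (\<lambda>x. (\<theta> s x - \<theta> t x) + (-1) * (\<eta> s x - \<eta> t x))
          \<le> L2_norm (\<lambda>x. \<theta> s x - \<theta> t x) + L2_norm (\<lambda>x. (-1) * (\<eta> s x - \<eta> t x))"
        using curve_sqi[OF c(1)] curve_sqi[OF c(2)] elim t
        by (intro L2_norm_triangle sqi_cmult sqi_diff) auto
      also have "L2_norm (\<lambda>x. (-1) * (\<eta> s x - \<eta> t x)) = L2_norm (\<lambda>x. \<eta> s x - \<eta> t x)"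
        by (subst L2_norm_cmult) simp
      also have "(\<lambda>x. (\<theta> s x - \<theta> t x) + (-1) * (\<eta> s x - \<eta> t x)) = (\<lambda>x. \<theta> s x - \<eta> s x - (\<theta> t x - \<eta> t x))"
        by (simp add: fun_eq_iff)
      finally show ?case by simp
    qed
  qed
qed

lemma curve_cmult: "curve I \<theta> \<Longrightarrow> curve I (\<lambda>t x. c * \<theta> t x)"
  unfolding curve_def
proof (intro ballI conjI)
  fix t assume "\<forall>t\<in>I. \<theta> t \<in> L2 \<and> ((\<lambda>s. L2_norm (\<lambda>x. \<theta> s x - \<theta> t x)) \<longlongrightarrow> 0) (at t within I)" and t: "t \<in> I"
  then have *: "\<theta> t \<in> L2" "((\<lambda>s. L2_norm (\<lambda>x. \<theta> s x - \<theta> t x)) \<longlongrightarrow> 0) (at t within I)" by auto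
  then show "(\<lambda>x. c * \<theta> t x) \<in> L2" by (simp add: L2_cmult)
  show "((\<lambda>s. L2_norm (\<lambda>x. c * \<theta> s x - c * \<theta> t x)) \<longlongrightarrow> 0) (at t within I)"
    using tendsto_mult_left[OF *(2), of "\<bar>c\<bar>"] by (simp add: L2_norm_cmult flip: right_diff_distrib)
qed

section \<open>Measurability in time of the drift coefficients\<close>

lemma LINT_torus_borel:
  assumes "f \<in> borel_measurable borel"
  shows "(LINT x|torus. f x) = (LINT x|lborel. indicator (cbox 0 1) x * (f x :: real))"
proof -
  have "(LINT x|torus. f x) = (LINT x|lebesgue. indicator (cbox 0 1) x *\<^sub>R f x)"
    unfolding torus_def by (subst integral_restrict_space) (auto simp: set_lebesgue_integral_def)
  also have "\<dots> = (LINT x|lborel. indicator (cbox 0 1) x *\<^sub>R f x)"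
    using assms by (intro integral_completion) measurable
  finally show ?thesis by simp
qed

text \<open>A parameter integral over the cell of a jointly Borel function; the joint measurability
  demanded by \<open>nice\<close> enters here.\<close>

lemma drift_hart_measurable:
  assumes "(\<lambda>(t, x). v t x) \<in> borel_measurable (borel :: (real \<times> (real^'n)) measure)"
  shows "(\<lambda>t. drift (v t) (hart k) l) \<in> borel_measurable borel"
proof -
  have v[measurable]: "(\<lambda>p. v (fst p) (snd p)) \<in> borel_measurable (borel \<Otimes>\<^sub>M borel)"
    using assms by (simp add: case_prod_beta' borel_prod)
  have [measurable]: "v t \<in> borel_measurable borel" for t
    using measurable_compose[OF measurable_Pair1' v, of t] by simp
  have "drift (v t) (hart k) l = (LINT x|lborel. indicator (cbox 0 1) x * (hart k x * (2 * pi * (freq l \<bullet> v t x) * hart (- l) x)))" for t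
    unfolding drift_def dir_deriv_hart by (subst LINT_torus_borel) auto
  moreover have "(\<lambda>t. LINT x|lborel. indicator (cbox 0 1) x * (hart k x * (2 * pi * (freq l \<bullet> v t x) * hart (- l) x)))
      \<in> borel_measurable borel"
  proof (rule lborel.borel_measurable_lebesgue_integral)
    have [measurable]: "(\<lambda>p. v (fst p) (snd p)) \<in> borel_measurable (borel \<Otimes>\<^sub>M lborel)"
      by (subst measurable_cong_sets[OF sets_pair_measure_cong[OF refl sets_lborel] refl]) (rule v)
    show "(\<lambda>(t, x). indicator (cbox 0 1) x * (hart k x * (2 * pi * (freq l \<bullet> v t x) * hart (- l) x)))
        \<in> borel_measurable (borel \<Otimes>\<^sub>M lborel)"
      unfolding split_beta by measurable
  qed
  ultimately show ?thesis by simp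
qed

lemma nice_tame:
  assumes "nice T' v" "ereal b < T'" "0 \<le> b"
  obtains M where "\<And>t. 0 \<le> t \<Longrightarrow> t \<le> b \<Longrightarrow> tame M (v t)" "0 \<le> M"
proof -
  obtain M where M: "\<forall>t\<in>{0..b}. tame M (v t)" using assms by (auto simp: nice_def time_interval_def)
  then have "tame M (v 0)" using assms by auto
  then have "0 \<le> M" unfolding tame_def by (meson norm_ge_zero order_trans)
  with M show thesis by (intro that) auto
qed

lemma borel_measurable_lebesgue_on_Icc: "f \<in> borel_measurable borel \<Longrightarrow> f \<in> borel_measurable (lebesgue_on {a..b::real})"
  by (intro measurable_restrict_space1 borel_measurable_subalgebra[of borel lebesgue])
    (auto simp: sets_completionI_sub)

text \<open>The curve is not assumed jointly measurable in time and space. Its drift is therefore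
  obtained as a pointwise limit of finite sums, in which continuous coefficients multiply the
  measurable drifts of single modes.\<close>

lemma drift_curve_bm:
  assumes v: "nice T' v" and c: "curve {a..b} \<theta>" and ab: "0 \<le> a" "ereal b < T'"
  shows "bm a b (\<lambda>t. drift (v t) (\<theta> t) l)"
proof (cases "a \<le> b")
  case True
  then obtain M where M: "\<And>t. 0 \<le> t \<Longrightarrow> t \<le> b \<Longrightarrow> tame M (v t)" "0 \<le> M"
    using nice_tame[OF v ab(2)] ab by auto
  have tm: "tame M (v t)" if "t \<in> {a..b}" for t using that M ab by auto
  obtain C where C: "\<And>t. t \<in> {a..b} \<Longrightarrow> \<bar>L2_norm (\<theta> t)\<bar> \<le> C"
    using bm_bound[OF bm_continuous[OF curve_norm_continuous[OF c]]] by metis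
  show ?thesis
  proof (rule bmI)
    show "(\<lambda>t. drift (v t) (\<theta> t) l) \<in> borel_measurable (lebesgue_on {a..b})"
    proof (rule borel_measurable_LIMSEQ_metric)
      fix n
      have "(\<lambda>t. \<Sum>k\<in>modes n. ip (\<theta> t) (hart k) * drift (v t) (hart k) l) \<in> borel_measurable (lebesgue_on {a..b})"
        using v curve_ip_continuous[OF c sqi_hart] unfolding nice_def
        by (intro borel_measurable_sum borel_measurable_times borel_measurable_lebesgue_on_Icc
            drift_hart_measurable continuous_imp_measurable_on_sets_lebesgue) auto
      moreover have "drift (v t) (proj n (\<theta> t)) l = (\<Sum>k\<in>modes n. ip (\<theta> t) (hart k) * drift (v t) (hart k) l)"
        if "t \<in> space (lebesgue_on {a..b})" for t
        using that tm by (intro drift_comb) auto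
      ultimately show "(\<lambda>t. drift (v t) (proj n (\<theta> t)) l) \<in> borel_measurable (lebesgue_on {a..b})"
        by (subst measurable_cong) auto
    next
      fix t assume "t \<in> space (lebesgue_on {a..b})"
      then have t: "t \<in> {a..b}" by simp
      show "(\<lambda>n. drift (v t) (proj n (\<theta> t)) l) \<longlonglongrightarrow> drift (v t) (\<theta> t) l"
        unfolding drift_ip
        using proj_tendsto[OF curve_L2[OF c t]] curve_sqi[OF c t] sqi_dir_deriv_hart[OF tm[OF t]]
        by (intro ip_tendsto) (auto simp: L2_norm_minus_commute[of "\<theta> t"])
    qed
    fix t assume t: "t \<in> {a..b}"
    have "\<bar>drift (v t) (\<theta> t) l\<bar> \<le> M * L2_norm (\<theta> t) * sqrt (lam l)"
      by (rule drift_bound1[OF tm[OF t] curve_sqi[OF c t]])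
    also have "\<dots> \<le> M * C * sqrt (lam l)"
      using C[OF t] M(2) by (intro mult_right_mono mult_left_mono) auto
    finally show "\<bar>drift (v t) (\<theta> t) l\<bar> \<le> M * C * sqrt (lam l)" .
  qed
qed (auto simp: bm_def measurable_def)

subsection \<open>Solutions in Hartley coordinates and the energy inequality\<close>

text \<open>The time derivative that the equation prescribes for the coefficient
  \<open>l\<close>.\<close>

definition rate :: "real \<Rightarrow> (real \<Rightarrow> real^'n \<Rightarrow> real^'n) \<Rightarrow> (real \<Rightarrow> real^'n \<Rightarrow> real) \<Rightarrow> int^'n \<Rightarrow> real \<Rightarrow> real" where
  "rate \<nu> v \<theta> l t = drift (v t) (\<theta> t) l - \<nu> * lam l * ip (\<theta> t) (hart l)"

text \<open>The equation in coordinates, in integrated form because the drift is only measurable in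
  time. Relating any two times of \<open>I\<close>, instead of each time to an initial one, makes
  restriction to subsets immediate.\<close>

definition fsol :: "real \<Rightarrow> (real \<Rightarrow> real^'n \<Rightarrow> real^'n) \<Rightarrow> real set \<Rightarrow> (real \<Rightarrow> real^'n \<Rightarrow> real) \<Rightarrow> bool" where
  "fsol \<nu> v I \<theta> \<longleftrightarrow> curve I \<theta> \<and> (\<forall>l. \<forall>s\<in>I. \<forall>t\<in>I. s \<le> t \<longrightarrow>
     ip (\<theta> t) (hart l) = ip (\<theta> s) (hart l) + integral {s..t} (rate \<nu> v \<theta> l))"

lemma fsol_subset: "fsol \<nu> v I \<theta> \<Longrightarrow> J \<subseteq> I \<Longrightarrow> fsol \<nu> v J \<theta>"
  unfolding fsol_def by (meson curve_subset subsetD)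

lemma fsol_curve: "fsol \<nu> v I \<theta> \<Longrightarrow> curve I \<theta>"
  unfolding fsol_def by (rule conjunct1)

lemma fsolD:
  "fsol \<nu> v I \<theta> \<Longrightarrow> s \<in> I \<Longrightarrow> t \<in> I \<Longrightarrow> s \<le> t \<Longrightarrow>
    ip (\<theta> t) (hart l) = ip (\<theta> s) (hart l) + integral {s..t} (rate \<nu> v \<theta> l)"
  unfolding fsol_def by blast

lemma rate_bm:
  assumes "nice T' v" "curve {a..b} \<theta>" "0 \<le> a" "ereal b < T'"
  shows "bm a b (rate \<nu> v \<theta> l)"
  unfolding rate_def[abs_def]
  by (intro bm_diff bm_mult bm_const drift_curve_bm[OF assms] bm_continuous curve_ip_continuous[OF assms(2)] sqi_hart)

text \<open>The drift of the projection tested against itself is 0, so only the residual of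
  \<open>f\<close> is transported. Its product with the gradient of the projection is absorbed by
  the dissipation through completion of the square, which leaves the squared residual.\<close>

lemma energy_rate:
  assumes w: "tame M w" and f: "sqi f" and nu: "\<nu> > 0"
  shows "(\<Sum>k\<in>modes n. 2 * (ip f (hart k) * (drift w f k - \<nu> * lam k * ip f (hart k))))
    \<le> M\<^sup>2 / (2 * \<nu>) * (L2_norm (\<lambda>x. f x - proj n f x))\<^sup>2"
proof -
  let ?c = "\<lambda>k. ip f (hart k)" let ?r = "L2_norm (\<lambda>x. f x - proj n f x)"
  define q where "q = sqrt (\<Sum>k\<in>modes n. lam k * (?c k)\<^sup>2)"
  have q2: "q\<^sup>2 = (\<Sum>k\<in>modes n. lam k * (?c k)\<^sup>2)"
    unfolding q_def by (simp add: sum_nonneg)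
  have "(\<Sum>k\<in>modes n. ?c k * drift w f k) = (\<Sum>k\<in>modes n. ?c k * drift w (\<lambda>x. f x - proj n f x) k)"
    using drift_comb_self[OF w finite_modes[of n], of ?c] f
    by (simp add: drift_diff[OF w] right_diff_distrib sum_subtractf)
  also have "\<dots> \<le> M * ?r * q"
    using drift_bound[OF w sqi_diff[OF f sqi_comb] finite_modes[of n], of ?c] unfolding q_def by (meson abs_le_D1)
  finally have d: "(\<Sum>k\<in>modes n. ?c k * drift w f k) \<le> M * ?r * q" .
  have "(\<Sum>k\<in>modes n. 2 * (?c k * (drift w f k - \<nu> * lam k * ?c k)))
      = 2 * (\<Sum>k\<in>modes n. ?c k * drift w f k) - 2 * \<nu> * q\<^sup>2"
    unfolding q2 by (simp add: sum_distrib_left right_diff_distrib sum_subtractf power2_eq_square ac_simps)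
  also have "\<dots> \<le> 2 * (M * ?r * q) - 2 * \<nu> * q\<^sup>2" using d by simp
  also have "\<dots> \<le> M\<^sup>2 / (2 * \<nu>) * ?r\<^sup>2"
  proof -
    have "0 \<le> (2 * \<nu> * q - M * ?r)\<^sup>2 / (2 * \<nu>)" using nu by simp
    also have "\<dots> = 2 * \<nu> * q\<^sup>2 - 2 * (M * ?r * q) + M\<^sup>2 / (2 * \<nu>) * ?r\<^sup>2"
      using nu by (simp add: power2_eq_square field_simps)
    finally show ?thesis by simp
  qed
  finally show ?thesis .
qed

text \<open>The coefficients satisfy integral equations, so the squared norm of each truncation
  obeys a balance by \<open>product_rule\<close>. The error given by \<open>energy_rate\<close>
  disappears as the truncation is removed.\<close>

theorem fsol_norm_mono:
  assumes v: "nice T' v" and sol: "fsol \<nu> v {a..b} \<theta>" and ab: "0 \<le> a" "a \<le> b" "ereal b < T'" and nu: "\<nu> > 0"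
  shows "L2_norm (\<theta> b) \<le> L2_norm (\<theta> a)"
proof -
  have c: "curve {a..b} \<theta>" using sol by (rule fsol_curve)
  obtain M where "\<And>t. 0 \<le> t \<Longrightarrow> t \<le> b \<Longrightarrow> tame M (v t)"
    using nice_tame[OF v ab(3)] ab by auto
  then have tm: "tame M (v t)" if "t \<in> {a..b}" for t using that ab by auto
  define E where "E n t = (\<Sum>k\<in>modes n. (ip (\<theta> t) (hart k))\<^sup>2)" for n t
  define R where "R n t = (L2_norm (\<lambda>x. \<theta> t x - proj n (\<theta> t) x))\<^sup>2" for n t
  have R: "R n t = (L2_norm (\<theta> t))\<^sup>2 - E n t" if "t \<in> {a..b}" for n t
    unfolding R_def E_def by (rule L2_norm_proj_residual[OF curve_sqi[OF c that]])
  have "continuous_on {a..b} (\<lambda>t. (L2_norm (\<theta> t))\<^sup>2 - E n t)" for n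
    unfolding E_def by (intro continuous_intros curve_norm_continuous[OF c] curve_ip_continuous[OF c] sqi_hart)
  then have contR: "continuous_on {a..b} (R n)" for n
    using R by (metis (no_types, lifting) continuous_on_cong)
  have intR: "(\<lambda>t. M\<^sup>2 / (2 * \<nu>) * R n t) integrable_on {a..b}" for n
    by (intro integrable_continuous_real continuous_intros contR)
  have step: "E n b \<le> E n a + integral {a..b} (\<lambda>t. M\<^sup>2 / (2 * \<nu>) * R n t)" for n
  proof -
    note bms = rate_bm[OF v c ab(1,3)] bm_continuous[OF curve_ip_continuous[OF c sqi_hart]]
    have "E n b - E n a = (\<Sum>k\<in>modes n. integral {a..b} (\<lambda>t. 2 * (ip (\<theta> t) (hart k) * rate \<nu> v \<theta> k t)))"
      unfolding E_def sum_subtractf[symmetric]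
    proof (intro sum.cong refl)
      fix k
      have eq: "ip (\<theta> t) (hart k) = ip (\<theta> a) (hart k) + integral {a..t} (rate \<nu> v \<theta> k)" if "t \<in> {a..b}" for t
        using fsolD[OF sol, of a t k] that ab by simp
      have "(ip (\<theta> b) (hart k))\<^sup>2 - (ip (\<theta> a) (hart k))\<^sup>2
          = integral {a..b} (\<lambda>t. ip (\<theta> t) (hart k) * rate \<nu> v \<theta> k t + rate \<nu> v \<theta> k t * ip (\<theta> t) (hart k))"
        unfolding power2_eq_square by (rule product_rule[OF ab(2) bms(1) bms(1) eq eq])
      then show "(ip (\<theta> b) (hart k))\<^sup>2 - (ip (\<theta> a) (hart k))\<^sup>2
          = integral {a..b} (\<lambda>t. 2 * (ip (\<theta> t) (hart k) * rate \<nu> v \<theta> k t))"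
        by (simp add: mult.commute[of "rate _ _ _ _ _"])
    qed
    also have "\<dots> = integral {a..b} (\<lambda>t. \<Sum>k\<in>modes n. 2 * (ip (\<theta> t) (hart k) * rate \<nu> v \<theta> k t))"
      by (intro integral_sum[symmetric] finite_modes bm_integrable bm_intros bms)
    also have "\<dots> \<le> integral {a..b} (\<lambda>t. M\<^sup>2 / (2 * \<nu>) * R n t)"
      using energy_rate[OF tm curve_sqi[OF c] nu, of _ _ n] unfolding R_def rate_def
      by (intro integral_le intR[unfolded R_def] bm_integrable bm_intros bms[unfolded rate_def]) auto
    finally show ?thesis by simp
  qed
  have limE: "(\<lambda>n. E n t) \<longlonglongrightarrow> (L2_norm (\<theta> t))\<^sup>2" if "t \<in> {a..b}" for t
    using Parseval[OF curve_L2[OF c that] curve_sqi[OF c that]]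
    unfolding E_def L2_norm_sq by (simp add: power2_eq_square)
  \<comment> \<open>The residuals tend to 0 at every time by completeness of the basis, and they are
    dominated by the continuous squared norm.\<close>
  have "(\<lambda>n. integral {a..b} (\<lambda>t. M\<^sup>2 / (2 * \<nu>) * R n t)) \<longlonglongrightarrow> integral {a..b} (\<lambda>t. 0)"
  proof (rule dominated_convergence(2))
    show "(\<lambda>t. M\<^sup>2 / (2 * \<nu>) * (L2_norm (\<theta> t))\<^sup>2) integrable_on {a..b}"
      by (intro integrable_continuous_real continuous_intros curve_norm_continuous[OF c])
    fix n t assume t: "t \<in> {a..b}"
    have "R n t \<le> (L2_norm (\<theta> t))\<^sup>2" using R[OF t, of n] by (simp add: E_def sum_nonneg)
    then have "M\<^sup>2 / (2 * \<nu>) * R n t \<le> M\<^sup>2 / (2 * \<nu>) * (L2_norm (\<theta> t))\<^sup>2"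
      using nu by (intro mult_left_mono) auto
    moreover have "0 \<le> M\<^sup>2 / (2 * \<nu>) * R n t" using nu by (simp add: R_def)
    ultimately show "norm (M\<^sup>2 / (2 * \<nu>) * R n t) \<le> M\<^sup>2 / (2 * \<nu>) * (L2_norm (\<theta> t))\<^sup>2" by simp
  next
    fix t assume t: "t \<in> {a..b}"
    have "(\<lambda>n. R n t) \<longlonglongrightarrow> 0\<^sup>2"
      unfolding R_def by (intro tendsto_power proj_tendsto curve_L2[OF c t])
    then show "(\<lambda>n. M\<^sup>2 / (2 * \<nu>) * R n t) \<longlonglongrightarrow> 0"
      by (intro tendsto_mult_right_zero) simp
  qed (rule intR)
  then have "(\<lambda>n. E n a + integral {a..b} (\<lambda>t. M\<^sup>2 / (2 * \<nu>) * R n t)) \<longlonglongrightarrow> (L2_norm (\<theta> a))\<^sup>2 + 0"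
    using ab by (intro tendsto_add limE) auto
  moreover have "(\<lambda>n. E n b) \<longlonglongrightarrow> (L2_norm (\<theta> b))\<^sup>2" using ab by (intro limE) auto
  ultimately have "(L2_norm (\<theta> b))\<^sup>2 \<le> (L2_norm (\<theta> a))\<^sup>2 + 0"
    using step by (intro LIMSEQ_le[where X="\<lambda>n. E n b" and Y="\<lambda>n. E n a + integral {a..b} (\<lambda>t. M\<^sup>2 / (2 * \<nu>) * R n t)"]) blast+
  then show ?thesis by (intro power2_le_imp_le[of "L2_norm (\<theta> b)"]) auto
qed

lemma fsol_diff:
  assumes v: "nice T' v" and I: "I \<subseteq> time_interval 0 T'" "is_interval I"
    and sol: "fsol \<nu> v I \<theta>" "fsol \<nu> v I \<eta>"
  shows "fsol \<nu> v I (\<lambda>t x. \<theta> t x - \<eta> t x)"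
  unfolding fsol_def
proof (intro conjI allI ballI impI)
  have c: "curve I \<theta>" "curve I \<eta>" by (rule fsol_curve[OF sol(1)], rule fsol_curve[OF sol(2)])
  then show "curve I (\<lambda>t x. \<theta> t x - \<eta> t x)" by (rule curve_diff)
  fix l s t assume st: "s \<in> I" "t \<in> I" "s \<le> t"
  have sub: "{s..t} \<subseteq> I" by (auto intro: mem_is_interval_1_I[OF I(2) st(1,2)])
  have t: "0 \<le> s" "ereal t < T'" 
    using subsetD[OF I(1) st(1)] subsetD[OF I(1) st(2)] by (simp_all add: time_interval_def)
  have "t \<in> time_interval 0 T'" using t st by (simp add: time_interval_def)
  with v have "\<exists>M. \<forall>r\<in>{0..t}. tame M (v r)" by (simp add: nice_def)
  then obtain M where M: "\<forall>r\<in>{0..t}. tame M (v r)" ..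
  have "integral {s..t} (rate \<nu> v (\<lambda>t x. \<theta> t x - \<eta> t x) l) = integral {s..t} (\<lambda>r. rate \<nu> v \<theta> l r - rate \<nu> v \<eta> l r)"
  proof (rule integral_cong)
    fix r assume r: "r \<in> {s..t}"
    then have "r \<in> {0..t}" using t(1) by simp
    with M have w: "tame M (v r)" by (rule bspec)
    have sq: "sqi (\<theta> r)" "sqi (\<eta> r)"
      using curve_sqi[OF c(1)] curve_sqi[OF c(2)] r sub by blast+
    show "rate \<nu> v (\<lambda>t x. \<theta> t x - \<eta> t x) l r = rate \<nu> v \<theta> l r - rate \<nu> v \<eta> l r"
      unfolding rate_def drift_diff[OF w sq] ip_diff_left[OF sq sqi_hart] by (simp add: algebra_simps)
  qed
  also have "\<dots> = integral {s..t} (rate \<nu> v \<theta> l) - integral {s..t} (rate \<nu> v \<eta> l)"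
    by (intro Henstock_Kurzweil_Integration.integral_diff bm_integrable rate_bm[OF v _ t]
        curve_subset[OF c(1) sub] curve_subset[OF c(2) sub])
  finally show "ip (\<lambda>x. \<theta> t x - \<eta> t x) (hart l) = ip (\<lambda>x. \<theta> s x - \<eta> s x) (hart l)
      + integral {s..t} (rate \<nu> v (\<lambda>t x. \<theta> t x - \<eta> t x) l)"
    using fsolD[OF sol(1) st, of l] fsolD[OF sol(2) st, of l] 
    by (simp add: ip_diff_left curve_sqi[OF c(1) st(1)] curve_sqi[OF c(1) st(2)]
        curve_sqi[OF c(2) st(1)] curve_sqi[OF c(2) st(2)])
qed

lemma drift_cmult: "drift w (\<lambda>x. c * f x) l = c * drift w f l"
  by (simp add: drift_ip ip_cmult_left)

lemma fsol_cmult: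
  assumes "fsol \<nu> v I \<theta>"
  shows "fsol \<nu> v I (\<lambda>t x. c * \<theta> t x)"
proof -
  have "rate \<nu> v (\<lambda>t x. c * \<theta> t x) l = (\<lambda>t. c * rate \<nu> v \<theta> l t)" for l
    unfolding rate_def by (simp add: drift_cmult ip_cmult_left algebra_simps fun_eq_iff)
  then have "ip (\<lambda>x. c * \<theta> t x) (hart l)
      = ip (\<lambda>x. c * \<theta> s x) (hart l) + integral {s..t} (rate \<nu> v (\<lambda>t x. c * \<theta> t x) l)"
    if "s \<in> I" "t \<in> I" "s \<le> t" for s t l
    using fsolD[OF assms that, of l] by (simp add: ip_cmult_left distrib_left)
  moreover have "curve I (\<lambda>t x. c * \<theta> t x)" by (rule curve_cmult[OF fsol_curve[OF assms]])
  ultimately show ?thesis unfolding fsol_def by blast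
qed

text \<open>Energy inequality for the difference of the two solutions, which starts at norm
  0.\<close>

lemma fsol_unique:
  assumes "nice T' v" "fsol \<nu> v {a..b} \<theta>" "fsol \<nu> v {a..b} \<eta>" "0 \<le> a" "ereal b < T'" "\<nu> > 0"
    and "L2_norm (\<lambda>x. \<theta> a x - \<eta> a x) = 0" "t \<in> {a..b}"
  shows "L2_norm (\<lambda>x. \<theta> t x - \<eta> t x) = 0"
proof -
  have t: "ereal t < T'" using assms(5,8) by (auto intro: le_less_trans[of "ereal t" "ereal b"])
  have "fsol \<nu> v {a..t} (\<lambda>t x. \<theta> t x - \<eta> t x)"
    using assms t
    by (intro fsol_diff[OF assms(1)] fsol_subset[OF assms(2)] fsol_subset[OF assms(3)])
      (auto simp: time_interval_def is_interval_cc intro: le_less_trans[of "ereal _" "ereal t"])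
  from fsol_norm_mono[OF assms(1) this assms(4) _ t assms(6)] assms(7,8) show ?thesis
    by (simp add: order_antisym)
qed

text \<open>In the new time \<open>c t + d\<close> rates are divided by \<open>c\<close>: the drift
  loses the factor carried by \<open>v\<close>, and the diffusivity becomes
  \<open>\<nu> / c\<close>.\<close>

lemma fsol_affine:
  fixes u :: "real \<Rightarrow> real^'n \<Rightarrow> real^'n"
  assumes c: "c > 0" and v: "\<And>t. t \<in> {p..q} \<Longrightarrow> v t = (\<lambda>x. c *\<^sub>R u (c * t + d) x)"
    and sol: "fsol \<nu> v {p..q} \<theta>"
  shows "fsol (\<nu> / c) u {c * p + d..c * q + d} (\<lambda>\<tau>. \<theta> ((\<tau> - d) / c))"
  unfolding fsol_def
proof (intro conjI allI ballI impI)
  let ?I = "{c * p + d..c * q + d}" and ?r = "\<lambda>\<tau>. (\<tau> - d) / c"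
  have r: "?r \<tau> \<in> {p..q}" if "\<tau> \<in> ?I" for \<tau> using that c by (auto simp: field_simps)
  have curve: "curve {p..q} \<theta>" using sol by (rule fsol_curve)
  show "curve ?I (\<lambda>\<tau>. \<theta> (?r \<tau>))"
    unfolding curve_def
  proof (intro ballI conjI)
    fix t assume t: "t \<in> ?I"
    show "\<theta> (?r t) \<in> L2" by (rule curve_L2[OF curve r[OF t]])
    show "((\<lambda>s. L2_norm (\<lambda>x. \<theta> (?r s) x - \<theta> (?r t) x)) \<longlongrightarrow> 0) (at t within ?I)"
    proof (rule filterlim_compose[where g="\<lambda>s. L2_norm (\<lambda>x. \<theta> s x - \<theta> (?r t) x)"])
      show "((\<lambda>s. L2_norm (\<lambda>x. \<theta> s x - \<theta> (?r t) x)) \<longlongrightarrow> 0) (at (?r t) within {p..q})"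
        using curve r[OF t] by (simp add: curve_def)
      show "filterlim ?r (at (?r t) within {p..q}) (at t within ?I)"
        unfolding filterlim_at
      proof
        show "\<forall>\<^sub>F s in at t within ?I. ?r s \<in> {p..q} \<and> ?r s \<noteq> ?r t"
          unfolding eventually_at_filter using r c by (intro always_eventually) auto
        show "(?r \<longlongrightarrow> ?r t) (at t within ?I)" using c by (intro tendsto_intros) auto
      qed
    qed
  qed
  fix l s t assume st: "s \<in> ?I" "t \<in> ?I" "s \<le> t"
  have rate: "rate (\<nu> / c) u (\<lambda>\<tau>. \<theta> (?r \<tau>)) l \<tau> = (1 / c) * rate \<nu> v \<theta> l (?r \<tau>)" if "\<tau> \<in> ?I" for \<tau>
  proof -
    have "c * ?r \<tau> + d = \<tau>" using c by simp
    then have "v (?r \<tau>) = (\<lambda>x. c *\<^sub>R u \<tau> x)" using v[OF r[OF that]] by simp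
    then have "drift (v (?r \<tau>)) (\<theta> (?r \<tau>)) l = c * drift (u \<tau>) (\<theta> (?r \<tau>)) l"
      unfolding drift_def dir_deriv_hart by (simp add: ac_simps flip: integral_mult_right_zero)
    then show ?thesis unfolding rate_def using c by (simp add: field_simps)
  qed
  have st': "?r s \<le> ?r t" using st c by (simp add: divide_right_mono)
  have "integral {s..t} (rate (\<nu> / c) u (\<lambda>\<tau>. \<theta> (?r \<tau>)) l) = integral {s..t} (\<lambda>\<tau>. (1 / c) * rate \<nu> v \<theta> l (?r \<tau>))"
    using rate st by (intro integral_cong) auto
  also have "\<dots> = integral {?r s..?r t} (rate \<nu> v \<theta> l)"
  proof -
    have "integral {s..t} (\<lambda>\<tau>. rate \<nu> v \<theta> l ((1 / c) *\<^sub>R \<tau> + (- d / c))) = integral {?r s..?r t} (rate \<nu> v \<theta> l) / (1 / c)"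
    \<comment> \<open>No regularity of \<open>v\<close> is assumed here. If one side is not
      integrable then, by the inverse substitution, neither is the other, and both integrals have
      the default value 0.\<close>
    proof (cases "rate \<nu> v \<theta> l integrable_on {?r s..?r t}")
      case True
      have "((\<lambda>\<tau>. rate \<nu> v \<theta> l ((1 / c) *\<^sub>R \<tau> + (- d / c))) has_integral
          (integral {?r s..?r t} (rate \<nu> v \<theta> l) /\<^sub>R (1 / c) ^ DIM(real)))
          (cbox ((?r s - (- d / c)) /\<^sub>R (1 / c)) ((?r t - (- d / c)) /\<^sub>R (1 / c)))"
        using True c by (intro has_integral_affinity') (auto intro: integrable_integral simp: cbox_interval)
      then show ?thesis using c by (intro integral_unique) (simp add: field_simps cbox_interval)
    next
      case False
      have "\<not> (\<lambda>\<tau>. rate \<nu> v \<theta> l ((1 / c) *\<^sub>R \<tau> + (- d / c))) integrable_on {s..t}"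
      proof
        assume "(\<lambda>\<tau>. rate \<nu> v \<theta> l ((1 / c) *\<^sub>R \<tau> + (- d / c))) integrable_on {s..t}"
        then obtain J where "((\<lambda>\<tau>. rate \<nu> v \<theta> l ((1 / c) *\<^sub>R \<tau> + (- d / c))) has_integral J) (cbox s t)"
          by (auto simp: integrable_on_def cbox_interval)
        from has_integral_affinity'[OF this c, of d]
        have "rate \<nu> v \<theta> l integrable_on cbox ((s - d) /\<^sub>R c) ((t - d) /\<^sub>R c)"
          using c by (auto simp: integrable_on_def field_simps)
        with False show False by (simp add: field_simps cbox_interval)
      qed
      with False show ?thesis by (simp add: not_integrable_integral)
    qed
    moreover have "(1 / c) *\<^sub>R \<tau> + (- d / c) = ?r \<tau>" for \<tau> by (simp add: diff_divide_distrib)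
    ultimately show ?thesis using c by simp
  qed
  finally show "ip (\<theta> (?r t)) (hart l) = ip (\<theta> (?r s)) (hart l) + integral {s..t} (rate (\<nu> / c) u (\<lambda>\<tau>. \<theta> (?r \<tau>)) l)"
    using fsolD[OF sol r[OF st(1)] r[OF st(2)] st', of l] by simp
qed

subsection \<open>Linear systems with bounded measurable coefficients\<close>

lemma integral_uniform_limit_bm:
  assumes u: "uniform_limit {a..b} f g sequentially" and f: "\<And>n. bm a b (f n)" and g: "bm a b g"
  shows "(\<lambda>n. integral {a..b} (f n)) \<longlonglongrightarrow> integral {a..b} g"
proof (cases "a \<le> b")
  case True
  show ?thesis
  proof (rule LIMSEQ_I)
    fix e :: real assume e: "e > 0"
    \<comment> \<open>The added 1 keeps the divisor positive when \<open>a = b\<close>.\<close>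
    define w where "w = b - a + 1"
    define d where "d = e / (2 * w)"
    have w: "w > 0" "b - a \<le> w" using True by (auto simp: w_def)
    have d0: "d > 0" using e w by (simp add: d_def)
    have "d * (b - a) \<le> d * w" using d0 w by simp
    also have "\<dots> = e / 2" using w by (simp add: d_def)
    finally have d: "d > 0" "d * (b - a) < e" using e d0 by simp_all
    obtain N where N: "\<And>n t. n \<ge> N \<Longrightarrow> t \<in> {a..b} \<Longrightarrow> \<bar>f n t - g t\<bar> < d"
      using u d(1) unfolding uniform_limit_iff eventually_sequentially dist_real_def by metis
    have "norm (integral {a..b} (f n) - integral {a..b} g) < e" if "n \<ge> N" for n
    proof -
      have "integral {a..b} (f n) - integral {a..b} g = integral {a..b} (\<lambda>t. f n t - g t)"
        by (intro Henstock_Kurzweil_Integration.integral_diff[symmetric] bm_integrable f g)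
      also have "\<bar>\<dots>\<bar> \<le> d * (b - a)"
        using N[OF that] d True by (intro bm_integral_bound bm_diff f g) (auto intro: less_imp_le)
      finally show ?thesis using d by simp
    qed
    then show "\<exists>N. \<forall>n\<ge>N. norm (integral {a..b} (f n) - integral {a..b} g) < e" by blast
  qed
qed simp

lemma uniform_limit_sum:
  fixes f :: "'i \<Rightarrow> nat \<Rightarrow> 'a \<Rightarrow> real"
  shows "finite F \<Longrightarrow> (\<And>k. k \<in> F \<Longrightarrow> uniform_limit S (f k) (g k) sequentially) \<Longrightarrow>
    uniform_limit S (\<lambda>n x. \<Sum>k\<in>F. f k n x) (\<lambda>x. \<Sum>k\<in>F. g k x) sequentially"
  by (induction F rule: finite_induct) (auto intro: uniform_limit_const uniform_limit_add)

text \<open>Picard iteration. The iterates do not depend on \<open>T\<close>, so one limit serves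
  all of \<open>I\<close>, although the coefficients are bounded only on each \<open>{s..T}\<close>
  separately. The right-hand side involves only unknowns in \<open>F\<close>, while the solution is
  defined for every index.\<close>

lemma linear_system:
  fixes B :: "real \<Rightarrow> 'i \<Rightarrow> 'i \<Rightarrow> real"
  assumes F: "finite F" and B: "\<And>T k l. T \<in> I \<Longrightarrow> bm s T (\<lambda>t. B t k l)" and I: "\<And>T. T \<in> I \<Longrightarrow> s \<le> T"
  shows "\<exists>X. (\<forall>T\<in>I. \<forall>l. continuous_on {s..T} (\<lambda>t. X t l)) \<and>
    (\<forall>t\<in>I. \<forall>l. X t l = x0 l + integral {s..t} (\<lambda>r. \<Sum>k\<in>F. B r k l * X r k))"
proof -
  define P where "P = rec_nat (\<lambda>t l. x0 l) (\<lambda>n p t l. x0 l + integral {s..t} (\<lambda>r. \<Sum>k\<in>F. B r k l * p r k))"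
  have P0: "P 0 t l = x0 l" for t l by (simp add: P_def)
  have PS: "P (Suc n) t l = x0 l + integral {s..t} (\<lambda>r. \<Sum>k\<in>F. B r k l * P n r k)" for n t l
    by (simp add: P_def)
  have contP: "continuous_on {s..T} (\<lambda>t. P n t l)" if T: "T \<in> I" for n l T
  proof (induction n arbitrary: l)
    case (Suc n)
    have "bm s T (\<lambda>r. \<Sum>k\<in>F. B r k l * P n r k)"
      by (intro bm_sum bm_mult B[OF T] bm_continuous Suc.IH)
    then show ?case
      unfolding PS by (intro continuous_intros bm_indefinite_continuous)
  qed (simp add: P0)
  have bmP: "bm s T (\<lambda>r. \<Sum>k\<in>F. B r k l * P n r k)" if "T \<in> I" for n l T
    by (intro bm_sum bm_mult B[OF that] bm_continuous contP[OF that])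
  define X where "X t l = x0 l + (\<Sum>n. P (Suc n) t l - P n t l)" for t l
  have unif: "uniform_limit {s..T} (\<lambda>n t. P n t l) (\<lambda>t. X t l) sequentially" if T: "T \<in> I" for T l
  proof -
    \<comment> \<open>The index \<open>l\<close> may lie outside \<open>F\<close>, hence the bound
      over \<open>insert l F\<close>.\<close>
    have "\<exists>C. \<forall>t\<in>{s..T}. \<forall>k\<in>insert l F. \<forall>l'\<in>insert l F. \<bar>B t k l'\<bar> \<le> C"
    proof -
      have "\<exists>C. \<forall>k l'. 0 \<le> C k l' \<and> (\<forall>t\<in>{s..T}. \<bar>B t k l'\<bar> \<le> C k l')"
      proof -
        have "\<exists>C\<ge>0. \<forall>t\<in>{s..T}. \<bar>B t k l'\<bar> \<le> C" for k l'
          by (rule bm_bound[OF B[OF T, of k l']]) blast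
        then show ?thesis by metis
      qed
      then obtain C where C: "\<And>k l'. 0 \<le> C k l'" "\<And>k l' t. t \<in> {s..T} \<Longrightarrow> \<bar>B t k l'\<bar> \<le> C k l'" by blast
      have "\<bar>B t k l'\<bar> \<le> (\<Sum>k\<in>insert l F. \<Sum>l'\<in>insert l F. C k l')"
        if "t \<in> {s..T}" "k \<in> insert l F" "l' \<in> insert l F" for t k l'
      proof -
        have "\<bar>B t k l'\<bar> \<le> C k l'" using C that by blast
        also have "\<dots> \<le> (\<Sum>l'\<in>insert l F. C k l')" using that F C(1) by (intro member_le_sum) auto
        also have "\<dots> \<le> (\<Sum>k\<in>insert l F. \<Sum>l'\<in>insert l F. C k l')"
          using that F C(1) by (intro member_le_sum[where f="\<lambda>k. \<Sum>l'\<in>insert l F. C k l'"] sum_nonneg) auto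
        finally show ?thesis .
      qed
      then show ?thesis by blast
    qed
    then obtain C' where C': "\<forall>t\<in>{s..T}. \<forall>k\<in>insert l F. \<forall>l'\<in>insert l F. \<bar>B t k l'\<bar> \<le> C'" by blast
    define C where "C = max C' 0"
    have C: "0 \<le> C" "\<And>t k l'. t \<in> {s..T} \<Longrightarrow> k \<in> insert l F \<Longrightarrow> l' \<in> insert l F \<Longrightarrow> \<bar>B t k l'\<bar> \<le> C"
      using C' by (auto simp: C_def le_max_iff_disj)
    \<comment> \<open>In the weight \<open>exp (g * (t - s))\<close> one iteration multiplies
      differences by at most \<open>card F * C / g\<close>, and this choice makes the factor at most
      1/2. The interval need not be short.\<close>
    define g where "g = 2 * (card F * C) + 1"
    have g: "g > 0" "card F * C / g \<le> 1/2" 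
    proof -
      have "0 \<le> card F * C" using C by simp
      then show "g > 0" "card F * C / g \<le> 1/2" by (simp_all add: g_def field_simps)
    qed
    define R where "R = (\<Sum>k\<in>F. \<bar>x0 k\<bar>) * C * (T - s)"
    have Ts: "s \<le> T" by (rule I[OF T])
    have R0: "0 \<le> R" unfolding R_def using C Ts by (intro mult_nonneg_nonneg sum_nonneg) auto
    have est: "\<bar>P (Suc n) t l' - P n t l'\<bar> \<le> R * (1/2)^n * exp (g * (t - s))"
      if "t \<in> {s..T}" "l' \<in> insert l F" for n t l'
      using that
    proof (induction n arbitrary: t l')
      case 0
      have tI: "bm s t (\<lambda>r. \<Sum>k\<in>F. B r k l' * P 0 r k)"
        using 0 by (intro bm_subinterval[OF bmP[OF T]]) auto
      have "\<bar>P (Suc 0) t l' - P 0 t l'\<bar> = \<bar>integral {s..t} (\<lambda>r. \<Sum>k\<in>F. B r k l' * P 0 r k)\<bar>"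
        unfolding PS P0 by simp
      also have "\<dots> \<le> ((\<Sum>k\<in>F. \<bar>x0 k\<bar>) * C) * (t - s)"
      proof (rule bm_integral_bound[OF tI])
        fix r assume r: "r \<in> {s..t}"
        have "\<bar>\<Sum>k\<in>F. B r k l' * P 0 r k\<bar> \<le> (\<Sum>k\<in>F. \<bar>B r k l'\<bar> * \<bar>x0 k\<bar>)"
          unfolding P0 by (rule sum_abs[THEN order_trans]) (simp add: abs_mult)
        also have "\<dots> \<le> (\<Sum>k\<in>F. C * \<bar>x0 k\<bar>)"
          using r 0 by (intro sum_mono mult_right_mono C) auto
        finally show "\<bar>\<Sum>k\<in>F. B r k l' * P 0 r k\<bar> \<le> (\<Sum>k\<in>F. \<bar>x0 k\<bar>) * C"
          by (simp add: sum_distrib_left mult.commute)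
      qed (use 0 C in \<open>auto intro!: mult_nonneg_nonneg sum_nonneg\<close>)
      also have "\<dots> \<le> R * 1" unfolding R_def using 0 C
        by (simp, intro mult_left_mono mult_nonneg_nonneg sum_nonneg) auto
      also have "\<dots> \<le> R * exp (g * (t - s))" using 0 g R0 by (intro mult_left_mono) auto
      finally show ?case by simp
    next
      case (Suc n)
      let ?d = "\<lambda>r. \<Sum>k\<in>F. B r k l' * (P (Suc n) r k - P n r k)"
      have sub: "bm s t (\<lambda>r. \<Sum>k\<in>F. B r k l' * P j r k)" for j
        using Suc.prems by (intro bm_subinterval[OF bmP[OF T]]) auto
      have d: "?d = (\<lambda>r. (\<Sum>k\<in>F. B r k l' * P (Suc n) r k) - (\<Sum>k\<in>F. B r k l' * P n r k))"
        by (simp add: right_diff_distrib sum_subtractf)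
      have "P (Suc (Suc n)) t l' - P (Suc n) t l' = integral {s..t} ?d"
        unfolding d PS[of "Suc n"] PS[of n t]
        by (subst Henstock_Kurzweil_Integration.integral_diff) (auto intro: bm_integrable sub)
      then have "\<bar>P (Suc (Suc n)) t l' - P (Suc n) t l'\<bar> = norm (integral {s..t} ?d)" by simp
      also have "\<dots> \<le> integral {s..t} (\<lambda>r. card F * C * R * (1/2)^n * exp (g * (r - s)))"
      proof (rule integral_norm_bound_integral)
        show "?d integrable_on {s..t}" unfolding d by (intro bm_integrable bm_diff sub)
        show "(\<lambda>r. card F * C * R * (1/2)^n * exp (g * (r - s))) integrable_on {s..t}"
          by (intro integrable_continuous_real continuous_intros)
        fix r assume r: "r \<in> {s..t}"
        then have r': "r \<in> {s..T}" using Suc.prems by auto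
        have "\<bar>?d r\<bar> \<le> (\<Sum>k\<in>F. \<bar>B r k l'\<bar> * \<bar>P (Suc n) r k - P n r k\<bar>)"
          by (rule sum_abs[THEN order_trans]) (simp add: abs_mult)
        also have "\<dots> \<le> (\<Sum>k\<in>F. C * (R * (1/2)^n * exp (g * (r - s))))"
          using Suc.prems C(1) by (intro sum_mono mult_mono C(2)[OF r'] Suc.IH[OF r']) auto
        also have "\<dots> = card F * C * R * (1/2)^n * exp (g * (r - s))" by simp
        finally show "norm (?d r) \<le> card F * C * R * (1/2)^n * exp (g * (r - s))" by simp
      qed
      also have "\<dots> = card F * C * R * (1/2)^n * ((exp (g * (t - s)) - 1) / g)"
      proof -
        have "((\<lambda>r. exp (g * (r - s))) has_integral (exp (g * (t - s)) / g - exp (g * (s - s)) / g)) {s..t}"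
          using Suc.prems g
          by (intro fundamental_theorem_of_calculus)
            (auto intro!: derivative_eq_intros simp flip: has_real_derivative_iff_has_vector_derivative)
        then have "integral {s..t} (\<lambda>r. exp (g * (r - s))) = (exp (g * (t - s)) - 1) / g"
          by (simp add: integral_unique diff_divide_distrib)
        then show ?thesis by simp
      qed
      also have "\<dots> = (R * (1/2)^n) * (card F * C / g) * (exp (g * (t - s)) - 1)" by simp
      also have "\<dots> \<le> (R * (1/2)^n) * (1/2) * exp (g * (t - s))"
        using R0 g C Suc.prems by (intro mult_mono) auto
      finally show ?case by simp
    qed
    have "uniform_limit {s..T} (\<lambda>n t. \<Sum>i<n. P (Suc i) t l - P i t l) (\<lambda>t. \<Sum>i. P (Suc i) t l - P i t l) sequentially"
    proof (rule Weierstrass_m_test)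
      show "summable (\<lambda>n. R * (1/2)^n * exp (g * (T - s)))"
        by (intro summable_mult2 summable_mult summable_geometric) auto
      fix n t assume t: "t \<in> {s..T}"
      have "\<bar>P (Suc n) t l - P n t l\<bar> \<le> R * (1/2)^n * exp (g * (t - s))" using est[OF t] by simp
      also have "\<dots> \<le> R * (1/2)^n * exp (g * (T - s))" using t g R0 by (intro mult_left_mono) auto
      finally show "norm (P (Suc n) t l - P n t l) \<le> R * (1/2)^n * exp (g * (T - s))" by simp
    qed
    then have "uniform_limit {s..T} (\<lambda>n t. x0 l + (\<Sum>i<n. P (Suc i) t l - P i t l)) (\<lambda>t. X t l) sequentially"
      unfolding X_def by (intro uniform_limit_intros)
    moreover have "x0 l + (\<Sum>i<n. P (Suc i) t l - P i t l) = P n t l" for n t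
      by (subst sum_lessThan_telescope) (simp add: P0)
    ultimately show ?thesis by simp
  qed
  have contX: "continuous_on {s..T} (\<lambda>t. X t l)" if "T \<in> I" for T l
    by (rule uniform_limit_theorem[OF _ unif[OF that]]) (simp_all add: contP[OF that])
  have limP: "(\<lambda>n. P n r k) \<longlonglongrightarrow> X r k" if "T \<in> I" "r \<in> {s..T}" for T r k
    by (rule tendsto_uniform_limitI[OF unif[OF that(1)] that(2)])
  have eq: "X t l = x0 l + integral {s..t} (\<lambda>r. \<Sum>k\<in>F. B r k l * X r k)" if t: "t \<in> I" for t l
  proof (rule LIMSEQ_unique)
    show "(\<lambda>n. P (Suc n) t l) \<longlonglongrightarrow> X t l"
      using limP[OF t, of t l] I[OF t] by (intro LIMSEQ_Suc) auto
    have "uniform_limit {s..t} (\<lambda>n r. \<Sum>k\<in>F. B r k l * P n r k) (\<lambda>r. \<Sum>k\<in>F. B r k l * X r k) sequentially"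
    proof (rule uniform_limit_sum[OF F])
      fix k
      obtain C where C: "\<And>r. r \<in> {s..t} \<Longrightarrow> \<bar>B r k l\<bar> \<le> C"
        using bm_bound[OF B[OF t, of k l]] by blast
      have b1: "bounded ((\<lambda>r. B r k l) ` {s..t})"
        using C by (intro boundedI[of _ C]) auto
      have b2: "bounded ((\<lambda>r. X r k) ` {s..t})"
        by (rule compact_imp_bounded[OF compact_continuous_image[OF contX[OF t]]]) simp
      show "uniform_limit {s..t} (\<lambda>n r. B r k l * P n r k) (\<lambda>r. B r k l * X r k) sequentially"
        using uniform_lim_mult[OF uniform_limit_const unif[OF t, of k] b1 b2] by simp
    qed
    then have u: "uniform_limit {s..t} (\<lambda>n r. \<Sum>k\<in>F. B r k l * P n r k) (\<lambda>r. \<Sum>k\<in>F. B r k l * X r k) sequentially"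
      by simp
    have bX: "bm s t (\<lambda>r. \<Sum>k\<in>F. B r k l * X r k)"
    proof (rule bm_sum)
      show "bm s t (\<lambda>r. B r k l * X r k)" for k
        by (rule bm_mult[OF B[OF t] bm_continuous[OF contX[OF t]]])
    qed
    then have "(\<lambda>n. integral {s..t} (\<lambda>r. \<Sum>k\<in>F. B r k l * P n r k))
        \<longlonglongrightarrow> integral {s..t} (\<lambda>r. \<Sum>k\<in>F. B r k l * X r k)"
      by (intro integral_uniform_limit_bm u bmP[OF t])
    then show "(\<lambda>n. P (Suc n) t l) \<longlonglongrightarrow> x0 l + integral {s..t} (\<lambda>r. \<Sum>k\<in>F. B r k l * X r k)"
      unfolding PS by (intro tendsto_intros)
  qed
  show ?thesis using contX eq by (intro exI[of _ X] conjI ballI allI)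
qed

subsection \<open>Existence by Galerkin approximation\<close>

definition galerkin :: "real \<Rightarrow> (real \<Rightarrow> real^'n \<Rightarrow> real^'n) \<Rightarrow> real set \<Rightarrow> real \<Rightarrow>
    (real^'n \<Rightarrow> real) \<Rightarrow> nat \<Rightarrow> (real \<Rightarrow> int^'n \<Rightarrow> real) \<Rightarrow> bool" where
  "galerkin \<nu> v I s f n X \<longleftrightarrow> (\<forall>T\<in>I. \<forall>l. continuous_on {s..T} (\<lambda>t. X t l)) \<and>
     (\<forall>t\<in>I. \<forall>l\<in>modes n. X t l = ip f (hart l)
       + integral {s..t} (\<lambda>r. drift (v r) (comb (modes n) (X r)) l - \<nu> * lam l * X r l))"

lemma galerkin_exists:
  fixes v :: "real \<Rightarrow> real^'n \<Rightarrow> real^'n" and f :: "real^'n \<Rightarrow> real"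
  assumes v: "nice T' v" and s: "0 \<le> s"
  shows "\<exists>X. galerkin \<nu> v (time_interval s T') s f n X"
proof -
  let ?I = "time_interval s T'"
  define B where "B t k l = drift (v t) (hart k) l - (if k = l then \<nu> * lam l else 0)" for t k l
  have hc: "curve {s..T} (\<lambda>t. hart k)" for T :: real and k :: "int^'n"
    by (simp add: curve_def hart_L2 L2_norm_def)
  have B: "bm s T (\<lambda>t. B t k l)" if "T \<in> ?I" for T k l
    unfolding B_def using that s drift_curve_bm[OF v hc]
    by (intro bm_diff bm_const) (auto simp: time_interval_def)
  have "\<exists>X. (\<forall>T\<in>?I. \<forall>l. continuous_on {s..T} (\<lambda>t. X t l)) \<and>
    (\<forall>t\<in>?I. \<forall>l. X t l = ip f (hart l) + integral {s..t} (\<lambda>r. \<Sum>k\<in>modes n. B r k l * X r k))"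
  proof (rule linear_system)
    show "bm s T (\<lambda>t. B t k l)" if "T \<in> ?I" for T k l by (rule B[OF that])
  qed (simp_all add: time_interval_def)
  then obtain X where X: "\<forall>T\<in>?I. \<forall>l. continuous_on {s..T} (\<lambda>t. X t l)"
    "\<forall>t\<in>?I. \<forall>l. X t l = ip f (hart l) + integral {s..t} (\<lambda>r. \<Sum>k\<in>modes n. B r k l * X r k)"
    by blast
  have rhs: "(\<Sum>k\<in>modes n. B r k l * X r k) = drift (v r) (comb (modes n) (X r)) l - \<nu> * lam l * X r l"
    if "t \<in> ?I" "l \<in> modes n" "r \<in> {s..t}" for t l r
  proof -
    have "0 \<le> t" "ereal t < T'" using that s by (auto simp: time_interval_def)
    then have "t \<in> time_interval 0 T'" by (simp add: time_interval_def)
    then obtain M where "\<forall>r\<in>{0..t}. tame M (v r)" using v unfolding nice_def by blast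
    moreover have "r \<in> {0..t}" using that s by simp
    ultimately have w: "tame M (v r)" by blast
    have "(\<Sum>k\<in>modes n. B r k l * X r k)
        = (\<Sum>k\<in>modes n. X r k * drift (v r) (hart k) l) - (\<Sum>k\<in>modes n. if k = l then \<nu> * lam l * X r k else 0)"
      unfolding B_def sum_subtractf[symmetric] by (intro sum.cong) (auto simp: algebra_simps)
    then show ?thesis using that by (simp add: drift_comb[OF w])
  qed
  have eq: "integral {s..t} (\<lambda>r. \<Sum>k\<in>modes n. B r k l * X r k)
      = integral {s..t} (\<lambda>r. drift (v r) (comb (modes n) (X r)) l - \<nu> * lam l * X r l)"
    if "t \<in> ?I" "l \<in> modes n" for t l
    by (rule integral_cong) (rule rhs[OF that])
  have "galerkin \<nu> v ?I s f n X"
    unfolding galerkin_def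
  proof (intro conjI X(1) ballI)
    fix t and l :: "int^'n" assume tl: "t \<in> ?I" "l \<in> modes n"
    show "X t l = ip f (hart l) + integral {s..t} (\<lambda>r. drift (v r) (comb (modes n) (X r)) l - \<nu> * lam l * X r l)"
      using X(2)[rule_format, OF tl(1), of l] unfolding eq[OF tl] .
  qed
  then show ?thesis by (rule exI[where x=X])
qed

lemma comb_diff: "(\<lambda>x. comb F a x - comb F b x) = comb F (\<lambda>k. a k - b k)"
  by (simp add: comb_def sum_subtractf left_diff_distrib fun_eq_iff)

lemma curve_comb:
  assumes F: "finite F" and X: "\<And>l. l \<in> F \<Longrightarrow> continuous_on I (\<lambda>t. X t l)"
  shows "curve I (\<lambda>t. comb F (X t))"
  unfolding curve_def
proof (intro ballI conjI comb_L2)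
  fix t assume t: "t \<in> I"
  have "((\<lambda>s. sqrt (\<Sum>k\<in>F. (X s k - X t k)\<^sup>2)) \<longlongrightarrow> sqrt (\<Sum>k\<in>F. (X t k - X t k)\<^sup>2)) (at t within I)"
    using X t by (intro tendsto_intros) (auto simp: continuous_on_def)
  then show "((\<lambda>s. L2_norm (\<lambda>x. comb F (X s) x - comb F (X t) x)) \<longlongrightarrow> 0) (at t within I)"
    by (simp add: comb_diff L2_norm_comb F)
qed

lemma sq_completion_bound:
  fixes x y M \<nu> :: real
  assumes "\<nu> > 0"
  shows "2 * M * x * y - 2 * \<nu> * x\<^sup>2 \<le> M\<^sup>2 / (2 * \<nu>) * y\<^sup>2"
proof -
  have "0 \<le> (2 * \<nu> * x - M * y)\<^sup>2 / (2 * \<nu>)" using assms by simp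
  also have "\<dots> = 2 * \<nu> * x\<^sup>2 - 2 * M * x * y + M\<^sup>2 / (2 * \<nu>) * y\<^sup>2"
    using assms by (simp add: power2_eq_square field_simps)
  finally show ?thesis by simp
qed

text \<open>
  With \<open>W\<close> the difference of the two approximations, the only term that does not cancel by
  antisymmetry tests the \<open>m\<close>-th one against the modes of \<open>W\<close> outside \<open>modes m\<close>, where
  \<open>\<parallel>W\<parallel> \<le> \<parallel>\<nabla>W\<parallel> / m\<close>.
\<close>

lemma galerkin_difference_rate:
  assumes w: "tame M w" and mn: "m \<le> n" "m > 0" and nu: "\<nu> > 0"
    and W: "\<And>l. W l = y l - (if l \<in> modes m then x l else 0)"
  shows "(\<Sum>l\<in>modes n. 2 * (W l * ((drift w (comb (modes n) y) l - \<nu> * lam l * y l)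
        - (if l \<in> modes m then drift w (comb (modes m) x) l - \<nu> * lam l * x l else 0))))
    \<le> M\<^sup>2 / (2 * \<nu> * (real m)\<^sup>2) * (\<Sum>l\<in>modes m. lam l * (x l)\<^sup>2)"
proof -
  let ?F = "modes m" and ?G = "modes n" and ?dy = "drift w (comb (modes n) y)" and ?dx = "drift w (comb (modes m) x)"
  have FG: "?F \<subseteq> ?G" by (rule modes_mono[OF mn(1)])
  have M0: "0 \<le> M" using w unfolding tame_def by (meson norm_ge_zero order_trans)
  define x' where "x' l = (if l \<in> ?F then x l else 0)" for l
  have W': "W l = y l - x' l" for l by (simp add: W x'_def)
  have cx: "comb ?F x = comb ?G x'"
    unfolding comb_def x'_def using FG by (intro ext sum.mono_neutral_cong_left) auto
  have "comb ?G W = (\<lambda>z. comb ?G y z - comb ?F x z)"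
    unfolding cx comb_diff by (simp add: W' comb_def)
  then have dW: "drift w (comb ?G W) l = ?dy l - ?dx l" for l
    using drift_diff[OF w sqi_comb sqi_comb, of ?G y ?F x l] by simp
  define Q where "Q = (\<Sum>l\<in>?G. lam l * (W l)\<^sup>2)"
  define q where "q = (\<Sum>l\<in>?F. lam l * (x l)\<^sup>2)"
  have Q0: "0 \<le> Q" and q0: "0 \<le> q" unfolding Q_def q_def by (auto intro: sum_nonneg)
  have "(\<Sum>l\<in>?G. 2 * (W l * ((?dy l - \<nu> * lam l * y l) - (if l \<in> ?F then ?dx l - \<nu> * lam l * x l else 0))))
      = (\<Sum>l\<in>?G. 2 * (W l * (?dy l - ?dx l)) + (if l \<in> ?G - ?F then 2 * (W l * ?dx l) else 0) - 2 * \<nu> * (lam l * (W l)\<^sup>2))"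
    by (intro sum.cong refl) (auto simp: W' x'_def algebra_simps power2_eq_square)
  also have "\<dots> = 2 * (\<Sum>l\<in>?G. W l * drift w (comb ?G W) l) + 2 * (\<Sum>l\<in>?G - ?F. W l * ?dx l) - 2 * \<nu> * Q"
    unfolding sum_subtractf sum.distrib dW Q_def sum_distrib_left
    by (simp add: sum.inter_restrict[symmetric] Int_absorb1 Diff_subset del: Diff_iff)
  also have "(\<Sum>l\<in>?G. W l * drift w (comb ?G W) l) = 0"
    by (rule drift_comb_self[OF w finite_modes])
  also have "(\<Sum>l\<in>?G - ?F. W l * ?dx l) \<le> M * sqrt Q / real m * sqrt q"
  proof -
    have "(\<Sum>l\<in>?G - ?F. W l * ?dx l) = (\<Sum>l\<in>?G - ?F. \<Sum>k\<in>?F. W l * (x k * drift w (hart k) l))"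
      by (simp add: drift_comb[OF w] sum_distrib_left)
    also have "\<dots> = (\<Sum>k\<in>?F. \<Sum>l\<in>?G - ?F. W l * (x k * drift w (hart k) l))" by (rule sum.swap)
    \<comment> \<open>Antisymmetry puts the derivative on the approximation with coefficients
      \<open>x\<close>, whose dissipation is controlled by the energy identity, and lets
      \<open>W\<close> enter only through its high modes.\<close>
    also have "\<dots> = - (\<Sum>k\<in>?F. x k * drift w (comb (?G - ?F) W) k)"
      unfolding drift_comb[OF w] sum_distrib_left sum_negf[symmetric]
      by (intro sum.cong refl) (subst drift_antisym[OF w], simp)
    also have "\<dots> \<le> M * L2_norm (comb (?G - ?F) W) * sqrt q"
      using drift_bound[OF w sqi_comb[of "?G - ?F" W] finite_modes[of m], of x] unfolding q_def by linarith
    also have "\<dots> \<le> M * (sqrt Q / real m) * sqrt q"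
    proof (intro mult_right_mono mult_left_mono M0)
      have "(\<Sum>l\<in>?G - ?F. (real m)\<^sup>2 * (W l)\<^sup>2) \<le> (\<Sum>l\<in>?G - ?F. lam l * (W l)\<^sup>2)"
        by (intro sum_mono mult_right_mono lam_ge) auto
      also have "\<dots> \<le> Q" unfolding Q_def by (intro sum_mono2) auto
      finally have "(\<Sum>l\<in>?G - ?F. (W l)\<^sup>2) \<le> Q / (real m)\<^sup>2"
        using mn by (simp add: field_simps flip: sum_distrib_left)
      then show "L2_norm (comb (?G - ?F) W) \<le> sqrt Q / real m"
        using real_sqrt_le_mono[of _ "Q / (real m)\<^sup>2"] by (simp add: L2_norm_comb real_sqrt_divide)
    qed (use q0 in auto)
    finally show ?thesis by simp
  qed
  also have "2 * 0 + 2 * (M * sqrt Q / real m * sqrt q) - 2 * \<nu> * Q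
      = 2 * M * sqrt Q * (sqrt q / real m) - 2 * \<nu> * (sqrt Q)\<^sup>2"
    using Q0 by simp
  also have "\<dots> \<le> M\<^sup>2 / (2 * \<nu>) * (sqrt q / real m)\<^sup>2" by (rule sq_completion_bound[OF nu])
  also have "\<dots> = M\<^sup>2 / (2 * \<nu> * (real m)\<^sup>2) * q" using q0 by (simp add: power_divide)
  finally show ?thesis by (simp add: q_def)
qed

lemma time_interval_nice:
  assumes v: "nice T' v" and "0 \<le> s" "T \<in> time_interval s T'"
  obtains M where "0 \<le> M" "\<And>r. r \<in> {0..T} \<Longrightarrow> tame M (v r)"
proof -
  have "T \<in> time_interval 0 T'" using assms by (simp add: time_interval_def)
  with v have "\<exists>M. \<forall>r\<in>{0..T}. tame M (v r)" unfolding nice_def by blast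
  then obtain M where M: "\<forall>r\<in>{0..T}. tame M (v r)" ..
  then have "tame M (v 0)" using assms by (simp add: time_interval_def)
  then have "0 \<le> M" unfolding tame_def by (meson norm_ge_zero order_trans)
  with M show thesis by (intro that) blast+
qed

lemma galerkin_curve:
  "galerkin \<nu> v I s f n X \<Longrightarrow> T \<in> I \<Longrightarrow> curve {s..T} (\<lambda>t. comb (modes n) (X t))"
  unfolding galerkin_def by (intro curve_comb finite_modes) blast

lemma galerkin_cont: "galerkin \<nu> v I s f n X \<Longrightarrow> T \<in> I \<Longrightarrow> continuous_on {s..T} (\<lambda>t. X t l)"
  unfolding galerkin_def by blast

lemma galerkin_eq:
  "galerkin \<nu> v I s f n X \<Longrightarrow> t \<in> I \<Longrightarrow> l \<in> modes n \<Longrightarrow>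
    X t l = ip f (hart l) + integral {s..t} (\<lambda>r. drift (v r) (comb (modes n) (X r)) l - \<nu> * lam l * X r l)"
  unfolding galerkin_def by blast

lemma galerkin_bm:
  assumes "nice T' v" "0 \<le> s" "galerkin \<nu> v (time_interval s T') s f n X" "t \<in> time_interval s T'"
  shows "bm s t (\<lambda>r. drift (v r) (comb (modes n) (X r)) l - \<nu> * lam l * X r l)"
proof (intro bm_diff bm_mult bm_const)
  have "ereal t < T'" using assms(4) by (simp add: time_interval_def)
  then show "bm s t (\<lambda>r. drift (v r) (comb (modes n) (X r)) l)"
    by (rule drift_curve_bm[OF assms(1) galerkin_curve[OF assms(3,4)] assms(2)])
  show "bm s t (\<lambda>r. X r l)"
    by (rule bm_continuous[OF galerkin_cont[OF assms(3,4)]])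
qed

lemma galerkin_start:
  assumes "galerkin \<nu> v (time_interval s T') s f n X" "t \<in> time_interval s T'" "l \<in> modes n"
  shows "X s l = ip f (hart l)"
    "r \<in> {s..t} \<Longrightarrow> X r l = X s l + integral {s..r} (\<lambda>r. drift (v r) (comb (modes n) (X r)) l - \<nu> * lam l * X r l)"
proof -
  have "s \<in> time_interval s T'"
    using assms(2) by (auto simp: time_interval_def intro: le_less_trans[of "ereal s" "ereal t"])
  from galerkin_eq[OF assms(1) this assms(3)] show *: "X s l = ip f (hart l)" by simp
  assume "r \<in> {s..t}"
  then have "r \<in> time_interval s T'"
    using assms(2) by (auto simp: time_interval_def intro: le_less_trans[of "ereal r" "ereal t"])
  from galerkin_eq[OF assms(1) this assms(3)]
  show "X r l = X s l + integral {s..r} (\<lambda>r. drift (v r) (comb (modes n) (X r)) l - \<nu> * lam l * X r l)"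
    unfolding * .
qed

text \<open>On the span of \<open>modes n\<close> the drift cancels exactly, since the system is
  tested with its own solution. The dissipation integral is kept because it bounds the error in
  \<open>galerkin_cauchy\<close>.\<close>

lemma galerkin_energy:
  assumes v: "nice T' v" and s: "0 \<le> s" and gal: "galerkin \<nu> v (time_interval s T') s f n X"
    and t: "t \<in> time_interval s T'" and f: "sqi f"
  shows "(\<Sum>l\<in>modes n. (X t l)\<^sup>2) + 2 * \<nu> * integral {s..t} (\<lambda>r. \<Sum>l\<in>modes n. lam l * (X r l)\<^sup>2) \<le> (L2_norm f)\<^sup>2"
proof -
  let ?g = "\<lambda>l r. drift (v r) (comb (modes n) (X r)) l - \<nu> * lam l * X r l"
  have st: "s \<le> t" using t by (simp add: time_interval_def)
  obtain M where M: "\<And>r. r \<in> {0..t} \<Longrightarrow> tame M (v r)" using time_interval_nice[OF v s t] by blast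
  note g = galerkin_bm[OF v s gal t] and X = bm_continuous[OF galerkin_cont[OF gal t]]
  have "(\<Sum>l\<in>modes n. (X t l)\<^sup>2) - (\<Sum>l\<in>modes n. (X s l)\<^sup>2) = (\<Sum>l\<in>modes n. integral {s..t} (\<lambda>r. X r l * ?g l r + ?g l r * X r l))"
    unfolding sum_subtractf[symmetric] power2_eq_square
    by (intro sum.cong refl product_rule[OF st g g] galerkin_start(2)[OF gal t])
  also have "\<dots> = integral {s..t} (\<lambda>r. \<Sum>l\<in>modes n. X r l * ?g l r + ?g l r * X r l)"
    by (intro integral_sum[symmetric] finite_modes bm_integrable bm_add bm_mult g X)
  also have "\<dots> = integral {s..t} (\<lambda>r. (- 2 * \<nu>) * (\<Sum>l\<in>modes n. lam l * (X r l)\<^sup>2))"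
  proof (rule integral_cong)
    fix r assume "r \<in> {s..t}"
    then have "tame M (v r)" using M s by simp
    then have "(\<Sum>l\<in>modes n. X r l * drift (v r) (comb (modes n) (X r)) l) = 0"
      by (rule drift_comb_self) simp
    moreover have "(\<Sum>l\<in>modes n. X r l * ?g l r + ?g l r * X r l)
        = 2 * (\<Sum>l\<in>modes n. X r l * drift (v r) (comb (modes n) (X r)) l)
          + (- 2 * \<nu>) * (\<Sum>l\<in>modes n. lam l * (X r l)\<^sup>2)"
      unfolding sum_distrib_left sum.distrib[symmetric]
      by (intro sum.cong refl) (simp add: algebra_simps power2_eq_square)
    ultimately show "(\<Sum>l\<in>modes n. X r l * ?g l r + ?g l r * X r l) = (- 2 * \<nu>) * (\<Sum>l\<in>modes n. lam l * (X r l)\<^sup>2)"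
      by simp
  qed
  also have "\<dots> = (- 2 * \<nu>) * integral {s..t} (\<lambda>r. \<Sum>l\<in>modes n. lam l * (X r l)\<^sup>2)"
    by (rule integral_mult_right)
  finally have "(\<Sum>l\<in>modes n. (X t l)\<^sup>2) + 2 * \<nu> * integral {s..t} (\<lambda>r. \<Sum>l\<in>modes n. lam l * (X r l)\<^sup>2)
      = (\<Sum>l\<in>modes n. (X s l)\<^sup>2)" by simp
  also have "\<dots> = (\<Sum>l\<in>modes n. (ip f (hart l))\<^sup>2)"
    by (intro sum.cong refl) (simp add: galerkin_start(1)[OF gal t])
  also have "\<dots> \<le> (L2_norm f)\<^sup>2" by (rule Bessel[OF f])
  finally show ?thesis .
qed

text \<open>The first term is the part of the initial data outside \<open>modes m\<close>. The
  second integrates \<open>galerkin_difference_rate\<close> in time, where the energy bound on the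
  dissipation of the \<open>m\<close>-th approximation contributes one factor
  \<open>2 * \<nu>\<close> of the denominator. The right-hand side depends neither on
  \<open>n\<close> nor on time except through \<open>M\<close>.\<close>

lemma galerkin_cauchy:
  fixes f :: "real^'n \<Rightarrow> real"
  assumes v: "nice T' v" and s: "0 \<le> s" and nu: "\<nu> > 0" and mn: "m \<le> n" "m > 0" and f: "sqi f"
    and galX: "galerkin \<nu> v (time_interval s T') s f m X"
    and galY: "galerkin \<nu> v (time_interval s T') s f n Y"
    and t: "t \<in> time_interval s T'" and M: "\<And>r. r \<in> {0..t} \<Longrightarrow> tame M (v r)"
  shows "(L2_norm (\<lambda>z. comb (modes n) (Y t) z - comb (modes m) (X t) z))\<^sup>2
    \<le> ((L2_norm f)\<^sup>2 - (\<Sum>l\<in>modes m. (ip f (hart l))\<^sup>2)) + M\<^sup>2 * (L2_norm f)\<^sup>2 / (4 * \<nu>\<^sup>2 * (real m)\<^sup>2)"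
proof -
  let ?F = "modes m" and ?G = "modes n"
  let ?gX = "\<lambda>l r. drift (v r) (comb ?F (X r)) l - \<nu> * lam l * X r l"
  let ?gY = "\<lambda>l r. drift (v r) (comb ?G (Y r)) l - \<nu> * lam l * Y r l"
  have st: "s \<le> t" using t by (simp add: time_interval_def)
  have FG: "(?F :: (int^'n) set) \<subseteq> ?G" by (rule modes_mono[OF mn(1)])
  define W where "W r l = Y r l - (if l \<in> ?F then X r l else 0)" for r l
  define h where "h l r = ?gY l r - (if l \<in> ?F then ?gX l r else 0)" for l r
  note bmX = galerkin_bm[OF v s galX t] and bmY = galerkin_bm[OF v s galY t]
  have bmh: "bm s t (h l)" for l
    unfolding h_def by (cases "l \<in> ?F") (auto intro: bm_diff bmX bmY)
  have contW: "bm s t (\<lambda>r. W r l)" for l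
  proof -
    have bX: "bm s t (\<lambda>r. X r l)" and bY: "bm s t (\<lambda>r. Y r l)"
      by (rule bm_continuous[OF galerkin_cont[OF galX t]], rule bm_continuous[OF galerkin_cont[OF galY t]])
    then show ?thesis unfolding W_def using bm_diff[OF bY bX] by (cases "l \<in> ?F") auto
  qed
  have W: "W r l = W s l + integral {s..r} (h l)" if "l \<in> ?G" "r \<in> {s..t}" for l r
  proof -
    note Y = galerkin_start(2)[OF galY t that]
    show ?thesis
    proof (cases "l \<in> ?F")
      case True
      note X = galerkin_start(2)[OF galX t True that(2)]
      have "integral {s..r} (h l) = integral {s..r} (?gY l) - integral {s..r} (?gX l)"
        unfolding h_def using True that(2)
        by (simp, intro Henstock_Kurzweil_Integration.integral_diff bm_integrable
          bm_subinterval[OF bmX] bm_subinterval[OF bmY]) auto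
      then show ?thesis using X Y True by (simp add: W_def)
    next
      case False
      then have "h l = ?gY l" by (simp add: h_def fun_eq_iff)
      then show ?thesis using Y False by (simp add: W_def)
    qed
  qed
  define Q where "Q r = (\<Sum>l\<in>?F. lam l * (X r l)\<^sup>2)" for r
  have "continuous_on {s..t} Q"
    unfolding Q_def by (intro continuous_intros galerkin_cont[OF galX t])
  then have bmQ: "bm s t Q" by (rule bm_continuous)
  let ?c = "M\<^sup>2 / (2 * \<nu> * (real m)\<^sup>2)"
  have "(\<Sum>l\<in>?G. (W t l)\<^sup>2) - (\<Sum>l\<in>?G. (W s l)\<^sup>2) = (\<Sum>l\<in>?G. integral {s..t} (\<lambda>r. W r l * h l r + h l r * W r l))"
    unfolding sum_subtractf[symmetric] power2_eq_square
    by (intro sum.cong refl product_rule[OF st bmh bmh] W)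
  also have "\<dots> = integral {s..t} (\<lambda>r. \<Sum>l\<in>?G. W r l * h l r + h l r * W r l)"
    by (intro integral_sum[symmetric] finite_modes bm_integrable bm_add bm_mult bmh contW)
  also have "\<dots> \<le> integral {s..t} (\<lambda>r. ?c * Q r)"
  proof (rule integral_le)
    show "(\<lambda>r. \<Sum>l\<in>?G. W r l * h l r + h l r * W r l) integrable_on {s..t}"
      by (intro bm_integrable bm_sum bm_add bm_mult bmh contW)
    show "(\<lambda>r. ?c * Q r) integrable_on {s..t}"
      by (intro bm_integrable bm_mult bm_const bmQ)
    fix r assume "r \<in> {s..t}"
    then have "tame M (v r)" using M s by simp
    from galerkin_difference_rate[OF this mn nu, of "W r" "Y r" "X r", OF W_def]
    show "(\<Sum>l\<in>?G. W r l * h l r + h l r * W r l) \<le> ?c * Q r"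
      unfolding h_def Q_def by (simp add: mult.commute[of _ "W r _"])
  qed
  also have "\<dots> = ?c * integral {s..t} Q" by (rule integral_mult_right)
  also have "\<dots> \<le> ?c * ((L2_norm f)\<^sup>2 / (2 * \<nu>))"
  proof (rule mult_left_mono)
    have "0 \<le> (\<Sum>l\<in>?F. (X t l)\<^sup>2)" by (intro sum_nonneg) auto
    then have "2 * \<nu> * integral {s..t} Q \<le> (L2_norm f)\<^sup>2"
      using galerkin_energy[OF v s galX t f] unfolding Q_def by linarith
    then show "integral {s..t} Q \<le> (L2_norm f)\<^sup>2 / (2 * \<nu>)" using nu by (simp add: field_simps)
  qed (use nu in simp)
  also have "\<dots> = M\<^sup>2 * (L2_norm f)\<^sup>2 / (4 * \<nu>\<^sup>2 * (real m)\<^sup>2)"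
    by (simp add: power2_eq_square)
  finally have 1: "(\<Sum>l\<in>?G. (W t l)\<^sup>2) \<le> (\<Sum>l\<in>?G. (W s l)\<^sup>2) + M\<^sup>2 * (L2_norm f)\<^sup>2 / (4 * \<nu>\<^sup>2 * (real m)\<^sup>2)" by simp
  have "(\<Sum>l\<in>?G. (W s l)\<^sup>2) = (\<Sum>l\<in>?G. (ip f (hart l))\<^sup>2 - (if l \<in> ?F then (ip f (hart l))\<^sup>2 else 0))"
    by (intro sum.cong refl) (simp add: W_def galerkin_start(1)[OF galX t] galerkin_start(1)[OF galY t])
  also have "\<dots> = (\<Sum>l\<in>?G. (ip f (hart l))\<^sup>2) - (\<Sum>l\<in>?F. (ip f (hart l))\<^sup>2)"
  proof -
    have "?G \<inter> ?F = (?F :: (int^'n) set)" using FG by blast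
    then show ?thesis unfolding sum_subtractf by (simp add: sum.inter_restrict[symmetric])
  qed
  also have "\<dots> \<le> (L2_norm f)\<^sup>2 - (\<Sum>l\<in>?F. (ip f (hart l))\<^sup>2)"
    using Bessel[OF f, of n] by simp
  finally have 2: "(\<Sum>l\<in>?G. (W s l)\<^sup>2) \<le> (L2_norm f)\<^sup>2 - (\<Sum>l\<in>?F. (ip f (hart l))\<^sup>2)" .
  have "comb ?F (X t) = comb ?G (\<lambda>l. if l \<in> ?F then X t l else 0)"
    unfolding comb_def using FG by (intro ext sum.mono_neutral_cong_left) auto
  then have "(\<lambda>z. comb ?G (Y t) z - comb ?F (X t) z) = comb ?G (W t)"
    by (simp add: comb_diff W_def[abs_def])
  then have "(L2_norm (\<lambda>z. comb ?G (Y t) z - comb ?F (X t) z))\<^sup>2 = (\<Sum>l\<in>?G. (W t l)\<^sup>2)"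
    by (simp add: L2_norm_comb sum_nonneg)
  with 1 2 show ?thesis by linarith
qed

text \<open>Pointwise limits of the Galerkin curves; by \<open>galerkin_cauchy\<close> the convergence is locally uniform.\<close>

theorem fsol_exists:
  fixes v :: "real \<Rightarrow> real^'n \<Rightarrow> real^'n" and f :: "real^'n \<Rightarrow> real"
  assumes v: "nice T' v" and s: "0 \<le> s" "ereal s < T'" and nu: "\<nu> > 0" and f: "f \<in> L2"
  shows "\<exists>\<theta>. fsol \<nu> v (time_interval s T') \<theta> \<and> L2_norm (\<lambda>x. \<theta> s x - f x) = 0"
proof -
  let ?I = "time_interval s T'"
  note sf = L2_sqi[OF f]
  have "\<exists>X. \<forall>n. galerkin \<nu> v ?I s f n (X n)" using galerkin_exists[OF v s(1)] by metis
  then obtain X where X: "\<And>n. galerkin \<nu> v ?I s f n (X n)" by blast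
  define A where "A n t = comb (modes n) (X n t)" for n t
  have sA: "sqi (A n t)" and LA: "A n t \<in> L2" for n t unfolding A_def by (simp_all add: comb_L2)
  define del where "del M m = ((L2_norm f)\<^sup>2 - (\<Sum>l\<in>modes m. (ip f (hart l))\<^sup>2)) + M\<^sup>2 * (L2_norm f)\<^sup>2 / (4 * \<nu>\<^sup>2 * (real m)\<^sup>2)" for M m
  have del0: "0 \<le> del M m" for M m
    using Bessel[OF sf, of m] by (simp add: del_def)
  have lim: "(\<lambda>m. sqrt (del M m)) \<longlonglongrightarrow> 0" for M
  proof -
    have p1: "(\<lambda>m. \<Sum>l\<in>modes m. (ip f (hart l))\<^sup>2) \<longlonglongrightarrow> (L2_norm f)\<^sup>2"
      using Parseval[OF f sf] unfolding L2_norm_sq by (simp add: power2_eq_square)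
    have p2: "(\<lambda>m. M\<^sup>2 * (L2_norm f)\<^sup>2 / (4 * \<nu>\<^sup>2) * (inverse (real m))\<^sup>2) \<longlonglongrightarrow> M\<^sup>2 * (L2_norm f)\<^sup>2 / (4 * \<nu>\<^sup>2) * 0\<^sup>2"
      by (intro tendsto_mult tendsto_power tendsto_const tendsto_inverse_0_at_top filterlim_real_sequentially)
    have "(\<lambda>m. ((L2_norm f)\<^sup>2 - (\<Sum>l\<in>modes m. (ip f (hart l))\<^sup>2)) + M\<^sup>2 * (L2_norm f)\<^sup>2 / (4 * \<nu>\<^sup>2) * (inverse (real m))\<^sup>2)
        \<longlonglongrightarrow> ((L2_norm f)\<^sup>2 - (L2_norm f)\<^sup>2) + M\<^sup>2 * (L2_norm f)\<^sup>2 / (4 * \<nu>\<^sup>2) * 0\<^sup>2"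
      by (rule tendsto_add[OF tendsto_diff[OF tendsto_const p1] p2])
    moreover have "((L2_norm f)\<^sup>2 - (\<Sum>l\<in>modes m. (ip f (hart l))\<^sup>2)) + M\<^sup>2 * (L2_norm f)\<^sup>2 / (4 * \<nu>\<^sup>2) * (inverse (real m))\<^sup>2 = del M m" for m
      by (simp add: del_def field_simps power2_eq_square)
    ultimately have "(\<lambda>m. del M m) \<longlonglongrightarrow> 0" by simp
    then show ?thesis using tendsto_real_sqrt by fastforce
  qed
  have cauchy: "L2_norm (\<lambda>x. A n t x - A m t x) \<le> sqrt (del M m)"
    if "t \<in> ?I" "\<And>r. r \<in> {0..t} \<Longrightarrow> tame M (v r)" "m \<le> n" "m > 0" for t m n M
    using galerkin_cauchy[OF v s(1) nu that(3,4) sf X X that(1,2)]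
    unfolding A_def del_def by (intro real_le_rsqrt)
  have "\<exists>g. g \<in> L2 \<and> (\<lambda>n. L2_norm (\<lambda>x. A n t x - g x)) \<longlonglongrightarrow> 0" if t: "t \<in> ?I" for t
  proof -
    obtain M where M: "\<And>r. r \<in> {0..t} \<Longrightarrow> tame M (v r)" using time_interval_nice[OF v s(1) t] by blast
    have "\<exists>N. \<forall>m\<ge>N. \<forall>n\<ge>N. L2_norm (\<lambda>x. A m t x - A n t x) \<le> e" if "e > 0" for e
    proof -
      have "\<forall>\<^sub>F m in sequentially. sqrt (del M m) < e \<and> m > 0"
        using order_tendstoD(2)[OF lim that] eventually_gt_at_top[of 0] by (rule eventually_conj)
      then obtain N where N: "\<And>m. m \<ge> N \<Longrightarrow> sqrt (del M m) < e" "\<And>m. m \<ge> N \<Longrightarrow> m > 0"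
        unfolding eventually_sequentially by blast
      have "L2_norm (\<lambda>x. A m t x - A n t x) \<le> e" if mn: "m \<ge> N" "n \<ge> N" for m n
      proof (cases "m \<le> n")
        case True
        then show ?thesis using cauchy[OF t M True N(2)[OF mn(1)]] N(1)[OF mn(1)]
          by (simp add: L2_norm_minus_commute[of "A m t"])
      next
        case False
        then show ?thesis using cauchy[OF t M _ N(2)[OF mn(2)], of m] N(1)[OF mn(2)] by simp
      qed
      then show ?thesis by blast
    qed
    from L2_complete[OF LA this] show ?thesis by blast
  qed
  then obtain \<theta> where \<theta>: "\<And>t. t \<in> ?I \<Longrightarrow> \<theta> t \<in> L2"
    "\<And>t. t \<in> ?I \<Longrightarrow> (\<lambda>n. L2_norm (\<lambda>x. A n t x - \<theta> t x)) \<longlonglongrightarrow> 0" by metis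
  note s\<theta> = L2_sqi[OF \<theta>(1)]
  have sub: "{s..T} \<subseteq> ?I" if "T \<in> ?I" for T
    using that by (auto simp: time_interval_def intro: le_less_trans[of "ereal _" "ereal T"])
  \<comment> \<open>The Cauchy bound is uniform in \<open>n\<close>, so it survives the limit in
    \<open>n\<close>.\<close>
  have unif: "L2_norm (\<lambda>x. A m t x - \<theta> t x) \<le> sqrt (del M m)"
    if t: "t \<in> ?I" and M: "\<And>r. r \<in> {0..t} \<Longrightarrow> tame M (v r)" and m: "m > 0" for t m M
  proof (rule LIMSEQ_le_const)
    have "(\<lambda>n. L2_norm (\<lambda>x. A n t x - \<theta> t x) + sqrt (del M m)) \<longlonglongrightarrow> 0 + sqrt (del M m)"
      by (intro tendsto_add \<theta>(2)[OF t] tendsto_const)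
    then show "(\<lambda>n. L2_norm (\<lambda>x. A n t x - \<theta> t x) + sqrt (del M m)) \<longlonglongrightarrow> sqrt (del M m)" by simp
    have "L2_norm (\<lambda>x. A m t x - \<theta> t x) \<le> L2_norm (\<lambda>x. A n t x - \<theta> t x) + sqrt (del M m)" if "n \<ge> m" for n
      using L2_norm_triangle_diff[OF sA[of m t] sA[of n t] s\<theta>[OF t]] cauchy[OF t M that m]
      by (simp add: L2_norm_minus_commute[of "A m t"])
    then show "\<exists>N. \<forall>n\<ge>N. L2_norm (\<lambda>x. A m t x - \<theta> t x) \<le> L2_norm (\<lambda>x. A n t x - \<theta> t x) + sqrt (del M m)" by blast
  qed
  have cA: "curve {s..T} (A n)" if "T \<in> ?I" for T n
    unfolding A_def[abs_def] by (rule galerkin_curve[OF X that])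
  have curveT: "curve {s..T} \<theta>" if T: "T \<in> ?I" for T
  proof -
    obtain M where M: "\<And>r. r \<in> {0..T} \<Longrightarrow> tame M (v r)" using time_interval_nice[OF v s(1) T] by blast
    have un: "L2_norm (\<lambda>x. A m t x - \<theta> t x) \<le> sqrt (del M m)" if "t \<in> {s..T}" "m > 0" for t m
      using that sub[OF T] M by (intro unif) auto
    show ?thesis
      unfolding curve_def
    proof (intro ballI conjI)
      fix t assume t: "t \<in> {s..T}"
      then have tI: "t \<in> ?I" using sub[OF T] by blast
      then show "\<theta> t \<in> L2" by (rule \<theta>)
      show "((\<lambda>r. L2_norm (\<lambda>x. \<theta> r x - \<theta> t x)) \<longlongrightarrow> 0) (at t within {s..T})"
      proof (rule tendstoI)
        fix e :: real assume e: "e > 0"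
        have "\<forall>\<^sub>F m in sequentially. sqrt (del M m) < e/3 \<and> m > 0"
          using e by (intro eventually_conj order_tendstoD(2)[OF lim] eventually_gt_at_top) auto
        then obtain m where m: "sqrt (del M m) < e/3" "m > 0"
          unfolding eventually_sequentially by blast
        have "((\<lambda>r. L2_norm (\<lambda>x. A m r x - A m t x)) \<longlongrightarrow> 0) (at t within {s..T})"
          using cA[OF T, of m] t unfolding curve_def by blast
        then have "\<forall>\<^sub>F r in at t within {s..T}. L2_norm (\<lambda>x. A m r x - A m t x) < e/3"
          using e by (intro order_tendstoD(2)) auto
        with eventually_at_within_mem
        show "\<forall>\<^sub>F r in at t within {s..T}. dist (L2_norm (\<lambda>x. \<theta> r x - \<theta> t x)) 0 < e"
        proof eventually_elim
          case (elim r)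
          have rI: "r \<in> ?I" using elim sub[OF T] by blast
          have "L2_norm (\<lambda>x. \<theta> r x - \<theta> t x) \<le> L2_norm (\<lambda>x. \<theta> r x - A m r x) + L2_norm (\<lambda>x. A m r x - \<theta> t x)"
            by (rule L2_norm_triangle_diff[OF s\<theta>[OF rI] sA s\<theta>[OF tI]])
          also have "L2_norm (\<lambda>x. A m r x - \<theta> t x) \<le> L2_norm (\<lambda>x. A m r x - A m t x) + L2_norm (\<lambda>x. A m t x - \<theta> t x)"
            by (rule L2_norm_triangle_diff[OF sA sA s\<theta>[OF tI]])
          also have "L2_norm (\<lambda>x. \<theta> r x - A m r x) = L2_norm (\<lambda>x. A m r x - \<theta> r x)"
            by (rule L2_norm_minus_commute)
          finally show ?case using un[OF elim(1) m(2)] un[OF t m(2)] elim(2) m(1) by simp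
        qed
      qed
    qed
  qed
  have curveI: "curve ?I \<theta>"
    unfolding curve_def
  proof (intro ballI conjI)
    fix t assume t: "t \<in> ?I"
    then show "\<theta> t \<in> L2" by (rule \<theta>)
    have "ereal t < T'" using t by (simp add: time_interval_def)
    \<comment> \<open>A compact interval reaching beyond \<open>t\<close> determines the same filter
      at \<open>t\<close> as the whole time interval, so uniform convergence on compact intervals
      suffices.\<close>
    then obtain T where T: "t < T" "ereal T < T'" using ereal_dense2[of "ereal t" T'] by auto
    then have TI: "T \<in> ?I" using t by (simp add: time_interval_def)
    have "at t within ?I = at t within {s..T}"
    proof (rule at_within_nhd)
      show "?I \<inter> {..<T} - {t} = {s..T} \<inter> {..<T} - {t}"
        using sub[OF TI] by (auto simp: time_interval_def)
    qed (use T in auto)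
    moreover have "t \<in> {s..T}" using t T by (simp add: time_interval_def)
    ultimately show "((\<lambda>r. L2_norm (\<lambda>x. \<theta> r x - \<theta> t x)) \<longlongrightarrow> 0) (at t within ?I)"
      using curveT[OF TI] unfolding curve_def by simp
  qed
  have eq: "ip (\<theta> t) (hart l) = ip (\<theta> r) (hart l) + integral {r..t} (rate \<nu> v \<theta> l)"
    if r: "r \<in> ?I" and t: "t \<in> ?I" and rt: "r \<le> t" for l r t
  proof -
    obtain M where M0: "0 \<le> M" and M: "\<And>r. r \<in> {0..t} \<Longrightarrow> tame M (v r)"
      using time_interval_nice[OF v s(1) t] by blast
    have sr: "s \<le> r" using r by (simp add: time_interval_def)
    have tT: "ereal t < T'" using t by (simp add: time_interval_def)
    have rsub: "{r..t} \<subseteq> {s..t}" using sr by auto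
    have bmA: "bm r t (rate \<nu> v (A n) l)" for n
      using s(1) sr by (intro rate_bm[OF v _ _ tT] curve_subset[OF cA[OF t] rsub]) simp
    have bm\<theta>: "bm r t (rate \<nu> v \<theta> l)"
      using s(1) sr by (intro rate_bm[OF v _ _ tT] curve_subset[OF curveT[OF t] rsub]) simp
    have "uniform_limit {r..t} (\<lambda>n. rate \<nu> v (A n) l) (rate \<nu> v \<theta> l) sequentially"
    proof (rule uniform_limitI)
      fix e :: real assume e: "e > 0"
      \<comment> \<open>Lipschitz constant of the rate in the L2 norm, enlarged by 1 to be
        positive.\<close>
      define C where "C = M * sqrt (lam l) + \<nu> * lam l + 1"
      have C: "C > 0" unfolding C_def using M0 nu by (intro add_nonneg_pos add_nonneg_nonneg mult_nonneg_nonneg) auto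
      have "\<forall>\<^sub>F n in sequentially. sqrt (del M n) < e / C"
        using e C by (intro order_tendstoD(2)[OF lim]) auto
      with eventually_gt_at_top[of 0]
      show "\<forall>\<^sub>F n in sequentially. \<forall>q\<in>{r..t}. dist (rate \<nu> v (A n) l q) (rate \<nu> v \<theta> l q) < e"
      proof eventually_elim
        case (elim n)
        show ?case
        proof
          fix q assume q: "q \<in> {r..t}"
          then have qI: "q \<in> ?I" using rsub sub[OF t] by blast
          have w: "tame M (v q)" using q M s(1) sr by simp
          let ?d = "\<lambda>x. A n q x - \<theta> q x"
          have sd: "sqi ?d" by (intro sqi_diff sA s\<theta> qI)
          have "rate \<nu> v (A n) l q - rate \<nu> v \<theta> l q = drift (v q) ?d l - \<nu> * lam l * ip ?d (hart l)"
            unfolding rate_def drift_diff[OF w sA s\<theta>[OF qI]] ip_diff_left[OF sA s\<theta>[OF qI] sqi_hart]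
            by (simp add: algebra_simps)
          also have "\<bar>\<dots>\<bar> \<le> \<bar>drift (v q) ?d l\<bar> + \<nu> * lam l * \<bar>ip ?d (hart l)\<bar>"
            using nu by (simp add: abs_mult abs_triangle_ineq4[THEN order_trans])
          also have "\<dots> \<le> M * L2_norm ?d * sqrt (lam l) + \<nu> * lam l * (L2_norm ?d * 1)"
          proof (intro add_mono mult_left_mono drift_bound1[OF w sd])
            show "\<bar>ip ?d (hart l)\<bar> \<le> L2_norm ?d * 1"
              using Cauchy_Schwarz_ip[OF sd sqi_hart, of l] by (simp add: L2_norm_ip[of "hart l"] hart_orthonormal)
          qed (use nu in simp)
          also have "\<dots> = (M * sqrt (lam l) + \<nu> * lam l) * L2_norm ?d" by (simp add: algebra_simps)
          also have "\<dots> \<le> C * L2_norm ?d" by (intro mult_right_mono) (simp_all add: C_def)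
          also have "\<dots> \<le> C * sqrt (del M n)"
            using C q M by (intro mult_left_mono unif[OF qI _ elim(1)]) auto
          also have "\<dots> < e" using elim(2) C by (simp add: field_simps)
          finally show "dist (rate \<nu> v (A n) l q) (rate \<nu> v \<theta> l q) < e" by (simp add: dist_real_def)
        qed
      qed
    qed
    from integral_uniform_limit_bm[OF this bmA bm\<theta>]
    have lim1: "(\<lambda>n. integral {r..t} (rate \<nu> v (A n) l)) \<longlonglongrightarrow> integral {r..t} (rate \<nu> v \<theta> l)" .
    have lim2: "(\<lambda>n. ip (A n q) (hart l)) \<longlonglongrightarrow> ip (\<theta> q) (hart l)" if "q \<in> ?I" for q
      by (rule ip_tendsto[OF \<theta>(2)[OF that] sA s\<theta>[OF that] sqi_hart])
    obtain n0 where n0: "{l} \<subseteq> modes n0" using finite_subset_modes[of "{l}"] by blast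
    have "ip (A n t) (hart l) = ip (A n r) (hart l) + integral {r..t} (rate \<nu> v (A n) l)" if n: "n \<ge> n0" for n
    proof -
      have l: "l \<in> modes n" using n0 modes_mono[OF n] by blast
      have ipA: "ip (A n q) (hart l) = X n q l" for q unfolding A_def using l by (simp add: ip_comb_hart)
      have rate: "rate \<nu> v (A n) l = (\<lambda>q. drift (v q) (comb (modes n) (X n q)) l - \<nu> * lam l * X n q l)"
        unfolding rate_def ipA by (simp add: A_def)
      show ?thesis
        unfolding ipA rate
        using galerkin_eq[OF X t l] galerkin_eq[OF X r l] integral_diff_bm[OF galerkin_bm[OF v s(1) X t, of n l], of r t] sr rt by simp
    qed
    then have ev: "\<forall>\<^sub>F n in sequentially. ip (A n r) (hart l) + integral {r..t} (rate \<nu> v (A n) l) = ip (A n t) (hart l)"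
      unfolding eventually_sequentially by metis
    have "(\<lambda>n. ip (A n r) (hart l) + integral {r..t} (rate \<nu> v (A n) l)) \<longlonglongrightarrow> ip (\<theta> r) (hart l) + integral {r..t} (rate \<nu> v \<theta> l)"
      by (intro tendsto_add lim1 lim2 r)
    then have "(\<lambda>n. ip (A n t) (hart l)) \<longlonglongrightarrow> ip (\<theta> r) (hart l) + integral {r..t} (rate \<nu> v \<theta> l)"
      by (rule Lim_transform_eventually[OF _ ev])
    with lim2[OF t] show ?thesis by (rule LIMSEQ_unique)
  qed
  have "L2_norm (\<lambda>x. \<theta> s x - f x) = 0"
  proof (rule LIMSEQ_unique)
    have sI: "s \<in> ?I" using s by (simp add: time_interval_def)
    have As: "A n s = proj n f" for n
      unfolding A_def comb_def using galerkin_start(1)[OF X sI] by (auto intro!: sum.cong)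
    show "(\<lambda>n. L2_norm (\<lambda>x. \<theta> s x - f x)) \<longlonglongrightarrow> L2_norm (\<lambda>x. \<theta> s x - f x)" by simp
    show "(\<lambda>n. L2_norm (\<lambda>x. \<theta> s x - f x)) \<longlonglongrightarrow> 0"
    proof (rule Lim_null_comparison)
      show "(\<lambda>n. L2_norm (\<lambda>x. A n s x - \<theta> s x) + L2_norm (\<lambda>x. f x - proj n f x)) \<longlonglongrightarrow> 0"
        by (rule tendsto_add_zero[OF \<theta>(2)[OF sI] proj_tendsto[OF f]])
      have "L2_norm (\<lambda>x. \<theta> s x - f x) \<le> L2_norm (\<lambda>x. A n s x - \<theta> s x) + L2_norm (\<lambda>x. f x - proj n f x)" for n
        using L2_norm_triangle_diff[OF s\<theta>[OF sI] sA[of n s] sf]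
        unfolding L2_norm_minus_commute[of "\<theta> s" "A n s"] L2_norm_minus_commute[of "A n s" f] unfolding As .
      then show "\<forall>\<^sub>F n in sequentially. norm (L2_norm (\<lambda>x. \<theta> s x - f x))
          \<le> L2_norm (\<lambda>x. A n s x - \<theta> s x) + L2_norm (\<lambda>x. f x - proj n f x)" by simp
    qed
  qed
  moreover have "fsol \<nu> v ?I \<theta>" unfolding fsol_def using curveI eq by blast
  ultimately show ?thesis by blast
qed

subsection \<open>Smooth functions on space-time\<close>

definition psmooth :: "(real \<times> (real^'n) \<Rightarrow> real) \<Rightarrow> bool" where
  "psmooth \<phi> \<longleftrightarrow> smooth \<phi> \<and> (\<forall>t. periodic (\<lambda>x. \<phi> (t, x)))"

lemma psmooth_dir_deriv:
  assumes "psmooth \<phi>" "b \<in> Basis"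
  shows "psmooth (dir_deriv b \<phi>)"
  unfolding psmooth_def
proof (intro conjI allI)
  have sm: "smooth \<phi>" using assms by (simp add: psmooth_def)
  show "smooth (dir_deriv b \<phi>)" using sm assms(2) by (rule smooth_dir_deriv)
  show "periodic (\<lambda>x. dir_deriv b \<phi> (t, x))" for t
    unfolding periodic_def
  proof (intro allI)
    fix x i
    let ?h = "(0, axis i 1) :: real \<times> (real^'a)"
    have "\<phi> (p + ?h) = \<phi> p" for p
      using assms(1) by (cases p) (auto simp: psmooth_def periodic_def)
    then have eq: "(\<lambda>p. \<phi> (p + ?h)) = \<phi>" by auto
    have "((\<lambda>p. p + ?h) has_derivative (\<lambda>d. d)) (at (t, x))"
      by (auto intro!: derivative_eq_intros)
    from has_derivative_compose[OF this smooth_has_derivative[OF sm]]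
    have "(\<phi> has_derivative frechet_derivative \<phi> (at (t, x + axis i 1))) (at (t, x))"
      by (simp add: eq)
    then show "dir_deriv b \<phi> (t, x + axis i 1) = dir_deriv b \<phi> (t, x)"
      using frechet_derivative_at by metis
  qed
qed

lemma psmooth_continuous: "psmooth \<phi> \<Longrightarrow> continuous_on S \<phi>"
  by (simp add: psmooth_def smooth_continuous)

lemma psmooth_slice_continuous: "psmooth \<phi> \<Longrightarrow> continuous_on S (\<lambda>x. \<phi> (t, x))"
  by (intro continuous_on_compose2[OF psmooth_continuous[of \<phi> UNIV]] continuous_intros) auto

lemma psmooth_bound:
  assumes "psmooth \<phi>"
  obtains C where "\<And>t x. t \<in> {a..b} \<Longrightarrow> x \<in> cbox 0 1 \<Longrightarrow> \<bar>\<phi> (t, x)\<bar> \<le> C" "0 \<le> C"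
proof -
  have "compact (\<phi> ` ({a..b} \<times> cbox 0 1))"
    by (intro compact_continuous_image psmooth_continuous assms compact_Times compact_Icc compact_cbox)
  then have "bounded (\<phi> ` ({a..b} \<times> cbox 0 1))" by (rule compact_imp_bounded)
  then obtain C where C: "\<forall>y\<in>\<phi> ` ({a..b} \<times> cbox 0 1). norm y \<le> C"
    unfolding bounded_iff ..
  have "\<bar>\<phi> (t, x)\<bar> \<le> max C 0" if "t \<in> {a..b}" "x \<in> cbox 0 1" for t x
  proof -
    have "norm (\<phi> (t, x)) \<le> C" by (rule bspec[OF C], rule imageI) (use that in simp)
    then show ?thesis by simp
  qed
  then show thesis by (rule that[of "max C 0"]) (assumption | rule max.cobounded2)+
qed

lemma continuous_periodic_L2:
  assumes c: "continuous_on UNIV f" and p: "periodic f"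
  shows "f \<in> L2"
proof -
  have "bounded (f ` cbox 0 1)"
    by (rule compact_imp_bounded[OF compact_continuous_image[OF continuous_on_subset[OF c]]]) auto
  then obtain C where C: "\<forall>y\<in>f ` cbox 0 1. norm y \<le> C"
    unfolding bounded_iff ..
  have "sqi f"
    using C by (intro sqi_bounded[OF continuous_on_UNIV_measurable_torus[OF c], of C]) auto
  moreover have "f \<in> borel_measurable lebesgue"
    by (intro borel_measurable_subalgebra[of borel lebesgue] borel_measurable_continuous_onI c)
      (auto simp: sets_completionI_sub)
  ultimately show ?thesis using p by (simp add: L2_def sqi_def)
qed

lemma psmooth_L2: "psmooth \<phi> \<Longrightarrow> (\<lambda>x. \<phi> (t, x)) \<in> L2"
  by (intro continuous_periodic_L2 psmooth_slice_continuous) (simp_all add: psmooth_def)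

lemma psmooth_norm_bound:
  assumes "psmooth \<phi>"
  obtains C where "\<And>t. t \<in> {a..b} \<Longrightarrow> L2_norm (\<lambda>x. \<phi> (t, x)) \<le> C" "0 \<le> C"
proof -
  obtain C where C: "\<And>t x. t \<in> {a..b} \<Longrightarrow> x \<in> cbox 0 1 \<Longrightarrow> \<bar>\<phi> (t, x)\<bar> \<le> C" "0 \<le> C"
    using psmooth_bound[OF assms, of a b] by blast
  have "L2_norm (\<lambda>x. \<phi> (t, x)) \<le> C" if "t \<in> {a..b}" for t
    using C(1)[OF that] C(2)
    by (intro L2_norm_bounded continuous_on_UNIV_measurable_torus psmooth_slice_continuous assms) auto
  then show thesis using C(2) by (rule that)
qed

lemma psmooth_slice_derivative:
  assumes "psmooth \<phi>"
  shows "((\<lambda>x. \<phi> (t, x)) has_derivative (\<lambda>w. dir_deriv (0, w) \<phi> (t, x))) (at x)"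
proof -
  have "((\<lambda>x. (t, x)) has_derivative (\<lambda>w. (0, w))) (at x)"
    by (auto intro!: derivative_eq_intros)
  from has_derivative_compose[OF this smooth_has_derivative] assms show ?thesis
    by (simp add: psmooth_def)
qed

lemma Basis_snd: "e \<in> Basis \<Longrightarrow> (0, e) \<in> Basis"
  by (simp add: Basis_prod_def)

text \<open>Integration by parts against \<open>hart (- k)\<close>: the minus sign it produces
  cancels the one in the gradient of that mode.\<close>

lemma ip_partial:
  fixes \<phi> :: "real \<times> (real^'n) \<Rightarrow> real"
  assumes ps: "psmooth \<phi>" and e: "e \<in> Basis"
  shows "ip (\<lambda>x. dir_deriv (0, e) \<phi> (t, x)) (hart (- k)) = 2 * pi * (freq k \<bullet> e) * ip (\<lambda>x. \<phi> (t, x)) (hart k)"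
proof -
  obtain j where j: "e = axis j 1" using e by (auto simp: Basis_vec_def)
  let ?f = "\<lambda>x. \<phi> (t, x)" and ?d = "\<lambda>x. dir_deriv (0, e) \<phi> (t, x)"
  let ?D = "\<lambda>x w. ?f x * (2 * pi * (freq (- k) \<bullet> w) * hart (- (- k)) x) + dir_deriv (0, w) \<phi> (t, x) * hart (- k) x"
  have d: "((\<lambda>x. ?f x * hart (- k) x) has_derivative ?D x) (at x)" for x
    by (intro has_derivative_mult psmooth_slice_derivative[OF ps] hart_has_derivative)
  have pd: "psmooth (dir_deriv (0, e) \<phi>)" by (intro psmooth_dir_deriv ps Basis_snd e)
  have "periodic (\<lambda>x. ?f x * hart (- k) x)"
    using ps periodic_hart[of "- k"] by (simp add: psmooth_def periodic_def)
  moreover have "continuous_on UNIV (\<lambda>x. ?D x (axis j 1))"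
    unfolding j[symmetric] by (intro continuous_intros psmooth_slice_continuous ps pd)
  ultimately have "(LINT x|torus. ?D x e) = 0"
    unfolding j by (intro torus_integral_partial_eq_0[OF _ d])
  moreover have "(LINT x|torus. ?D x e) = (- (2 * pi * (freq k \<bullet> e))) * ip ?f (hart k) + ip ?d (hart (- k))"
  proof -
    have "integrable torus (\<lambda>x. ?f x * hart k x)" "integrable torus (\<lambda>x. ?d x * hart (- k) x)"
      by (intro sqi_mult_integrable L2_sqi psmooth_L2 ps pd sqi_hart)+
    then have "(LINT x|torus. (- (2 * pi * (freq k \<bullet> e))) * (?f x * hart k x) + ?d x * hart (- k) x)
        = (- (2 * pi * (freq k \<bullet> e))) * ip ?f (hart k) + ip ?d (hart (- k))"
      unfolding ip_def by (subst Bochner_Integration.integral_add) auto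
    then show ?thesis by (simp add: algebra_simps)
  qed
  ultimately show ?thesis by simp
qed

lemma psmooth_add: "psmooth f \<Longrightarrow> psmooth g \<Longrightarrow> psmooth (\<lambda>p. f p + g p)"
  by (auto simp: psmooth_def periodic_def intro: smooth_add)

lemma psmooth_sum: "finite I \<Longrightarrow> (\<And>i. i \<in> I \<Longrightarrow> psmooth (f i)) \<Longrightarrow> psmooth (\<lambda>p. \<Sum>i\<in>I. f i p)"
proof (induction I rule: finite_induct)
  case empty
  show ?case by (simp add: psmooth_def periodic_def smooth_const)
next
  case (insert i I)
  then show ?case using psmooth_add[of "f i" "\<lambda>p. \<Sum>i\<in>I. f i p"] by simp
qed

lemma psmooth_laplacian: "psmooth \<phi> \<Longrightarrow> psmooth (laplacian_x \<phi>)"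
  unfolding laplacian_x_def[abs_def] by (intro psmooth_sum psmooth_dir_deriv Basis_snd finite_Basis)

text \<open>Two integrations by parts, from \<open>k\<close> to \<open>- k\<close> and back; the
  second one contributes the minus sign.\<close>

lemma ip_laplacian:
  assumes ps: "psmooth \<phi>"
  shows "ip (\<lambda>x. laplacian_x \<phi> (t, x)) (hart k) = - lam k * ip (\<lambda>x. \<phi> (t, x)) (hart k)"
proof -
  let ?c = "ip (\<lambda>x. \<phi> (t, x)) (hart k)"
  have pd: "psmooth (dir_deriv (0, e) \<phi>)" if "e \<in> Basis" for e by (intro psmooth_dir_deriv ps Basis_snd that)
  have "ip (\<lambda>x. laplacian_x \<phi> (t, x)) (hart k) = (\<Sum>e\<in>Basis. ip (\<lambda>x. dir_deriv (0, e) (dir_deriv (0, e) \<phi>) (t, x)) (hart k))"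
    unfolding laplacian_x_def by (intro ip_sum_left L2_sqi psmooth_L2 psmooth_dir_deriv pd Basis_snd sqi_hart)
  also have "\<dots> = (\<Sum>e\<in>Basis. - (4 * pi\<^sup>2) * ?c * ((freq k \<bullet> e) * (freq k \<bullet> e)))"
  proof (rule sum.cong[OF refl])
    fix e :: "real^'a" assume e: "e \<in> Basis"
    show "ip (\<lambda>x. dir_deriv (0, e) (dir_deriv (0, e) \<phi>) (t, x)) (hart k) = - (4 * pi\<^sup>2) * ?c * ((freq k \<bullet> e) * (freq k \<bullet> e))"
      using ip_partial[OF pd[OF e] e, of t "- k"] ip_partial[OF ps e, of t k] by (simp add: power2_eq_square)
  qed
  also have "\<dots> = - lam k * ?c"
    unfolding sum_distrib_left[symmetric] euclidean_inner[symmetric] lam_def by simp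
  finally show ?thesis .
qed

text \<open>Puts the coefficients of a test function in the integrated form that
  \<open>product_rule\<close> takes as input.\<close>

lemma ip_time_integral:
  fixes \<phi> :: "real \<times> (real^'n) \<Rightarrow> real"
  assumes ps: "psmooth \<phi>" and ab: "a \<le> b"
  shows "ip (\<lambda>x. \<phi> (b, x)) (hart l) = ip (\<lambda>x. \<phi> (a, x)) (hart l)
      + integral {a..b} (\<lambda>t. ip (\<lambda>x. dir_deriv (1, 0) \<phi> (t, x)) (hart l))"
    and "continuous_on {a..b} (\<lambda>t. ip (\<lambda>x. \<phi> (t, x)) (hart l))"
proof -
  have pd: "psmooth (dir_deriv (1, 0) \<phi>)" by (intro psmooth_dir_deriv ps) (simp add: Basis_prod_def)
  have HK: "ip (\<lambda>x. \<psi> (t, x)) (hart l) = integral (cbox 0 1) (\<lambda>x. \<psi> (t, x) * hart l x)" if "psmooth \<psi>" for \<psi> t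
    unfolding ip_def by (intro torus_integral_HK sqi_mult_integrable L2_sqi psmooth_L2 that sqi_hart)
  have D: "((\<lambda>t. ip (\<lambda>x. \<phi> (t, x)) (hart l)) has_field_derivative ip (\<lambda>x. dir_deriv (1, 0) \<phi> (t0, x)) (hart l)) (at t0 within {a..b})"
    if "t0 \<in> {a..b}" for t0
    unfolding HK[OF ps] HK[OF pd]
  proof (rule leibniz_rule_field_derivative)
    fix t and x :: "real^'n"
    have "((\<lambda>t. (t, x)) has_derivative (\<lambda>h. h *\<^sub>R (1, 0))) (at t within {a..b})"
      by (auto intro!: derivative_eq_intros)
    moreover have "(\<phi> has_derivative frechet_derivative \<phi> (at (t, x))) (at (t, x))"
      using ps by (intro smooth_has_derivative) (simp add: psmooth_def)
    ultimately have "((\<lambda>t. \<phi> (t, x)) has_derivative (\<lambda>h. frechet_derivative \<phi> (at (t, x)) (h *\<^sub>R (1, 0)))) (at t within {a..b})"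
      by (rule has_derivative_compose)
    moreover have "frechet_derivative \<phi> (at (t, x)) (h *\<^sub>R (1, 0)) = dir_deriv (1, 0) \<phi> (t, x) * h" for h
    proof -
      have lin: "linear (frechet_derivative \<phi> (at (t, x)))"
        using ps by (intro has_derivative_linear[OF smooth_has_derivative]) (simp add: psmooth_def)
      show ?thesis unfolding linear_cmul[OF lin] by (simp add: mult.commute)
    qed
    then have "(\<lambda>h. frechet_derivative \<phi> (at (t, x)) (h *\<^sub>R (1, 0))) = (*) (dir_deriv (1, 0) \<phi> (t, x))"
      by (rule ext)
    ultimately have "((\<lambda>t. \<phi> (t, x)) has_field_derivative dir_deriv (1, 0) \<phi> (t, x)) (at t within {a..b})"
      unfolding has_field_derivative_def by (simp only:)
    then show "((\<lambda>t. \<phi> (t, x) * hart l x) has_field_derivative dir_deriv (1, 0) \<phi> (t, x) * hart l x) (at t within {a..b})"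
      by (rule DERIV_cmult_right)
  next
    fix t show "(\<lambda>x. \<phi> (t, x) * hart l x) integrable_on cbox 0 1"
      by (rule integrable_continuous[OF continuous_on_mult[OF psmooth_slice_continuous[OF ps] continuous_on_hart]])
  next
    show "continuous_on ({a..b} \<times> cbox 0 1) (\<lambda>(t, x). dir_deriv (1, 0) \<phi> (t, x) * hart l x)"
    proof -
      have "continuous_on ({a..b} \<times> cbox 0 1) (\<lambda>p. hart l (snd p))"
        by (rule continuous_on_compose2[OF continuous_on_hart[of UNIV] continuous_on_snd[OF continuous_on_id]]) simp
      from continuous_on_mult[OF psmooth_continuous[OF pd] this] show ?thesis
        by (simp add: split_beta)
    qed
  qed (use that in auto)
  then show "continuous_on {a..b} (\<lambda>t. ip (\<lambda>x. \<phi> (t, x)) (hart l))"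
    by (rule DERIV_continuous_on)
  have "((\<lambda>t. ip (\<lambda>x. dir_deriv (1, 0) \<phi> (t, x)) (hart l)) has_integral
      ip (\<lambda>x. \<phi> (b, x)) (hart l) - ip (\<lambda>x. \<phi> (a, x)) (hart l)) {a..b}"
    using D by (intro fundamental_theorem_of_calculus ab) (simp add: has_real_derivative_iff_has_vector_derivative)
  then show "ip (\<lambda>x. \<phi> (b, x)) (hart l) = ip (\<lambda>x. \<phi> (a, x)) (hart l)
      + integral {a..b} (\<lambda>t. ip (\<lambda>x. dir_deriv (1, 0) \<phi> (t, x)) (hart l))"
    by (simp add: integral_unique)
qed

lemma dir_deriv_space:
  assumes ps: "psmooth \<phi>"
  shows "dir_deriv (0, w) \<phi> (t, x) = (\<Sum>e\<in>Basis. (w \<bullet> e) * dir_deriv (0, e) \<phi> (t, x))"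
proof -
  have lin: "linear (\<lambda>w. dir_deriv (0, w) \<phi> (t, x))"
    by (rule has_derivative_linear[OF psmooth_slice_derivative[OF ps]])
  have "dir_deriv (0, w) \<phi> (t, x) = dir_deriv (0, \<Sum>e\<in>Basis. (w \<bullet> e) *\<^sub>R e) \<phi> (t, x)"
    by (simp add: euclidean_representation)
  also have "\<dots> = (\<Sum>e\<in>Basis. dir_deriv (0, (w \<bullet> e) *\<^sub>R e) \<phi> (t, x))"
    by (rule linear_sum[OF lin])
  also have "\<dots> = (\<Sum>e\<in>Basis. (w \<bullet> e) * dir_deriv (0, e) \<phi> (t, x))"
    by (intro sum.cong refl) (simp add: linear_cmul[OF lin])
  finally show ?thesis .
qed

text \<open>Projection commutes with partial derivatives because \<open>modes n\<close> is invariant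
  under negation.\<close>

lemma grad_proj:
  assumes ps: "psmooth \<phi>" and e: "e \<in> Basis"
  shows "grad (modes n) (\<lambda>k. ip (\<lambda>x. \<phi> (t, x)) (hart k)) x \<bullet> e = proj n (\<lambda>x. dir_deriv (0, e) \<phi> (t, x)) x"
proof -
  have "grad (modes n) (\<lambda>k. ip (\<lambda>x. \<phi> (t, x)) (hart k)) x \<bullet> e
      = (\<Sum>k\<in>modes n. ip (\<lambda>x. dir_deriv (0, e) \<phi> (t, x)) (hart (- k)) * hart (- k) x)"
    unfolding grad_def ip_partial[OF ps e] by (simp add: inner_sum_left ac_simps)
  also have "\<dots> = (\<Sum>k\<in>modes n. ip (\<lambda>x. dir_deriv (0, e) \<phi> (t, x)) (hart k) * hart k x)"
    by (rule sum.reindex_bij_witness[of _ uminus uminus]) auto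
  finally show ?thesis by (simp add: comb_def)
qed

subsection \<open>Weak solutions in Hartley coordinates\<close>

lemma time_interval_lebesgue [measurable]: "time_interval s T' \<in> sets lebesgue"
proof -
  have "{t \<in> space borel. s \<le> t \<and> ereal t < T'} \<in> sets borel" by measurable
  then show ?thesis by (simp add: time_interval_def sets_completionI_sub)
qed

lemma LINT_time_interval:
  fixes G :: "real \<Rightarrow> real"
  assumes sub: "{a..b} \<subseteq> time_interval s T'" and zero: "\<And>t. t \<in> time_interval s T' \<Longrightarrow> t \<notin> {a..b} \<Longrightarrow> G t = 0"
  shows "(LINT t|lebesgue_on (time_interval s T'). G t) = (LINT t|lebesgue_on {a..b}. G t)"
proof -
  have "(LINT t|lebesgue_on (time_interval s T'). G t) = (LINT t|lebesgue. indicator (time_interval s T') t *\<^sub>R G t)"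
    by (subst integral_restrict_space) (auto simp: set_lebesgue_integral_def)
  also have "\<dots> = (LINT t|lebesgue. indicator {a..b} t *\<^sub>R G t)"
    using sub zero by (intro Bochner_Integration.integral_cong refl) (auto simp: indicator_def)
  also have "\<dots> = (LINT t|lebesgue_on {a..b}. G t)"
    by (subst integral_restrict_space) (auto simp: set_lebesgue_integral_def)
  finally show ?thesis .
qed

lemma curve_iff_L2_tendsto:
  assumes "\<And>t. t \<in> I \<Longrightarrow> \<theta> t \<in> L2"
  shows "curve I \<theta> \<longleftrightarrow> (\<forall>t\<in>I. L2_tendsto \<theta> (\<theta> t) (at t within I))"
proof -
  have "\<forall>\<^sub>F s in at t within I. \<theta> s \<in> L2" for t
    using eventually_at_within_mem by eventually_elim (rule assms)
  then show ?thesis using assms unfolding curve_def L2_tendsto_def by blast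
qed

section \<open>From the coefficient equations to the weak formulation\<close>

text \<open>Collects the transport terms of all modes into projections of the partial derivatives of
  the test function, whose limit in \<open>n\<close> is given by
  \<open>ip_proj_tendsto\<close>.\<close>

lemma drift_sum_proj:
  assumes w: "tame M w" and f: "sqi f" and ps: "psmooth \<phi>"
  shows "(\<Sum>l\<in>modes n. ip (\<lambda>x. \<phi> (t, x)) (hart l) * drift w f l)
    = (\<Sum>e\<in>Basis. ip (\<lambda>x. (w x \<bullet> e) * f x) (proj n (\<lambda>x. dir_deriv (0, e) \<phi> (t, x))))"
proof -
  have wm: "w \<in> borel_measurable torus" and wM: "norm (w x) \<le> M" for x
    using w by (auto simp: tame_def)
  have sw: "sqi (\<lambda>x. (w x \<bullet> e) * f x)" if "e \<in> Basis" for e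
  proof (rule sqi_bmult[OF f])
    show "(\<lambda>x. w x \<bullet> e) \<in> borel_measurable torus" using wm by measurable
    show "\<bar>w x \<bullet> e\<bar> \<le> M" for x using Basis_le_norm[OF that, of "w x"] wM[of x] by linarith
  qed
  let ?g = "grad (modes n) (\<lambda>k. ip (\<lambda>x. \<phi> (t, x)) (hart k))"
  have "(\<Sum>l\<in>modes n. ip (\<lambda>x. \<phi> (t, x)) (hart l) * drift w f l) = (LINT x|torus. f x * (?g x \<bullet> w x))"
    unfolding sum_drift[OF w f] ip_def ..
  also have "\<dots> = (LINT x|torus. (\<Sum>e\<in>Basis. ((w x \<bullet> e) * f x) * proj n (\<lambda>x. dir_deriv (0, e) \<phi> (t, x)) x))"
  proof (intro Bochner_Integration.integral_cong refl)
    fix x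
    have "?g x \<bullet> w x = (\<Sum>e\<in>Basis. (?g x \<bullet> e) * (w x \<bullet> e))" by (rule euclidean_inner)
    also have "\<dots> = (\<Sum>e\<in>Basis. (w x \<bullet> e) * proj n (\<lambda>x. dir_deriv (0, e) \<phi> (t, x)) x)"
      by (intro sum.cong refl) (simp add: grad_proj[OF ps])
    finally show "f x * (?g x \<bullet> w x) = (\<Sum>e\<in>Basis. ((w x \<bullet> e) * f x) * proj n (\<lambda>x. dir_deriv (0, e) \<phi> (t, x)) x)"
      by (simp add: sum_distrib_left ac_simps)
  qed
  also have "\<dots> = (\<Sum>e\<in>Basis. ip (\<lambda>x. (w x \<bullet> e) * f x) (proj n (\<lambda>x. dir_deriv (0, e) \<phi> (t, x))))"
    unfolding ip_def
    by (rule Bochner_Integration.integral_sum) (intro sqi_mult_integrable sw sqi_comb)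
  finally show ?thesis .
qed

lemma ip_proj_tendsto:
  assumes f: "sqi f" and g: "g \<in> L2"
  shows "(\<lambda>n. ip f (proj n g)) \<longlonglongrightarrow> ip f g"
proof -
  have "(\<lambda>n. ip (proj n g) f) \<longlonglongrightarrow> ip g f"
    using proj_tendsto[OF g]
    by (intro ip_tendsto[OF _ sqi_comb L2_sqi[OF g] f]) (simp add: L2_norm_minus_commute[of g])
  then show ?thesis by (simp only: ip_commute[of f])
qed

lemma ip_proj_bound:
  assumes f: "sqi f" and g: "sqi g"
  shows "\<bar>ip f (proj n g)\<bar> \<le> L2_norm f * L2_norm g"
  using Cauchy_Schwarz_ip[OF f sqi_comb] L2_norm_proj_le[OF g, of n]
  by (meson L2_norm_nonneg mult_left_mono order_trans)

lemma L2_norm_bmult: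
  assumes f: "sqi f" and w: "w \<in> borel_measurable torus" "\<And>x. \<bar>w x\<bar> \<le> M" and M: "0 \<le> M"
  shows "L2_norm (\<lambda>x. w x * f x) \<le> M * L2_norm f"
proof -
  have "(LINT x|torus. (w x * f x)\<^sup>2) \<le> (LINT x|torus. M\<^sup>2 * (f x)\<^sup>2)"
  proof (rule integral_mono)
    show "integrable torus (\<lambda>x. (w x * f x)\<^sup>2)"
      using sqi_bmult[OF f w] by (simp add: sqi_def)
    show "integrable torus (\<lambda>x. M\<^sup>2 * (f x)\<^sup>2)" using f by (simp add: sqi_def)
    fix x
    have "(w x)\<^sup>2 \<le> M\<^sup>2" using w(2)[of x] M by (metis abs_ge_zero power2_abs power_mono)
    then show "(w x * f x)\<^sup>2 \<le> M\<^sup>2 * (f x)\<^sup>2" by (simp add: power_mult_distrib mult_right_mono)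
  qed
  also have "\<dots> = M\<^sup>2 * (LINT x|torus. (f x)\<^sup>2)" by simp
  finally show ?thesis
    unfolding L2_norm_def using M real_sqrt_le_mono by (fastforce simp: real_sqrt_mult)
qed

lemma weak_integrand:
  assumes w: "tame M w" and f: "sqi f" and ps: "psmooth \<phi>"
  shows "(LINT x|torus. f x * (dir_deriv (1, 0) \<phi> (t, x) + \<nu> * laplacian_x \<phi> (t, x) + dir_deriv (0, w x) \<phi> (t, x)))
    = ip f (\<lambda>x. dir_deriv (1, 0) \<phi> (t, x)) + \<nu> * ip f (\<lambda>x. laplacian_x \<phi> (t, x))
      + (\<Sum>e\<in>Basis. ip (\<lambda>x. (w x \<bullet> e) * f x) (\<lambda>x. dir_deriv (0, e) \<phi> (t, x)))"
proof -
  have wm: "w \<in> borel_measurable torus" and wM: "norm (w x) \<le> M" for x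
    using w by (auto simp: tame_def)
  have sw: "sqi (\<lambda>x. (w x \<bullet> e) * f x)" if "e \<in> Basis" for e
  proof (rule sqi_bmult[OF f])
    show "(\<lambda>x. w x \<bullet> e) \<in> borel_measurable torus" using wm by measurable
    show "\<bar>w x \<bullet> e\<bar> \<le> M" for x using Basis_le_norm[OF that, of "w x"] wM[of x] by linarith
  qed
  have b1: "(1, 0) \<in> (Basis :: (real \<times> (real^'a)) set)" by (simp add: Basis_prod_def)
  have i1: "integrable torus (\<lambda>x. f x * dir_deriv (1, 0) \<phi> (t, x))"
    by (intro sqi_mult_integrable f L2_sqi psmooth_L2 psmooth_dir_deriv ps b1)
  have i2: "integrable torus (\<lambda>x. f x * laplacian_x \<phi> (t, x))"
    by (intro sqi_mult_integrable f L2_sqi psmooth_L2 psmooth_laplacian ps)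
  have i3: "integrable torus (\<lambda>x. ((w x \<bullet> e) * f x) * dir_deriv (0, e) \<phi> (t, x))" if "e \<in> Basis" for e
    by (intro sqi_mult_integrable sw L2_sqi psmooth_L2 psmooth_dir_deriv ps Basis_snd that)
  have i4: "integrable torus (\<lambda>x. (\<Sum>e\<in>Basis. ((w x \<bullet> e) * f x) * dir_deriv (0, e) \<phi> (t, x)))"
    by (intro Bochner_Integration.integrable_sum i3)
  have pt: "f x * (dir_deriv (1, 0) \<phi> (t, x) + \<nu> * laplacian_x \<phi> (t, x) + dir_deriv (0, w x) \<phi> (t, x))
    = f x * dir_deriv (1, 0) \<phi> (t, x) + \<nu> * (f x * laplacian_x \<phi> (t, x))
        + (\<Sum>e\<in>Basis. ((w x \<bullet> e) * f x) * dir_deriv (0, e) \<phi> (t, x))" for x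
  proof -
    have "f x * dir_deriv (0, w x) \<phi> (t, x) = (\<Sum>e\<in>Basis. ((w x \<bullet> e) * f x) * dir_deriv (0, e) \<phi> (t, x))"
      by (subst dir_deriv_space[OF ps]) (simp add: sum_distrib_left mult_ac)
    then show ?thesis by (simp add: distrib_left mult.left_commute)
  qed
  have "(LINT x|torus. f x * (dir_deriv (1, 0) \<phi> (t, x) + \<nu> * laplacian_x \<phi> (t, x) + dir_deriv (0, w x) \<phi> (t, x)))
    = (LINT x|torus. f x * dir_deriv (1, 0) \<phi> (t, x)) + (LINT x|torus. \<nu> * (f x * laplacian_x \<phi> (t, x)))
      + (LINT x|torus. (\<Sum>e\<in>Basis. ((w x \<bullet> e) * f x) * dir_deriv (0, e) \<phi> (t, x)))"
    unfolding pt
    by (subst Bochner_Integration.integral_add[OF Bochner_Integration.integrable_add[OF i1 integrable_mult_right[OF i2]] i4],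
      subst Bochner_Integration.integral_add[OF i1 integrable_mult_right[OF i2]]) (rule refl)
  also have "\<dots> = (LINT x|torus. f x * dir_deriv (1, 0) \<phi> (t, x)) + \<nu> * (LINT x|torus. f x * laplacian_x \<phi> (t, x))
      + (\<Sum>e\<in>Basis. (LINT x|torus. ((w x \<bullet> e) * f x) * dir_deriv (0, e) \<phi> (t, x)))"
    by (subst Bochner_Integration.integral_sum[OF i3]) simp_all
  finally show ?thesis by (simp add: ip_def)
qed

text \<open>For the projected test function the integrand is a finite sum of derivatives of products
  of coefficients, so its integral is a boundary term and vanishes. The projection is then removed
  by dominated convergence in time.\<close>

lemma fsol_weak_form:
  fixes v :: "real \<Rightarrow> real^'n \<Rightarrow> real^'n"
  assumes v: "nice T' v" and s: "0 \<le> s" "ereal s < T'" and nu: "\<nu> > 0"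
    and sol: "fsol \<nu> v (time_interval s T') \<theta>" and tf: "test_function s T' \<phi>"
  shows "(LINT t|lebesgue_on (time_interval s T'). LINT x|torus.
           \<theta> t x * (dir_deriv (1, 0) \<phi> (t, x) + \<nu> * laplacian_x \<phi> (t, x)
                    + dir_deriv (0, v t x) \<phi> (t, x))) = 0"
proof -
  let ?I = "time_interval s T'"
  have ps: "psmooth \<phi>" using tf by (simp add: test_function_def psmooth_def)
  obtain a b where ab: "s < a" "ereal b < T'" and supp: "\<And>t x. t \<notin> {a..b} \<Longrightarrow> \<phi> (t, x) = 0"
    using tf unfolding test_function_def by blast
  obtain c0 where c0: "b < c0" "ereal c0 < T'" using ereal_dense2[OF ab(2)] by auto
  \<comment> \<open>The support may be empty with \<open>b\<close> below \<open>s\<close>; the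
    maximum keeps \<open>{s..c}\<close> nonempty.\<close>
  define c where "c = max c0 s"
  have c: "s \<le> c" "b < c" "ereal c < T'" using c0 s by (auto simp: c_def max_def)
  have sub: "{s..c} \<subseteq> ?I" using c by (auto simp: time_interval_def intro: le_less_trans[of "ereal _" "ereal c"])
  have sI: "s \<in> ?I" and cI: "c \<in> ?I" using sub c by auto
  have curve: "curve {s..c} \<theta>" by (rule curve_subset[OF fsol_curve[OF sol] sub])
  obtain M where M0: "0 \<le> M" and M: "\<And>r. r \<in> {0..c} \<Longrightarrow> tame M (v r)" using time_interval_nice[OF v s(1) cI] by blast
  have tm: "tame M (v t)" if "t \<in> {s..c}" for t using M that s by auto
  have sq: "sqi (\<theta> t)" if "t \<in> {s..c}" for t by (rule curve_sqi[OF curve that])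
  have b1: "(1, 0) \<in> (Basis :: (real \<times> (real^'n)) set)" by (simp add: Basis_prod_def)
  define p1 where "p1 = dir_deriv (1, 0) \<phi>"
  define pL where "pL = laplacian_x \<phi>"
  define pe where "pe e = dir_deriv (0, e) \<phi>" for e
  have ps1: "psmooth p1" and psL: "psmooth pL" and pse: "e \<in> Basis \<Longrightarrow> psmooth (pe e)" for e
    unfolding p1_def pL_def pe_def by (auto intro: psmooth_dir_deriv psmooth_laplacian ps b1 Basis_snd)
  define Y where "Y t = ip (\<theta> t) (\<lambda>x. p1 (t, x)) + \<nu> * ip (\<theta> t) (\<lambda>x. pL (t, x))
      + (\<Sum>e\<in>Basis. ip (\<lambda>x. (v t x \<bullet> e) * \<theta> t x) (\<lambda>x. pe e (t, x)))" for t
  define Yn where "Yn n t = ip (\<theta> t) (proj n (\<lambda>x. p1 (t, x))) + \<nu> * ip (\<theta> t) (proj n (\<lambda>x. pL (t, x)))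
      + (\<Sum>e\<in>Basis. ip (\<lambda>x. (v t x \<bullet> e) * \<theta> t x) (proj n (\<lambda>x. pe e (t, x))))" for n t
  let ?ph = "\<lambda>l t. ip (\<lambda>x. \<phi> (t, x)) (hart l)" and ?p1 = "\<lambda>l t. ip (\<lambda>x. p1 (t, x)) (hart l)"
  \<comment> \<open>Both end points lie outside the support, so the boundary terms of the product
    rule vanish.\<close>
  have zero: "\<phi> (t, x) = 0" if "t = s \<or> t = c" for t x using that ab c supp by auto
  have ph0: "?ph l s = 0" "?ph l c = 0" for l by (simp_all add: zero ip_def)
  have cont_ph: "continuous_on {s..c} (?ph l)" and cont_p1: "continuous_on {s..c} (?p1 l)" for l
    by (rule ip_time_integral(2)[OF ps c(1)], rule ip_time_integral(2)[OF ps1 c(1)])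
  note bms = bm_continuous[OF cont_p1] bm_continuous[OF cont_ph] rate_bm[OF v curve s(1) c(3)]
    bm_continuous[OF curve_ip_continuous[OF curve sqi_hart]]
  have Yn_eq: "Yn n t = (\<Sum>l\<in>modes n. ip (\<theta> t) (hart l) * ?p1 l t + rate \<nu> v \<theta> l t * ?ph l t)" if t: "t \<in> {s..c}" for n t
  proof -
    have 1: "ip (\<theta> t) (proj n (\<lambda>x. p1 (t, x))) = (\<Sum>l\<in>modes n. ?p1 l t * ip (\<theta> t) (hart l))"
      by (rule ip_comb_right[OF sq[OF t]])
    have 2: "ip (\<theta> t) (proj n (\<lambda>x. pL (t, x))) = (\<Sum>l\<in>modes n. - lam l * ?ph l t * ip (\<theta> t) (hart l))"
      unfolding ip_comb_right[OF sq[OF t]] pL_def ip_laplacian[OF ps] ..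
    have 3: "(\<Sum>e\<in>Basis. ip (\<lambda>x. (v t x \<bullet> e) * \<theta> t x) (proj n (\<lambda>x. pe e (t, x)))) = (\<Sum>l\<in>modes n. ?ph l t * drift (v t) (\<theta> t) l)"
      unfolding pe_def by (rule drift_sum_proj[OF tm[OF t] sq[OF t] ps, symmetric])
    show ?thesis unfolding Yn_def 1 2 3 rate_def sum_distrib_left sum.distrib[symmetric]
      by (intro sum.cong refl) (simp add: algebra_simps)
  qed
  have bmYn: "bm s c (\<lambda>t. \<Sum>l\<in>modes n. ip (\<theta> t) (hart l) * ?p1 l t + rate \<nu> v \<theta> l t * ?ph l t)" for n
    by (intro bm_sum bm_add bm_mult bms)
  have intYn: "Yn n integrable_on {s..c}" for n
    using integrable_cong[of "{s..c}" "Yn n" "\<lambda>t. \<Sum>l\<in>modes n. ip (\<theta> t) (hart l) * ?p1 l t + rate \<nu> v \<theta> l t * ?ph l t"]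
      Yn_eq bm_integrable[OF bmYn] by blast
  have zeroYn: "integral {s..c} (Yn n) = 0" for n
  proof -
    have "integral {s..c} (Yn n) = integral {s..c} (\<lambda>t. \<Sum>l\<in>modes n. ip (\<theta> t) (hart l) * ?p1 l t + rate \<nu> v \<theta> l t * ?ph l t)"
      by (rule integral_cong) (rule Yn_eq)
    also have "\<dots> = (\<Sum>l\<in>modes n. integral {s..c} (\<lambda>t. ip (\<theta> t) (hart l) * ?p1 l t + rate \<nu> v \<theta> l t * ?ph l t))"
      by (intro integral_sum finite_modes bm_integrable bm_add bm_mult bms)
    also have "\<dots> = (\<Sum>l\<in>modes n. ip (\<theta> c) (hart l) * ?ph l c - ip (\<theta> s) (hart l) * ?ph l s)"
    proof (intro sum.cong refl product_rule[OF c(1) bms(3) bms(1), symmetric])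
      fix l t assume t: "t \<in> {s..c}"
      then have "t \<in> ?I" using sub by blast
      then show "ip (\<theta> t) (hart l) = ip (\<theta> s) (hart l) + integral {s..t} (rate \<nu> v \<theta> l)"
        using t by (intro fsolD[OF sol sI]) auto
      show "?ph l t = ?ph l s + integral {s..t} (?p1 l)"
        unfolding p1_def using t by (intro ip_time_integral(1)[OF ps]) auto
    qed
    also have "\<dots> = 0" by (simp add: ph0)
    finally show ?thesis .
  qed
  obtain C where C: "\<And>t. t \<in> {s..c} \<Longrightarrow> \<bar>L2_norm (\<theta> t)\<bar> \<le> C" "0 \<le> C"
    using bm_bound[OF bm_continuous[OF curve_norm_continuous[OF curve]]] by blast
  obtain C1 where C1: "\<And>t. t \<in> {s..c} \<Longrightarrow> L2_norm (\<lambda>x. p1 (t, x)) \<le> C1" "0 \<le> C1"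
    using psmooth_norm_bound[OF ps1, of s c] by blast
  obtain CL where CL: "\<And>t. t \<in> {s..c} \<Longrightarrow> L2_norm (\<lambda>x. pL (t, x)) \<le> CL" "0 \<le> CL"
    using psmooth_norm_bound[OF psL, of s c] by blast
  have "\<forall>e\<in>Basis. \<exists>D. (\<forall>t\<in>{s..c}. L2_norm (\<lambda>x. pe e (t, x)) \<le> D) \<and> 0 \<le> D"
  proof
    fix e :: "real^'n" assume "e \<in> Basis"
    then show "\<exists>D. (\<forall>t\<in>{s..c}. L2_norm (\<lambda>x. pe e (t, x)) \<le> D) \<and> 0 \<le> D"
      by (rule psmooth_norm_bound[OF pse, of e s c]) blast
  qed
  then obtain D where D: "\<And>e t. e \<in> Basis \<Longrightarrow> t \<in> {s..c} \<Longrightarrow> L2_norm (\<lambda>x. pe e (t, x)) \<le> D e" "\<And>e. e \<in> Basis \<Longrightarrow> 0 \<le> D e"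
    by metis
  have wv: "(\<lambda>x. v t x \<bullet> e) \<in> borel_measurable torus" "\<bar>v t x \<bullet> e\<bar> \<le> M" if "t \<in> {s..c}" "e \<in> Basis" for t e x
  proof -
    have [measurable]: "v t \<in> borel_measurable torus" using tm[OF that(1)] by (simp add: tame_def)
    show "(\<lambda>x. v t x \<bullet> e) \<in> borel_measurable torus" by measurable
    show "\<bar>v t x \<bullet> e\<bar> \<le> M" using Basis_le_norm[OF that(2), of "v t x"] tm[OF that(1)] unfolding tame_def by (meson order_trans)
  qed
  have sw: "sqi (\<lambda>x. (v t x \<bullet> e) * \<theta> t x)" if "t \<in> {s..c}" "e \<in> Basis" for t e
    by (rule sqi_bmult[OF sq[OF that(1)] wv[OF that]])
  have slice: "sqi (\<lambda>x. \<psi> (t, x))" if "psmooth \<psi>" for \<psi> t by (rule L2_sqi[OF psmooth_L2[OF that]])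
  have "(\<lambda>n. integral {s..c} (Yn n)) \<longlonglongrightarrow> integral {s..c} Y"
  proof (rule dominated_convergence(2))
    show "(\<lambda>t. C * C1 + \<nu> * (C * CL) + (\<Sum>e\<in>Basis. (M * C) * D e)) integrable_on {s..c}"
      by (rule integrable_const_ivl)
    fix n t assume t: "t \<in> {s..c}"
    have "\<bar>Yn n t\<bar> \<le> \<bar>ip (\<theta> t) (proj n (\<lambda>x. p1 (t, x)))\<bar> + \<nu> * \<bar>ip (\<theta> t) (proj n (\<lambda>x. pL (t, x)))\<bar>
      + (\<Sum>e\<in>Basis. \<bar>ip (\<lambda>x. (v t x \<bullet> e) * \<theta> t x) (proj n (\<lambda>x. pe e (t, x)))\<bar>)"
      unfolding Yn_def using nu
      by (intro order_trans[OF abs_triangle_ineq] add_mono sum_abs order_refl) (simp add: abs_mult)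
    also have "\<dots> \<le> C * C1 + \<nu> * (C * CL) + (\<Sum>e\<in>Basis. (M * C) * D e)"
    proof (intro add_mono sum_mono mult_left_mono)
      have Ct: "L2_norm (\<theta> t) \<le> C" using C(1)[OF t] by simp
      show "\<bar>ip (\<theta> t) (proj n (\<lambda>x. p1 (t, x)))\<bar> \<le> C * C1"
        by (rule order_trans[OF ip_proj_bound[OF sq[OF t] slice[OF ps1]]]) (intro mult_mono Ct C1 C t L2_norm_nonneg)
      show "\<bar>ip (\<theta> t) (proj n (\<lambda>x. pL (t, x)))\<bar> \<le> C * CL"
        by (rule order_trans[OF ip_proj_bound[OF sq[OF t] slice[OF psL]]]) (intro mult_mono Ct CL C t L2_norm_nonneg)
      fix e :: "real^'n" assume e: "e \<in> Basis"
      have "L2_norm (\<lambda>x. (v t x \<bullet> e) * \<theta> t x) \<le> M * L2_norm (\<theta> t)"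
        by (rule L2_norm_bmult[OF sq[OF t] wv[OF t e] M0])
      also have "\<dots> \<le> M * C" by (intro mult_left_mono Ct M0)
      finally have MC: "L2_norm (\<lambda>x. (v t x \<bullet> e) * \<theta> t x) \<le> M * C" .
      show "\<bar>ip (\<lambda>x. (v t x \<bullet> e) * \<theta> t x) (proj n (\<lambda>x. pe e (t, x)))\<bar> \<le> (M * C) * D e"
        by (rule order_trans[OF ip_proj_bound[OF sw[OF t e] slice[OF pse[OF e]]]])
          (intro mult_mono MC D e t L2_norm_nonneg mult_nonneg_nonneg M0 C)
    qed (use nu in simp)
    finally show "norm (Yn n t) \<le> C * C1 + \<nu> * (C * CL) + (\<Sum>e\<in>Basis. (M * C) * D e)" by simp
  next
    fix t assume t: "t \<in> {s..c}"
    show "(\<lambda>n. Yn n t) \<longlonglongrightarrow> Y t"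
      unfolding Yn_def Y_def
      by (intro tendsto_add tendsto_mult tendsto_const tendsto_sum ip_proj_tendsto sq[OF t] sw[OF t] psmooth_L2 ps1 psL pse)
  qed (rule intYn)
  then have intY: "integral {s..c} Y = 0" unfolding zeroYn using LIMSEQ_unique tendsto_const by blast
  let ?G = "\<lambda>t. LINT x|torus. \<theta> t x * (dir_deriv (1, 0) \<phi> (t, x) + \<nu> * laplacian_x \<phi> (t, x) + dir_deriv (0, v t x) \<phi> (t, x))"
  have GY: "?G t = Y t" if "t \<in> {s..c}" for t
    unfolding Y_def p1_def pL_def pe_def by (rule weak_integrand[OF tm[OF that] sq[OF that] ps])
  have "?G t = 0" if t: "t \<in> ?I" "t \<notin> {s..c}" for t
  proof -
    have tb: "b < t" using t c by (auto simp: time_interval_def)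
    have z0: "\<phi> (t, x) = 0" if "b < t" for t x using supp that by simp
    have nz: "dir_deriv d \<psi> (t', x) = 0" if z: "\<And>t x. b < t \<Longrightarrow> \<psi> (t, x) = 0" and "b < t'" for d \<psi> t' and x :: "real^'n"
    proof -
      have "((\<lambda>p. 0) has_derivative (\<lambda>d. 0)) (at (t', x))" by simp
      then have "(\<psi> has_derivative (\<lambda>d. 0)) (at (t', x))"
      proof (rule has_derivative_transform_within_open[where s="{b<..} \<times> UNIV"])
        show "open ({b<..} \<times> (UNIV :: (real^'n) set))" by (intro open_Times) auto
      qed (use that in auto)
      then show ?thesis using frechet_derivative_at by metis
    qed
    have z1: "dir_deriv d \<phi> (t', x) = 0" if "b < t'" for d t' and x :: "real^'n"
      by (rule nz[of \<phi>, OF _ that]) (rule z0)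
    have z2: "dir_deriv d (dir_deriv d' \<phi>) (t', x) = 0" if "b < t'" for d d' t' and x :: "real^'n"
      by (rule nz[of "dir_deriv d' \<phi>", OF _ that]) (rule z1)
    show ?thesis
      unfolding laplacian_x_def by (simp add: z1[OF tb] z2[OF tb])
  qed
  then have "(LINT t|lebesgue_on ?I. ?G t) = (LINT t|lebesgue_on {s..c}. ?G t)"
    by (rule LINT_time_interval[OF sub])
  also have "\<dots> = (LINT t|lebesgue_on {s..c}. Y t)"
    by (rule Bochner_Integration.integral_cong[OF refl]) (rule GY, simp)
  also have "\<dots> = 0"
  \<comment> \<open>Either the Bochner integral equals the gauge integral, which is 0, or it takes
    its default value 0.\<close>
  proof (cases "integrable (lebesgue_on {s..c}) Y")
    case True
    then show ?thesis using intY by (simp add: lebesgue_integral_eq_integral)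
  next
    case False
    then show ?thesis by (rule not_integrable_integral_eq)
  qed
  finally show ?thesis .
qed

section \<open>From the weak formulation to the coefficient equations\<close>

lemma locally_constant_deriv:
  assumes "\<And>x. (f has_real_derivative f' x) (at x)" "open U" "x \<in> U" "\<And>y. y \<in> U \<Longrightarrow> f y = c"
  shows "f' x = 0"
proof -
  have "((\<lambda>y. c) has_real_derivative 0) (at x)" by simp
  then have "(f has_real_derivative 0) (at x)"
    by (rule has_field_derivative_transform_within_open[OF _ assms(2,3)]) (simp add: assms(4))
  with assms(1) show ?thesis by (rule DERIV_unique)
qed

text \<open>\<open>S 0 (N * (t - p))\<close> is a smoothed Heaviside function, and its derivative
  has mass one and lives on \<open>[p, p + 1 / N]\<close>. Since the step rises to the right of
  \<open>p\<close>, the case \<open>p = a\<close> is included.\<close>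

lemma step_limit:
  fixes S :: "nat \<Rightarrow> real \<Rightarrow> real"
  assumes S: "\<And>k x. (S k has_real_derivative S (Suc k) x) (at x)"
    and S0: "\<And>x. x \<le> 0 \<Longrightarrow> S 0 x = 0" and S1: "\<And>x. x \<ge> 1 \<Longrightarrow> S 0 x = 1"
    and Sn: "\<And>x. 0 \<le> S 0 x" "\<And>x. S 0 x \<le> 1"
    and p: "a \<le> p" "p < b" and c: "continuous_on {a..b} c" and g: "bm a b g"
  shows "(\<lambda>n. integral {a..b} (\<lambda>t. real (Suc n) * S 1 (real (Suc n) * (t - p)) * c t + S 0 (real (Suc n) * (t - p)) * g t))
    \<longlonglongrightarrow> c p + integral {p..b} g"
proof -
  have contS: "continuous_on T (S k)" for T k
    using S by (meson DERIV_isCont continuous_at_imp_continuous_on)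
  have contSl: "continuous_on T (\<lambda>t. S k (real (Suc n) * (t - p)))" for T k n
    by (rule continuous_on_compose2[OF contS[of UNIV]]) (auto intro!: continuous_intros)
  have z0: "S (Suc 0) x = 0" if "x < 0" for x
    by (rule locally_constant_deriv[OF S, of "{..<0}" x 0 0]) (use that S0 in auto)
  have z1: "S (Suc 0) x = 0" if "x > 1" for x
    by (rule locally_constant_deriv[OF S, of "{1<..}" x 0 1]) (use that S1 in auto)
  have "bounded (S 1 ` {0..1})"
    by (rule compact_imp_bounded[OF compact_continuous_image[OF contS]]) simp
  then obtain K0 where K0: "\<forall>y\<in>S 1 ` {0..1}. norm y \<le> K0" unfolding bounded_iff ..
  define K where "K = max K0 1"
  have K: "K > 0" "\<And>x. x \<in> {0..1} \<Longrightarrow> \<bar>S 1 x\<bar> \<le> K" using K0 by (auto simp: K_def le_max_iff_disj)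
  have A: "(\<lambda>n. integral {a..b} (\<lambda>t. real (Suc n) * S 1 (real (Suc n) * (t - p)) * c t)) \<longlonglongrightarrow> c p"
  proof (rule LIMSEQ_I)
    fix e :: real assume e: "e > 0"
    have "p \<in> {a..b}" using p by simp
    then obtain d where d: "d > 0" "\<And>t. t \<in> {a..b} \<Longrightarrow> dist t p < d \<Longrightarrow> dist (c t) (c p) < e / (2 * K)"
      using c e K unfolding continuous_on_iff by (metis divide_pos_pos mult_pos_pos zero_less_numeral)
    define r where "r = min d (b - p)"
    have r: "r > 0" using d p by (simp add: r_def)
    obtain n0 where n0: "inverse (real (Suc n0)) < r" using reals_Archimedean[OF r] by blast
    have "norm (integral {a..b} (\<lambda>t. real (Suc n) * S 1 (real (Suc n) * (t - p)) * c t) - c p) < e" if n: "n \<ge> n0" for n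
    proof -
      define N where "N = real (Suc n)"
      have N: "N > 0" by (simp add: N_def)
      have "inverse N \<le> inverse (real (Suc n0))" unfolding N_def using n by (intro le_imp_inverse_le) auto
      then have Nr: "inverse N < r" using n0 by simp
      define q where "q = p + inverse N"
      have q: "p < q" "q < b" "q - p < d" using Nr N unfolding q_def r_def by auto
      have scale: "N * (q - p) = 1" using N by (simp add: q_def)
      have cont: "continuous_on {p..q} (\<lambda>t. N * S 1 (N * (t - p)) * c t)"
        unfolding N_def using p q by (intro continuous_intros contSl continuous_on_subset[OF c]) auto
      have "((\<lambda>t. N * S 1 (N * (t - p)) * c t) has_integral integral {p..q} (\<lambda>t. N * S 1 (N * (t - p)) * c t)) {p..q}"
        by (rule integrable_integral[OF integrable_continuous_real[OF cont]])
      then have "((\<lambda>t. N * S 1 (N * (t - p)) * c t) has_integral integral {p..q} (\<lambda>t. N * S 1 (N * (t - p)) * c t)) {a..b}"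
      proof (rule has_integral_on_superset)
        show "{p..q} \<subseteq> {a..b}" using p q by auto
        fix t assume "t \<notin> {p..q}"
        then consider "t < p" | "t > q" by fastforce
        then have "S (Suc 0) (N * (t - p)) = 0"
        proof cases
          case 1
          then show ?thesis using N by (intro z0) (simp add: mult_pos_neg)
        next
          case 2
          then have "N * (q - p) < N * (t - p)" using N by simp
          then show ?thesis unfolding scale by (rule z1)
        qed
        then show "N * S 1 (N * (t - p)) * c t = 0" by simp
      qed
      then have I1: "integral {a..b} (\<lambda>t. N * S 1 (N * (t - p)) * c t) = integral {p..q} (\<lambda>t. N * S 1 (N * (t - p)) * c t)"
        by (rule integral_unique)
      have "((\<lambda>t. N * S 1 (N * (t - p))) has_integral S 0 (N * (q - p)) - S 0 (N * (p - p))) {p..q}"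
      proof (rule fundamental_theorem_of_calculus)
        show "p \<le> q" using q by simp
        fix t
        have "((\<lambda>t. N * (t - p)) has_real_derivative N) (at t within {p..q})"
          by (auto intro!: derivative_eq_intros)
        from DERIV_chain2[OF S this, of 0]
        show "((\<lambda>t. S 0 (N * (t - p))) has_vector_derivative N * S 1 (N * (t - p))) (at t within {p..q})"
          by (simp add: has_real_derivative_iff_has_vector_derivative mult.commute)
      qed
      then have "((\<lambda>t. N * S 1 (N * (t - p)) * c p) has_integral 1 * c p) {p..q}"
        by (intro has_integral_mult_left) (simp add: scale S0 S1)
      from integral_unique[OF this] have I2: "integral {p..q} (\<lambda>t. N * S 1 (N * (t - p)) * c p) = c p"
        by (simp only: mult_1)
      have cont2: "continuous_on {p..q} (\<lambda>t. N * S 1 (N * (t - p)) * c p)"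
        unfolding N_def by (intro continuous_intros contSl)
      have "integral {a..b} (\<lambda>t. N * S 1 (N * (t - p)) * c t) - c p
          = integral {p..q} (\<lambda>t. N * S 1 (N * (t - p)) * c t) - integral {p..q} (\<lambda>t. N * S 1 (N * (t - p)) * c p)"
        unfolding I1 I2 ..
      also have "\<dots> = integral {p..q} (\<lambda>t. N * S 1 (N * (t - p)) * c t - N * S 1 (N * (t - p)) * c p)"
        by (rule Henstock_Kurzweil_Integration.integral_diff[symmetric, OF integrable_continuous_real[OF cont] integrable_continuous_real[OF cont2]])
      also have "\<bar>\<dots>\<bar> \<le> (N * K * (e / (2 * K))) * (q - p)"
      proof (rule bm_integral_bound)
        show "bm p q (\<lambda>t. N * S 1 (N * (t - p)) * c t - N * S 1 (N * (t - p)) * c p)"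
          by (intro bm_diff bm_continuous cont cont2)
        fix t assume t: "t \<in> {p..q}"
        then have "t \<in> {a..b}" "dist t p < d" using p q by (auto simp: dist_real_def)
        from d(2)[OF this] have ct: "\<bar>c t - c p\<bar> \<le> e / (2 * K)" by (simp add: dist_real_def)
        have "N * (t - p) \<le> N * (q - p)" using t N by (intro mult_left_mono) auto
        then have "\<bar>S 1 (N * (t - p))\<bar> \<le> K" using t N scale by (intro K(2)) auto
        then have "N * \<bar>S 1 (N * (t - p))\<bar> * \<bar>c t - c p\<bar> \<le> N * K * (e / (2 * K))"
          using ct N K(1) by (intro mult_mono) auto
        moreover have "\<bar>N * S 1 (N * (t - p)) * c t - N * S 1 (N * (t - p)) * c p\<bar> = N * \<bar>S 1 (N * (t - p))\<bar> * \<bar>c t - c p\<bar>"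
          using N by (simp add: abs_mult flip: right_diff_distrib)
        ultimately show "\<bar>N * S 1 (N * (t - p)) * c t - N * S 1 (N * (t - p)) * c p\<bar> \<le> N * K * (e / (2 * K))" by simp
      qed (use q N K e in auto)
      also have "\<dots> = (N * (q - p)) * (e / 2)" using K by simp
      also have "\<dots> < e" unfolding scale using e by simp
      finally show ?thesis by (simp add: N_def)
    qed
    then show "\<exists>n0. \<forall>n\<ge>n0. norm (integral {a..b} (\<lambda>t. real (Suc n) * S 1 (real (Suc n) * (t - p)) * c t) - c p) < e" by blast
  qed
  have gp: "bm p b g" by (rule bm_subinterval[OF g p(1)]) simp
  have B: "(\<lambda>n. integral {a..b} (\<lambda>t. S 0 (real (Suc n) * (t - p)) * g t)) \<longlonglongrightarrow> integral {p..b} g"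
  proof -
    have bmS: "bm a b (\<lambda>t. S 0 (real (Suc n) * (t - p)) * g t)" for n
      by (rule bm_mult[OF bm_continuous[OF contSl] g])
    have eq: "integral {a..b} (\<lambda>t. S 0 (real (Suc n) * (t - p)) * g t) = integral {p..b} (\<lambda>t. S 0 (real (Suc n) * (t - p)) * g t)" for n
    proof -
      have "integral {a..p} (\<lambda>t. S 0 (real (Suc n) * (t - p)) * g t) = integral {a..p} (\<lambda>t. 0)"
        by (rule integral_cong) (simp add: S0 mult_nonneg_nonpos)
      then show ?thesis
        using Henstock_Kurzweil_Integration.integral_combine[OF p(1) less_imp_le[OF p(2)] bm_integrable[OF bmS[of n]]] by simp
    qed
    obtain C where C: "0 \<le> C" "\<And>t. t \<in> {p..b} \<Longrightarrow> \<bar>g t\<bar> \<le> C" using bm_bound[OF gp] by blast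
    \<comment> \<open>At \<open>p\<close> itself the step is 0 for every \<open>n\<close>, so the
      pointwise limit may differ from \<open>g\<close> at that single point.\<close>
    have "(\<lambda>n. integral {p..b} (\<lambda>t. S 0 (real (Suc n) * (t - p)) * g t)) \<longlonglongrightarrow> integral {p..b} (\<lambda>t. if t = p then 0 else g t)"
    proof (rule dominated_convergence(2))
      show "(\<lambda>t. S 0 (real (Suc n) * (t - p)) * g t) integrable_on {p..b}" for n
        by (rule bm_integrable[OF bm_mult[OF bm_continuous[OF contSl] gp]])
      show "(\<lambda>t. C) integrable_on {p..b}" by (rule integrable_const_ivl)
      fix n t assume t: "t \<in> {p..b}"
      have "\<bar>S 0 (real (Suc n) * (t - p))\<bar> * \<bar>g t\<bar> \<le> 1 * C"
        using Sn[of "real (Suc n) * (t - p)"] C(2)[OF t] by (intro mult_mono) auto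
      then show "norm (S 0 (real (Suc n) * (t - p)) * g t) \<le> C" by (simp add: abs_mult)
    next
      fix t assume t: "t \<in> {p..b}"
      show "(\<lambda>n. S 0 (real (Suc n) * (t - p)) * g t) \<longlonglongrightarrow> (if t = p then 0 else g t)"
      proof (cases "t = p")
        case False
        then have tp: "t - p > 0" using t by simp
        obtain n0 where n0: "inverse (real (Suc n0)) < t - p" using reals_Archimedean[OF tp] by blast
        have "S 0 (real (Suc n) * (t - p)) * g t = g t" if "n \<ge> n0" for n
        proof -
          have "1 < real (Suc n0) * (t - p)" using n0 by (simp add: field_simps)
          also have "\<dots> \<le> real (Suc n) * (t - p)" using that tp by (intro mult_right_mono) auto
          finally show ?thesis by (simp add: S1)
        qed
        then have "\<forall>\<^sub>F n in sequentially. S 0 (real (Suc n) * (t - p)) * g t = g t"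
          unfolding eventually_sequentially by blast
        then show ?thesis using False by (simp add: tendsto_eventually)
      qed (simp add: S0)
    qed
    moreover have "integral {p..b} (\<lambda>t. if t = p then 0 else g t) = integral {p..b} g"
      by (rule integral_spike[of "{p}"]) auto
    ultimately show ?thesis unfolding eq by simp
  qed
  have "integral {a..b} (\<lambda>t. real (Suc n) * S 1 (real (Suc n) * (t - p)) * c t + S 0 (real (Suc n) * (t - p)) * g t)
      = integral {a..b} (\<lambda>t. real (Suc n) * S 1 (real (Suc n) * (t - p)) * c t) + integral {a..b} (\<lambda>t. S 0 (real (Suc n) * (t - p)) * g t)" for n
    by (intro Henstock_Kurzweil_Integration.integral_add bm_integrable bm_mult bm_const bm_continuous contSl c g)
  then show ?thesis using tendsto_add[OF A B] by simp
qed

lemma product_test_derivative: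
  fixes l :: "int^'n"
  assumes "\<And>t. (\<eta> has_real_derivative \<eta>' t) (at t)"
  shows "((\<lambda>p. \<eta> (fst p) * hart l (snd p)) has_derivative
      (\<lambda>d. \<eta> (fst p) * (2 * pi * (freq l \<bullet> snd d) * hart (- l) (snd p)) + (\<eta>' (fst p) * fst d) * hart l (snd p))) (at p)"
proof -
  have "(fst has_derivative fst) (at p)" "(snd has_derivative snd) (at p)"
    by (intro bounded_linear_imp_has_derivative bounded_linear_fst bounded_linear_snd)+
  from has_derivative_compose[OF this(1) assms[of "fst p", unfolded has_field_derivative_def]]
    has_derivative_compose[OF this(2) hart_has_derivative[of l "snd p"]]
  have f: "((\<lambda>p. \<eta> (fst p)) has_derivative (\<lambda>d. \<eta>' (fst p) * fst d)) (at p)"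
    and h: "((\<lambda>p. hart l (snd p)) has_derivative (\<lambda>d. 2 * pi * (freq l \<bullet> snd d) * hart (- l) (snd p))) (at p)" .
  show ?thesis by (rule has_derivative_mult[OF f h])
qed

lemma product_test_dir_deriv:
  fixes l :: "int^'n"
  assumes "\<And>t. (\<eta> has_real_derivative \<eta>' t) (at t)"
  shows "dir_deriv d (\<lambda>p. \<eta> (fst p) * hart l (snd p)) p
    = \<eta> (fst p) * (2 * pi * (freq l \<bullet> snd d) * hart (- l) (snd p)) + (\<eta>' (fst p) * fst d) * hart l (snd p)"
  using fun_cong[OF frechet_derivative_at[OF product_test_derivative[OF assms, where l=l and p=p]], of d] by simp

lemma product_test_laplacian:
  fixes l :: "int^'n"
  assumes \<eta>: "\<And>t. (\<eta> has_real_derivative \<eta>' t) (at t)"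
  shows "laplacian_x (\<lambda>p. \<eta> (fst p) * hart l (snd p)) p = - lam l * \<eta> (fst p) * hart l (snd p)"
proof -
  have "dir_deriv (0, e) (dir_deriv (0, e) (\<lambda>p. \<eta> (fst p) * hart l (snd p))) p
      = - (4 * pi\<^sup>2) * \<eta> (fst p) * hart l (snd p) * ((freq l \<bullet> e) * (freq l \<bullet> e))" for e
  proof -
    have 1: "dir_deriv (0, e) (\<lambda>p. \<eta> (fst p) * hart l (snd p)) = (\<lambda>p. (2 * pi * (freq l \<bullet> e) * \<eta> (fst p)) * hart (- l) (snd p))"
      by (simp add: product_test_dir_deriv[OF \<eta>] fun_eq_iff)
    have "((\<lambda>t. 2 * pi * (freq l \<bullet> e) * \<eta> t) has_real_derivative 2 * pi * (freq l \<bullet> e) * \<eta>' t) (at t)" for t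
      by (intro DERIV_cmult \<eta>)
    from product_test_dir_deriv[OF this, where d="(0, e)" and l="- l" and p=p]
    show ?thesis unfolding 1 by (simp add: power2_eq_square)
  qed
  then have "laplacian_x (\<lambda>p. \<eta> (fst p) * hart l (snd p)) p
      = (\<Sum>e\<in>Basis. - (4 * pi\<^sup>2) * \<eta> (fst p) * hart l (snd p) * ((freq l \<bullet> e) * (freq l \<bullet> e)))"
    unfolding laplacian_x_def by simp
  also have "\<dots> = - lam l * \<eta> (fst p) * hart l (snd p)"
    unfolding sum_distrib_left[symmetric] euclidean_inner[symmetric] lam_def by simp
  finally show ?thesis .
qed

lemma bm_LINT: "bm a b G \<Longrightarrow> (LINT t|lebesgue_on {a..b}. G t) = integral {a..b} G"
  by (rule lebesgue_integral_eq_integral)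
    (use bm_absint in \<open>simp_all add: integrable_restrict_space set_integrable_def\<close>)

text \<open>The test function is \<open>hart l\<close> times the difference of two smoothed steps,
  rising just after \<open>p\<close> and just after \<open>q\<close>. As they sharpen, each
  contributes the coefficient at its jump plus the integral of the rate from there to
  \<open>b\<close>. Test functions vanish up to some time after \<open>s\<close>, hence the strict
  \<open>s < p\<close>.\<close>

lemma weak_form_interior:
  fixes v :: "real \<Rightarrow> real^'n \<Rightarrow> real^'n"
  assumes v: "nice T' v" and s: "0 \<le> s"
    and curve: "curve (time_interval s T') \<theta>"
    and weak: "\<And>\<phi>. test_function s T' \<phi> \<Longrightarrow>
        (LINT t|lebesgue_on (time_interval s T'). LINT x|torus.
           \<theta> t x * (dir_deriv (1, 0) \<phi> (t, x) + \<nu> * laplacian_x \<phi> (t, x)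
                    + dir_deriv (0, v t x) \<phi> (t, x))) = 0"
    and pq: "s < p" "p < q" "ereal q < T'"
  shows "ip (\<theta> q) (hart l) = ip (\<theta> p) (hart l) + integral {p..q} (rate \<nu> v \<theta> l)"
proof -
  let ?I = "time_interval s T'" and ?c = "\<lambda>t. ip (\<theta> t) (hart l)" and ?g = "rate \<nu> v \<theta> l"
  obtain S :: "nat \<Rightarrow> real \<Rightarrow> real" where S: "\<And>k x. (S k has_real_derivative S (Suc k) x) (at x)"
    and S0: "\<And>x. x \<le> 0 \<Longrightarrow> S 0 x = 0" and S1: "\<And>x. x \<ge> 1 \<Longrightarrow> S 0 x = 1"
    and Sn: "\<And>x. 0 \<le> S 0 x" "\<And>x. S 0 x \<le> 1"
    by (rule smooth_step) blast
  \<comment> \<open>Room to the right of \<open>q\<close> for a step of width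
    \<open>inverse N\<close>, so that the test function has support inside the time
    interval.\<close>
  obtain b where b: "q < b" "ereal b < T'" using ereal_dense2[OF pq(3)] by auto
  have sub: "{p..b} \<subseteq> ?I"
  proof
    fix t assume "t \<in> {p..b}"
    then show "t \<in> ?I" using pq b le_less_trans[of "ereal t" "ereal b" T'] by (simp add: time_interval_def)
  qed
  have p0: "0 \<le> p" using s pq by simp
  have cpb: "curve {p..b} \<theta>" by (rule curve_subset[OF curve sub])
  have contc: "continuous_on {p..b} ?c" by (rule curve_ip_continuous[OF cpb sqi_hart])
  have bmg: "bm p b ?g" by (rule rate_bm[OF v cpb p0 b(2)])
  have bI: "b \<in> ?I" using sub pq b by auto
  obtain M where M: "\<And>r. r \<in> {0..b} \<Longrightarrow> tame M (v r)" using time_interval_nice[OF v s bI] by blast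
  define J where "J n r = integral {p..b} (\<lambda>t. real (Suc n) * S 1 (real (Suc n) * (t - r)) * ?c t + S 0 (real (Suc n) * (t - r)) * ?g t)" for n r
  have limJ: "(\<lambda>n. J n r) \<longlonglongrightarrow> ?c r + integral {r..b} ?g" if "p \<le> r" "r < b" for r
    unfolding J_def by (rule step_limit[OF S S0 S1 Sn that contc bmg])
  have contSl: "continuous_on T (\<lambda>t. S k (N * (t - r)))" for T k N r
  proof -
    have "continuous_on UNIV (S k)" using S by (meson DERIV_isCont continuous_at_imp_continuous_on)
    then show ?thesis by (rule continuous_on_compose2) (auto intro!: continuous_intros)
  qed
  obtain n0 where n0: "inverse (real (Suc n0)) < b - q" using reals_Archimedean[of "b - q"] b by auto
  have JJ: "J n p = J n q" if n: "n \<ge> n0" for n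
  proof -
    define N where "N = real (Suc n)"
    have N: "N > 0" by (simp add: N_def)
    have "inverse N \<le> inverse (real (Suc n0))" unfolding N_def using n by (intro le_imp_inverse_le) auto
    then have Nb: "inverse N < b - q" using n0 by simp
    define D where "D k t = N ^ k * S k (N * (t - p)) + (- (N ^ k)) * S k (N * (t - q))" for k t
    have Sl: "((\<lambda>t. S k (N * (t - r))) has_real_derivative N * S (Suc k) (N * (t - r))) (at t)" for k r t
    proof -
      have "((\<lambda>t. N * (t - r)) has_real_derivative N) (at t)" by (auto intro!: derivative_eq_intros)
      from DERIV_chain2[OF S this] show ?thesis by (simp add: mult.commute)
    qed
    have D: "(D k has_real_derivative D (Suc k) t) (at t)" for k t
    proof -
      have "((\<lambda>t. N ^ k * S k (N * (t - p)) + (- (N ^ k)) * S k (N * (t - q))) has_real_derivative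
          N ^ k * (N * S (Suc k) (N * (t - p))) + (- (N ^ k)) * (N * S (Suc k) (N * (t - q)))) (at t)"
        by (intro DERIV_add DERIV_cmult Sl)
      then show ?thesis unfolding D_def[abs_def] by (simp add: mult.assoc mult.left_commute)
    qed
    define \<phi> :: "real \<times> (real^'n) \<Rightarrow> real" where "\<phi> pt = D 0 (fst pt) * hart l (snd pt)" for pt
    have out: "D 0 t = 0" if "t \<notin> {p..q + inverse N}" for t
    proof (cases "t < p")
      case True
      then have "N * (t - p) \<le> 0" "N * (t - q) \<le> 0" using N pq by (auto simp: mult_le_0_iff)
      then show ?thesis by (simp add: D_def S0)
    next
      case False
      then have "q + inverse N < t" using that by auto
      then have "inverse N \<le> t - q" "inverse N \<le> t - p" using pq by simp_all
      then have "N * inverse N \<le> N * (t - q)" "N * inverse N \<le> N * (t - p)"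
        using N by (simp_all only: mult_le_cancel_left_pos)
      then show ?thesis using N by (simp add: D_def S1)
    qed
    have tf: "test_function s T' \<phi>"
      unfolding test_function_def
    proof (intro conjI allI)
      have 1: "smooth (\<lambda>pt :: real \<times> (real^'n). D 0 (fst pt))"
        by (rule smooth_compose_linear[of D, OF D bounded_linear_fst])
      have "bounded_linear (\<lambda>pt :: real \<times> (real^'n). 2 * pi * (freq l \<bullet> snd pt))"
        by (intro bounded_linear_const_mult bounded_linear_inner_right_comp bounded_linear_snd)
      from smooth_compose_linear[of cas_chain, OF cas_chain this, of 0]
      have "smooth (\<lambda>pt :: real \<times> (real^'n). hart l (snd pt))"
        by (simp add: cas_chain_def hart_def)
      with 1 show "smooth \<phi>" unfolding \<phi>_def[abs_def] by (rule smooth_mult)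
      show "periodic (\<lambda>x. \<phi> (t, x))" for t
        using periodic_hart[of l] by (simp add: \<phi>_def periodic_def)
      have "ereal (q + inverse N) < T'" by (rule le_less_trans[of _ "ereal b" T']) (use Nb b in auto)
      then show "\<exists>a b. s < a \<and> ereal b < T' \<and> (\<forall>t x. t \<notin> {a..b} \<longrightarrow> \<phi> (t, x) = 0)"
        using pq(1) out by (intro exI[where x=p] exI[where x="q + inverse N"]) (simp add: \<phi>_def)
    qed
    let ?G = "\<lambda>t. LINT x|torus. \<theta> t x * (dir_deriv (1, 0) \<phi> (t, x) + \<nu> * laplacian_x \<phi> (t, x) + dir_deriv (0, v t x) \<phi> (t, x))"
    have integrand: "dir_deriv (1, 0) \<phi> (t, x) + \<nu> * laplacian_x \<phi> (t, x) + dir_deriv (0, w) \<phi> (t, x)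
        = (D 1 t - \<nu> * lam l * D 0 t) * hart l x + D 0 t * dir_deriv w (hart l) x" for t x w
      unfolding \<phi>_def[abs_def] product_test_dir_deriv[OF D] product_test_laplacian[OF D] dir_deriv_hart
      by (simp add: algebra_simps)
    have Gin: "?G t = D 1 t * ?c t + D 0 t * ?g t" if t: "t \<in> {p..b}" for t
    proof -
      have w: "tame M (v t)" using t M p0 by simp
      have f: "sqi (\<theta> t)" by (rule curve_sqi[OF cpb t])
      have "?G t = ip (\<theta> t) (\<lambda>x. (D 1 t - \<nu> * lam l * D 0 t) * hart l x + D 0 t * dir_deriv (v t x) (hart l) x)"
        unfolding integrand ip_def ..
      also have "\<dots> = (D 1 t - \<nu> * lam l * D 0 t) * ?c t + D 0 t * drift (v t) (\<theta> t) l"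
        unfolding drift_ip
        by (subst ip_add_right) (intro sqi_cmult sqi_hart sqi_dir_deriv_hart[OF w] f | simp add: ip_cmult_right)+
      finally show ?thesis by (simp add: rate_def algebra_simps)
    qed
    have D1out: "D 1 t = 0" if "t \<notin> {p..b}" for t
    proof -
      have "open (- {p..q + inverse N})" by (simp add: open_Compl)
      moreover have "t \<in> - {p..q + inverse N}" using that Nb by auto
      ultimately show ?thesis
        using locally_constant_deriv[of "D 0" "D (Suc 0)" "- {p..q + inverse N}" t 0] D out by simp
    qed
    have "?G t = 0" if "t \<in> ?I" "t \<notin> {p..b}" for t
    proof -
      have "D 0 t = 0" by (rule out) (use that Nb in auto)
      then show ?thesis unfolding integrand D1out[OF that(2)] by simp
    qed
    then have "(LINT t|lebesgue_on ?I. ?G t) = (LINT t|lebesgue_on {p..b}. ?G t)"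
      by (rule LINT_time_interval[OF sub])
    also have "\<dots> = (LINT t|lebesgue_on {p..b}. D 1 t * ?c t + D 0 t * ?g t)"
      by (rule Bochner_Integration.integral_cong[OF refl]) (rule Gin, simp)
    also have "\<dots> = integral {p..b} (\<lambda>t. D 1 t * ?c t + D 0 t * ?g t)"
    proof (rule bm_LINT)
      have "continuous_on {p..b} (D k)" for k
        using D by (meson DERIV_isCont continuous_at_imp_continuous_on)
      then show "bm p b (\<lambda>t. D 1 t * ?c t + D 0 t * ?g t)"
        by (intro bm_add bm_mult bmg bm_continuous contc)
    qed
    finally have zero: "integral {p..b} (\<lambda>t. D 1 t * ?c t + D 0 t * ?g t) = 0"
      using weak[OF tf] by simp
    have bmJ: "bm p b (\<lambda>t. N * S 1 (N * (t - r)) * ?c t + S 0 (N * (t - r)) * ?g t)" for r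
      by (intro bm_add bm_mult bm_const bmg bm_continuous contc contSl)
    have "J n p - J n q = integral {p..b} (\<lambda>t. (N * S 1 (N * (t - p)) * ?c t + S 0 (N * (t - p)) * ?g t)
        - (N * S 1 (N * (t - q)) * ?c t + S 0 (N * (t - q)) * ?g t))"
      unfolding J_def N_def[symmetric]
      by (rule Henstock_Kurzweil_Integration.integral_diff[symmetric, OF bm_integrable[OF bmJ] bm_integrable[OF bmJ]])
    also have "\<dots> = integral {p..b} (\<lambda>t. D 1 t * ?c t + D 0 t * ?g t)"
      by (rule integral_cong) (simp add: D_def algebra_simps)
    finally show ?thesis using zero by simp
  qed
  have "(\<lambda>n. J n q) \<longlonglongrightarrow> ?c p + integral {p..b} ?g"
  proof (rule Lim_transform_eventually[OF limJ])
    show "\<forall>\<^sub>F n in sequentially. J n p = J n q" unfolding eventually_sequentially using JJ by blast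
  qed (use pq b in auto)
  moreover have "(\<lambda>n. J n q) \<longlonglongrightarrow> ?c q + integral {q..b} ?g" using pq b by (intro limJ) auto
  ultimately have "?c p + integral {p..b} ?g = ?c q + integral {q..b} ?g" by (rule LIMSEQ_unique)
  moreover have "integral {p..q} ?g + integral {q..b} ?g = integral {p..b} ?g"
    using pq b by (intro Henstock_Kurzweil_Integration.integral_combine bm_integrable[OF bmg]) auto
  ultimately show ?thesis by simp
qed

text \<open>The initial time, where test functions vanish, is reached by continuity: the coefficient
  minus its integrated rate is constant on a half-open interval and hence on its closure.\<close>

lemma weak_imp_fsol:
  fixes v :: "real \<Rightarrow> real^'n \<Rightarrow> real^'n"
  assumes v: "nice T' v" and s: "0 \<le> s"
    and curve: "curve (time_interval s T') \<theta>"
    and weak: "\<And>\<phi>. test_function s T' \<phi> \<Longrightarrow>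
        (LINT t|lebesgue_on (time_interval s T'). LINT x|torus.
           \<theta> t x * (dir_deriv (1, 0) \<phi> (t, x) + \<nu> * laplacian_x \<phi> (t, x)
                    + dir_deriv (0, v t x) \<phi> (t, x))) = 0"
  shows "fsol \<nu> v (time_interval s T') \<theta>"
proof -
  let ?I = "time_interval s T'"
  have "ip (\<theta> t) (hart l) = ip (\<theta> r) (hart l) + integral {r..t} (rate \<nu> v \<theta> l)"
    if r: "r \<in> ?I" and t: "t \<in> ?I" and rt: "r \<le> t" for l r t
  proof (cases "r = t")
    case False
    then have rt: "r < t" using rt by simp
    have rs: "s \<le> r" and tT: "ereal t < T'" using r t by (auto simp: time_interval_def)
    have sub: "{r..t} \<subseteq> ?I"
    proof
      fix q assume "q \<in> {r..t}"
      then show "q \<in> ?I" using rs tT le_less_trans[of "ereal q" "ereal t" T'] by (simp add: time_interval_def)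
    qed
    have c: "curve {r..t} \<theta>" by (rule curve_subset[OF curve sub])
    have r0: "0 \<le> r" using s rs by simp
    have bmg: "bm r t (rate \<nu> v \<theta> l)" by (rule rate_bm[OF v c r0 tT])
    define W where "W q = ip (\<theta> q) (hart l) - integral {r..q} (rate \<nu> v \<theta> l)" for q
    have contW: "continuous_on {r..t} W"
      unfolding W_def by (intro continuous_on_diff curve_ip_continuous[OF c sqi_hart] bm_indefinite_continuous[OF bmg])
    have const: "W q = W t" if q: "q \<in> {r<..t}" for q
    proof (cases "q = t")
      case False
      have "ip (\<theta> t) (hart l) = ip (\<theta> q) (hart l) + integral {q..t} (rate \<nu> v \<theta> l)"
        using q rs False by (intro weak_form_interior[OF v s curve weak _ _ tT]) auto
      moreover have "integral {r..t} (rate \<nu> v \<theta> l) - integral {r..q} (rate \<nu> v \<theta> l) = integral {q..t} (rate \<nu> v \<theta> l)"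
        using q by (intro integral_diff_bm[OF bmg]) auto
      ultimately show ?thesis by (simp add: W_def)
    qed simp
    have cl: "closure {r<..t} = {r..t}" using rt by simp
    have "W r = W t"
    proof (rule continuous_constant_on_closure[of "{r<..t}" W "W t" r])
      show "continuous_on (closure {r<..t}) W" unfolding cl by (rule contW)
      show "r \<in> closure {r<..t}" unfolding cl using rt by simp
    qed (rule const)
    then show ?thesis by (simp add: W_def)
  qed simp
  then show ?thesis unfolding fsol_def using curve by blast
qed

section \<open>Mean zero, and existence of weak solutions\<close>

lemma LINT_hart_0: "(LINT x|torus. f x) = ip f (hart 0)"
  by (simp add: ip_def)

text \<open>The mean is the coefficient of the constant mode, whose rate is 0.\<close>

lemma fsol_mean_zero:
  assumes sol: "fsol \<nu> v I \<theta>" and st: "s \<in> I" "t \<in> I" "s \<le> t" and z: "(LINT x|torus. \<theta> s x) = 0"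
  shows "\<theta> t \<in> L2_0"
proof -
  have "rate \<nu> v \<theta> 0 = (\<lambda>r. 0)"
    unfolding rate_def[abs_def] drift_def dir_deriv_hart by (simp add: lam_def)
  then have "ip (\<theta> t) (hart 0) = ip (\<theta> s) (hart 0)"
    using fsolD[OF sol st, of 0] by simp
  then show ?thesis
    using z curve_L2[OF fsol_curve[OF sol] st(2)] by (simp add: L2_0_def LINT_hart_0)
qed

text \<open>Makes uniqueness and the energy inequality available for the solutions from which
  \<open>solution_op\<close> chooses.\<close>

theorem weak_solution_iff_fsol:
  fixes v :: "real \<Rightarrow> real^'n \<Rightarrow> real^'n"
  assumes v: "nice T' v" and s: "0 \<le> s" "ereal s < T'" and nu: "\<nu> > 0"
  shows "weak_solution v T' \<nu> s \<theta>\<^sub>0 \<theta> \<longleftrightarrow> fsol \<nu> v (time_interval s T') \<theta> \<and>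
    (\<forall>t\<in>time_interval s T'. \<theta> t \<in> L2_0) \<and> (AE x in torus. \<theta> s x = \<theta>\<^sub>0 x)"
proof
  assume w: "weak_solution v T' \<nu> s \<theta>\<^sub>0 \<theta>"
  then have L: "\<forall>t\<in>time_interval s T'. \<theta> t \<in> L2_0" and ini: "AE x in torus. \<theta> s x = \<theta>\<^sub>0 x"
    unfolding weak_solution_def by blast+
  have "curve (time_interval s T') \<theta>"
    using w L unfolding weak_solution_def by (subst curve_iff_L2_tendsto) (blast intro: L2_0_L2)+
  then have "fsol \<nu> v (time_interval s T') \<theta>"
    using w unfolding weak_solution_def by (intro weak_imp_fsol[OF v s(1)]) blast+
  with L ini show "fsol \<nu> v (time_interval s T') \<theta> \<and>
    (\<forall>t\<in>time_interval s T'. \<theta> t \<in> L2_0) \<and> (AE x in torus. \<theta> s x = \<theta>\<^sub>0 x)" by blast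
next
  assume f: "fsol \<nu> v (time_interval s T') \<theta> \<and>
    (\<forall>t\<in>time_interval s T'. \<theta> t \<in> L2_0) \<and> (AE x in torus. \<theta> s x = \<theta>\<^sub>0 x)"
  then have sol: "fsol \<nu> v (time_interval s T') \<theta>" and L: "\<And>t. t \<in> time_interval s T' \<Longrightarrow> \<theta> t \<in> L2_0" by blast+
  have "\<forall>t\<in>time_interval s T'. L2_tendsto \<theta> (\<theta> t) (at t within time_interval s T')"
    using fsol_curve[OF sol] curve_iff_L2_tendsto[of "time_interval s T'" \<theta>, OF L2_0_L2[OF L]] by simp
  then show "weak_solution v T' \<nu> s \<theta>\<^sub>0 \<theta>"
    using f fsol_weak_form[OF v s nu sol] unfolding weak_solution_def by blast
qed

theorem weak_solution_exists:
  fixes v :: "real \<Rightarrow> real^'n \<Rightarrow> real^'n"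
  assumes v: "nice T' v" and s: "0 \<le> s" "ereal s < T'" and nu: "\<nu> > 0" and f: "f \<in> L2_0"
  obtains \<theta> where "weak_solution v T' \<nu> s f \<theta>"
proof -
  let ?I = "time_interval s T'"
  have sI: "s \<in> ?I" using s by (simp add: time_interval_def)
  obtain \<theta> where \<theta>: "fsol \<nu> v ?I \<theta>" "L2_norm (\<lambda>x. \<theta> s x - f x) = 0"
    using fsol_exists[OF v s nu L2_0_L2[OF f]] by blast
  have s\<theta>: "sqi (\<theta> s)" and sf: "sqi f"
    by (rule curve_sqi[OF fsol_curve[OF \<theta>(1)] sI], rule L2_sqi[OF L2_0_L2[OF f]])
  have "AE x in torus. \<theta> s x - f x = 0"
    by (rule L2_norm_eq_0[OF sqi_diff[OF s\<theta> sf] \<theta>(2)])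
  then have ae: "AE x in torus. \<theta> s x = f x" by simp
  then have "(LINT x|torus. \<theta> s x) = (LINT x|torus. f x)"
    using s\<theta> sf by (intro integral_cong_AE) auto
  also have "\<dots> = 0" using f by (simp add: L2_0_def)
  finally have z: "(LINT x|torus. \<theta> s x) = 0" .
  have "\<theta> t \<in> L2_0" if "t \<in> ?I" for t
    using that by (intro fsol_mean_zero[OF \<theta>(1) sI _ _ z]) (auto simp: time_interval_def)
  with \<theta>(1) ae have "weak_solution v T' \<nu> s f \<theta>"
    unfolding weak_solution_iff_fsol[OF v s nu] by blast
  then show thesis by (rule that)
qed

subsection \<open>A time change with prescribed speeds\<close>

text \<open>End points 0, 1/2, 2/3, ... of the intervals accumulating at 1. The time change is
  affine on \<open>[knot k, mid k]\<close> and adjusts its slope on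
  \<open>[mid k, knot (Suc k)]\<close>.\<close>

definition knot :: "nat \<Rightarrow> real" where
  "knot k = 1 - 1 / (real k + 1)"

definition mid :: "nat \<Rightarrow> real" where
  "mid k = (knot k + knot (Suc k)) / 2"

lemma knot_0 [simp]: "knot 0 = 0"
  by (simp add: knot_def)

lemma knot_mono_Suc: "knot k < knot (Suc k)"
  unfolding knot_def by (simp add: field_simps)

lemma knot_mono: "j \<le> k \<Longrightarrow> knot j \<le> knot k"
  unfolding knot_def by (simp add: frac_le)

lemma knot_less_1: "knot k < 1"
  by (simp add: knot_def)

lemma knot_mid: "knot k < mid k" "mid k < knot (Suc k)"
  using knot_mono_Suc[of k] by (auto simp: mid_def)

lemma mid_pos: "0 < mid k"
  using knot_mid(1)[of k] knot_mono[of 0 k] by simp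

lemma knot_unbounded:
  assumes "t < 1"
  obtains K where "t < knot K"
proof -
  obtain n where n: "inverse (real (Suc n)) < 1 - t" using reals_Archimedean[of "1 - t"] assms by auto
  then have "t < knot n" by (simp add: knot_def inverse_eq_divide add.commute)
  then show thesis by (rule that)
qed

text \<open>The slope is \<open>c 0\<close> plus smooth steps of height
  \<open>c (Suc k) - c k\<close>, of which only finitely many are nonzero near any time before 1.
  Monotone speeds keep it positive, and \<open>clen\<close> makes each affine piece advance \<sigma>
  by at least 1, which gives surjectivity.\<close>

lemma time_change:
  fixes c :: "nat \<Rightarrow> real"
  assumes c0: "c 0 > 0" and cmono: "\<And>k. c k \<le> c (Suc k)" and clen: "\<And>k. 1 \<le> c k * (mid k - knot k)"
  obtains \<sigma> \<sigma>' :: "real \<Rightarrow> real" where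
    "increasing_diffeo \<sigma> {0..<1} {0..}"
    "\<And>t. t \<in> {0..<1} \<Longrightarrow> (\<sigma> has_real_derivative \<sigma>' t) (at t within {0..<1})"
    "continuous_on {0..<1} \<sigma>'" "\<And>t. t \<in> {0..<1} \<Longrightarrow> 0 < \<sigma>' t"
    "\<And>k t. t \<in> {knot k..mid k} \<Longrightarrow> \<sigma> t = \<sigma> (knot k) + c k * (t - knot k)"
    "\<And>k t. t \<in> {knot k..mid k} \<Longrightarrow> \<sigma>' t = c k"
proof -
  obtain S :: "nat \<Rightarrow> real \<Rightarrow> real" where S: "\<And>k x. (S k has_real_derivative S (Suc k) x) (at x)"
    and S0: "\<And>x. x \<le> 0 \<Longrightarrow> S 0 x = 0" and S1: "\<And>x. x \<ge> 1 \<Longrightarrow> S 0 x = 1"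
    and Sn: "\<And>x. 0 \<le> S 0 x" "\<And>x. S 0 x \<le> 1"
    by (rule smooth_step) blast
  have Sneg: "S j x = 0" if "x < 0" for j x
    using that
  proof (induction j arbitrary: x)
    case (Suc j)
    then show ?case by (intro locally_constant_deriv[OF S, of "{..<0}" x j 0]) auto
  qed (simp add: S0)
  define h where "h k = knot (Suc k) - mid k" for k
  have h: "h k > 0" for k using knot_mid(2)[of k] by (simp add: h_def)
  \<comment> \<open>\<open>T 0 k\<close> raises the slope from \<open>c k\<close> to
    \<open>c (Suc k)\<close> between \<open>mid k\<close> and \<open>knot (Suc k)\<close>;
    \<open>T j k\<close> is its \<open>j\<close>-th derivative.\<close>
  define T where "T j k t = (c (Suc k) - c k) * (inverse (h k) ^ j * S j ((t - mid k) / h k))" for j k t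
  define F where "F j K t = (if j = 0 then c 0 else 0) + (\<Sum>k<K. T j k t)" for j K t
  have Tz: "T j k t = 0" if "t < mid k" for j k t
    using that h[of k] by (simp add: T_def Sneg divide_neg_pos)
  have F_mono: "F j K t = F j L t" if "t < knot L" "L \<le> K" for j K L t
  proof -
    have "(\<Sum>k<K. T j k t) = (\<Sum>k<L. T j k t)"
    proof (rule sum.mono_neutral_right)
      show "\<forall>i\<in>{..<K} - {..<L}. T j i t = 0"
      proof
        fix i assume "i \<in> {..<K} - {..<L}"
        then have "knot L \<le> knot i" by (intro knot_mono) auto
        then show "T j i t = 0" using that(1) knot_mid(1)[of i] by (intro Tz) simp
      qed
    qed (use that in auto)
    then show ?thesis by (simp add: F_def)
  qed
  \<comment> \<open>To the left of \<open>knot K\<close> only the first \<open>K\<close> steps can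
    be nonzero, so any such \<open>K\<close> gives the value of the infinite sum; the least one is a
    definite choice.\<close>
  define G where "G j t = F j (LEAST K. t < knot K) t" for j t
  have GF: "G j t = F j K t" if "t < knot K" for j t K
    unfolding G_def using that by (intro F_mono[symmetric] Least_le LeastI[of "\<lambda>K. t < knot K" K])
  have dT: "(T j k has_real_derivative T (Suc j) k t) (at t)" for j k t
  proof -
    have "((\<lambda>t. (t - mid k) / h k) has_real_derivative inverse (h k)) (at t)"
      using h[of k] by (auto intro!: derivative_eq_intros simp: inverse_eq_divide)
    from DERIV_chain2[OF S this]
    have "((\<lambda>t. S j ((t - mid k) / h k)) has_real_derivative S (Suc j) ((t - mid k) / h k) * inverse (h k)) (at t)" .
    then have "((\<lambda>t. (c (Suc k) - c k) * (inverse (h k) ^ j * S j ((t - mid k) / h k))) has_real_derivative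
        (c (Suc k) - c k) * (inverse (h k) ^ j * (S (Suc j) ((t - mid k) / h k) * inverse (h k)))) (at t)"
      by (intro DERIV_cmult)
    then show ?thesis unfolding T_def[abs_def] by (simp add: mult_ac)
  qed
  have dF: "(F j K has_real_derivative F (Suc j) K t) (at t)" for j K t
  proof -
    have "((\<lambda>t. (if j = 0 then c 0 else 0) + (\<Sum>k<K. T j k t)) has_real_derivative 0 + (\<Sum>k<K. T (Suc j) k t)) (at t)"
      by (intro DERIV_add DERIV_const DERIV_sum dT)
    then show ?thesis by (simp add: F_def[abs_def])
  qed
  have dG: "(G j has_real_derivative G (Suc j) t) (at t)" if t: "t < 1" for j t
  proof -
    obtain K where K: "t < knot K" using knot_unbounded[OF t] by blast
    have "(G j has_real_derivative F (Suc j) K t) (at t)"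
      by (rule has_field_derivative_transform_within_open[OF dF, of "{..<knot K}"]) (use K GF in auto)
    then show ?thesis by (simp add: GF[OF K])
  qed
  have contG: "continuous_on A (G j)" if "A \<subseteq> {..<1}" for A j
  proof (rule continuous_at_imp_continuous_on, rule ballI)
    fix t assume "t \<in> A"
    then have "t < 1" using that by blast
    then show "isCont (G j) t" by (rule DERIV_isCont[OF dG])
  qed
  have Gge: "c 0 \<le> G 0 t" if t1: "t < 1" for t
  proof -
    obtain K where K: "t < knot K" using knot_unbounded[OF t1] by blast
    have "0 \<le> (\<Sum>k<K. T 0 k t)"
      unfolding T_def using Sn cmono by (intro sum_nonneg mult_nonneg_nonneg) auto
    then show ?thesis by (simp add: GF[OF K] F_def)
  qed
  have Gpos: "0 < G 0 t" if "t < 1" for t using Gge[OF that] c0 by simp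
  have Gknot: "G 0 t = c k" if t: "t \<in> {knot k..mid k}" for k t
  proof -
    have K: "t < knot (Suc k)" using t knot_mid(2)[of k] by auto
    have 1: "T 0 i t = c (Suc i) - c i" if "i < k" for i
    proof -
      have "knot (Suc i) \<le> knot k" using that by (intro knot_mono) auto
      then have "h i \<le> t - mid i" using t by (simp add: h_def)
      then have "1 \<le> (t - mid i) / h i" using h[of i] by simp
      then show ?thesis by (simp add: T_def S1)
    qed
    have "(t - mid k) / h k \<le> 0" using t h[of k] by (intro divide_nonpos_pos) auto
    then have 2: "T 0 k t = 0" by (simp add: T_def S0)
    have "(\<Sum>i<Suc k. T 0 i t) = (\<Sum>i<k. c (Suc i) - c i)" using 1 2 by simp
    also have "\<dots> = c k - c 0" by (rule sum_lessThan_telescope)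
    finally show ?thesis by (simp add: GF[OF K] F_def)
  qed
  have Gneg: "G 0 t = c 0" if "t < mid 0" for t
    using GF[of t 1 0] that knot_mid(2)[of 0] by (simp add: F_def Tz)
  \<comment> \<open>Integration starts at -1 to make 0 an interior point, where two-sided
    derivatives exist. On \<open>[-1, 0]\<close> the slope is \<open>c 0\<close>, and subtracting
    \<open>c 0\<close> gives \<open>\<sigma> 0 = 0\<close>.\<close>
  define \<sigma> where "\<sigma> t = integral {-1..t} (G 0) - c 0" for t
  have intG: "G 0 integrable_on {a..b}" if "b < 1" for a b
    by (intro integrable_continuous_real contG) (use that in auto)
  have d\<sigma>: "(\<sigma> has_real_derivative G 0 t) (at t)" if t: "-1 < t" "t < 1" for t
  proof -
    define b where "b = (t + 1) / 2"
    have b: "t < b" "b < 1" using t by (auto simp: b_def)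
    have "((\<lambda>t. integral {-1..t} (G 0)) has_real_derivative G 0 t) (at t within {-1..b})"
      by (rule integral_has_real_derivative) (use b t in \<open>auto intro: contG\<close>)
    then have "((\<lambda>t. integral {-1..t} (G 0)) has_real_derivative G 0 t) (at t)"
      using at_within_interior[of t "{-1..b}"] b t by (simp add: interior_atLeastAtMost_real)
    then show ?thesis unfolding \<sigma>_def[abs_def] by (auto intro!: derivative_eq_intros)
  qed
  have diff: "\<sigma> t - \<sigma> s = integral {s..t} (G 0)" if "-1 \<le> s" "s \<le> t" "t < 1" for s t
    using Henstock_Kurzweil_Integration.integral_combine[OF that(1,2) intG[OF that(3)]] by (simp add: \<sigma>_def)
  have \<sigma>0: "\<sigma> 0 = 0"
  proof -
    have "integral {-1..0} (G 0) = integral {-1..0} (\<lambda>t::real. c 0)"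
      using mid_pos[of 0] by (intro integral_cong Gneg) auto
    then show ?thesis by (simp add: \<sigma>_def)
  qed
  have incr: "c 0 * (t - s) \<le> \<sigma> t - \<sigma> s" if "-1 \<le> s" "s \<le> t" "t < 1" for s t
  proof -
    have "integral {s..t} (\<lambda>_. c 0) \<le> integral {s..t} (G 0)"
      using that by (intro integral_le intG Gge) auto
    then show ?thesis using diff[OF that] that by (simp add: mult.commute)
  qed
  have smono: "\<sigma> s < \<sigma> t" if "-1 \<le> s" "s < t" "t < 1" for s t
    proof -
    have "0 < c 0 * (t - s)" using that c0 by (intro mult_pos_pos) auto
    then show ?thesis using incr[of s t] that by simp
  qed
  have lin: "\<sigma> t = \<sigma> (knot k) + c k * (t - knot k)" if t: "t \<in> {knot k..mid k}" for k t
  proof -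
    have k0: "0 \<le> knot k" using knot_mono[of 0 k] by simp
    have t1: "t < 1" using t knot_mid(2)[of k] knot_less_1[of "Suc k"] by auto
    have "\<sigma> t - \<sigma> (knot k) = integral {knot k..t} (G 0)" using t k0 t1 by (intro diff) auto
    also have "\<dots> = integral {knot k..t} (\<lambda>_. c k)" using t by (intro integral_cong Gknot) auto
    also have "\<dots> = c k * (t - knot k)" using t by simp
    finally show ?thesis by simp
  qed
  have large: "real k \<le> \<sigma> (knot k)" for k
  proof (induction k)
    case (Suc k)
    have k0: "0 \<le> knot k" using knot_mono[of 0 k] by simp
    have "\<sigma> (mid k) = \<sigma> (knot k) + c k * (mid k - knot k)" using knot_mid(1)[of k] by (intro lin) auto
    moreover have "\<sigma> (mid k) < \<sigma> (knot (Suc k))"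
      using knot_mid[of k] k0 knot_less_1[of "Suc k"] by (intro smono) auto
    ultimately show ?case using Suc clen[of k] by simp
  qed (simp add: \<sigma>0)
  have cont\<sigma>: "continuous_on A \<sigma>" if "A \<subseteq> {-1<..<1}" for A
  proof (rule continuous_at_imp_continuous_on, rule ballI)
    fix t assume "t \<in> A"
    then have "-1 < t" "t < 1" using that by auto
    then show "isCont \<sigma> t" by (rule DERIV_isCont[OF d\<sigma>])
  qed
  have sm: "strict_mono_on {0..<1} \<sigma>" by (auto simp: strict_mono_on_def intro: smono)
  have img: "\<sigma> ` {0..<1} = {0..}"
  proof (intro equalityI subsetI)
    fix y assume "y \<in> \<sigma> ` {0..<1}"
    then obtain t where t: "0 \<le> t" "t < 1" "y = \<sigma> t" by auto
    then show "y \<in> {0..}" using smono[of 0 t] \<sigma>0 by (cases "t = 0") auto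
  next
    fix y :: real assume y: "y \<in> {0..}"
    obtain k where k: "y \<le> real k" using real_arch_simple by blast
    have k0: "0 \<le> knot k" using knot_mono[of 0 k] by simp
    have "y \<le> \<sigma> (knot k)" using k large[of k] by simp
    moreover have "continuous_on {0..knot k} \<sigma>" using knot_less_1[of k] by (intro cont\<sigma>) auto
    ultimately obtain t where "0 \<le> t" "t \<le> knot k" "\<sigma> t = y"
      using IVT'[of \<sigma> 0 y "knot k"] y k0 \<sigma>0 by auto
    then show "y \<in> \<sigma> ` {0..<1}" using knot_less_1[of k] by (intro image_eqI[of _ _ t]) auto
  qed
  have bij: "bij_betw \<sigma> {0..<1} {0..}"
    using img strict_mono_on_imp_inj_on[OF sm] by (simp add: bij_betw_def)
  have smooth\<sigma>: "smooth_on_interval {0..<1} \<sigma>"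
    unfolding smooth_on_interval_def
  proof (intro exI[of _ "\<lambda>k. case k of 0 \<Rightarrow> \<sigma> | Suc j \<Rightarrow> G j"] conjI ballI allI)
    fix k t assume t: "t \<in> {0..<1::real}"
    show "((case k of 0 \<Rightarrow> \<sigma> | Suc j \<Rightarrow> G j) has_real_derivative (case Suc k of 0 \<Rightarrow> \<sigma> | Suc j \<Rightarrow> G j) t) (at t within {0..<1})"
    proof (cases k)
      case 0
      have "(\<sigma> has_real_derivative G 0 t) (at t)" using t by (intro d\<sigma>) auto
      then show ?thesis using 0 by (simp add: has_field_derivative_at_within)
    next
      case (Suc j)
      have "(G j has_real_derivative G (Suc j) t) (at t)" using t by (intro dG) auto
      then show ?thesis using Suc by (simp add: has_field_derivative_at_within)
    qed
  qed simp
  have inj: "inj_on \<sigma> {-1<..<1}"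
  proof (rule inj_onI)
    fix x y assume xy: "x \<in> {-1<..<1}" "y \<in> {-1<..<1}" "\<sigma> x = \<sigma> y"
    show "x = y" using smono[of x y] smono[of y x] xy by (cases x y rule: linorder_cases) auto
  qed
  \<comment> \<open>The inverse is taken on the larger open interval so that the inverse function
    theorem applies at 0 too.\<close>
  define \<tau> where "\<tau> = inv_into {-1<..<1} \<sigma>"
  have \<tau>\<sigma>: "\<tau> (\<sigma> t) = t" if "t \<in> {-1<..<1}" for t
    unfolding \<tau>_def by (rule inv_into_f_f[OF inj that])
  have \<tau>_in: "\<tau> y \<in> {0..<1}" if y: "y \<in> {0..}" for y
  proof -
    obtain t where "t \<in> {0..<1}" "y = \<sigma> t" using y img by blast
    then show ?thesis using \<tau>\<sigma>[of t] by simp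
  qed
  have \<tau>_inv: "inv_into {0..<1} \<sigma> y = \<tau> y" if y: "y \<in> {0..}" for y
  proof -
    obtain t where t: "t \<in> {0..<1}" "y = \<sigma> t" using y img by blast
    then show ?thesis
      using inv_into_f_f[OF strict_mono_on_imp_inj_on[OF sm] t(1)] \<tau>\<sigma>[of t] by simp
  qed
  define r where "r t = inverse (G 0 t)" for t
  have d\<tau>: "(\<tau> has_real_derivative r (\<tau> y)) (at y)" if y: "y \<in> {0..}" for y
  proof -
    obtain t where t: "t \<in> {0..<1}" "y = \<sigma> t" using y img by blast
    have "(\<tau> has_field_derivative inverse (G 0 t)) (at (\<sigma> t))"
      unfolding has_field_derivative_def
    proof (rule has_derivative_inverse_strong[where f = \<sigma> and x = t and S = "{-1<..<1}" and f' = "(*) (G 0 t)"])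
      have "G 0 t \<noteq> 0" using Gpos[of t] t by simp
      then show "(*) (G 0 t) \<circ> (*) (inverse (G 0 t)) = id" by (auto simp: fun_eq_iff)
      show "(\<sigma> has_derivative (*) (G 0 t)) (at t)"
        using t d\<sigma>[of t] by (simp add: has_field_derivative_def)
      show "open {-1<..<1::real}" by simp
      show "t \<in> {-1<..<1}" using t by simp
      show "continuous_on {-1<..<1} \<sigma>" by (rule cont\<sigma>) simp
    qed (rule \<tau>\<sigma>)
    then show ?thesis using t \<tau>\<sigma>[of t] by (simp add: r_def)
  qed
  \<comment> \<open>The derivative of \<tau> is \<open>r\<close> evaluated at \<tau>. By the chain
    rule each further differentiation adds a factor \<open>r\<close>, and the derivative of
    \<open>r\<close> is again a polynomial in \<open>r\<close> and \<open>G 1\<close>. So all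
    derivatives of \<tau> are elements of this algebra evaluated at \<tau>.\<close>
  define B where "B = insert r (range G)"
  have GB: "G j \<in> alg B" and rB: "r \<in> alg B" for j by (auto simp: B_def intro: alg.base)
  have dB: "\<exists>f'\<in>alg B. \<forall>x\<in>{0..<1}. (f has_real_derivative f' x) (at x within {0..<1})" if fB: "f \<in> B" for f
  proof -
    consider "f = r" | j where "f = G j" using fB by (auto simp: B_def)
    then show ?thesis
    proof cases
      case 1
      have m1: "(\<lambda>x. (-1) * (G 1 x * (r x * r x))) \<in> alg B" by (intro alg.mult alg.const GB rB)
      have m2: "(r has_real_derivative (-1) * (G 1 x * (r x * r x))) (at x within {0..<1})" if "x \<in> {0..<1}" for x
      proof -
        have g: "(G 0 has_real_derivative G 1 x) (at x within {0..<1})"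
          using dG[of x 0] that by (simp add: has_field_derivative_at_within)
        have "G 0 x \<noteq> 0" using Gpos[of x] that by simp
        from DERIV_inverse_fun[OF g this] show ?thesis
          unfolding r_def[abs_def] by (simp add: mult.assoc mult.commute mult.left_commute)
      qed
      show ?thesis unfolding 1 by (rule bexI[OF _ m1]) (rule ballI, rule m2)
    next
      case 2
      have m: "(G j has_real_derivative G (Suc j) x) (at x within {0..<1})" if "x \<in> {0..<1}" for x
        using dG[of x j] that by (simp add: has_field_derivative_at_within)
      show ?thesis unfolding 2 by (rule bexI[OF _ GB]) (rule ballI, rule m)
    qed
  qed
  have dalg: "\<exists>f'\<in>alg B. \<forall>y\<in>{0..}. ((\<lambda>y. f (\<tau> y)) has_real_derivative f' (\<tau> y)) (at y within {0..})" if f: "f \<in> alg B" for f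
  proof -
    obtain D where D: "D 0 = f" "\<And>k. D k \<in> alg B"
      "\<And>k x. x \<in> {0..<1} \<Longrightarrow> (D k has_real_derivative D (Suc k) x) (at x within {0..<1})"
      by (rule alg_chain[OF dB f]) auto
    have m: "((\<lambda>y. f (\<tau> y)) has_real_derivative D 1 (\<tau> y) * r (\<tau> y)) (at y within {0..})" if y: "y \<in> {0..}" for y
    proof -
      have 1: "(f has_real_derivative D 1 (\<tau> y)) (at (\<tau> y) within {0..<1})"
        using D(3)[OF \<tau>_in[OF y], of 0] D(1) by simp
      have sub: "\<tau> ` {0..} \<subseteq> {0..<1}" using \<tau>_in by blast
      have 2: "(\<tau> has_real_derivative r (\<tau> y)) (at y within {0..})"
        by (rule has_field_derivative_at_within[OF d\<tau>[OF y]])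
      from DERIV_image_chain[OF DERIV_subset[OF 1 sub] 2] show ?thesis by (simp add: o_def)
    qed
    have mem: "(\<lambda>x. D 1 x * r x) \<in> alg B" by (intro alg.mult D(2) rB)
    show ?thesis by (rule bexI[OF _ mem]) (rule ballI, rule m)
  qed
  have "\<exists>E. \<forall>n. (E n \<in> alg B \<and> (n = 0 \<longrightarrow> E n = r)) \<and>
      (\<forall>y\<in>{0..}. ((\<lambda>y. E n (\<tau> y)) has_real_derivative E (Suc n) (\<tau> y)) (at y within {0..}))"
    by (rule dependent_nat_choice) (use rB dalg in auto)
  then obtain E where E: "E 0 = r"
    "\<And>n y. y \<in> {0..} \<Longrightarrow> ((\<lambda>y. E n (\<tau> y)) has_real_derivative E (Suc n) (\<tau> y)) (at y within {0..})"
    by blast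
  have smooth\<tau>: "smooth_on_interval {0..} (inv_into {0..<1} \<sigma>)"
    unfolding smooth_on_interval_def
  proof (intro exI[of _ "\<lambda>k. case k of 0 \<Rightarrow> \<tau> | Suc j \<Rightarrow> (\<lambda>y. E j (\<tau> y))"] conjI ballI allI)
    fix y assume "y \<in> {0::real..}"
    then show "(case 0 of 0 \<Rightarrow> \<tau> | Suc j \<Rightarrow> (\<lambda>y. E j (\<tau> y))) y = inv_into {0..<1} \<sigma> y"
      by (simp add: \<tau>_inv)
  next
    fix k y assume y: "y \<in> {0::real..}"
    show "((case k of 0 \<Rightarrow> \<tau> | Suc j \<Rightarrow> (\<lambda>y. E j (\<tau> y))) has_real_derivative
        (case Suc k of 0 \<Rightarrow> \<tau> | Suc j \<Rightarrow> (\<lambda>y. E j (\<tau> y))) y) (at y within {0..})"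
      using has_field_derivative_at_within[OF d\<tau>[OF y]] E(1) E(2)[OF y] by (cases k) auto
  qed
  have "increasing_diffeo \<sigma> {0..<1} {0..}"
    unfolding increasing_diffeo_def using bij sm smooth\<sigma> smooth\<tau> by blast
  moreover have "(\<sigma> has_real_derivative G 0 t) (at t within {0..<1})" if "t \<in> {0..<1}" for t
    using that by (intro has_field_derivative_at_within[OF d\<sigma>]) auto
  moreover have "continuous_on {0..<1} (G 0)" by (rule contG) auto
  ultimately show thesis using Gpos lin Gknot by (intro that[of \<sigma> "G 0"]) auto
qed

subsection \<open>Changing a flow on a null set\<close>

lemma complete_measure_lebesgue_on:
  assumes "S \<in> sets lebesgue"
  shows "complete_measure (lebesgue_on S)"
proof
  fix A B assume "A \<subseteq> B" "B \<in> null_sets (lebesgue_on S)"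
  then have "B \<in> null_sets lebesgue" "A \<subseteq> S" "A \<subseteq> B"
    using assms by (auto simp: null_sets_restrict_space)
  then have "A \<in> sets lebesgue" "A \<subseteq> S" using completion.complete by blast+
  then show "A \<in> sets (lebesgue_on S)" using assms by (auto simp: sets_restrict_space_iff)
qed

lemma measurable_lebesgue_on_cong_AE:
  fixes f g :: "'a::euclidean_space \<Rightarrow> real"
  assumes S: "S \<in> sets lebesgue" and ae: "AE x in lebesgue_on S. f x = g x"
    and f: "f \<in> borel_measurable (lebesgue_on S)"
  shows "g \<in> borel_measurable (lebesgue_on S)"
proof (rule measurableI)
  interpret complete_measure "lebesgue_on S" by (rule complete_measure_lebesgue_on[OF S])
  fix A :: "real set" assume A: "A \<in> sets borel"
  show "g -` A \<inter> space (lebesgue_on S) \<in> sets (lebesgue_on S)"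
  proof (rule in_sets_AE)
    show "f -` A \<inter> space (lebesgue_on S) \<in> sets (lebesgue_on S)"
      using f A by (rule measurable_sets)
    show "AE x in lebesgue_on S. x \<in> f -` A \<inter> space (lebesgue_on S) \<longleftrightarrow> x \<in> g -` A \<inter> space (lebesgue_on S)"
      using ae by eventually_elim auto
  qed simp
qed simp

text \<open>
  If one function is not measurable then, the measure being complete, neither is the other, and both
  integrals take the junk value 0.
\<close>

lemma LINT_lebesgue_on_cong_AE:
  fixes f g :: "'a::euclidean_space \<Rightarrow> real"
  assumes S: "S \<in> sets lebesgue" and ae: "AE x in lebesgue_on S. f x = g x"
  shows "(LINT x|lebesgue_on S. f x) = (LINT x|lebesgue_on S. g x)"
proof (cases "f \<in> borel_measurable (lebesgue_on S)")
  case True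
  show ?thesis by (rule integral_cong_AE[OF True measurable_lebesgue_on_cong_AE[OF S ae True] ae])
next
  case False
  have "AE x in lebesgue_on S. g x = f x" using ae by eventually_elim simp
  from measurable_lebesgue_on_cong_AE[OF S this] have "g \<notin> borel_measurable (lebesgue_on S)"
    using False by blast
  then have "\<not> integrable (lebesgue_on S) f" "\<not> integrable (lebesgue_on S) g"
    using False borel_measurable_integrable by blast+
  then show ?thesis by (simp add: not_integrable_integral_eq)
qed

lemma LINT_torus_cong_AE:
  fixes f g :: "real^'n \<Rightarrow> real"
  shows "AE x in torus. f x = g x \<Longrightarrow> (LINT x|torus. f x) = (LINT x|torus. g x)"
  unfolding torus_def by (rule LINT_lebesgue_on_cong_AE) auto

text \<open>For an arbitrary flow nothing is known about measurability of the inner or outer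
  integrand, so both integrals are compared by the congruence rules that hold for every
  function.\<close>

lemma weak_solution_mono_AE:
  fixes v w :: "real \<Rightarrow> real^'n \<Rightarrow> real^'n"
  assumes ae: "AE t in lebesgue_on (time_interval s T'). AE x in torus. v t x = w t x"
    and sol: "weak_solution v T' \<nu> s \<theta>\<^sub>0 \<theta>"
  shows "weak_solution w T' \<nu> s \<theta>\<^sub>0 \<theta>"
proof -
  let ?I = "time_interval s T'"
  have "(LINT t|lebesgue_on ?I. LINT x|torus. \<theta> t x * (dir_deriv (1, 0) \<phi> (t, x) + \<nu> * laplacian_x \<phi> (t, x)
          + dir_deriv (0, w t x) \<phi> (t, x)))
      = (LINT t|lebesgue_on ?I. LINT x|torus. \<theta> t x * (dir_deriv (1, 0) \<phi> (t, x) + \<nu> * laplacian_x \<phi> (t, x)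
          + dir_deriv (0, v t x) \<phi> (t, x)))" for \<phi> :: "real \<times> (real^'n) \<Rightarrow> real"
  proof (rule LINT_lebesgue_on_cong_AE[OF time_interval_lebesgue])
    show "AE t in lebesgue_on ?I. (LINT x|torus. \<theta> t x * (dir_deriv (1, 0) \<phi> (t, x) + \<nu> * laplacian_x \<phi> (t, x)
          + dir_deriv (0, w t x) \<phi> (t, x)))
      = (LINT x|torus. \<theta> t x * (dir_deriv (1, 0) \<phi> (t, x) + \<nu> * laplacian_x \<phi> (t, x)
          + dir_deriv (0, v t x) \<phi> (t, x)))"
      using ae
    proof eventually_elim
      case (elim t)
      show ?case by (rule LINT_torus_cong_AE) (use elim in eventually_elim, simp)
    qed
  qed
  then show ?thesis using sol unfolding weak_solution_def by presburger
qed

text \<open>Equivalent predicates have the same solutions, so \<open>SOME\<close> in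
  \<open>solution_op\<close> can be analysed with the modified flow.\<close>

lemma weak_solution_cong_AE:
  assumes "AE t in lebesgue_on (time_interval s T'). AE x in torus. v t x = w t x"
  shows "weak_solution v T' \<nu> s \<theta>\<^sub>0 \<theta> \<longleftrightarrow> weak_solution w T' \<nu> s \<theta>\<^sub>0 \<theta>"
proof -
  have "AE t in lebesgue_on (time_interval s T'). AE x in torus. w t x = v t x"
    using assms by (auto elim!: eventually_mono)
  then show ?thesis using weak_solution_mono_AE[OF assms] weak_solution_mono_AE by blast
qed

lemma AE_time_interval_mono:
  assumes "AE t in lebesgue_on (time_interval 0 T'). P t" "0 \<le> s"
  shows "AE t in lebesgue_on (time_interval s T'). P t"
proof -
  have "AE t in lebesgue. t \<in> time_interval 0 T' \<longrightarrow> P t"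
    using assms(1) time_interval_lebesgue[of 0 T'] by (subst (asm) AE_restrict_space_iff) auto
  then have "AE t in lebesgue. t \<in> time_interval s T' \<longrightarrow> P t"
    by eventually_elim (use assms(2) in \<open>auto simp: time_interval_def\<close>)
  then show ?thesis using time_interval_lebesgue[of s T'] by (subst AE_restrict_space_iff) auto
qed

lemma time_interval_0_infinity: "time_interval 0 \<infinity> = {0..}"
  by (auto simp: time_interval_def)

lemma dir_deriv_scaleR: "smooth \<psi> \<Longrightarrow> dir_deriv (c *\<^sub>R e) \<psi> x = c * dir_deriv e \<psi> x"
  using linear_scale[OF has_derivative_linear[OF smooth_has_derivative[of \<psi> x]], of c e] by simp

lemma tame_scaleR:
  assumes "tame M w"
  shows "tame (\<bar>c\<bar> * M) (\<lambda>x. c *\<^sub>R w x)"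
  unfolding tame_def
proof (intro conjI allI impI)
  show "(\<lambda>x. c *\<^sub>R w x) \<in> borel_measurable torus"
    using assms by (auto simp: tame_def intro: borel_measurable_scaleR)
  show "norm (c *\<^sub>R w x) \<le> \<bar>c\<bar> * M" for x
    using assms by (auto simp: tame_def intro: mult_left_mono)
  fix \<psi> :: "real^'a \<Rightarrow> real" assume "smooth \<psi> \<and> periodic \<psi>"
  then show "(LINT x|torus. dir_deriv (c *\<^sub>R w x) \<psi> x) = 0"
    using assms by (simp add: dir_deriv_scaleR tame_def)
qed

lemma tame_zero:
  assumes "0 \<le> M"
  shows "tame M (\<lambda>x. 0)"
proof -
  have "dir_deriv 0 \<psi> x = 0" if "smooth \<psi>" for \<psi> :: "real^'a \<Rightarrow> real" and x
    using dir_deriv_scaleR[OF that, where c = 0 and e = 0 and x = x] by simp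
  then show ?thesis using assms by (auto simp: tame_def intro!: integral_eq_zero_AE)
qed

lemma tame_mono: "tame M w \<Longrightarrow> M \<le> M' \<Longrightarrow> tame M' w"
  unfolding tame_def using order_trans by blast

text \<open>Each component of the flow agrees almost everywhere with a Borel function. Fubini's
  theorem turns null sets of space-time into null sets of space at almost every time. The field is
  set to 0 at the remaining times and wherever the bound fails.\<close>

lemma nice_version:
  fixes u :: "real \<Rightarrow> real^'n \<Rightarrow> real^'n"
  assumes L: "Linf_loc \<infinity> u" and div: "divergence_free \<infinity> u"
  obtains u' where "nice \<infinity> u'"
    "AE t in lebesgue_on (time_interval 0 \<infinity>). AE x in torus. u t x = u' t x"
proof -
  define g where "g p = (if p \<in> {0..} \<times> UNIV then u (fst p) (snd p) else 0)" for p :: "real \<times> (real^'n)"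
  have cl: "closed ({0::real..} \<times> (UNIV :: (real^'n) set))" by (intro closed_Times) auto
  have half: "{0::real..} \<times> (UNIV :: (real^'n) set) \<in> sets lebesgue"
    using borel_closed[OF cl] by (intro sets_completionI_sets) simp
  have g: "g \<in> borel_measurable lebesgue"
    unfolding g_def
    by (rule borel_measurable_if_I[OF _ half])
      (use L in \<open>simp add: Linf_loc_def time_interval_0_infinity case_prod_unfold\<close>)
  have "\<exists>W. W \<in> borel_measurable lborel \<and> (AE p in lborel. g p $ i = W p)" for i
  proof -
    have "(\<lambda>p. g p \<bullet> axis i 1) \<in> borel_measurable lebesgue" using g by (intro borel_measurable_inner) auto
    then have "(\<lambda>p. g p $ i) \<in> borel_measurable lebesgue" by (simp add: inner_axis)
    from completion_ex_borel_measurable_real[OF this] show ?thesis by blast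
  qed
  then obtain W where W: "\<And>i. W i \<in> borel_measurable lborel" "\<And>i. AE p in lborel. g p $ i = W i p"
    by metis
  define V where "V p = (\<Sum>i\<in>UNIV. W i p *\<^sub>R axis i (1::real))" for p
  have V: "V \<in> borel_measurable borel" unfolding V_def using W(1) by measurable
  have Vi: "V p $ i = W i p" for p i
    by (simp add: V_def axis_def if_distrib cong: if_cong)
  have "AE p in lborel. \<forall>i\<in>UNIV. g p $ i = W i p" by (intro AE_finite_allI W) auto
  then have gV: "AE p in lborel. g p = V p" by eventually_elim (simp add: vec_eq_iff Vi)
  have fibre: "AE t in lborel. AE x in lborel. Q (t, x)" if "AE p in lborel. Q p" for Q :: "real \<times> (real^'n) \<Rightarrow> bool"
    by (rule lborel_pair.AE_pair) (subst lborel_prod, rule that)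
  have "\<forall>n. \<exists>C. AE p in lebesgue_on ({0..real n} \<times> UNIV). norm (u (fst p) (snd p)) \<le> C"
    using L by (auto simp: Linf_loc_def time_interval_0_infinity case_prod_unfold)
  from choice[OF this] obtain C where C: "\<And>n. AE p in lebesgue_on ({0..real n} \<times> UNIV). norm (u (fst p) (snd p)) \<le> C n"
    by blast
  have C': "AE p in lborel. p \<in> {0..real n} \<times> UNIV \<longrightarrow> norm (u (fst p) (snd p)) \<le> C n" for n
  proof -
    have cl: "closed ({0..real n} \<times> (UNIV :: (real^'n) set))" by (intro closed_Times) auto
    have "{0..real n} \<times> (UNIV :: (real^'n) set) \<in> sets lebesgue"
      using borel_closed[OF cl] by (intro sets_completionI_sets) simp
    then have "AE p in lebesgue. p \<in> {0..real n} \<times> UNIV \<longrightarrow> norm (u (fst p) (snd p)) \<le> C n"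
      using C[of n] by (subst (asm) AE_restrict_space_iff) auto
    then show ?thesis by (simp only: AE_completion_iff)
  qed
  have D: "AE t in lborel. t \<in> {0..} \<longrightarrow> (\<forall>\<psi>. smooth \<psi> \<and> periodic \<psi> \<longrightarrow> (LINT x|torus. dir_deriv (u t x) \<psi> x) = 0)"
  proof -
    have "AE t in lebesgue. t \<in> {0..} \<longrightarrow> (\<forall>\<psi>. smooth \<psi> \<and> periodic \<psi> \<longrightarrow> (LINT x|torus. dir_deriv (u t x) \<psi> x) = 0)"
      using div unfolding divergence_free_def time_interval_0_infinity
      by (subst (asm) AE_restrict_space_iff) auto
    then show ?thesis by (simp only: AE_completion_iff)
  qed
  have "AE t in lborel. \<forall>n. AE x in lborel. (t, x) \<in> {0..real n} \<times> UNIV \<longrightarrow> norm (u t x) \<le> C n"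
    using fibre[OF C'] by (subst AE_all_countable) simp
  with fibre[OF gV] D have "AE t in lborel. (AE x in lborel. g (t, x) = V (t, x)) \<and>
      (\<forall>n. AE x in lborel. (t, x) \<in> {0..real n} \<times> UNIV \<longrightarrow> norm (u t x) \<le> C n) \<and>
      (t \<in> {0..} \<longrightarrow> (\<forall>\<psi>. smooth \<psi> \<and> periodic \<psi> \<longrightarrow> (LINT x|torus. dir_deriv (u t x) \<psi> x) = 0))"
    by eventually_elim blast
  then obtain N where good: "\<And>t. t \<in> space lborel - N \<Longrightarrow> (AE x in lborel. g (t, x) = V (t, x)) \<and>
      (\<forall>n. AE x in lborel. (t, x) \<in> {0..real n} \<times> UNIV \<longrightarrow> norm (u t x) \<le> C n) \<and>
      (t \<in> {0..} \<longrightarrow> (\<forall>\<psi>. smooth \<psi> \<and> periodic \<psi> \<longrightarrow> (LINT x|torus. dir_deriv (u t x) \<psi> x) = 0))"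
    and N: "N \<in> null_sets lborel"
    by (rule AE_E3) blast
  have torus_AE: "AE x in torus. P x" if "AE x in lborel. P x" for P :: "real^'n \<Rightarrow> bool"
    by (rule AE_torus_if_lebesgue) (simp add: AE_completion_iff that)
  \<comment> \<open>The essential bounds \<open>C n\<close> are arbitrary choices, possibly negative
    or not monotone in \<open>n\<close>; these sums are nonnegative and monotone.\<close>
  define K where "K n = (\<Sum>j\<le>n. \<bar>C j\<bar>)" for n
  have K_mono: "K m \<le> K n" if "m \<le> n" for m n unfolding K_def using that by (intro sum_mono2) auto
  have K0: "0 \<le> K n" for n unfolding K_def by (intro sum_nonneg) auto
  have CK: "C n \<le> K n" for n
    unfolding K_def using member_le_sum[of n "{..n}" "\<lambda>j. \<bar>C j\<bar>"] by fastforce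
  \<comment> \<open>At a good time the bound fails only on a null set of \<open>x\<close>, so the
    cut-off changes no integral over the cell, and the divergence condition survives.\<close>
  define G where "G t x \<longleftrightarrow> t \<in> {0..} - N \<and> norm (V (t, x)) \<le> K (nat \<lceil>t\<rceil>)" for t x
  define u' where "u' t x = (if G t x then V (t, x) else 0)" for t x
  have u'_eq: "AE x in torus. u t x = u' t x" if "t \<in> {0..} - N" for t
  proof -
    have "t \<le> real (nat \<lceil>t\<rceil>)" by linarith
    then have "AE x in lborel. norm (u t x) \<le> C (nat \<lceil>t\<rceil>)" and "AE x in lborel. g (t, x) = V (t, x)"
      using good[of t] that by auto
    then have "AE x in lborel. u t x = u' t x"
    proof eventually_elim
      case (elim x)
      have "V (t, x) = u t x" using elim(2) that by (simp add: g_def)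
      moreover have "norm (u t x) \<le> K (nat \<lceil>t\<rceil>)" using elim(1) CK order_trans by blast
      ultimately show ?case using that by (simp add: u'_def G_def)
    qed
    then show ?thesis by (rule torus_AE)
  qed
  have bor: "(\<lambda>(t, x). u' t x) \<in> borel_measurable borel"
  proof -
    have [measurable]: "N \<in> sets borel" using N by auto
    have [measurable]: "V \<in> borel_measurable borel" by (rule V)
    have [measurable]: "(fst :: real \<times> (real^'n) \<Rightarrow> real) \<in> borel_measurable borel"
      by (intro borel_measurable_continuous_onI continuous_intros)
    have "(\<lambda>p. if fst p \<in> {0..} - N \<and> norm (V p) \<le> K (nat \<lceil>fst p\<rceil>) then V p else 0) \<in> borel_measurable borel"
      by measurable
    then show ?thesis by (simp add: u'_def G_def case_prod_unfold cong: if_cong)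
  qed
  have tame: "tame (K (nat \<lceil>t\<rceil>)) (u' t)" if t: "0 \<le> t" for t
  proof (cases "t \<in> N")
    case True
    then have "u' t = (\<lambda>x. 0)" by (simp add: u'_def G_def fun_eq_iff)
    then show ?thesis by (simp only: tame_zero[OF K0])
  next
    case False
    have "(\<lambda>x. (\<lambda>(t, x). u' t x) (t, x)) \<in> borel_measurable borel"
      by (rule measurable_compose[OF _ bor]) (intro borel_measurable_continuous_onI continuous_intros)
    then have "u' t \<in> borel_measurable torus" by (intro measurable_borel_torus) simp
    moreover have "norm (u' t x) \<le> K (nat \<lceil>t\<rceil>)" for x using K0 by (simp add: u'_def G_def)
    moreover have "(LINT x|torus. dir_deriv (u' t x) \<psi> x) = 0" if "smooth \<psi> \<and> periodic \<psi>" for \<psi>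
    proof -
      have tN: "t \<in> {0..} - N" using t False by simp
      have "(LINT x|torus. dir_deriv (u' t x) \<psi> x) = (LINT x|torus. dir_deriv (u t x) \<psi> x)"
        by (rule LINT_torus_cong_AE) (use u'_eq[OF tN] in eventually_elim, simp)
      then show ?thesis using good[of t] tN that by simp
    qed
    ultimately show ?thesis by (simp add: tame_def)
  qed
  have "nice \<infinity> u'"
    unfolding nice_def
  proof (intro conjI ballI exI)
    fix T t :: real assume "t \<in> {0..T}"
    then have "0 \<le> t" "t \<le> T" by auto
    moreover from \<open>t \<le> T\<close> have "nat \<lceil>t\<rceil> \<le> nat \<lceil>T\<rceil>" by (intro nat_mono ceiling_mono)
    ultimately show "tame (K (nat \<lceil>T\<rceil>)) (u' t)" using tame_mono[OF tame K_mono] by blast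
  qed (rule bor)
  moreover have "AE t in lebesgue_on (time_interval 0 \<infinity>). AE x in torus. u t x = u' t x"
  proof -
    have "AE t in lebesgue. t \<notin> N" using AE_not_in[OF N] by (simp add: AE_completion_iff)
    then have "AE t in lebesgue. t \<in> {0..} \<longrightarrow> (AE x in torus. u t x = u' t x)"
      by eventually_elim (use u'_eq in blast)
    then show ?thesis unfolding time_interval_0_infinity by (subst AE_restrict_space_iff) auto
  qed
  ultimately show thesis by (rule that)
qed

subsection \<open>The accelerated flow\<close>

text \<open>The exceptional times are the image of a null set under the inverse of \<sigma>, which
  is differentiable and therefore preserves null sets.\<close>

lemma AE_time_change:
  assumes \<sigma>: "increasing_diffeo \<sigma> {0..<1} {0..}"
    and ae: "AE t in lebesgue_on {0..}. P t"
  shows "AE t in lebesgue_on {0..<1}. P (\<sigma> t)"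
proof -
  let ?\<tau> = "inv_into {0..<1} \<sigma>"
  define N where "N = {t \<in> {0..}. \<not> P t}"
  have "smooth_on_interval {0..} ?\<tau>" using \<sigma> by (simp only: increasing_diffeo_def)
  then obtain D :: "nat \<Rightarrow> real \<Rightarrow> real" where D: "\<forall>t\<in>{0..}. D 0 t = ?\<tau> t"
    "\<forall>k. \<forall>t\<in>{0..}. (D k has_real_derivative D (Suc k) t) (at t within {0..})"
    unfolding smooth_on_interval_def by (elim exE conjE) (rule that)
  have "AE t in lebesgue. t \<in> {0..} \<longrightarrow> P t"
    using ae by (subst (asm) AE_restrict_space_iff) auto
  then have "{t \<in> space lebesgue. \<not> (t \<in> {0..} \<longrightarrow> P t)} \<in> null_sets lebesgue"
    by (simp only: completion.AE_iff_null_sets)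
  then have "negligible N" by (simp add: N_def negligible_iff_null_sets)
  moreover have "D 0 differentiable_on {0..}"
    unfolding differentiable_on_def using D(2)[THEN spec, of 0] real_differentiable_def by blast
  then have "D 0 differentiable_on N" by (rule differentiable_on_subset) (auto simp: N_def)
  ultimately have "negligible (D 0 ` N)" by (intro negligible_differentiable_image_negligible) auto
  then have "AE t in lebesgue. t \<notin> D 0 ` N" by (intro AE_not_in) (simp add: negligible_iff_null_sets)
  then have "AE t in lebesgue. t \<in> {0..<1} \<longrightarrow> P (\<sigma> t)"
  proof eventually_elim
    case (elim t)
    show ?case
    proof (rule impI, rule ccontr)
      assume t: "t \<in> {0..<1}" and "\<not> P (\<sigma> t)"
      have b: "inj_on \<sigma> {0..<1}" "\<sigma> t \<in> {0..}"
        using \<sigma> t by (auto simp: increasing_diffeo_def bij_betw_def)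
      have "\<sigma> t \<in> N" using b \<open>\<not> P (\<sigma> t)\<close> by (simp add: N_def)
      moreover have "D 0 (\<sigma> t) = t" using bspec[OF D(1) b(2)] inv_into_f_f[OF b(1) t] by simp
      ultimately show False using elim by (metis image_eqI)
    qed
  qed
  then show ?thesis by (subst AE_restrict_space_iff) auto
qed

text \<open>The accelerated flow with an explicit derivative and the value 0 outside
  \<open>[0, 1)\<close>, so that it is Borel on all of space-time.\<close>

definition scaled :: "(real \<Rightarrow> real) \<Rightarrow> (real \<Rightarrow> real) \<Rightarrow> (real \<Rightarrow> real^'n \<Rightarrow> real^'n) \<Rightarrow> real \<Rightarrow> real^'n \<Rightarrow> real^'n" where
  "scaled \<sigma> \<sigma>' u t x = (if t \<in> {0..<1} then \<sigma>' t *\<^sub>R u (\<sigma> t) x else 0)"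

lemma time_interval_0_1: "time_interval 0 1 = {0..<1}"
  by (auto simp: time_interval_def one_ereal_def)

lemma nice_scaled:
  fixes u :: "real \<Rightarrow> real^'n \<Rightarrow> real^'n"
  assumes \<sigma>: "increasing_diffeo \<sigma> {0..<1} {0..}"
    and d: "\<And>t. t \<in> {0..<1} \<Longrightarrow> (\<sigma> has_real_derivative \<sigma>' t) (at t within {0..<1})"
    and c: "continuous_on {0..<1} \<sigma>'" and u: "nice \<infinity> u"
  shows "nice 1 (scaled \<sigma> \<sigma>' u)"
  unfolding nice_def
proof (intro conjI ballI)
  have img: "\<sigma> t \<in> {0..}" if "t \<in> {0..<1}" for t
    using \<sigma> that by (auto simp: increasing_diffeo_def bij_betw_def)
  have mono: "\<sigma> s \<le> \<sigma> t" if "s \<in> {0..<1}" "t \<in> {0..<1}" "s \<le> t" for s t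
    using \<sigma> that strict_mono_onD[of "{0..<1}" \<sigma> s t] by (cases "s = t") (auto simp: increasing_diffeo_def)
  have c\<sigma>: "continuous_on {0..<1} \<sigma>" using d by (rule DERIV_continuous_on)
  define a where "a t = (if t \<in> {0..<1} then \<sigma> t else 0)" for t
  define b where "b t = (if t \<in> {0..<1} then \<sigma>' t else 0)" for t
  have a [measurable]: "a \<in> borel_measurable borel"
    unfolding a_def using c\<sigma> by (intro borel_measurable_continuous_on_if) auto
  have b [measurable]: "b \<in> borel_measurable borel"
    unfolding b_def using c by (intro borel_measurable_continuous_on_if) auto
  have fst_m: "(fst :: real \<times> (real^'n) \<Rightarrow> real) \<in> borel_measurable borel"
    and snd_m: "(snd :: real \<times> (real^'n) \<Rightarrow> real^'n) \<in> borel_measurable borel"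
    by (intro borel_measurable_continuous_onI continuous_intros)+
  have "(\<lambda>p. (a (fst p), snd p)) \<in> borel_measurable (borel :: (real \<times> (real^'n)) measure)"
    by (intro borel_measurable_Pair measurable_compose[OF fst_m a] snd_m)
  moreover have "(\<lambda>(t, x). u t x) \<in> borel_measurable borel" using u by (simp add: nice_def)
  ultimately have "(\<lambda>p. (\<lambda>(t, x). u t x) (a (fst p), snd p)) \<in> borel_measurable (borel :: (real \<times> (real^'n)) measure)"
    by (rule measurable_compose)
  then have "(\<lambda>p. b (fst p) *\<^sub>R u (a (fst p)) (snd p)) \<in> borel_measurable borel"
    by (intro borel_measurable_scaleR measurable_compose[OF fst_m b]) simp
  moreover have "(\<lambda>(t, x). scaled \<sigma> \<sigma>' u t x) = (\<lambda>p. b (fst p) *\<^sub>R u (a (fst p)) (snd p))"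
    by (auto simp: scaled_def a_def b_def fun_eq_iff)
  ultimately show "(\<lambda>(t, x). scaled \<sigma> \<sigma>' u t x) \<in> borel_measurable borel" by simp
  fix T assume T: "T \<in> time_interval 0 1"
  then have T': "T \<in> {0..<1}" by (simp add: time_interval_0_1)
  have "continuous_on {0..T} \<sigma>'" by (rule continuous_on_subset[OF c]) (use T' in auto)
  then have "bounded (\<sigma>' ` {0..T})" by (intro compact_imp_bounded compact_continuous_image) auto
  then obtain C where "\<forall>y\<in>\<sigma>' ` {0..T}. norm y \<le> C" unfolding bounded_iff ..
  then have C: "\<bar>\<sigma>' t\<bar> \<le> C" if "t \<in> {0..T}" for t using that by simp
  have "\<sigma> T \<in> time_interval 0 \<infinity>" using img[OF T'] by (simp add: time_interval_def)
  then have "\<exists>M. \<forall>t\<in>{0..\<sigma> T}. tame M (u t)" using u by (simp only: nice_def)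
  then obtain M where "\<forall>t\<in>{0..\<sigma> T}. tame M (u t)" ..
  then have M: "\<And>t. t \<in> {0..\<sigma> T} \<Longrightarrow> tame M (u t)" by (rule bspec)
  have "tame (C * M) (scaled \<sigma> \<sigma>' u t)" if t: "t \<in> {0..T}" for t
  proof -
    have t1: "t \<in> {0..<1}" using t T' by auto
    have tm: "tame M (u (\<sigma> t))" using img[OF t1] mono[OF t1 T'] t by (intro M) auto
    have "norm (u (\<sigma> t) 0) \<le> M" using tm by (simp add: tame_def)
    then have M0: "0 \<le> M" using norm_ge_zero order_trans by blast
    have "\<bar>\<sigma>' t\<bar> * M \<le> C * M" by (intro mult_right_mono C t M0)
    from tame_mono[OF tame_scaleR[OF tm] this]
    have "tame (C * M) (\<lambda>x. \<sigma>' t *\<^sub>R u (\<sigma> t) x)" .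
    moreover have "scaled \<sigma> \<sigma>' u t = (\<lambda>x. \<sigma>' t *\<^sub>R u (\<sigma> t) x)" using t1 by (simp add: scaled_def fun_eq_iff)
    ultimately show ?thesis by simp
  qed
  then show "\<exists>M. \<forall>t\<in>{0..T}. tame M (scaled \<sigma> \<sigma>' u t)" by blast
qed

lemma accelerated_eq_scaled:
  fixes u v :: "real \<Rightarrow> real^'n \<Rightarrow> real^'n"
  assumes \<sigma>: "increasing_diffeo \<sigma> {0..<1} {0..}"
    and d: "\<And>t. t \<in> {0..<1} \<Longrightarrow> (\<sigma> has_real_derivative \<sigma>' t) (at t within {0..<1})"
    and ae: "AE t in lebesgue_on (time_interval 0 \<infinity>). AE x in torus. u t x = v t x"
  shows "AE t in lebesgue_on (time_interval 0 1). AE x in torus. accelerated_flow \<sigma> u t x = scaled \<sigma> \<sigma>' v t x"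
proof -
  have vd: "vector_derivative \<sigma> (at t within {0..<1}) = \<sigma>' t" if t: "t \<in> {0..<1}" for t
  proof (rule vector_derivative_within)
    have "{0..<1} \<noteq> {x}" for x :: real
    proof
      assume e: "{0..<1} = {x}"
      have "0 \<in> {0..<1::real}" "1 / 2 \<in> {0..<1::real}" by auto
      then show False unfolding e by simp
    qed
    then have "t islimpt {0..<1}" by (intro connected_imp_perfect) (use t in auto)
    then show "at t within {0..<1} \<noteq> bot" by (simp add: trivial_limit_within)
    show "(\<sigma> has_vector_derivative \<sigma>' t) (at t within {0..<1})"
      using d[OF t] by (simp add: has_real_derivative_iff_has_vector_derivative)
  qed
  have "AE t in lebesgue_on {0..<1}. AE x in torus. u (\<sigma> t) x = v (\<sigma> t) x"
    using ae unfolding time_interval_0_infinity by (rule AE_time_change[OF \<sigma>])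
  then have "AE t in lebesgue. t \<in> {0..<1} \<longrightarrow> (AE x in torus. u (\<sigma> t) x = v (\<sigma> t) x)"
    by (subst (asm) AE_restrict_space_iff) auto
  then have "AE t in lebesgue. t \<in> {0..<1} \<longrightarrow> (AE x in torus. accelerated_flow \<sigma> u t x = scaled \<sigma> \<sigma>' v t x)"
  proof eventually_elim
    case (elim t)
    show ?case
    proof
      assume t: "t \<in> {0..<1}"
      show "AE x in torus. accelerated_flow \<sigma> u t x = scaled \<sigma> \<sigma>' v t x"
        using elim[rule_format, OF t]
      proof eventually_elim
        case (elim x)
        then show ?case using t by (simp only: accelerated_flow_def scaled_def vd if_True)
      qed
    qed
  qed
  then show ?thesis unfolding time_interval_0_1 by (subst AE_restrict_space_iff) auto
qed

subsection \<open>Contraction\<close>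

text \<open>The operator norm concerns the solution selected by \<open>SOME\<close> from normalized
  data. By uniqueness this is the given solution divided by its initial norm, up to null sets. From
  \<open>t\<close> to \<open>q\<close> the norm does not increase.\<close>

lemma halving:
  fixes u u' :: "real \<Rightarrow> real^'n \<Rightarrow> real^'n"
  assumes nice: "nice \<infinity> u'"
    and ae: "AE t in lebesgue_on (time_interval 0 \<infinity>). AE x in torus. u t x = u' t x"
    and nu: "\<nu> > 0" and s: "0 \<le> s" "s \<le> t" "t \<le> q"
    and op: "L2_0_opnorm (solution_op u \<infinity> \<nu> s t) \<le> 1 / 2"
    and sol: "fsol \<nu> u' {s..q} \<theta>" and ini: "\<theta> s \<in> L2_0"
  shows "L2_norm (\<theta> q) \<le> L2_norm (\<theta> s) / 2"
proof -
  define a where "a = L2_norm (\<theta> s)"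
  have curv: "curve {s..q} \<theta>" by (rule fsol_curve[OF sol])
  have le: "L2_norm (\<theta> q) \<le> L2_norm (\<theta> t)"
  proof (rule fsol_norm_mono[OF nice])
    show "fsol \<nu> u' {t..q} \<theta>" by (rule fsol_subset[OF sol]) (use s in auto)
  qed (use s nu in auto)
  have ineq: "L2_norm (\<theta> t) \<le> a / 2"
  \<comment> \<open>Zero data cannot be normalized; there monotonicity of the norm already gives
    0.\<close>
  proof (cases "a = 0")
    case True
    have "L2_norm (\<theta> t) \<le> L2_norm (\<theta> s)"
    proof (rule fsol_norm_mono[OF nice])
      show "fsol \<nu> u' {s..t} \<theta>" by (rule fsol_subset[OF sol]) (use s in auto)
    qed (use s nu in auto)
    then show ?thesis using True by (simp add: a_def)
  next
    case False
    then have a: "a > 0" by (simp add: a_def less_le)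
    define f where "f x = 1 / a * \<theta> s x" for x
    have f: "f \<in> L2_0" "L2_norm f \<le> 1"
    proof -
      have "f \<in> L2" unfolding f_def using ini by (intro L2_cmult L2_0_L2)
      moreover have "(LINT x|torus. f x) = 0" using ini by (simp add: f_def L2_0_def)
      ultimately show "f \<in> L2_0" by (simp add: L2_0_def)
      show "L2_norm f \<le> 1" using a unfolding f_def L2_norm_cmult by (simp add: a_def)
    qed
    note cong = weak_solution_cong_AE[OF AE_time_interval_mono[OF ae s(1)]]
    \<comment> \<open>\<open>SOME\<close> yields a solution because one exists for \<open>u'\<close>
      and the two flows have the same solutions.\<close>
    define \<Theta> where "\<Theta> = (SOME \<Theta>. weak_solution u \<infinity> \<nu> s f \<Theta>)"
    obtain \<Theta>' where "weak_solution u' \<infinity> \<nu> s f \<Theta>'"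
      by (rule weak_solution_exists[OF nice s(1) _ nu f(1)]) auto
    then have "weak_solution u \<infinity> \<nu> s f \<Theta>" unfolding \<Theta>_def cong by (rule someI[of "weak_solution u' \<infinity> \<nu> s f"])
    then have "weak_solution u' \<infinity> \<nu> s f \<Theta>" by (simp only: cong)
    then have \<Theta>: "fsol \<nu> u' (time_interval s \<infinity>) \<Theta>" "\<And>r. r \<in> time_interval s \<infinity> \<Longrightarrow> \<Theta> r \<in> L2_0"
      "AE x in torus. \<Theta> s x = f x"
      using weak_solution_iff_fsol[OF nice s(1) _ nu, of f \<Theta>] by auto
    have sub: "{s..t} \<subseteq> time_interval s \<infinity>" by (auto simp: time_interval_def)
    have sqi\<Theta>: "sqi (\<Theta> r)" if "r \<in> {s..t}" for r
      using \<Theta>(2) that sub L2_0_L2 L2_sqi by blast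
    have sqi\<theta>: "sqi (\<lambda>x. 1 / a * \<theta> r x)" if "r \<in> {s..t}" for r
      using that s by (intro sqi_cmult curve_sqi[OF curv]) auto
    have "L2_norm (\<lambda>x. \<Theta> t x - 1 / a * \<theta> t x) = 0"
    proof (rule fsol_unique[OF nice, where a = s and b = t and \<nu> = \<nu>])
      show "fsol \<nu> u' {s..t} \<Theta>" by (rule fsol_subset[OF \<Theta>(1) sub])
      show "fsol \<nu> u' {s..t} (\<lambda>t x. 1 / a * \<theta> t x)"
        by (rule fsol_cmult, rule fsol_subset[OF sol]) (use s in auto)
      have "s \<in> {s..t}" using s by simp
      have "L2_norm (\<lambda>x. \<Theta> s x - 1 / a * \<theta> s x) = L2_norm (\<lambda>x::real^'n. 0)"
      proof (rule L2_norm_cong)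
        show "AE x in torus. \<Theta> s x - 1 / a * \<theta> s x = 0" using \<Theta>(3) by eventually_elim (simp add: f_def)
        show "(\<lambda>x. \<Theta> s x - 1 / a * \<theta> s x) \<in> borel_measurable torus"
          using \<open>s \<in> {s..t}\<close> by (intro sqi_measurable sqi_diff sqi\<Theta> sqi\<theta>)
      qed simp
      then show "L2_norm (\<lambda>x. \<Theta> s x - 1 / a * \<theta> s x) = 0" by (simp add: L2_norm_def)
    qed (use s nu in auto)
    moreover have "\<bar>L2_norm (\<Theta> t) - L2_norm (\<lambda>x. 1 / a * \<theta> t x)\<bar> \<le> L2_norm (\<lambda>x. \<Theta> t x - 1 / a * \<theta> t x)"
      using s by (intro L2_norm_diff_ge sqi\<Theta> sqi\<theta>) auto
    ultimately have eq: "L2_norm (\<theta> t) / a = L2_norm (\<Theta> t)"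
      using a unfolding L2_norm_cmult by simp
    have "ennreal (L2_norm (solution_op u \<infinity> \<nu> s t f)) \<le> L2_0_opnorm (solution_op u \<infinity> \<nu> s t)"
      unfolding L2_0_opnorm_def by (rule SUP_upper) (use f in auto)
    also have "\<dots> \<le> 1 / 2" by (rule op)
    also have "1 / 2 = ennreal (1 / 2)" using divide_ennreal[of 1 2] by simp
    finally have "L2_norm (\<Theta> t) \<le> 1 / 2"
      by (subst (asm) ennreal_le_iff) (auto simp: solution_op_def \<Theta>_def)
    then show ?thesis using a by (simp add: eq[symmetric] field_simps)
  qed
  show ?thesis using le ineq by (simp add: a_def)
qed

text \<open>The supremum over initial times is below \<open>e / \<mu>\<close>, so the infimum at the
  given \<open>s\<close> is too, and strictness provides a time attaining the factor 1/2.\<close>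

lemma dissipation_timeD:
  assumes "ennreal \<mu> * dissipation_time u \<mu> < ennreal e" "\<mu> > 0" "0 \<le> s" "e / \<mu> \<le> l"
  obtains t where "s \<le> t" "t - s < l" "L2_0_opnorm (solution_op u \<infinity> \<mu> s t) \<le> 1 / 2"
proof -
  have e: "e > 0" using assms(1) by (metis ennreal_neg linorder_not_le not_less_zero)
  have "dissipation_time u \<mu> < ennreal (e / \<mu>)"
  proof (rule ccontr)
    assume "\<not> dissipation_time u \<mu> < ennreal (e / \<mu>)"
    then have "ennreal (e / \<mu>) \<le> dissipation_time u \<mu>" by simp
    then have "ennreal \<mu> * ennreal (e / \<mu>) \<le> ennreal \<mu> * dissipation_time u \<mu>" by (rule mult_left_mono) simp
    moreover have "ennreal \<mu> * ennreal (e / \<mu>) = ennreal e"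
      using assms(2) e by (simp add: ennreal_mult[symmetric])
    ultimately show False using assms(1) by simp
  qed
  moreover have "(INF t\<in>{t. s \<le> t \<and> L2_0_opnorm (solution_op u \<infinity> \<mu> s t) \<le> 1 / 2}. ennreal (t - s)) \<le> dissipation_time u \<mu>"
    unfolding dissipation_time_def by (rule SUP_upper) (use assms(3) in simp)
  ultimately have "(INF t\<in>{t. s \<le> t \<and> L2_0_opnorm (solution_op u \<infinity> \<mu> s t) \<le> 1 / 2}. ennreal (t - s)) < ennreal (e / \<mu>)"
    by (rule le_less_trans[rotated])
  then obtain t where t: "s \<le> t" "L2_0_opnorm (solution_op u \<infinity> \<mu> s t) \<le> 1 / 2" "ennreal (t - s) < ennreal (e / \<mu>)"
    by (auto simp: INF_less_iff)
  have "t - s < l" using t assms(4) by (simp add: ennreal_less_iff)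
  with t show thesis by (intro that) auto
qed

theorem theorem1p6:
  fixes u :: "real \<Rightarrow> real^'n \<Rightarrow> real^'n"
  assumes "Linf_loc \<infinity> u"
    and "divergence_free \<infinity> u"
    and "relaxation_enhancing u"
  shows "\<exists>\<sigma>. increasing_diffeo \<sigma> {0..<1} {0..} \<and>
    (\<forall>\<nu>>0. \<forall>s\<in>{0..<1}. \<forall>\<theta>\<^sub>0\<in>L2_0.
       L2_tendsto (\<lambda>t. solution_op (accelerated_flow \<sigma> u) 1 \<nu> s t \<theta>\<^sub>0) (\<lambda>x. 0) (at_left 1))"
proof -
  obtain u' where nice: "nice \<infinity> u'"
    and ae: "AE t in lebesgue_on (time_interval 0 \<infinity>). AE x in torus. u t x = u' t x"
    by (rule nice_version[OF assms(1,2)])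
  define len where "len k = mid k - knot k" for k
  have len: "len k > 0" for k using knot_mid(1)[of k] by (simp add: len_def)
  \<comment> \<open>At diffusivity \<open>\<nu> / c k\<close> this threshold bounds the dissipation
    time by \<open>c k * len k / (\<nu> * (k + 1))\<close>, which is at most
    \<open>c k * len k\<close> once \<open>\<nu> \<ge> 1 / (k + 1)\<close>.\<close>
  have "\<exists>\<delta>>0. \<forall>\<mu>. 0 < \<mu> \<and> \<mu> < \<delta> \<longrightarrow> ennreal \<mu> * dissipation_time u \<mu> < ennreal (len k / (real k + 1))" for k
  proof -
    have "0 < ennreal (len k / (real k + 1))" using len[of k] by simp
    then have "eventually (\<lambda>\<mu>. ennreal \<mu> * dissipation_time u \<mu> < ennreal (len k / (real k + 1))) (at_right 0)"
      using assms(3) unfolding relaxation_enhancing_def by (rule order_tendstoD(2)[rotated])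
    then show ?thesis by (auto simp: eventually_at_right_field)
  qed
  then obtain \<delta> where \<delta>: "\<And>k. \<delta> k > 0"
    "\<And>k \<mu>. 0 < \<mu> \<Longrightarrow> \<mu> < \<delta> k \<Longrightarrow> ennreal \<mu> * dissipation_time u \<mu> < ennreal (len k / (real k + 1))"
    by metis
  \<comment> \<open>The first summand forces \<open>\<nu> / c k < \<delta> k\<close> for all
    \<open>\<nu> \<le> k + 1\<close>; the second makes the affine piece advance \<sigma> by at least
    1.\<close>
  define f where "f k = (real k + 1) / \<delta> k + 1 / len k + 1" for k
  have f_parts: "0 < (real k + 1) / \<delta> k" "0 < 1 / len k" for k using \<delta>(1)[of k] len[of k] by auto
  have fpos: "f k > 0" for k using f_parts[of k] unfolding f_def by linarith
  \<comment> \<open>Partial sums, because \<open>time_change\<close> asks for nondecreasing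
    speeds.\<close>
  define c where "c k = (\<Sum>j\<le>k. f j)" for k
  have cf: "f k \<le> c k" for k
    unfolding c_def using fpos by (intro member_le_sum) (auto intro: less_imp_le)
  have c0: "c k > 0" for k using cf[of k] fpos[of k] by simp
  have cmono: "c k \<le> c (Suc k)" for k using fpos[of "Suc k"] by (simp add: c_def)
  have clen: "1 \<le> c k * (mid k - knot k)" for k
  proof -
    have "1 / len k \<le> c k" using cf[of k] f_parts[of k] unfolding f_def by linarith
    then show ?thesis using len[of k] by (simp add: field_simps len_def)
  qed
  have cdel: "\<nu> / c k < \<delta> k" if "\<nu> \<le> real k + 1" for \<nu> k
  proof -
    have "(real k + 1) / \<delta> k < c k" using cf[of k] f_parts[of k] unfolding f_def by linarith
    then have "real k + 1 < \<delta> k * c k" using \<delta>(1)[of k] by (simp add: field_simps)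
    then show ?thesis using that c0[of k] by (simp add: field_simps)
  qed
  obtain \<sigma> \<sigma>' :: "real \<Rightarrow> real" where \<sigma>: "increasing_diffeo \<sigma> {0..<1} {0..}"
    and d: "\<And>t. t \<in> {0..<1} \<Longrightarrow> (\<sigma> has_real_derivative \<sigma>' t) (at t within {0..<1})"
    and cont: "continuous_on {0..<1} \<sigma>'"
    and lin: "\<And>k t. t \<in> {knot k..mid k} \<Longrightarrow> \<sigma> t = \<sigma> (knot k) + c k * (t - knot k)"
    and slope: "\<And>k t. t \<in> {knot k..mid k} \<Longrightarrow> \<sigma>' t = c k"
    by (rule time_change[OF c0 cmono clen]) blast
  define v where "v = scaled \<sigma> \<sigma>' u'"
  have nv: "nice 1 v" unfolding v_def by (rule nice_scaled[OF \<sigma> d cont nice])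
  have aev: "AE t in lebesgue_on (time_interval 0 1). AE x in torus. accelerated_flow \<sigma> u t x = v t x"
    unfolding v_def by (rule accelerated_eq_scaled[OF \<sigma> d ae])
  have "L2_tendsto (\<lambda>t. solution_op (accelerated_flow \<sigma> u) 1 \<nu> s t \<theta>\<^sub>0) (\<lambda>x. 0) (at_left 1)"
    if nu: "\<nu> > 0" and s: "s \<in> {0..<1}" and \<theta>0: "\<theta>\<^sub>0 \<in> L2_0" for \<nu> s \<theta>\<^sub>0
  proof -
    have s0: "0 \<le> s" "ereal s < 1" using s by (auto simp: one_ereal_def)
    note cong = weak_solution_cong_AE[OF AE_time_interval_mono[OF aev s0(1)]]
    define \<Theta> where "\<Theta> = (SOME \<Theta>. weak_solution (accelerated_flow \<sigma> u) 1 \<nu> s \<theta>\<^sub>0 \<Theta>)"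
    obtain \<Theta>' where "weak_solution v 1 \<nu> s \<theta>\<^sub>0 \<Theta>'"
      by (rule weak_solution_exists[OF nv s0 nu \<theta>0]) auto
    then have "weak_solution (accelerated_flow \<sigma> u) 1 \<nu> s \<theta>\<^sub>0 \<Theta>" unfolding \<Theta>_def cong by (rule someI[of "weak_solution v 1 \<nu> s \<theta>\<^sub>0"])
    then have "weak_solution v 1 \<nu> s \<theta>\<^sub>0 \<Theta>" by (simp only: cong)
    then have sol: "fsol \<nu> v (time_interval s 1) \<Theta>"
      and mem: "\<And>t. t \<in> time_interval s 1 \<Longrightarrow> \<Theta> t \<in> L2_0"
      using weak_solution_iff_fsol[OF nv s0 nu] by auto
    have ti: "t \<in> time_interval s 1" if "s \<le> t" "t < 1" for t
      using that by (auto simp: time_interval_def one_ereal_def)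
    have decr: "L2_norm (\<Theta> b) \<le> L2_norm (\<Theta> a)" if "s \<le> a" "a \<le> b" "b < 1" for a b
    proof (rule fsol_norm_mono[OF nv])
      show "fsol \<nu> v {a..b} \<Theta>" by (rule fsol_subset[OF sol]) (use that in \<open>auto intro!: ti\<close>)
    qed (use that s0 nu in \<open>auto simp: one_ereal_def\<close>)
    have half: "L2_norm (\<Theta> (knot (Suc k))) \<le> L2_norm (\<Theta> (knot k)) / 2"
      if k: "s \<le> knot k" "\<nu> \<le> real k + 1" "1 / \<nu> \<le> real k + 1" for k
    proof -
      define s1 where "s1 = \<sigma> (knot k)"
      \<comment> \<open>On the \<open>k\<close>-th affine piece
        \<open>\<sigma> t = c k * t + e\<close>, and the piece is mapped onto \<open>[s1, q]\<close>
        in the time of \<open>u\<close>.\<close>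
      define e where "e = s1 - c k * knot k"
      define q where "q = s1 + c k * len k"
      have k0: "0 \<le> knot k" using knot_mono[of 0 k] by simp
      have mid1: "mid k < 1" using knot_mid(2)[of k] knot_less_1[of "Suc k"] by simp
      have ends: "c k * knot k + e = s1" "c k * mid k + e = q"
        by (auto simp: e_def q_def len_def algebra_simps)
      have s1: "0 \<le> s1"
        using \<sigma> k0 knot_less_1[of k] by (auto simp: s1_def increasing_diffeo_def bij_betw_def)
      have vk: "v t = (\<lambda>x. c k *\<^sub>R u' (c k * t + e) x)" if t: "t \<in> {knot k..mid k}" for t
      proof -
        have "t \<in> {0..<1}" using t k0 mid1 by auto
        moreover have "\<sigma> t = c k * t + e" using lin[OF t] by (simp add: e_def s1_def algebra_simps)
        ultimately show ?thesis using slope[OF t] by (simp add: v_def scaled_def fun_eq_iff)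
      qed
      have "fsol \<nu> v {knot k..mid k} \<Theta>"
        by (rule fsol_subset[OF sol]) (use k mid1 in \<open>auto intro!: ti\<close>)
      from fsol_affine[OF c0[of k] vk this, unfolded ends]
      have sol': "fsol (\<nu> / c k) u' {s1..q} (\<lambda>\<tau>. \<Theta> ((\<tau> - e) / c k))" .
      have \<mu>: "\<nu> / c k > 0" using nu c0 by simp
      \<comment> \<open>The lower bound on \<nu> makes the dissipation time fit into the affine
        piece.\<close>
      have "len k / (real k + 1) / (\<nu> / c k) \<le> c k * len k"
      proof -
        have "1 \<le> \<nu> * (real k + 1)" using k(3) nu by (simp add: field_simps)
        then have "c k * len k / (\<nu> * (real k + 1)) \<le> c k * len k / 1"
          using c0[of k] len[of k] by (intro divide_left_mono) auto
        then show ?thesis using c0[of k] nu by (simp add: field_simps)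
      qed
      then obtain t1 where t1: "s1 \<le> t1" "t1 - s1 < c k * len k"
        "L2_0_opnorm (solution_op u \<infinity> (\<nu> / c k) s1 t1) \<le> 1 / 2"
        by (rule dissipation_timeD[OF \<delta>(2)[OF \<mu> cdel[OF k(2)]] \<mu> s1])
      have pts: "(s1 - e) / c k = knot k" "(q - e) / c k = mid k"
        using c0[of k] by (auto simp: ends[symmetric])
      have "L2_norm (\<Theta> ((q - e) / c k)) \<le> L2_norm (\<Theta> ((s1 - e) / c k)) / 2"
      proof (rule halving[OF nice ae \<mu> s1 t1(1) _ t1(3) sol'])
        show "t1 \<le> q" using t1(2) by (simp add: q_def)
        show "\<Theta> ((s1 - e) / c k) \<in> L2_0" unfolding pts using k(1) knot_less_1 by (intro mem ti)
      qed
      \<comment> \<open>On the transition from \<open>mid k\<close> to \<open>knot (Suc k)\<close>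
        no decay is claimed, only that the norm does not grow.\<close>
      moreover have "L2_norm (\<Theta> (knot (Suc k))) \<le> L2_norm (\<Theta> (mid k))"
        using k(1) knot_mid[of k] knot_less_1[of "Suc k"] by (intro decr) auto
      ultimately show ?thesis unfolding pts by simp
    qed
    obtain K where K: "s < knot K" using knot_unbounded[of s] s by auto
    \<comment> \<open>From this index on the knots lie beyond \<open>s\<close> and \<nu> is in the
      admissible range, so every further interval halves the norm.\<close>
    define k0 where "k0 = K + nat \<lceil>\<nu>\<rceil> + nat \<lceil>1 / \<nu>\<rceil>"
    have k0: "K \<le> k0" "nat \<lceil>\<nu>\<rceil> \<le> k0" "nat \<lceil>1 / \<nu>\<rceil> \<le> k0" unfolding k0_def by linarith+
    have large: "s \<le> knot (k0 + j)" "\<nu> \<le> real (k0 + j) + 1" "1 / \<nu> \<le> real (k0 + j) + 1" for j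
    proof -
      show "s \<le> knot (k0 + j)" using K knot_mono[of K "k0 + j"] k0(1) by simp
      have "\<nu> \<le> real (nat \<lceil>\<nu>\<rceil>)" "1 / \<nu> \<le> real (nat \<lceil>1 / \<nu>\<rceil>)" by linarith+
      then show "\<nu> \<le> real (k0 + j) + 1" "1 / \<nu> \<le> real (k0 + j) + 1" using k0 by linarith+
    qed
    have geo: "L2_norm (\<Theta> (knot (k0 + j))) \<le> L2_norm (\<Theta> s) * (1 / 2) ^ j" for j
    proof (induction j)
      case 0
      show ?case using large(1)[of 0] knot_less_1 by (simp add: decr)
    next
      case (Suc j)
      show ?case using half[OF large, of j] Suc by simp
    qed
    have near: "\<forall>\<^sub>F t in at_left 1. a < t \<and> t < 1" if "a < (1::real)" for a
      using that eventually_at_left_field by blast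
    have "((\<lambda>t. L2_norm (\<lambda>x. \<Theta> t x - 0)) \<longlongrightarrow> 0) (at_left 1)"
    proof (rule tendstoI)
      fix e :: real assume e: "e > 0"
      have "(\<lambda>j. L2_norm (\<Theta> s) * (1 / 2) ^ j) \<longlonglongrightarrow> 0"
        by (intro tendsto_mult_right_zero LIMSEQ_power_zero) simp
      then obtain j where j: "L2_norm (\<Theta> s) * (1 / 2) ^ j < e"
        using e order_tendstoD(2) by (metis (no_types, lifting) eventually_sequentially order_refl)
      show "\<forall>\<^sub>F t in at_left 1. dist (L2_norm (\<lambda>x. \<Theta> t x - 0)) 0 < e"
        using near[OF knot_less_1[of "k0 + j"]]
      proof eventually_elim
        case (elim t)
        have "L2_norm (\<Theta> t) \<le> L2_norm (\<Theta> (knot (k0 + j)))" using elim large(1)[of j] by (intro decr) auto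
        then show ?case using geo[of j] j L2_norm_nonneg[of "\<Theta> t"] by simp
      qed
    qed
    moreover have "\<forall>\<^sub>F t in at_left 1. \<Theta> t \<in> L2"
      using near[of s] s by (auto elim!: eventually_mono intro!: L2_0_L2 mem ti)
    ultimately have "L2_tendsto \<Theta> (\<lambda>x. 0) (at_left 1)" by (simp add: L2_tendsto_def L2_zero)
    then show ?thesis by (simp add: solution_op_def \<Theta>_def)
  qed
  with \<sigma> show ?thesis by blast
qed

end
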